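(* Let $\mathfrak{g}$ be a finite-dimensional simple Lie superalgebra over $\mathbb{C}$ with non-degenerate Killing form, $\mathfrak{h}$ a Cartan subalgebra, $\Gamma$ a set of simple roots, $(\Gamma_1,\Gamma_2,\tau)$ an admissible triple, and let $e_\alpha\in\mathfrak{g}_\alpha$ ($\alpha\in\Delta$) be root vectors chosen compatibly with the triple as described in the context. Let $r_0 \in \mathfrak{h}\otimes\mathfrak{h}$ satisfy $$r_0^{12}+r_0^{21}=\Omega_0,\qquad (\tau(\alpha)\otimes 1)(r_0)+(1\otimes\alpha)(r_0)=0 \ \text{ for all } \alpha\in\Gamma_1 .$$ Then the element $r\in\mathfrak{g}\otimes\mathfrak{g}$ defined by $$ r = r_0+\sum_{\alpha>0} e_{-\alpha}\otimes e_{\alpha}+\sum_{\alpha,\beta>0,\ \alpha<\beta}\left(e_{-\alpha}\otimes e_{\beta}-(-1)^{|\alpha|}e_{\beta}\otimes e_{-\alpha}\right)$$ is a solution of the system $$ r^{12}+r^{21}=\Omega, \qquad [r^{12},r^{13}]+[r^{12},r^{23}]+[r^{13},r^{23}]=0 .$$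
   Context: All Lie superalgebras are finite-dimensional over $\mathbb{C}$; $|x|\in\{0,1\}$ is the parity of a homogeneous element $x$. $(\ ,\ )$ is the Killing form $(x,y)=\mathrm{str}(\mathrm{ad}\,x\,\mathrm{ad}\,y)$, which is even (consistent), supersymmetric, invariant, and assumed non-degenerate on $\mathfrak{g}$. Casimir element: for a homogeneous basis $\{I_a\}$ of $\mathfrak{g}$ with dual basis $\{I_a^*\}$, $(I_a,I_b^* )=\delta_{ab}$, put $\Omega=\sum_a(-1)^{|I_a|}I_a\otimes I_a^*\in\mathfrak{g}\otimes\mathfrak{g}$. Roots: $\mathfrak{h}\subset\mathfrak{g}_{\overline 0}$ is a Cartan subalgebra of the even part, $\Delta=\Delta_{\overline 0}\cup\Delta_{\overline 1}$ the set of (even and odd) roots, $|\alpha|$ the parity of a root $\alpha$, $\mathfrak{g}_\alpha$ its root space (one-dimensional here). $\Gamma=\{\alpha_1,\dots,\alpha_r\}$ is a fixed set of simple roots (a base of $\Delta$; it may contain even and odd roots, and any base is allowed); $\Delta^+$ is the set of roots that are nonnegative integral combinations of $\Gamma$, and $\alpha>0$ means $\alpha\in\Delta^+$. For $\alpha\in\mathfrak{h}^*$, $h_\alpha\in\mathfrak{h}$ is defined by $(h_\alpha,h)=\alpha(h)$ for all $h\in\mathfrak{h}$, and $(\alpha,\beta):=(h_\alpha,h_\beta)$. The vectors $h_{\alpha_i}$ form a basis of $\mathfrak{h}$; with $\{h_{\alpha_i}^*\}$ the dual basis of $\mathfrak{h}$ for $(\ ,\ )$, $\Omega_0=\sum_{i=1}^r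 h_{\alpha_i}\otimes h_{\alpha_i}^*$ is the $\mathfrak{h}$-part of $\Omega$. Admissible triple: $(\Gamma_1,\Gamma_2,\tau)$ with $\Gamma_1,\Gamma_2\subset\Gamma$ and $\tau:\Gamma_1\to\Gamma_2$ a bijection such that (1) $(\tau(\alpha),\tau(\beta))=(\alpha,\beta)$ for all $\alpha,\beta\in\Gamma_1$; (2) for each $\alpha\in\Gamma_1$ there is an integer $k\ge1$ such that $\tau^k(\alpha)\notin\Gamma_1$ (where $\tau^j(\alpha)\in\Gamma_1$ for all $j<k$); (3) $\tau$ maps even roots to even roots and odd roots to odd roots. Let $\overline\Gamma_i$ be the set of roots that are nonnegative integral combinations of elements of $\Gamma_i$; $\tau$ extends linearly to a bijection $\overline\tau:\overline\Gamma_1\to\overline\Gamma_2$. For $\alpha,\beta\in\Delta^+$, $\alpha<\beta$ means that there is an integer $k\ge1$ with $\beta=\overline\tau^{\,k}(\alpha)$ (in particular $\overline\tau^{\,j}(\alpha)\in\overline\Gamma_1$ for $0\le j<k$). Choice of root vectors: for each $\alpha\in\Gamma$ fix $X_\alpha\in\mathfrak{g}_\alpha$, $Y_\alpha\in\mathfrak{g}_{-\alpha}$ with $(X_\alpha,Y_\alpha)=1$, and $H_\alpha=[X_\alpha,Y_\alpha]=h_\alpha$. Let $\mathfrak{g}_i$ be the subsuperalgebra generated by $X_\alpha,Y_\alpha,H_\alpha$, $\alpha\in\Gamma_i$. Let $\varphi:\mathfrak{g}_1\to\mathfrak{g}_2$ be the Lie superalgebra isomorphism with $\varphi(X_\alpha)=X_{\tau(\alpha)}$,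 $\varphi(Y_\alpha)=Y_{\tau(\alpha)}$, $\varphi(H_\alpha)=H_{\tau(\alpha)}$ for $\alpha\in\Gamma_1$. The nonzero $e_\alpha\in\mathfrak{g}_\alpha$ ($\alpha\in\Delta$) are chosen so that $(e_\alpha,e_{-\alpha})=1$ for all $\alpha\in\Delta^+$ and $\varphi(e_\alpha)=e_{\overline\tau(\alpha)}$ for all $\alpha\in\overline\Gamma_1$. Tensor notation: $(\lambda\otimes1)(a\otimes b)=\lambda(a)b$ and $(1\otimes\lambda)(a\otimes b)=\lambda(b)a$ for $\lambda\in\mathfrak{h}^*$, $a,b\in\mathfrak{h}$. For $r=\sum a\otimes b$ with homogeneous $a,b$: $r^{12}=r$ and $r^{21}=\sum(-1)^{|a||b|}b\otimes a$ in the equation $r^{12}+r^{21}=\Omega$ (similarly for $r_0$, where all signs are $+$). In the classical Yang–Baxter equation, $r^{12}=\sum a\otimes b\otimes1$, $r^{13}=\sum a\otimes1\otimes b$, $r^{23}=\sum1\otimes a\otimes b$, and the brackets, with values in $\mathfrak{g}^{\otimes3}$, are determined by $[a\otimes b\otimes1,c\otimes1\otimes d]=(-1)^{|b||c|}[a,c]\otimes b\otimes d$, $[a\otimes b\otimes1,1\otimes c\otimes d]=a\otimes[b,c]\otimes d$, $[a\otimes1\otimes b,1\otimes c\otimes d]=(-1)^{|b||c|}a\otimes c\otimes[b,d]$. *)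

theory Defs
  imports Complex_Main "HOL-Library.Function_Algebras"
begin

section \<open>Lie superalgebras\<close>

record 'g lie_superalg =
  scl :: "complex \<Rightarrow> 'g \<Rightarrow> 'g"
  even_part :: "'g set"
  odd_part :: "'g set"
  brk :: "'g \<Rightarrow> 'g \<Rightarrow> 'g"

text \<open>Degrees are natural numbers, of which only the parity matters.\<close>

definition part :: "('g, 'm) lie_superalg_scheme \<Rightarrow> nat \<Rightarrow> 'g set" where
  "part L i = (if even i then even_part L else odd_part L)"

locale lie_superalgebra = vector_space "scl L"
  for L :: "'g::ab_group_add lie_superalg" +
  assumes subspace_even: "subspace (even_part L)"
    and subspace_odd: "subspace (odd_part L)"
    and even_inter_odd: "even_part L \<inter> odd_part L = {0}"
    and even_plus_odd: "\<exists>a\<in>even_part L. \<exists>b\<in>odd_part L. x = a + b"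
    and linear_brk_right: "Vector_Spaces.linear (scl L) (scl L) (\<lambda>y. brk L x y)"
    and linear_brk_left: "Vector_Spaces.linear (scl L) (scl L) (\<lambda>x. brk L x y)"
    and brk_part: "x \<in> part L i \<Longrightarrow> y \<in> part L j \<Longrightarrow> brk L x y \<in> part L (i + j)"
    and brk_skew: "x \<in> part L i \<Longrightarrow> y \<in> part L j \<Longrightarrow>
      brk L x y = scl L (- ((-1) ^ (i * j))) (brk L y x)"
    and brk_jacobi: "x \<in> part L i \<Longrightarrow> y \<in> part L j \<Longrightarrow>
      brk L x (brk L y z) = brk L (brk L x y) z + scl L ((-1) ^ (i * j)) (brk L y (brk L x z))"

definition finite_dim :: "'g::ab_group_add lie_superalg \<Rightarrow> bool" where
  "finite_dim L \<longleftrightarrow> (\<exists>B. finite B \<and> module.span (scl L) B = UNIV)"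

definition graded_subspace :: "'g::ab_group_add lie_superalg \<Rightarrow> 'g set \<Rightarrow> bool" where
  "graded_subspace L S \<longleftrightarrow> module.subspace (scl L) S \<and>
     (\<forall>x\<in>S. \<exists>a\<in>S \<inter> even_part L. \<exists>b\<in>S \<inter> odd_part L. x = a + b)"

definition graded_ideal :: "'g::ab_group_add lie_superalg \<Rightarrow> 'g set \<Rightarrow> bool" where
  "graded_ideal L I \<longleftrightarrow> graded_subspace L I \<and> (\<forall>x. \<forall>y\<in>I. brk L x y \<in> I)"

definition simple_lie_superalgebra :: "'g::ab_group_add lie_superalg \<Rightarrow> bool" where
  "simple_lie_superalgebra L \<longleftrightarrow> lie_superalgebra L \<and> (\<exists>x y. brk L x y \<noteq> 0) \<and>
     (\<forall>I. graded_ideal L I \<longrightarrow> I = {0} \<or> I = UNIV)"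

definition sub_superalgebra :: "'g::ab_group_add lie_superalg \<Rightarrow> 'g set \<Rightarrow> bool" where
  "sub_superalgebra L S \<longleftrightarrow> graded_subspace L S \<and> (\<forall>x\<in>S. \<forall>y\<in>S. brk L x y \<in> S)"

definition generated_subalgebra :: "'g::ab_group_add lie_superalg \<Rightarrow> 'g set \<Rightarrow> 'g set" where
  "generated_subalgebra L S = \<Inter> {T. sub_superalgebra L T \<and> S \<subseteq> T}"

definition superalgebra_iso ::
    "'g::ab_group_add lie_superalg \<Rightarrow> 'g set \<Rightarrow> 'g set \<Rightarrow> ('g \<Rightarrow> 'g) \<Rightarrow> bool" where
  "superalgebra_iso L S T \<phi> \<longleftrightarrow> bij_betw \<phi> S T \<and>
     (\<forall>x\<in>S. \<forall>y\<in>S. \<phi> (x + y) = \<phi> x + \<phi> y) \<and>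
     (\<forall>c. \<forall>x\<in>S. \<phi> (scl L c x) = scl L c (\<phi> x)) \<and>
     (\<forall>i. \<phi> ` (S \<inter> part L i) \<subseteq> part L i) \<and>
     (\<forall>x\<in>S. \<forall>y\<in>S. \<phi> (brk L x y) = brk L (\<phi> x) (\<phi> y))"


section \<open>The Killing form\<close>

text \<open>Only meaningful for nonzero homogeneous \<open>x\<close>.\<close>

definition parity :: "'g lie_superalg \<Rightarrow> 'g \<Rightarrow> nat" where
  "parity L x = (if x \<in> even_part L then 0 else 1)"

definition homogeneous_basis :: "'g::ab_group_add lie_superalg \<Rightarrow> 'g set \<Rightarrow> bool" where
  "homogeneous_basis L B \<longleftrightarrow> B \<subseteq> even_part L \<union> odd_part L \<and>
     \<not> module.dependent (scl L) B \<and> module.span (scl L) B = UNIV"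

text \<open>The supertrace does not depend on the chosen homogeneous basis.\<close>

definition supertrace :: "'g::ab_group_add lie_superalg \<Rightarrow> ('g \<Rightarrow> 'g) \<Rightarrow> complex" where
  "supertrace L T = (let B = (SOME B. homogeneous_basis L B)
     in \<Sum>b\<in>B. (-1) ^ parity L b * module.representation (scl L) B (T b) b)"

definition killing :: "'g::ab_group_add lie_superalg \<Rightarrow> 'g \<Rightarrow> 'g \<Rightarrow> complex" where
  "killing L x y = supertrace L (\<lambda>z. brk L x (brk L y z))"

definition nondegenerate_killing :: "'g::ab_group_add lie_superalg \<Rightarrow> bool" where
  "nondegenerate_killing L \<longleftrightarrow> (\<forall>x. (\<forall>y. killing L x y = 0) \<longrightarrow> x = 0)"


section \<open>Cartan subalgebras and roots\<close>

primrec lower_central :: "'g::ab_group_add lie_superalg \<Rightarrow> 'g set \<Rightarrow> nat \<Rightarrow> 'g set" where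
  "lower_central L H 0 = H"
| "lower_central L H (Suc n) =
     module.span (scl L) {brk L x y |x y. x \<in> H \<and> y \<in> lower_central L H n}"

text \<open>A nilpotent, self-normalizing subalgebra of the Lie algebra \<open>even_part L\<close>.\<close>

definition cartan_subalgebra :: "'g::ab_group_add lie_superalg \<Rightarrow> 'g set \<Rightarrow> bool" where
  "cartan_subalgebra L H \<longleftrightarrow> module.subspace (scl L) H \<and> H \<subseteq> even_part L \<and>
     (\<forall>x\<in>H. \<forall>y\<in>H. brk L x y \<in> H) \<and>
     (\<exists>n. lower_central L H n = {0}) \<and>
     {x \<in> even_part L. \<forall>y\<in>H. brk L x y \<in> H} = H"

text \<open>A functional on \<open>H\<close> is represented by its extension by \<open>0\<close> outside \<open>H\<close>, so that
  equality, addition and negation in the dual of \<open>H\<close> are those of functions. (The extended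
  function is in general not linear on all of \<open>L\<close>.)\<close>

definition dual_space :: "'g::ab_group_add lie_superalg \<Rightarrow> 'g set \<Rightarrow> ('g \<Rightarrow> complex) set" where
  "dual_space L H = {\<alpha>. (\<forall>x\<in>H. \<forall>y\<in>H. \<alpha> (x + y) = \<alpha> x + \<alpha> y) \<and>
     (\<forall>c. \<forall>x\<in>H. \<alpha> (scl L c x) = c * \<alpha> x) \<and> (\<forall>x. x \<notin> H \<longrightarrow> \<alpha> x = 0)}"

definition root_space ::
    "'g::ab_group_add lie_superalg \<Rightarrow> 'g set \<Rightarrow> ('g \<Rightarrow> complex) \<Rightarrow> 'g set" where
  "root_space L H \<alpha> = {x. \<forall>t\<in>H. brk L t x = scl L (\<alpha> t) x}"

definition roots_of_parity ::
    "'g::ab_group_add lie_superalg \<Rightarrow> 'g set \<Rightarrow> nat \<Rightarrow> ('g \<Rightarrow> complex) set" where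
  "roots_of_parity L H i =
     {\<alpha> \<in> dual_space L H. \<alpha> \<noteq> 0 \<and> (\<exists>x \<in> root_space L H \<alpha> \<inter> part L i. x \<noteq> 0)}"

definition roots :: "'g::ab_group_add lie_superalg \<Rightarrow> 'g set \<Rightarrow> ('g \<Rightarrow> complex) set" where
  "roots L H = roots_of_parity L H 0 \<union> roots_of_parity L H 1"

definition root_parity ::
    "'g::ab_group_add lie_superalg \<Rightarrow> 'g set \<Rightarrow> ('g \<Rightarrow> complex) \<Rightarrow> nat" where
  "root_parity L H \<alpha> = (if \<alpha> \<in> roots_of_parity L H 0 then 0 else 1)"

definition nonneg_combination :: "('g \<Rightarrow> complex) set \<Rightarrow> ('g \<Rightarrow> complex) \<Rightarrow> bool" where
  "nonneg_combination S \<alpha> \<longleftrightarrow> (\<exists>n :: _ \<Rightarrow> nat. \<alpha> = (\<lambda>x. \<Sum>\<gamma>\<in>S. of_nat (n \<gamma>) * \<gamma> x))"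

text \<open>The roots that are nonnegative integral combinations of \<open>S\<close>.\<close>

definition roots_over ::
    "'g::ab_group_add lie_superalg \<Rightarrow> 'g set \<Rightarrow> ('g \<Rightarrow> complex) set \<Rightarrow> ('g \<Rightarrow> complex) set" where
  "roots_over L H S = {\<alpha> \<in> roots L H. nonneg_combination S \<alpha>}"

text \<open>Every root is a nonnegative or a nonpositive integral combination of the linearly
  independent set \<open>\<Gamma>\<close>, which may contain both even and odd roots.\<close>

definition root_base ::
    "'g::ab_group_add lie_superalg \<Rightarrow> 'g set \<Rightarrow> ('g \<Rightarrow> complex) set \<Rightarrow> bool" where
  "root_base L H \<Gamma> \<longleftrightarrow> finite \<Gamma> \<and> \<Gamma> \<subseteq> roots L H \<and>
     \<not> module.dependent (\<lambda>c \<alpha> x. c * \<alpha> x) \<Gamma> \<and>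
     (\<forall>\<alpha>\<in>roots L H. nonneg_combination \<Gamma> \<alpha> \<or> nonneg_combination \<Gamma> (- \<alpha>))"

definition coroot :: "'g::ab_group_add lie_superalg \<Rightarrow> 'g set \<Rightarrow> ('g \<Rightarrow> complex) \<Rightarrow> 'g" where
  "coroot L H \<alpha> = (THE t. t \<in> H \<and> (\<forall>s\<in>H. killing L t s = \<alpha> s))"

definition root_form ::
    "'g::ab_group_add lie_superalg \<Rightarrow> 'g set \<Rightarrow> ('g \<Rightarrow> complex) \<Rightarrow> ('g \<Rightarrow> complex) \<Rightarrow> complex" where
  "root_form L H \<alpha> \<beta> = killing L (coroot L H \<alpha>) (coroot L H \<beta>)"


section \<open>Admissible triples\<close>

definition admissible_triple ::
    "'g::ab_group_add lie_superalg \<Rightarrow> 'g set \<Rightarrow> ('g \<Rightarrow> complex) set \<Rightarrow> ('g \<Rightarrow> complex) set \<Rightarrow>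
     ('g \<Rightarrow> complex) set \<Rightarrow> (('g \<Rightarrow> complex) \<Rightarrow> 'g \<Rightarrow> complex) \<Rightarrow> bool" where
  "admissible_triple L H \<Gamma> \<Gamma>1 \<Gamma>2 \<tau> \<longleftrightarrow> \<Gamma>1 \<subseteq> \<Gamma> \<and> \<Gamma>2 \<subseteq> \<Gamma> \<and> bij_betw \<tau> \<Gamma>1 \<Gamma>2 \<and>
     (\<forall>\<alpha>\<in>\<Gamma>1. \<forall>\<beta>\<in>\<Gamma>1. root_form L H (\<tau> \<alpha>) (\<tau> \<beta>) = root_form L H \<alpha> \<beta>) \<and>
     (\<forall>\<alpha>\<in>\<Gamma>1. \<exists>k\<ge>1. (\<forall>j<k. (\<tau> ^^ j) \<alpha> \<in> \<Gamma>1) \<and> (\<tau> ^^ k) \<alpha> \<notin> \<Gamma>1) \<and>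
     (\<forall>i. \<forall>\<alpha>\<in>\<Gamma>1 \<inter> roots_of_parity L H i. \<tau> \<alpha> \<in> roots_of_parity L H i)"

text \<open>The additive extension of \<open>\<tau>\<close> to nonnegative integral combinations of \<open>\<Gamma>1\<close>
  (unique since \<open>\<Gamma>1\<close> is linearly independent).\<close>

definition tau_ext ::
    "('g \<Rightarrow> complex) set \<Rightarrow> (('g \<Rightarrow> complex) \<Rightarrow> 'g \<Rightarrow> complex) \<Rightarrow> ('g \<Rightarrow> complex) \<Rightarrow> 'g \<Rightarrow> complex" where
  "tau_ext \<Gamma>1 \<tau> \<alpha> = (THE \<beta>. \<exists>n :: _ \<Rightarrow> nat.
     \<alpha> = (\<lambda>x. \<Sum>\<gamma>\<in>\<Gamma>1. of_nat (n \<gamma>) * \<gamma> x) \<and> \<beta> = (\<lambda>x. \<Sum>\<gamma>\<in>\<Gamma>1. of_nat (n \<gamma>) * \<tau> \<gamma> x))"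

definition triple_less ::
    "'g::ab_group_add lie_superalg \<Rightarrow> 'g set \<Rightarrow> ('g \<Rightarrow> complex) set \<Rightarrow>
     (('g \<Rightarrow> complex) \<Rightarrow> 'g \<Rightarrow> complex) \<Rightarrow> ('g \<Rightarrow> complex) \<Rightarrow> ('g \<Rightarrow> complex) \<Rightarrow> bool" where
  "triple_less L H \<Gamma>1 \<tau> \<alpha> \<beta> \<longleftrightarrow>
     (\<exists>k\<ge>1. (\<forall>j<k. (tau_ext \<Gamma>1 \<tau> ^^ j) \<alpha> \<in> roots_over L H \<Gamma>1) \<and> \<beta> = (tau_ext \<Gamma>1 \<tau> ^^ k) \<alpha>)"

text \<open>The identity \<open>brk L (X \<alpha>) (Y \<alpha>) = coroot L H \<alpha>\<close> is not required separately: it follows from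
  the normalization by invariance of the Killing form.\<close>

definition chevalley_vectors ::
    "'g::ab_group_add lie_superalg \<Rightarrow> 'g set \<Rightarrow> ('g \<Rightarrow> complex) set \<Rightarrow>
     (('g \<Rightarrow> complex) \<Rightarrow> 'g) \<Rightarrow> (('g \<Rightarrow> complex) \<Rightarrow> 'g) \<Rightarrow> bool" where
  "chevalley_vectors L H \<Gamma> X Y \<longleftrightarrow>
     (\<forall>\<alpha>\<in>\<Gamma>. X \<alpha> \<in> root_space L H \<alpha> \<and> Y \<alpha> \<in> root_space L H (- \<alpha>) \<and> killing L (X \<alpha>) (Y \<alpha>) = 1)"

definition chevalley_subalgebra ::
    "'g::ab_group_add lie_superalg \<Rightarrow> (('g \<Rightarrow> complex) \<Rightarrow> 'g) \<Rightarrow> (('g \<Rightarrow> complex) \<Rightarrow> 'g) \<Rightarrow>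
     ('g \<Rightarrow> complex) set \<Rightarrow> 'g set" where
  "chevalley_subalgebra L X Y S =
     generated_subalgebra L (X ` S \<union> Y ` S \<union> (\<lambda>\<alpha>. brk L (X \<alpha>) (Y \<alpha>)) ` S)"

definition triple_iso ::
    "'g::ab_group_add lie_superalg \<Rightarrow> (('g \<Rightarrow> complex) \<Rightarrow> 'g) \<Rightarrow> (('g \<Rightarrow> complex) \<Rightarrow> 'g) \<Rightarrow>
     ('g \<Rightarrow> complex) set \<Rightarrow> ('g \<Rightarrow> complex) set \<Rightarrow> (('g \<Rightarrow> complex) \<Rightarrow> 'g \<Rightarrow> complex) \<Rightarrow>
     ('g \<Rightarrow> 'g) \<Rightarrow> bool" where
  "triple_iso L X Y \<Gamma>1 \<Gamma>2 \<tau> \<phi> \<longleftrightarrow>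
     superalgebra_iso L (chevalley_subalgebra L X Y \<Gamma>1) (chevalley_subalgebra L X Y \<Gamma>2) \<phi> \<and>
     (\<forall>\<alpha>\<in>\<Gamma>1. \<phi> (X \<alpha>) = X (\<tau> \<alpha>) \<and> \<phi> (Y \<alpha>) = Y (\<tau> \<alpha>) \<and>
        \<phi> (brk L (X \<alpha>) (Y \<alpha>)) = brk L (X (\<tau> \<alpha>)) (Y (\<tau> \<alpha>)))"

definition compatible_root_vectors ::
    "'g::ab_group_add lie_superalg \<Rightarrow> 'g set \<Rightarrow> ('g \<Rightarrow> complex) set \<Rightarrow> ('g \<Rightarrow> complex) set \<Rightarrow>
     (('g \<Rightarrow> complex) \<Rightarrow> 'g \<Rightarrow> complex) \<Rightarrow> ('g \<Rightarrow> 'g) \<Rightarrow> (('g \<Rightarrow> complex) \<Rightarrow> 'g) \<Rightarrow> bool" where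
  "compatible_root_vectors L H \<Gamma> \<Gamma>1 \<tau> \<phi> e \<longleftrightarrow>
     (\<forall>\<alpha>\<in>roots L H. e \<alpha> \<in> root_space L H \<alpha> \<and> e \<alpha> \<noteq> 0) \<and>
     (\<forall>\<alpha>\<in>roots_over L H \<Gamma>. killing L (e \<alpha>) (e (- \<alpha>)) = 1) \<and>
     (\<forall>\<alpha>\<in>roots_over L H \<Gamma>1. \<phi> (e \<alpha>) = e (tau_ext \<Gamma>1 \<tau> \<alpha>))"


section \<open>Tensors\<close>

text \<open>The tensor powers of a vector space embed canonically into the multilinear forms on its
  dual, with \<open>a \<otimes> b\<close> acting by \<open>(f, g) \<mapsto> f a * g b\<close>; for finite-dimensional spaces this is an
  isomorphism. Forms are extended by \<open>0\<close> to arguments that are not linear functionals, so that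
  equality of tensors is equality of functions.\<close>

type_synonym 'g tensor2 = "('g \<Rightarrow> complex) \<Rightarrow> ('g \<Rightarrow> complex) \<Rightarrow> complex"
type_synonym 'g tensor3 = "('g \<Rightarrow> complex) \<Rightarrow> ('g \<Rightarrow> complex) \<Rightarrow> ('g \<Rightarrow> complex) \<Rightarrow> complex"

abbreviation functional :: "'g::ab_group_add lie_superalg \<Rightarrow> ('g \<Rightarrow> complex) \<Rightarrow> bool" where
  "functional L f \<equiv> Vector_Spaces.linear (scl L) (*) f"

definition tensor2 :: "'g::ab_group_add lie_superalg \<Rightarrow> 'g \<Rightarrow> 'g \<Rightarrow> 'g tensor2" where
  "tensor2 L a b = (\<lambda>f g. if functional L f \<and> functional L g then f a * g b else 0)"

definition tensor3 :: "'g::ab_group_add lie_superalg \<Rightarrow> 'g \<Rightarrow> 'g \<Rightarrow> 'g \<Rightarrow> 'g tensor3" where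
  "tensor3 L a b c = (\<lambda>f g k. if functional L f \<and> functional L g \<and> functional L k
     then f a * g b * k c else 0)"

definition tscale :: "complex \<Rightarrow> 'g tensor2 \<Rightarrow> 'g tensor2" where
  "tscale c t = (\<lambda>f g. c * t f g)"

definition tensors_over :: "'g::ab_group_add lie_superalg \<Rightarrow> 'g set \<Rightarrow> 'g tensor2 set" where
  "tensors_over L S =
     {t. \<exists>(n::nat) a b. (\<forall>i<n. a i \<in> S \<and> b i \<in> S) \<and> t = (\<Sum>i<n. tensor2 L (a i) (b i))}"

text \<open>The component of \<open>x\<close> in \<open>part L i\<close>.\<close>

definition component :: "'g::ab_group_add lie_superalg \<Rightarrow> nat \<Rightarrow> 'g \<Rightarrow> 'g" where
  "component L i x = (THE y. y \<in> part L i \<and> x - y \<in> part L (Suc i))"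

text \<open>The definitions of \<open>r\<^sup>2\<^sup>1\<close> and of the three brackets contract the forms against the
  relevant functionals; their values on pure tensors and on sums of these are computed in
  \<open>super_flip_tensor2\<close>, \<open>super_flip_sum\<close>, \<open>brk12_13_tensor2\<close>, \<open>brk12_23_tensor2\<close>,
  \<open>brk13_23_tensor2\<close> and \<open>brk_sum\<close> below.\<close>

definition super_flip :: "'g::ab_group_add lie_superalg \<Rightarrow> 'g tensor2 \<Rightarrow> 'g tensor2" where
  "super_flip L t = (\<lambda>f g. if functional L f \<and> functional L g
     then \<Sum>i<2. \<Sum>j<2. (-1) ^ (i * j) * t (g \<circ> component L i) (f \<circ> component L j) else 0)"

definition brk12_13 ::
    "'g::ab_group_add lie_superalg \<Rightarrow> 'g tensor2 \<Rightarrow> 'g tensor2 \<Rightarrow> 'g tensor3" where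
  "brk12_13 L r s = (\<lambda>f g k. if functional L f \<and> functional L g \<and> functional L k
     then \<Sum>i<2. \<Sum>j<2. (-1) ^ (i * j) *
       r (\<lambda>a. s (\<lambda>c. f (brk L a (component L j c))) k) (g \<circ> component L i) else 0)"

definition brk12_23 ::
    "'g::ab_group_add lie_superalg \<Rightarrow> 'g tensor2 \<Rightarrow> 'g tensor2 \<Rightarrow> 'g tensor3" where
  "brk12_23 L r s = (\<lambda>f g k. if functional L f \<and> functional L g \<and> functional L k
     then r f (\<lambda>b. s (\<lambda>c. g (brk L b c)) k) else 0)"

definition brk13_23 ::
    "'g::ab_group_add lie_superalg \<Rightarrow> 'g tensor2 \<Rightarrow> 'g tensor2 \<Rightarrow> 'g tensor3" where
  "brk13_23 L r s = (\<lambda>f g k. if functional L f \<and> functional L g \<and> functional L k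
     then \<Sum>i<2. \<Sum>j<2. (-1) ^ (i * j) *
       r f (\<lambda>b. s (g \<circ> component L j) (\<lambda>d. k (brk L (component L i b) d))) else 0)"

text \<open>\<open>(\<lambda> \<otimes> 1) t\<close> and \<open>(1 \<otimes> \<lambda>) t\<close> for \<open>\<lambda>\<close> in the dual of \<open>H\<close> and \<open>t \<in> H \<otimes> H\<close>; see the lemmas
  \<open>contract_left_eq\<close> and \<open>contract_right_eq\<close>.\<close>

definition contract_left ::
    "'g::ab_group_add lie_superalg \<Rightarrow> 'g set \<Rightarrow> ('g \<Rightarrow> complex) \<Rightarrow> 'g tensor2 \<Rightarrow> 'g" where
  "contract_left L H \<mu> t = (THE v. \<exists>(n::nat) a b. (\<forall>i<n. a i \<in> H \<and> b i \<in> H) \<and>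
     t = (\<Sum>i<n. tensor2 L (a i) (b i)) \<and> v = (\<Sum>i<n. scl L (\<mu> (a i)) (b i)))"

definition contract_right ::
    "'g::ab_group_add lie_superalg \<Rightarrow> 'g set \<Rightarrow> ('g \<Rightarrow> complex) \<Rightarrow> 'g tensor2 \<Rightarrow> 'g" where
  "contract_right L H \<mu> t = (THE v. \<exists>(n::nat) a b. (\<forall>i<n. a i \<in> H \<and> b i \<in> H) \<and>
     t = (\<Sum>i<n. tensor2 L (a i) (b i)) \<and> v = (\<Sum>i<n. scl L (\<mu> (b i)) (a i)))"

definition casimir :: "'g::ab_group_add lie_superalg \<Rightarrow> 'g set \<Rightarrow> 'g tensor2" where
  "casimir L B = (\<Sum>b\<in>B. tscale ((-1) ^ parity L b)
     (tensor2 L b (THE v. \<forall>a\<in>B. killing L a v = (if a = b then 1 else 0))))"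

definition cartan_casimir ::
    "'g::ab_group_add lie_superalg \<Rightarrow> 'g set \<Rightarrow> ('g \<Rightarrow> complex) set \<Rightarrow> 'g tensor2" where
  "cartan_casimir L H \<Gamma> = (\<Sum>\<gamma>\<in>\<Gamma>. tensor2 L (coroot L H \<gamma>)
     (THE v. v \<in> H \<and> (\<forall>\<delta>\<in>\<Gamma>. killing L (coroot L H \<delta>) v = (if \<delta> = \<gamma> then 1 else 0))))"

definition r_matrix ::
    "'g::ab_group_add lie_superalg \<Rightarrow> 'g set \<Rightarrow> ('g \<Rightarrow> complex) set \<Rightarrow> ('g \<Rightarrow> complex) set \<Rightarrow>
     (('g \<Rightarrow> complex) \<Rightarrow> 'g \<Rightarrow> complex) \<Rightarrow> (('g \<Rightarrow> complex) \<Rightarrow> 'g) \<Rightarrow> 'g tensor2 \<Rightarrow> 'g tensor2" where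
  "r_matrix L H \<Gamma> \<Gamma>1 \<tau> e r0 = r0 +
     (\<Sum>\<alpha>\<in>roots_over L H \<Gamma>. tensor2 L (e (- \<alpha>)) (e \<alpha>)) +
     (\<Sum>(\<alpha>, \<beta>) \<in> {(\<alpha>, \<beta>). \<alpha> \<in> roots_over L H \<Gamma> \<and> \<beta> \<in> roots_over L H \<Gamma> \<and> triple_less L H \<Gamma>1 \<tau> \<alpha> \<beta>}.
        tensor2 L (e (- \<alpha>)) (e \<beta>) - tscale ((-1) ^ root_parity L H \<alpha>) (tensor2 L (e \<beta>) (e (- \<alpha>))))"


subsection \<open>Values on pure tensors\<close>

lemma sum_lessThan_2: "(\<Sum>i<2. F i) = F 0 + F (Suc 0)" for F :: "nat \<Rightarrow> 'a::comm_monoid_add"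
  by (simp add: numeral_2_eq_2)

lemma sum_tensor_apply: "(\<Sum>i\<in>A. t i) f g = (\<Sum>i\<in>A. t i f g)"
  for t :: "'i \<Rightarrow> 'g tensor2"
  by (induction A rule: infinite_finite_induct) auto

context lie_superalgebra
begin

lemma vector_space_mult: "vector_space ((*) :: complex \<Rightarrow> complex \<Rightarrow> complex)"
  by unfold_locales (auto simp: algebra_simps)

lemma functional_iff:
  "functional L f \<longleftrightarrow> (\<forall>x y. f (x + y) = f x + f y) \<and> (\<forall>c x. f (scl L c x) = c * f x)"
  using vector_space_axioms vector_space_mult
  unfolding Vector_Spaces.linear_def module_hom_def module_hom_axioms_def
  by (auto simp: module_iff_vector_space)

lemma subspace_part: "subspace (part L i)"
  using subspace_even subspace_odd by (simp add: part_def)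

lemma component_eqI:
  assumes "y \<in> part L i" "x - y \<in> part L (Suc i)"
  shows "component L i x = y"
  unfolding component_def
proof (rule the_equality)
  fix z assume z: "z \<in> part L i \<and> x - z \<in> part L (Suc i)"
  have "z - y \<in> part L i"
    using z assms subspace_diff[OF subspace_part] by blast
  moreover have "(x - y) - (x - z) \<in> part L (Suc i)"
    using z assms subspace_diff[OF subspace_part] by blast
  hence "z - y \<in> part L (Suc i)" by simp
  ultimately have "z - y \<in> even_part L \<inter> odd_part L" by (auto simp: part_def split: if_splits)
  thus "z = y" using even_inter_odd by simp
qed (use assms in auto)

lemma component_homogeneous:
  assumes "x \<in> part L i"
  shows "component L j x = (if even (i + j) then x else 0)"
  using assms subspace_0[OF subspace_part, of j] subspace_0[OF subspace_part, of "Suc j"]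
  by (auto intro!: component_eqI simp: part_def)

lemma component_in_part:
  "component L i x \<in> part L i" "x - component L i x \<in> part L (Suc i)"
proof -
  obtain a b where ab: "a \<in> even_part L" "b \<in> odd_part L" "x = a + b"
    using even_plus_odd by blast
  have "component L i x = (if even i then a else b)"
    using ab by (auto intro!: component_eqI simp: part_def)
  thus "component L i x \<in> part L i" "x - component L i x \<in> part L (Suc i)"
    using ab by (auto simp: part_def)
qed

lemma component_add: "component L i (x + y) = component L i x + component L i y"
proof (rule component_eqI)
  show "component L i x + component L i y \<in> part L i"
    using subspace_add[OF subspace_part] component_in_part(1) by blast
  have "(x - component L i x) + (y - component L i y) \<in> part L (Suc i)"
    using subspace_add[OF subspace_part] component_in_part(2) by blast
  thus "x + y - (component L i x + component L i y) \<in> part L (Suc i)"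
    by (simp add: algebra_simps)
qed

lemma component_scale: "component L i (scl L c x) = scl L c (component L i x)"
proof (rule component_eqI)
  show "scl L c (component L i x) \<in> part L i"
    using subspace_scale[OF subspace_part] component_in_part(1) by blast
  have "scl L c (x - component L i x) \<in> part L (Suc i)"
    using subspace_scale[OF subspace_part] component_in_part(2) by blast
  thus "scl L c x - scl L c (component L i x) \<in> part L (Suc i)"
    by (simp add: scale_right_diff_distrib)
qed

lemma brk_linear_simps:
  "brk L (x + y) z = brk L x z + brk L y z" "brk L z (x + y) = brk L z x + brk L z y"
  "brk L (scl L c x) z = scl L c (brk L x z)" "brk L z (scl L c x) = scl L c (brk L z x)"
  using linear_brk_left linear_brk_right
  by (auto simp: Vector_Spaces.linear_iff)

lemma brk_zero: "brk L 0 x = 0" "brk L x 0 = 0"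
  using brk_linear_simps(1)[of 0 0 x] brk_linear_simps(2)[of x 0 0] by simp_all

lemma functional_0: "functional L f \<Longrightarrow> f 0 = 0"
  unfolding functional_iff by (metis add_cancel_right_right)

lemma functional_sum: "functional L f \<Longrightarrow> f (\<Sum>i\<in>A. x i) = (\<Sum>i\<in>A. f (x i))"
  by (induction A rule: infinite_finite_induct) (simp_all add: functional_0, simp add: functional_iff)

lemma functional_comp:
  "functional L f \<Longrightarrow> functional L (\<lambda>x. f (component L i x))"
  "functional L f \<Longrightarrow> functional L (f \<circ> component L i)"
  "functional L f \<Longrightarrow> functional L (\<lambda>y. f (brk L x y))"
  "functional L f \<Longrightarrow> functional L (\<lambda>x. f (brk L x y))"
  "functional L f \<Longrightarrow> functional L (\<lambda>y. f (brk L x (component L i y)))"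
  "functional L f \<Longrightarrow> functional L (\<lambda>x. f (brk L (component L i x) y))"
  by (auto simp: functional_iff component_add component_scale brk_linear_simps)

lemma functional_mult:
  "functional L f \<Longrightarrow> functional L (\<lambda>x. f x * c)" "functional L f \<Longrightarrow> functional L (\<lambda>x. c * f x)"
  by (auto simp: functional_iff algebra_simps)

lemma functional_sumI:
  assumes "\<And>i. i \<in> A \<Longrightarrow> functional L (f i)"
  shows "functional L (\<lambda>x. \<Sum>i\<in>A. f i x)"
  using assms by (auto simp: functional_iff sum.distrib sum_distrib_left)

lemmas functional_intros = functional_comp functional_mult functional_sumI

lemma tensor2_apply: "functional L f \<Longrightarrow> functional L g \<Longrightarrow> tensor2 L a b f g = f a * g b"
  by (simp add: tensor2_def)

lemma super_flip_tensor2: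
  assumes "a \<in> part L i" "b \<in> part L j"
  shows "super_flip L (tensor2 L a b) = tscale ((-1) ^ (i * j)) (tensor2 L b a)"
  using assms
  by (auto simp: fun_eq_iff super_flip_def tensor2_def tscale_def sum_lessThan_2
      component_homogeneous minus_one_power_iff functional_0 functional_intros)

lemma brk12_13_tensor2:
  assumes "b \<in> part L i" "c \<in> part L j"
  shows "brk12_13 L (tensor2 L a b) (tensor2 L c d) =
    (\<lambda>f g k. (-1) ^ (i * j) * tensor3 L (brk L a c) b d f g k)"
proof (intro ext)
  fix f g k
  show "brk12_13 L (tensor2 L a b) (tensor2 L c d) f g k =
    (-1) ^ (i * j) * tensor3 L (brk L a c) b d f g k"
  proof (cases "functional L f \<and> functional L g \<and> functional L k")
    case True
    thus ?thesis
      using assms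
      by (simp add: brk12_13_def tensor2_apply tensor3_def functional_intros sum_lessThan_2 brk_zero
          component_homogeneous minus_one_power_iff functional_0)
  next
    case False
    show ?thesis
      by (simp only: brk12_13_def tensor3_def False if_False mult_zero_right)
  qed
qed

lemma brk12_23_tensor2:
  "brk12_23 L (tensor2 L a b) (tensor2 L c d) = tensor3 L a (brk L b c) d"
  by (auto simp: fun_eq_iff brk12_23_def tensor2_def tensor3_def functional_intros)

lemma brk13_23_tensor2:
  assumes "b \<in> part L i" "c \<in> part L j"
  shows "brk13_23 L (tensor2 L a b) (tensor2 L c d) =
    (\<lambda>f g k. (-1) ^ (i * j) * tensor3 L a c (brk L b d) f g k)"
proof (intro ext)
  fix f g k
  show "brk13_23 L (tensor2 L a b) (tensor2 L c d) f g k =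
    (-1) ^ (i * j) * tensor3 L a c (brk L b d) f g k"
  proof (cases "functional L f \<and> functional L g \<and> functional L k")
    case True
    thus ?thesis
      using assms
      by (simp add: brk13_23_def tensor2_apply tensor3_def functional_intros sum_lessThan_2 brk_zero
          component_homogeneous minus_one_power_iff functional_0)
  next
    case False
    show ?thesis
      by (simp only: brk13_23_def tensor3_def False if_False mult_zero_right)
  qed
qed

lemma super_flip_sum: "super_flip L (\<Sum>i\<in>A. t i) = (\<Sum>i\<in>A. super_flip L (t i))"
proof (intro ext)
  fix f g
  show "super_flip L (\<Sum>i\<in>A. t i) f g = (\<Sum>i\<in>A. super_flip L (t i)) f g"
  proof (cases "functional L f \<and> functional L g")
    case True
    thus ?thesis
      by (simp add: super_flip_def sum_tensor_apply sum_lessThan_2 sum.distrib sum_subtractf)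
  next
    case False
    show ?thesis
      by (simp only: super_flip_def sum_tensor_apply False if_False sum.neutral_const)
  qed
qed

lemma brk_sum:
  fixes I :: "'i set" and J :: "'j set" and a b :: "'i \<Rightarrow> 'g" and c d :: "'j \<Rightarrow> 'g"
  defines "r \<equiv> \<Sum>i\<in>I. tensor2 L (a i) (b i)" and "s \<equiv> \<Sum>j\<in>J. tensor2 L (c j) (d j)"
  shows "brk12_13 L r s = (\<Sum>i\<in>I. \<Sum>j\<in>J. brk12_13 L (tensor2 L (a i) (b i)) (tensor2 L (c j) (d j)))"
    and "brk12_23 L r s = (\<Sum>i\<in>I. \<Sum>j\<in>J. brk12_23 L (tensor2 L (a i) (b i)) (tensor2 L (c j) (d j)))"
    and "brk13_23 L r s = (\<Sum>i\<in>I. \<Sum>j\<in>J. brk13_23 L (tensor2 L (a i) (b i)) (tensor2 L (c j) (d j)))"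
proof -
  have apply3: "(\<Sum>i\<in>A. t i) f g k = (\<Sum>i\<in>A. t i f g k)" for A f g k and t :: "'x \<Rightarrow> 'g tensor3"
    by (induction A rule: infinite_finite_induct) auto
  have r: "r f g = (\<Sum>i\<in>I. f (a i) * g (b i))" if "functional L f" "functional L g" for f g
    using that by (simp add: r_def sum_tensor_apply tensor2_def)
  have s: "s f g = (\<Sum>j\<in>J. f (c j) * g (d j))" if "functional L f" "functional L g" for f g
    using that by (simp add: s_def sum_tensor_apply tensor2_def)
  have dist: "(\<Sum>i\<in>I. \<Sum>j\<in>J. \<Sum>p<2. \<Sum>q<2. F i j p q) = (\<Sum>p<2. \<Sum>q<2. \<Sum>i\<in>I. \<Sum>j\<in>J. F i j p q)"
    for F :: "'i \<Rightarrow> 'j \<Rightarrow> nat \<Rightarrow> nat \<Rightarrow> complex"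
    by (simp only: sum_lessThan_2 sum.distrib)
  show "brk12_13 L r s = (\<Sum>i\<in>I. \<Sum>j\<in>J. brk12_13 L (tensor2 L (a i) (b i)) (tensor2 L (c j) (d j)))"
  proof (intro ext)
    fix f g k
    show "brk12_13 L r s f g k =
      (\<Sum>i\<in>I. \<Sum>j\<in>J. brk12_13 L (tensor2 L (a i) (b i)) (tensor2 L (c j) (d j))) f g k"
    proof (cases "functional L f \<and> functional L g \<and> functional L k")
      case True
      hence fgk: "functional L f" "functional L g" "functional L k" by blast+
      have G: "functional L (g \<circ> component L p)" for p
        using fgk by (simp add: functional_iff component_add component_scale)
      have F: "functional L (\<lambda>y. f (brk L x (component L q y)))" for x q
        by (rule functional_comp) (rule fgk)
      have F': "functional L (\<lambda>x. f (brk L x y) * z)" for y z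
        by (intro functional_mult functional_comp) (rule fgk)
      have F'': "functional L (\<lambda>x. \<Sum>j\<in>J. f (brk L x (y j)) * z j)" for y z
        by (intro functional_sumI F')
      show ?thesis
        by (simp only: apply3 brk12_13_def True if_True simp_thms s[OF F fgk(3)] r[OF F'' G] tensor2_apply[OF F fgk(3)] tensor2_apply[OF F' G] dist sum_distrib_left
            sum_distrib_right mult.assoc)
    next
      case False
      thus ?thesis by (simp only: apply3 brk12_13_def if_False sum.neutral_const)
    qed
  qed
  show "brk12_23 L r s = (\<Sum>i\<in>I. \<Sum>j\<in>J. brk12_23 L (tensor2 L (a i) (b i)) (tensor2 L (c j) (d j)))"
  proof (intro ext)
    fix f g k
    show "brk12_23 L r s f g k =
      (\<Sum>i\<in>I. \<Sum>j\<in>J. brk12_23 L (tensor2 L (a i) (b i)) (tensor2 L (c j) (d j))) f g k"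
    proof (cases "functional L f \<and> functional L g \<and> functional L k")
      case True
      hence fgk: "functional L f" "functional L g" "functional L k" by blast+
      have F: "functional L (\<lambda>y. g (brk L x y))" for x
        by (rule functional_comp) (rule fgk)
      have F': "functional L (\<lambda>x. g (brk L x y) * z)" for y z
        by (intro functional_mult functional_comp) (rule fgk)
      have F'': "functional L (\<lambda>x. \<Sum>j\<in>J. g (brk L x (y j)) * z j)" for y z
        by (intro functional_sumI F')
      show ?thesis
        by (simp only: apply3 brk12_23_def True if_True simp_thms s[OF F fgk(3)] r[OF fgk(1) F''] tensor2_apply[OF F fgk(3)] tensor2_apply[OF fgk(1) F'] sum_distrib_left
            sum_distrib_right mult.assoc)
    next
      case False
      thus ?thesis by (simp only: apply3 brk12_23_def if_False sum.neutral_const)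
    qed
  qed
  show "brk13_23 L r s = (\<Sum>i\<in>I. \<Sum>j\<in>J. brk13_23 L (tensor2 L (a i) (b i)) (tensor2 L (c j) (d j)))"
  proof (intro ext)
    fix f g k
    show "brk13_23 L r s f g k =
      (\<Sum>i\<in>I. \<Sum>j\<in>J. brk13_23 L (tensor2 L (a i) (b i)) (tensor2 L (c j) (d j))) f g k"
    proof (cases "functional L f \<and> functional L g \<and> functional L k")
      case True
      hence fgk: "functional L f" "functional L g" "functional L k" by blast+
      have G: "functional L (g \<circ> component L p)" for p
        using fgk by (simp add: functional_iff component_add component_scale)
      have F: "functional L (\<lambda>y. k (brk L (component L q x) y))" for x q
        by (rule functional_comp) (rule fgk)
      have F': "functional L (\<lambda>x. z * k (brk L (component L q x) y))" for y z q
        using fgk by (simp add: functional_iff component_add component_scale brk_linear_simps algebra_simps)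
      have F'': "functional L (\<lambda>x. \<Sum>j\<in>J. z j * k (brk L (component L q x) (y j)))" for y z q
        by (intro functional_sumI F')
      show ?thesis
        by (simp only: apply3 brk13_23_def True if_True simp_thms s[OF G F] r[OF fgk(1) F''] tensor2_apply[OF G F] tensor2_apply[OF fgk(1) F'] dist sum_distrib_left
            sum_distrib_right mult.assoc)
    next
      case False
      thus ?thesis by (simp only: apply3 brk13_23_def if_False sum.neutral_const)
    qed
  qed
qed


subsection \<open>Contractions are well defined\<close>

interpretation vsp: vector_space_pair "scl L" "(*) :: complex \<Rightarrow> complex \<Rightarrow> complex"
  by (intro vector_space_pair.intro vector_space_axioms vector_space_mult)

lemma functional_separates:
  assumes "\<And>f. functional L f \<Longrightarrow> f x = f y"
  shows "x = y"
proof (rule ccontr)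
  assume "x \<noteq> y"
  hence "independent {x - y}" by (simp add: independent_insert)
  then obtain f where f: "functional L f" "f (x - y) = 1"
    using vsp.linear_independent_extend[of "{x - y}" "\<lambda>_. 1"] by auto
  moreover have "f (x - y) + f y = f x"
    using f(1) by (metis diff_add_cancel functional_iff)
  ultimately show False using assms[OF f(1)] by simp
qed

lemma dual_space_extends:
  assumes H: "subspace H" and \<mu>: "\<mu> \<in> dual_space L H"
  obtains f where "functional L f" "\<And>x. x \<in> H \<Longrightarrow> f x = \<mu> x"
proof -
  obtain B where B: "B \<subseteq> H" "independent B" "H \<subseteq> span B"
    using basis_exists[of H] by metis
  obtain f where f: "functional L f" "\<And>x. x \<in> B \<Longrightarrow> f x = \<mu> x"
    using vsp.linear_independent_extend[OF B(2), of \<mu>] by metis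
  have \<mu>_add: "\<mu> (x + y) = \<mu> x + \<mu> y" if "x \<in> H" "y \<in> H" for x y
    using \<mu> that unfolding dual_space_def by blast
  have \<mu>_scale: "\<mu> (scl L c x) = c * \<mu> x" if "x \<in> H" for c x
    using \<mu> that unfolding dual_space_def by blast
  have \<mu>_0: "\<mu> 0 = 0"
    using \<mu>_scale[OF subspace_0[OF H], of 0] by simp
  have "x \<in> H \<and> f x = \<mu> x" if "x \<in> span B" for x
    using that
  proof (induction rule: span_induct_alt)
    case base
    show ?case using f(1) \<mu>_0 subspace_0[OF H] by (simp add: functional_0)
  next
    case (step c x y)
    have x: "x \<in> H" using step B by blast
    hence cx: "scl L c x \<in> H" by (rule subspace_scale[OF H])
    have y: "y \<in> H" using step by blast
    have "f (scl L c x + y) = c * f x + f y"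
      using f(1) unfolding functional_iff by metis
    also have "\<dots> = c * \<mu> x + \<mu> y"
      using step f(2) by simp
    also have "\<dots> = \<mu> (scl L c x + y)"
      by (simp only: \<mu>_add[OF cx y] \<mu>_scale[OF x])
    finally show ?case
      using subspace_add[OF H cx y] by blast
  qed
  hence "\<And>x. x \<in> H \<Longrightarrow> f x = \<mu> x" using B(3) by blast
  thus thesis by (rule that[OF f(1)])
qed

lemma contract_left_eq:
  fixes n :: nat
  assumes H: "subspace H" and \<mu>: "\<mu> \<in> dual_space L H"
    and ab: "\<And>i. i < n \<Longrightarrow> a i \<in> H \<and> b i \<in> H"
  shows "contract_left L H \<mu> (\<Sum>i<n. tensor2 L (a i) (b i)) = (\<Sum>i<n. scl L (\<mu> (a i)) (b i))"
proof -
  obtain m where m: "functional L m" "\<And>x. x \<in> H \<Longrightarrow> m x = \<mu> x"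
    using dual_space_extends[OF H \<mu>] by metis
  have val: "f (\<Sum>i<n. scl L (\<mu> (a i)) (b i)) = (\<Sum>i<n. tensor2 L (a i) (b i)) m f"
    if "functional L f" "\<forall>i<n. a i \<in> H \<and> b i \<in> H" for f and n :: nat and a b
    using that m
    by (auto simp: functional_sum sum_tensor_apply tensor2_apply simp flip: m(2)
        intro!: sum.cong) (simp add: functional_iff)
  show ?thesis
    unfolding contract_left_def
  proof (rule the_equality)
    fix v assume "\<exists>(n'::nat) a' b'. (\<forall>i<n'. a' i \<in> H \<and> b' i \<in> H) \<and>
      (\<Sum>i<n. tensor2 L (a i) (b i)) = (\<Sum>i<n'. tensor2 L (a' i) (b' i)) \<and>
      v = (\<Sum>i<n'. scl L (\<mu> (a' i)) (b' i))"
    then obtain n' :: nat and a' b' where *: "\<forall>i<n'. a' i \<in> H \<and> b' i \<in> H"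
      "(\<Sum>i<n. tensor2 L (a i) (b i)) = (\<Sum>i<n'. tensor2 L (a' i) (b' i))"
      "v = (\<Sum>i<n'. scl L (\<mu> (a' i)) (b' i))" by blast
    show "v = (\<Sum>i<n. scl L (\<mu> (a i)) (b i))"
    proof (rule functional_separates)
      fix f assume "functional L f"
      thus "f v = f (\<Sum>i<n. scl L (\<mu> (a i)) (b i))"
        using val[of f n a b] val[of f n' a' b'] * ab by simp
    qed
  qed (use ab in blast)
qed

lemma contract_right_eq:
  fixes n :: nat
  assumes H: "subspace H" and \<mu>: "\<mu> \<in> dual_space L H"
    and ab: "\<And>i. i < n \<Longrightarrow> a i \<in> H \<and> b i \<in> H"
  shows "contract_right L H \<mu> (\<Sum>i<n. tensor2 L (a i) (b i)) = (\<Sum>i<n. scl L (\<mu> (b i)) (a i))"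
proof -
  obtain m where m: "functional L m" "\<And>x. x \<in> H \<Longrightarrow> m x = \<mu> x"
    using dual_space_extends[OF H \<mu>] by metis
  have val: "f (\<Sum>i<n. scl L (\<mu> (b i)) (a i)) = (\<Sum>i<n. tensor2 L (a i) (b i)) f m"
    if "functional L f" "\<forall>i<n. a i \<in> H \<and> b i \<in> H" for f and n :: nat and a b
    using that m
    by (auto simp: functional_sum sum_tensor_apply tensor2_apply simp flip: m(2)
        intro!: sum.cong) (simp add: functional_iff mult.commute)
  show ?thesis
    unfolding contract_right_def
  proof (rule the_equality)
    fix v assume "\<exists>(n'::nat) a' b'. (\<forall>i<n'. a' i \<in> H \<and> b' i \<in> H) \<and>
      (\<Sum>i<n. tensor2 L (a i) (b i)) = (\<Sum>i<n'. tensor2 L (a' i) (b' i)) \<and>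
      v = (\<Sum>i<n'. scl L (\<mu> (b' i)) (a' i))"
    then obtain n' :: nat and a' b' where *: "\<forall>i<n'. a' i \<in> H \<and> b' i \<in> H"
      "(\<Sum>i<n. tensor2 L (a i) (b i)) = (\<Sum>i<n'. tensor2 L (a' i) (b' i))"
      "v = (\<Sum>i<n'. scl L (\<mu> (b' i)) (a' i))" by blast
    show "v = (\<Sum>i<n. scl L (\<mu> (b i)) (a i))"
    proof (rule functional_separates)
      fix f assume "functional L f"
      thus "f v = f (\<Sum>i<n. scl L (\<mu> (b i)) (a i))"
        using val[of f n a b] val[of f n' a' b'] * ab by simp
    qed
  qed (use ab in blast)
qed

end

end

theory Submission
  imports Defs "HOL-Computational_Algebra.Fundamental_Theorem_Algebra"
begin

text \<open>
  Contracting with the Killing form turns \<open>r\<close> into an operator \<open>f\<close> on \<open>L\<close>. The equation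
  \<open>r + r21 = \<Omega>\<close> says that the other contraction of \<open>r\<close> is \<open>1 - f\<close>, and the Yang--Baxter equation becomes
  \<open>[f x, f y] = f ([f x, y] + [x, f y] - [x, y])\<close>, i.e. the pairs \<open>(f z - z, f z)\<close> form a subalgebra of
  \<open>L \<times> L\<close>. Up to signs it is spanned by \<open>(\<tau> e\<^sub>\<alpha>, e\<^sub>\<alpha>)\<close> and \<open>(e\<^sub>-\<^sub>\<beta>, \<tau>\<^sup>-\<^sup>1 e\<^sub>-\<^sub>\<beta>)\<close> for positive roots (read as \<open>0\<close>
  where \<open>\<tau>\<close> or its inverse is undefined) and by \<open>((f - 1) h, f h)\<close> for \<open>h \<in> H\<close>.

  The structure theory comes from the Killing form. Even derivations are inner, so \<open>H\<close> acts
  diagonalizably, and traces along root strings show that root spaces are one-dimensional. A positive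
  root outside \<open>\<Gamma>\<close> that is not a sum of positive roots whose root vectors have nonzero bracket would give an
  outer derivation, as happens for psl(3|3), whose Killing form vanishes. Hence every \<open>e\<^sub>\<alpha>\<close> lies in the
  subalgebra generated by the simple root vectors, and \<open>\<phi>\<close> transports root vectors.
\<close>

section \<open>Traces and eigenspaces\<close>

text \<open>The obstacle is that a root of the form \<alpha> + \<beta> need not come from a nonzero
  bracket: if \<alpha>, \<beta> and \<alpha> + \<beta> are all odd, parity makes
  [e_\<alpha>, e_\<beta>] vanish, and psl(3|3) has such triples. Decompositions of roots are
  therefore tracked by nonvanishing brackets. The Jacobi identity shows that the number of
  occurrences of an indecomposable \<theta> in such a decomposition is well defined; this number is
  the eigenvalue of the derivation that excludes \<theta> outside the base. Derivations are inner
  because x \<mapsto> str(D ad x) is represented by the Killing form. Applied to the semisimple part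
  of ad h, this brings Jordan components into the algebra. The operator form of the Yang--Baxter
  equation carries no signs: r is even, and when the first factor is tested with (x, -) and the
  third with (-, y), the signs of the tensor brackets cancel against those of skew-symmetry. If p =
  f x - x, q = f x and p', q' belong to y in the same way, the equation says that z = [q, q'] -
  [p, p'] satisfies f z = [q, q'], hence f z - z = [p, p'].\<close>

locale complex_fd_space = finite_dimensional_vector_space scale Basis
  for scale :: "complex \<Rightarrow> 'b::ab_group_add \<Rightarrow> 'b" and Basis :: "'b set"
begin

definition lin :: "('b \<Rightarrow> 'b) \<Rightarrow> bool" where
  "lin f \<longleftrightarrow> Vector_Spaces.linear scale scale f"

lemma lin_iff:
  "lin f \<longleftrightarrow> (\<forall>x y. f (x + y) = f x + f y) \<and> (\<forall>c x. f (scale c x) = scale c (f x))"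
  using vector_space_axioms by (auto simp: lin_def Vector_Spaces.linear_iff)

lemma lin_add: "lin f \<Longrightarrow> f (x + y) = f x + f y"
  and lin_scale: "lin f \<Longrightarrow> f (scale c x) = scale c (f x)"
  by (auto simp: lin_iff)

lemma lin_0: "lin f \<Longrightarrow> f 0 = 0"
  using lin_scale[of f 0 0] by simp

lemma lin_uminus: "lin f \<Longrightarrow> f (- x) = - f x"
  using lin_scale[of f "-1" x] by simp

lemma lin_diff: "lin f \<Longrightarrow> f (x - y) = f x - f y"
  using lin_add[of f x "- y"] by (simp add: lin_uminus)

lemma lin_sum: "lin f \<Longrightarrow> f (\<Sum>i\<in>A. x i) = (\<Sum>i\<in>A. f (x i))"
  by (induction A rule: infinite_finite_induct) (simp_all add: lin_0 lin_add)

lemma lin_compI: "lin f \<Longrightarrow> lin g \<Longrightarrow> lin (\<lambda>x. f (g x))"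
  and lin_plusI: "lin f \<Longrightarrow> lin g \<Longrightarrow> lin (\<lambda>x. f x + g x)"
  and lin_minusI: "lin f \<Longrightarrow> lin g \<Longrightarrow> lin (\<lambda>x. f x - g x)"
  and lin_scaleI: "lin f \<Longrightarrow> lin (\<lambda>x. scale c (f x))"
  and lin_idI: "lin (\<lambda>x. x)"
  and lin_zeroI: "lin (\<lambda>x. 0)"
  by (auto simp: lin_iff algebra_simps)

lemma lin_funpowI: "lin f \<Longrightarrow> lin (f ^^ n)"
  by (induction n) (simp_all add: lin_iff)

lemma lin_span_image:
  assumes "lin T" "\<And>s. s \<in> S \<Longrightarrow> T s \<in> span S'" "x \<in> span S"
  shows "T x \<in> span S'"
  using assms(3)
proof (induction rule: span_induct_alt)
  case base
  show ?case using assms(1) by (simp add: lin_0 span_zero)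
next
  case (step c x y)
  show ?case
    using step assms by (simp add: lin_add lin_scale span_add span_scale)
qed

lemma lin_span_eq:
  assumes "lin T" "lin U" "\<And>s. s \<in> S \<Longrightarrow> T s = U s" "x \<in> span S"
  shows "T x = U x"
  using assms(4)
  by (induction rule: span_induct_alt) (use assms in \<open>simp_all add: lin_0 lin_add lin_scale\<close>)

lemma span_subset_subspace: "S \<subseteq> T \<Longrightarrow> subspace T \<Longrightarrow> span S \<subseteq> T"
  by (rule span_minimal)

lemma basis_image_expansion:
  assumes C: "finite C" "independent C" and "lin T" "x \<in> span C"
  shows "T x = (\<Sum>c\<in>C. scale (representation C x c) (T c))"
proof -
  have "T x = T (\<Sum>c\<in>C. scale (representation C x c) c)"
    using sum_representation_eq[of C x C] assms by simp
  thus ?thesis using assms by (simp add: lin_sum lin_scale)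
qed

text \<open>Both traces are the same double sum of matrix entries of \<open>A\<close> and
  \<open>A'\<close>. Allowing bases of two different spaces gives at once the independence of a
  trace from the basis and cyclicity between subspaces.\<close>

lemma trace_bases_cyclic:
  assumes B: "finite B" "independent B" and C: "finite C" "independent C"
    and lin: "lin A" "lin A'"
    and A: "\<And>b. b \<in> B \<Longrightarrow> A b \<in> span C" and A': "\<And>c. c \<in> C \<Longrightarrow> A' c \<in> span B"
  shows "(\<Sum>b\<in>B. representation B (A' (A b)) b) = (\<Sum>c\<in>C. representation C (A (A' c)) c)"
proof -
  have l: "representation B (A' (A b)) b = (\<Sum>c\<in>C. representation C (A b) c * representation B (A' c) b)"
    if "b \<in> B" for b
    using A' A that
    by (simp add: basis_image_expansion[OF C lin(2)] representation_sum[OF B(2)] span_scale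
        representation_scale[OF B(2)])
  have r: "representation C (A (A' c)) c = (\<Sum>b\<in>B. representation B (A' c) b * representation C (A b) c)"
    if "c \<in> C" for c
    using A' A that
    by (simp add: basis_image_expansion[OF B lin(1)] representation_sum[OF C(2)] span_scale
        representation_scale[OF C(2)])
  show ?thesis
    by (simp add: l r) (subst sum.swap, simp add: mult.commute)
qed

text \<open>The trace on an invariant subspace; \<open>trace_on_span\<close> shows that the chosen
  basis does not matter. Root strings are in general proper subspaces, hence the parameter
  \<open>S\<close>.\<close>

definition trace_on :: "'b set \<Rightarrow> ('b \<Rightarrow> 'b) \<Rightarrow> complex" where
  "trace_on S T = (let B = (SOME B. finite B \<and> independent B \<and> span B = S)
     in \<Sum>b\<in>B. representation B (T b) b)"

lemma trace_on_span:
  assumes B: "finite B" "independent B" and T: "lin T" "\<And>b. b \<in> B \<Longrightarrow> T b \<in> span B"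
  shows "trace_on (span B) T = (\<Sum>b\<in>B. representation B (T b) b)"
proof -
  define C where "C = (SOME C. finite C \<and> independent C \<and> span C = span B)"
  have C: "finite C" "independent C" "span C = span B"
    using someI[of "\<lambda>C. finite C \<and> independent C \<and> span C = span B" B] B
    by (auto simp: C_def)
  have "(\<Sum>b\<in>B. representation B (T b) b) = (\<Sum>c\<in>C. representation C (T c) c)"
  proof (rule trace_bases_cyclic[OF B C(1,2) T(1) lin_idI])
    show "T b \<in> span C" if "b \<in> B" for b
      using T(2)[OF that] C(3) by simp
    show "c \<in> span B" if "c \<in> C" for c
      using that C(3) span_base by auto
  qed
  thus ?thesis by (simp add: trace_on_def C_def Let_def)
qed

section \<open>Generalized eigenspaces and annihilating polynomials\<close>

definition gen_eigenspace :: "('b \<Rightarrow> 'b) \<Rightarrow> complex \<Rightarrow> 'b set" where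
  "gen_eigenspace T c = {x. \<exists>n. ((\<lambda>x. T x - scale c x) ^^ n) x = 0}"

lemma lin_shift: "lin T \<Longrightarrow> lin (\<lambda>x. T x - scale c x)"
  by (simp add: lin_iff algebra_simps)

lemma funpow_eq_0_mono:
  assumes "lin N" "(N ^^ n) x = 0" "n \<le> m"
  shows "(N ^^ m) x = 0"
proof -
  have "(N ^^ m) x = (N ^^ (m - n)) ((N ^^ n) x)"
    using assms(3) funpow_add[of "m - n" n N] by simp
  thus ?thesis using assms lin_0[OF lin_funpowI] by simp
qed

lemma subspace_locally_nilpotent:
  assumes "lin N"
  shows "subspace {x. \<exists>n. (N ^^ n) x = 0}"
proof (rule subspaceI)
  fix x y assume "x \<in> {x. \<exists>n. (N ^^ n) x = 0}" "y \<in> {x. \<exists>n. (N ^^ n) x = 0}"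
  then obtain m n where mn: "(N ^^ m) x = 0" "(N ^^ n) y = 0" by blast
  have "(N ^^ max m n) x = 0" "(N ^^ max m n) y = 0"
    using funpow_eq_0_mono[OF assms] mn by auto
  hence "(N ^^ max m n) (x + y) = 0"
    using lin_add[OF lin_funpowI[OF assms]] by simp
  thus "x + y \<in> {x. \<exists>n. (N ^^ n) x = 0}" by blast
qed (auto simp: lin_scale[OF lin_funpowI[OF assms]] lin_0[OF lin_funpowI[OF assms]])

lemma subspace_gen_eigenspace: "lin T \<Longrightarrow> subspace (gen_eigenspace T c)"
  unfolding gen_eigenspace_def by (rule subspace_locally_nilpotent[OF lin_shift])

lemma gen_eigenspace_shift:
  assumes T: "lin T" and x: "x \<in> gen_eigenspace T c"
  shows "T x - scale c x \<in> gen_eigenspace T c"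
proof -
  let ?N = "\<lambda>x. T x - scale c x"
  obtain n where n: "(?N ^^ n) x = 0"
    using x by (auto simp: gen_eigenspace_def)
  have "(?N ^^ n) (?N x) = ?N ((?N ^^ n) x)"
    by (rule funpow_swap1[symmetric])
  also have "\<dots> = 0" using n by (simp add: lin_0[OF T])
  finally show ?thesis unfolding gen_eigenspace_def by blast
qed

lemma gen_eigenspace_commuting:
  assumes "lin R" "\<And>x. R (T x) = T (R x)" "x \<in> gen_eigenspace T c"
  shows "R x \<in> gen_eigenspace T c"
proof -
  obtain n where n: "((\<lambda>x. T x - scale c x) ^^ n) x = 0"
    using assms by (auto simp: gen_eigenspace_def)
  have "((\<lambda>x. T x - scale c x) ^^ n) (R x) = R (((\<lambda>x. T x - scale c x) ^^ n) x)"
    by (induction n) (simp_all add: assms lin_diff lin_scale)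
  thus ?thesis using n assms(1) by (auto simp: gen_eigenspace_def lin_0)
qed

text \<open>On this space \<open>T - a\<close> is the nonzero scalar \<open>c - a\<close> plus a
  nilpotent map. The induction on the nilpotency order first solves the equation for
  \<open>T y - c y\<close> and then corrects the solution.\<close>

lemma gen_eigenspace_shift_surj:
  assumes T: "lin T" and "c \<noteq> a" "y \<in> gen_eigenspace T c"
  obtains x where "x \<in> gen_eigenspace T c" "T x - scale a x = y"
proof -
  have "\<exists>x\<in>gen_eigenspace T c. T x - scale a x = y"
    if "((\<lambda>x. T x - scale c x) ^^ n) y = 0" "y \<in> gen_eigenspace T c" for n y
    using that
  proof (induction n arbitrary: y)
    case 0
    thus ?case using lin_0[OF T] by (intro bexI[of _ 0]) auto
  next
    case (Suc n)
    let ?y = "T y - scale c y"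
    have "((\<lambda>x. T x - scale c x) ^^ n) ?y = 0"
      using Suc.prems(1) by (simp add: funpow_Suc_right del: funpow.simps)
    then obtain x where x: "x \<in> gen_eigenspace T c" "T x - scale a x = ?y"
      using Suc.IH gen_eigenspace_shift[OF T Suc.prems(2)] by blast
    let ?z = "scale (1 / (c - a)) (y - x)"
    have "?z \<in> gen_eigenspace T c"
      using subspace_gen_eigenspace[OF T] Suc.prems(2) x(1) by (simp add: subspace_diff subspace_scale)
    moreover have "T ?z - scale a ?z = scale (1 / (c - a)) (T y - scale a y - (T x - scale a x))"
      by (simp add: lin_scale[OF T] lin_diff[OF T] algebra_simps)
    hence "T ?z - scale a ?z = scale (1 / (c - a)) (scale (c - a) y)"
      by (simp add: x(2) algebra_simps)
    hence "T ?z - scale a ?z = y" using \<open>c \<noteq> a\<close> by simp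
    ultimately show ?case by blast
  qed
  moreover obtain n where "((\<lambda>x. T x - scale c x) ^^ n) y = 0"
    using assms(3) unfolding gen_eigenspace_def by blast
  ultimately show thesis using assms(3) that by blast
qed

lemma gen_eigenspace_disjoint:
  assumes T: "lin T" and "c \<noteq> a" "y \<in> gen_eigenspace T c" "T y = scale a y"
  shows "y = 0"
proof -
  obtain n where n: "((\<lambda>x. T x - scale c x) ^^ n) y = 0"
    using assms by (auto simp: gen_eigenspace_def)
  have "((\<lambda>x. T x - scale c x) ^^ n) y = scale ((a - c) ^ n) y"
    by (induction n) (simp_all add: assms lin_scale[OF T] algebra_simps)
  thus ?thesis using n \<open>c \<noteq> a\<close> by simp
qed

lemma gen_eigenspace_shift_inj:
  assumes T: "lin T" and "c \<noteq> a" "y \<in> gen_eigenspace T c" "((\<lambda>x. T x - scale a x) ^^ n) y = 0"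
  shows "y = 0"
  using assms(3,4)
proof (induction n arbitrary: y)
  case (Suc n)
  have "T y - scale a y \<in> gen_eigenspace T c"
    by (rule gen_eigenspace_commuting[OF lin_shift[OF T] _ Suc.prems(1)])
      (simp add: lin_diff[OF T] lin_scale[OF T])
  moreover have "((\<lambda>x. T x - scale a x) ^^ n) (T y - scale a y) = 0"
    using Suc.prems(2) by (simp add: funpow_Suc_right del: funpow.simps)
  ultimately have "T y - scale a y = 0" by (rule Suc.IH)
  thus ?case using gen_eigenspace_disjoint[OF T assms(2) Suc.prems(1)] by simp
qed simp

text \<open>A power of \<open>T - a\<close> kills the summand at \<open>a\<close> but is injective
  on the other generalized eigenspaces, so the induction hypothesis applies to the images of the
  remaining summands.\<close>

lemma gen_eigenspaces_independent:
  assumes T: "lin T" and "finite A" "\<And>c. c \<in> A \<Longrightarrow> y c \<in> gen_eigenspace T c" "(\<Sum>c\<in>A. y c) = 0"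
    and "c \<in> A"
  shows "y c = 0"
  using assms(2-5)
proof (induction A arbitrary: y c rule: finite_induct)
  case (insert a A)
  obtain n where n: "((\<lambda>x. T x - scale a x) ^^ n) (y a) = 0"
    using insert.prems by (auto simp: gen_eigenspace_def)
  let ?P = "(\<lambda>x. T x - scale a x) ^^ n"
  have P: "lin ?P" by (rule lin_funpowI[OF lin_shift[OF T]])
  have comm: "?P (T x) = T (?P x)" for x
    by (induction n) (simp_all add: lin_diff[OF T] lin_scale[OF T])
  have "(\<Sum>c\<in>A. ?P (y c)) = ?P (\<Sum>c\<in>insert a A. y c)"
    using insert.hyps n by (simp add: lin_add[OF P] lin_sum[OF P])
  hence s0: "(\<Sum>c\<in>A. ?P (y c)) = 0" using insert.prems(2) by (simp add: lin_0[OF P])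
  have y0: "y c = 0" if "c \<in> A" for c
  proof (rule gen_eigenspace_shift_inj[OF T])
    show "c \<noteq> a" using that insert.hyps by blast
    show "y c \<in> gen_eigenspace T c" using that insert.prems by blast
    show "?P (y c) = 0"
    proof (rule insert.IH[of "\<lambda>c. ?P (y c)" c, OF _ s0 that])
      fix d assume "d \<in> A"
      thus "?P (y d) \<in> gen_eigenspace T d"
        using gen_eigenspace_commuting[of ?P T "y d" d, OF P comm] insert.prems(1) by simp
    qed
  qed
  hence "y a = 0" using insert.prems(2) insert.hyps by simp
  thus ?case using y0 insert.prems(3) by blast
qed simp

text \<open>Induction over the factors: \<open>T x - a x\<close> already splits into generalized
  eigenvectors, and away from \<open>a\<close> each of them has a preimage under
  \<open>T - a\<close> in its own space.\<close>

lemma gen_eigen_product: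
  assumes T: "lin T" and "foldl (\<lambda>y a. T y - scale a y) x as = 0"
  shows "\<exists>A y. finite A \<and> (\<forall>c\<in>A. y c \<in> gen_eigenspace T c) \<and> x = (\<Sum>c\<in>A. y c)"
  using assms(2)
  proof (induction as arbitrary: x)
    case Nil
    thus ?case by (intro exI[of _ "{}"]) auto
  next
    case (Cons a as)
    have "foldl (\<lambda>y a. T y - scale a y) (T x - scale a x) as = 0"
      using Cons.prems by simp
    from Cons.IH[OF this] obtain A y
      where A: "finite A" "\<And>c. c \<in> A \<Longrightarrow> y c \<in> gen_eigenspace T c"
      "T x - scale a x = (\<Sum>c\<in>A. y c)"
      by auto
    have "\<exists>z. z \<in> gen_eigenspace T c \<and> T z - scale a z = y c" if "c \<in> A - {a}" for c
      using gen_eigenspace_shift_surj[OF T, of c a "y c"] A(2) that by blast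
    then obtain z where z: "\<And>c. c \<in> A - {a} \<Longrightarrow> z c \<in> gen_eigenspace T c"
      "\<And>c. c \<in> A - {a} \<Longrightarrow> T (z c) - scale a (z c) = y c" by metis
    \<comment> \<open>Removing these preimages leaves a vector which \<open>T - a\<close> maps into
      the generalized eigenspace of \<open>a\<close>; hence it lies there itself.\<close>
    let ?w = "x - (\<Sum>c\<in>A - {a}. z c)"
    have "T ?w - scale a ?w = (T x - scale a x) - (\<Sum>c\<in>A - {a}. T (z c) - scale a (z c))"
      by (simp add: lin_diff[OF T] lin_sum[OF T] scale_right_diff_distrib scale_sum_right
          sum_subtractf algebra_simps)
    also have "\<dots> = (\<Sum>c\<in>A. y c) - (\<Sum>c\<in>A - {a}. y c)"
      using A(3) z(2) by simp
    also have "\<dots> = (if a \<in> A then y a else 0)"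
      using A(1) by (simp add: sum_diff1)
    finally have "T ?w - scale a ?w \<in> gen_eigenspace T a"
      using A(2)[of a] subspace_0[OF subspace_gen_eigenspace[OF T]] by (auto split: if_splits)
    then obtain n where "((\<lambda>x. T x - scale a x) ^^ n) (T ?w - scale a ?w) = 0"
      by (auto simp: gen_eigenspace_def)
    hence "((\<lambda>x. T x - scale a x) ^^ Suc n) ?w = 0"
      by (simp add: funpow_Suc_right del: funpow.simps)
    hence w: "?w \<in> gen_eigenspace T a" unfolding gen_eigenspace_def by blast
    have "x = (\<Sum>c\<in>insert a A. (z(a := ?w)) c)"
      using A(1) by (subst sum.insert_remove) simp_all
    moreover have "\<forall>c\<in>insert a A. (z(a := ?w)) c \<in> gen_eigenspace T c"
      using w z(1) by simp
    ultimately show ?case using A(1) by (intro exI[of _ "insert a A"]) blast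
  qed

lemma eigen_sum:
  assumes T: "lin T" and "x \<in> span {x. \<exists>c. T x = scale c x}"
  shows "\<exists>A y. finite A \<and> (\<forall>c\<in>A. T (y c) = scale c (y c)) \<and> x = (\<Sum>c\<in>A. y c)"
  using assms(2)
proof (induction rule: span_induct_alt)
  case base
  show ?case by (intro exI[of _ "{}"] exI[of _ "\<lambda>_. 0"]) simp
next
  case (step a v w)
  then obtain A y c where A: "finite A" "\<forall>c\<in>A. T (y c) = scale c (y c)" "w = (\<Sum>c\<in>A. y c)"
    and v: "T v = scale c v" by blast
  define u where "u = (\<lambda>d. (if d \<in> A then y d else 0) + (if d = c then scale a v else 0))"
  have "scale a v + w = (\<Sum>d\<in>insert c A. u d)"
    unfolding u_def sum.distrib using A(1)
    by (auto simp: A(3) sum.If_cases Int_absorb1 subset_insertI insert_absorb intro: sum.cong)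
  moreover have "\<forall>d\<in>insert c A. T (u d) = scale d (u d)"
    using A v by (simp add: u_def lin_add[OF T] lin_scale[OF T] lin_0[OF T] algebra_simps)
  ultimately show ?case using A(1) by (intro exI[of _ "insert c A"] exI[of _ u]) simp
qed

text \<open>Applying \<open>T - a\<close> to the sum removes the summand at \<open>a\<close> and
  rescales the others by the nonzero \<open>c - a\<close>, so induction on the number of eigenvalues
  isolates each summand.\<close>

lemma eigen_sum_in_invariant:
  assumes T: "lin T" and V: "subspace V" "\<And>x. x \<in> V \<Longrightarrow> T x \<in> V"
    and "finite A" "\<And>c. c \<in> A \<Longrightarrow> T (y c) = scale c (y c)" "(\<Sum>c\<in>A. y c) \<in> V" "c \<in> A"
  shows "y c \<in> V"
  using assms(4-7)
proof (induction A arbitrary: y c rule: finite_induct)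
  case (insert a A)
  let ?s = "\<Sum>c\<in>insert a A. y c"
  have "T ?s - scale a ?s = (\<Sum>c\<in>insert a A. scale (c - a) (y c))"
    using insert.prems(1)
    by (simp add: lin_sum[OF T] scale_sum_right scale_left_diff_distrib sum_subtractf del: sum.insert)
  also have "\<dots> = (\<Sum>c\<in>A. scale (c - a) (y c))"
    using insert.hyps by simp
  finally have eq: "T ?s - scale a ?s = (\<Sum>c\<in>A. scale (c - a) (y c))" .
  have s: "(\<Sum>c\<in>A. scale (c - a) (y c)) \<in> V"
    unfolding eq[symmetric]
    by (intro subspace_diff[OF V(1)] subspace_scale[OF V(1)] V(2) insert.prems(2))
  have yV: "y c \<in> V" if "c \<in> A" for c
  proof -
    have "scale (c - a) (y c) \<in> V"
      using insert.IH[of "\<lambda>c. scale (c - a) (y c)"] s that insert.prems(1)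
      by (simp add: lin_scale[OF T] mult.commute)
    hence "scale (1 / (c - a)) (scale (c - a) (y c)) \<in> V" using V(1) subspace_scale by blast
    moreover have "c \<noteq> a" using that insert.hyps by blast
    ultimately show ?thesis by simp
  qed
  hence "(\<Sum>c\<in>A. y c) \<in> V" using V(1) by (simp add: subspace_sum)
  hence "y a \<in> V"
    using insert.prems(2) insert.hyps V(1) subspace_diff[of V ?s "\<Sum>c\<in>A. y c"] by simp
  thus ?case using yV insert.prems(3) by blast
qed simp

text \<open>Links a polynomial in \<open>T\<close>, given by coefficients, with the successive
  application of its linear factors. The bound \<open>N\<close> is any number above the degree, so
  that multiplication by the variable becomes an index shift.\<close>

lemma foldl_shift_poly:
  assumes T: "lin T" and "length as < N"
  shows "(\<Sum>i<N. scale (coeff (\<Prod>a\<leftarrow>as. [:- a, 1:]) i) ((T ^^ i) x)) =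
    foldl (\<lambda>y a. T y - scale a y) x as"
  using assms(2)
proof (induction as arbitrary: x N)
  case Nil
  then obtain M where "N = Suc M" by (cases N) auto
  thus ?case by (simp add: sum.lessThan_Suc_shift del: sum.lessThan_Suc)
next
  case (Cons a as)
  then obtain M where N: "N = Suc M" "length as < M" by (cases N) auto
  let ?q = "\<Prod>a\<leftarrow>as. [:- a, 1:]"
  have "degree ?q \<le> (\<Sum>p\<leftarrow>map (\<lambda>a. [:- a, 1:]) as. degree p)"
    by (rule degree_prod_list_le)
  also have "\<dots> = length as" by (induction as) auto
  finally have qM: "coeff ?q M = 0" using N by (intro coeff_eq_0) simp
  have "(\<Sum>i<N. scale (coeff (\<Prod>a\<leftarrow>a # as. [:- a, 1:]) i) ((T ^^ i) x)) =
      (\<Sum>i<Suc M. scale (- a * coeff ?q i) ((T ^^ i) x)) +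
      (\<Sum>i<Suc M. scale (coeff (pCons 0 ?q) i) ((T ^^ i) x))"
    unfolding sum.distrib[symmetric] N by (rule sum.cong) (simp_all add: algebra_simps)
  also have "(\<Sum>i<Suc M. scale (- a * coeff ?q i) ((T ^^ i) x)) =
      (\<Sum>i<M. scale (- a * coeff ?q i) ((T ^^ i) x))"
    by (simp add: qM)
  also have "(\<Sum>i<Suc M. scale (coeff (pCons 0 ?q) i) ((T ^^ i) x)) =
      (\<Sum>i<M. scale (coeff ?q i) ((T ^^ Suc i) x))"
    by (simp add: sum.lessThan_Suc_shift del: sum.lessThan_Suc)
  also have "(\<Sum>i<M. scale (- a * coeff ?q i) ((T ^^ i) x)) +
      (\<Sum>i<M. scale (coeff ?q i) ((T ^^ Suc i) x)) =
      (\<Sum>i<M. scale (coeff ?q i) ((T ^^ i) (T x - scale a x)))"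
    unfolding sum.distrib[symmetric]
  proof (rule sum.cong)
    fix i
    have e: "(T ^^ i) (T x - scale a x) = (T ^^ Suc i) x - scale a ((T ^^ i) x)"
      using lin_diff[OF lin_funpowI[OF T]] lin_scale[OF lin_funpowI[OF T]]
      by (simp add: funpow_swap1)
    show "scale (- a * coeff ?q i) ((T ^^ i) x) + scale (coeff ?q i) ((T ^^ Suc i) x) =
        scale (coeff ?q i) ((T ^^ i) (T x - scale a x))"
      unfolding e by (simp add: algebra_simps)
  qed simp
  also have "\<dots> = foldl (\<lambda>y a. T y - scale a y) (T x - scale a x) as"
    by (rule Cons.IH[OF N(2)])
  finally show ?case by simp
qed

text \<open>The iterates \<open>(T ^^ i) x\<close> with \<open>i\<close> up to the dimension are one
  too many to be independent: they satisfy a linear relation unless two of them coincide.\<close>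

lemma annihilating_poly:
  assumes T: "lin T"
  obtains p where "p \<noteq> 0" "(\<Sum>i\<le>degree p. scale (coeff p i) ((T ^^ i) x)) = 0"
proof -
  have "\<exists>p N. p \<noteq> 0 \<and> degree p < N \<and> (\<Sum>i<N. scale (coeff p i) ((T ^^ i) x)) = 0"
  proof (cases "inj_on (\<lambda>i. (T ^^ i) x) {..dimension}")
    case True
    let ?S = "(\<lambda>i. (T ^^ i) x) ` {..dimension}"
    have "card ?S = Suc dimension" using True by (simp add: card_image)
    hence "dependent ?S"
      using independent_card_le_dim[of ?S UNIV] by (auto simp: dim_UNIV dimension_def)
    then obtain u where u: "\<exists>v\<in>?S. u v \<noteq> 0" "(\<Sum>v\<in>?S. scale (u v) v) = 0"
      using dependent_finite[of ?S] by auto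
    define p where "p = Abs_poly (\<lambda>i. if i \<le> dimension then u ((T ^^ i) x) else 0)"
    have c: "coeff p i = (if i \<le> dimension then u ((T ^^ i) x) else 0)" for i
      unfolding p_def by (subst coeff_Abs_poly[of dimension]) auto
    obtain i where "i \<le> dimension" "u ((T ^^ i) x) \<noteq> 0" using u(1) by auto
    hence "coeff p i \<noteq> 0" using c by simp
    hence "p \<noteq> 0" by auto
    moreover have "degree p < Suc dimension"
      using degree_le[of dimension p] c by simp
    moreover have "(\<Sum>i<Suc dimension. scale (coeff p i) ((T ^^ i) x)) = 0"
      using u(2) True by (simp add: sum.reindex c lessThan_Suc_atMost del: sum.lessThan_Suc)
    ultimately show ?thesis by blast
  next
    case False
    then obtain i j where ij: "i < j" "(T ^^ i) x = (T ^^ j) x"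
      unfolding inj_on_def by (metis linorder_neqE_nat)
    \<comment> \<open>Coinciding iterates collapse in the image set, so here the relation is the
      difference of two monomials.\<close>
    define p :: "complex poly" where "p = monom 1 i - monom 1 j"
    have "coeff p i = 1" using ij by (simp add: p_def)
    hence "p \<noteq> 0" by auto
    moreover have "degree p \<le> j" unfolding p_def
      by (rule degree_diff_le) (use ij in \<open>simp_all add: degree_monom_eq\<close>)
    moreover have "(\<Sum>k<Suc j. scale (coeff p k) ((T ^^ k) x)) =
        (\<Sum>k<Suc j. (if k = i then (T ^^ i) x else 0)) - (\<Sum>k<Suc j. (if k = j then (T ^^ j) x else 0))"
      unfolding sum_subtractf[symmetric]
      by (rule sum.cong) (auto simp: p_def algebra_simps)
    hence "(\<Sum>k<Suc j. scale (coeff p k) ((T ^^ k) x)) = 0"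
      using ij by (simp del: sum.lessThan_Suc)
    ultimately show ?thesis by (intro exI[of _ p] exI[of _ "Suc j"]) (auto simp del: sum.lessThan_Suc)
  qed
  then obtain p N where p: "p \<noteq> 0" "degree p < N" "(\<Sum>i<N. scale (coeff p i) ((T ^^ i) x)) = 0"
    by blast
  have "(\<Sum>i\<le>degree p. scale (coeff p i) ((T ^^ i) x)) = (\<Sum>i<N. scale (coeff p i) ((T ^^ i) x))"
    by (rule sum.mono_neutral_left) (use p in \<open>auto simp: coeff_eq_0\<close>)
  thus thesis using that p by simp
qed

text \<open>An annihilating polynomial of \<open>x\<close> factors over the complex numbers, which
  reduces the claim to \<open>gen_eigen_product\<close>.\<close>

lemma gen_eigenspace_decomposition:
  assumes T: "lin T"
  shows "\<exists>A y. finite A \<and> (\<forall>c\<in>A. y c \<in> gen_eigenspace T c) \<and> x = (\<Sum>c\<in>A. y c)"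
proof -
  obtain p where p: "p \<noteq> 0" "(\<Sum>i\<le>degree p. scale (coeff p i) ((T ^^ i) x)) = 0"
    using annihilating_poly[OF T] by blast
  obtain A where A: "size A = degree p" "p = smult (lead_coeff p) (\<Prod>a\<in>#A. [:- a, 1:])"
    using alg_closed_imp_factorization[OF p(1)] by blast
  obtain as where as: "mset as = A" using ex_mset by blast
  let ?q = "\<Prod>a\<leftarrow>as. [:- a, 1:]"
  have pq: "p = smult (lead_coeff p) ?q"
    using A(2) by (simp flip: as add: prod_mset_prod_list mset_map[symmetric] del: mset_map)
  have "scale (lead_coeff p) (\<Sum>i<Suc (degree p). scale (coeff ?q i) ((T ^^ i) x)) =
      (\<Sum>i\<le>degree p. scale (coeff (smult (lead_coeff p) ?q) i) ((T ^^ i) x))"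
    by (simp add: scale_sum_right lessThan_Suc_atMost del: sum.lessThan_Suc)
  also have "\<dots> = 0" using p(2) by (simp flip: pq)
  finally have "(\<Sum>i<Suc (degree p). scale (coeff ?q i) ((T ^^ i) x)) = 0"
    using p(1) by (simp del: sum.lessThan_Suc)
  moreover have "length as < Suc (degree p)" using A(1) as by auto
  ultimately have "foldl (\<lambda>y a. T y - scale a y) x as = 0"
    using foldl_shift_poly[OF T, of as "Suc (degree p)" x] by simp
  thus ?thesis by (rule gen_eigen_product[OF T])
qed

section \<open>Jordan decomposition and joint diagonalization\<close>

lemma span_UNIV_mono: "A \<subseteq> B \<Longrightarrow> span A = UNIV \<Longrightarrow> span B = UNIV"
  using span_mono[of A B] by blast

lemma span_gen_eigenspaces:
  assumes T: "lin T"
  shows "span (\<Union>c. gen_eigenspace T c) = UNIV"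
proof -
  have "x \<in> span (\<Union>c. gen_eigenspace T c)" for x
  proof -
    obtain A y where "finite A" "\<forall>c\<in>A. y c \<in> gen_eigenspace T c" "x = (\<Sum>c\<in>A. y c)"
      using gen_eigenspace_decomposition[OF T] by blast
    thus ?thesis by (simp only:) (rule span_sum, rule span_base, blast)
  qed
  thus ?thesis by blast
qed

text \<open>\<open>S\<close> is prescribed on a basis of generalized eigenvectors. It has the right
  value on every generalized eigenvector because such a vector involves only basis vectors with its
  own eigenvalue.\<close>

lemma semisimple_part:
  assumes T: "lin T"
  obtains S where "lin S" "\<And>c x. x \<in> gen_eigenspace T c \<Longrightarrow> S x = scale c x"
proof -
  let ?G = "\<Union>c. gen_eigenspace T c"
  have G: "span ?G = UNIV" by (rule span_gen_eigenspaces[OF T])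
  obtain B where B: "B \<subseteq> ?G" "independent B" "?G \<subseteq> span B"
    using maximal_independent_subset[of ?G] by blast
  have spanB: "span B = UNIV" using B(3) G by (metis span_mono span_span top.extremum_uniqueI)
  have finB: "finite B" using B(2) by (rule finiteI_independent)
  have "\<forall>b\<in>B. \<exists>c. b \<in> gen_eigenspace T c" using B(1) by blast
  then obtain l where l: "\<And>b. b \<in> B \<Longrightarrow> b \<in> gen_eigenspace T (l b)" by metis
  interpret vp: vector_space_pair scale scale by unfold_locales
  obtain S where S: "lin S" "\<And>b. b \<in> B \<Longrightarrow> S b = scale (l b) b"
    using vp.linear_independent_extend[OF B(2), of "\<lambda>b. scale (l b) b"] unfolding lin_def by blast
  have "S x = scale c x" if x: "x \<in> gen_eigenspace T c" for c x
  proof -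
    let ?r = "representation B x"
    define y where "y d = (\<Sum>b\<in>{b\<in>B. l b = d}. scale (?r b) b)" for d
    have xs: "x = (\<Sum>b\<in>B. scale (?r b) b)"
      using sum_representation_eq[of B x B] B(2) finB spanB by simp
    define A where "A = insert c (l ` B)"
    have fA: "finite A" using finB by (simp add: A_def)
    have xy: "x = (\<Sum>d\<in>A. y d)"
      unfolding y_def by (subst sum.group[OF finB fA]) (auto simp: A_def simp flip: xs)
    have yG: "y d \<in> gen_eigenspace T d" for d
      unfolding y_def using l
      by (auto intro!: subspace_sum subspace_scale subspace_gen_eigenspace[OF T])
    \<comment> \<open>Subtracting \<open>x\<close> from its own component at \<open>c\<close> gives
      generalized eigenvectors with sum 0, so this component equals \<open>x\<close>.\<close>
    define z where "z d = y d - (if d = c then x else 0)" for d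
    have zG: "z d \<in> gen_eigenspace T d" for d
      using yG[of d] x subspace_gen_eigenspace[OF T, of d]
      by (auto simp: z_def intro: subspace_diff)
    have "(\<Sum>d\<in>A. z d) = 0"
      using fA by (simp add: z_def sum_subtractf flip: xy) (simp add: A_def)
    hence "z c = 0"
      using gen_eigenspaces_independent[OF T fA zG, of c] by (simp add: A_def)
    hence "x = (\<Sum>b\<in>{b\<in>B. l b = c}. scale (?r b) b)" by (simp add: z_def y_def)
    moreover have "S (\<Sum>b\<in>{b\<in>B. l b = c}. scale (?r b) b) =
        scale c (\<Sum>b\<in>{b\<in>B. l b = c}. scale (?r b) b)"
      using S by (simp add: lin_sum lin_scale scale_sum_right mult.commute)
    ultimately show ?thesis by simp
  qed
  thus thesis using that S(1) by blast
qed

lemma locally_nilpotent_imp_nilpotent: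
  assumes N: "lin N" and "span {x. \<exists>n. (N ^^ n) x = 0} = UNIV"
  obtains n where "\<And>x. (N ^^ n) x = 0"
proof -
  have all: "\<exists>n. (N ^^ n) x = 0" for x
    using assms(2) span_subset_subspace[OF subset_refl subspace_locally_nilpotent[OF N]] by blast
  then obtain k where k: "\<And>x. (N ^^ k x) x = 0" by metis
  define n where "n = Max (insert 0 (k ` Basis))"
  have "(N ^^ n) b = 0" if "b \<in> Basis" for b
    by (rule funpow_eq_0_mono[OF N k[of b]]) (use that finite_Basis in \<open>simp add: n_def\<close>)
  hence "(N ^^ n) x = (\<lambda>x. 0) x" for x
    using lin_span_eq[of "N ^^ n" "\<lambda>x. 0" Basis x] lin_funpowI[OF N] lin_zeroI span_Basis by blast
  thus thesis using that by blast
qed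

text \<open>The last clause, that whatever commutes with \<open>T\<close> commutes with
  \<open>S\<close>, is applied to \<open>grade\<close> to show that the semisimple part of ad h is
  even.\<close>

lemma jordan_decomposition:
  assumes T: "lin T"
  obtains S n where "lin S" "span {x. \<exists>c. S x = scale c x} = UNIV"
    "\<And>x. ((\<lambda>x. T x - S x) ^^ n) x = 0"
    "\<And>c x. x \<in> gen_eigenspace T c \<Longrightarrow> S x = scale c x"
    "\<And>R x. lin R \<Longrightarrow> (\<And>x. R (T x) = T (R x)) \<Longrightarrow> R (S x) = S (R x)"
proof -
  obtain S where S: "lin S" "\<And>c x. x \<in> gen_eigenspace T c \<Longrightarrow> S x = scale c x"
    using semisimple_part[OF T] by blast
  have "(\<Union>c. gen_eigenspace T c) \<subseteq> {x. \<exists>c. S x = scale c x}" using S(2) by blast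
  hence diag: "span {x. \<exists>c. S x = scale c x} = UNIV"
    by (rule span_UNIV_mono) (rule span_gen_eigenspaces[OF T])
  have N: "lin (\<lambda>x. T x - S x)" using T S(1) by (rule lin_minusI)
  have "\<exists>n. ((\<lambda>x. T x - S x) ^^ n) x = 0" if x: "x \<in> gen_eigenspace T c" for x c
  proof -
    obtain n where n: "((\<lambda>x. T x - scale c x) ^^ n) x = 0"
      using x by (auto simp: gen_eigenspace_def)
    have "((\<lambda>x. T x - S x) ^^ n) x = ((\<lambda>x. T x - scale c x) ^^ n) x \<and>
        ((\<lambda>x. T x - scale c x) ^^ n) x \<in> gen_eigenspace T c" for n
      by (induction n) (use x gen_eigenspace_shift[OF T] S(2) in auto)
    thus ?thesis using n by metis
  qed
  hence "(\<Union>c. gen_eigenspace T c) \<subseteq> {x. \<exists>n. ((\<lambda>x. T x - S x) ^^ n) x = 0}"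
    by (intro UN_least subsetI CollectI)
  hence "span {x. \<exists>n. ((\<lambda>x. T x - S x) ^^ n) x = 0} = UNIV"
    by (rule span_UNIV_mono) (rule span_gen_eigenspaces[OF T])
  then obtain n where n: "\<And>x. ((\<lambda>x. T x - S x) ^^ n) x = 0"
    using locally_nilpotent_imp_nilpotent[OF N] by blast
  have "R (S x) = S (R x)" if R: "lin R" "\<And>x. R (T x) = T (R x)" for R x
  proof (rule lin_span_eq[where T = "\<lambda>x. R (S x)" and U = "\<lambda>x. S (R x)"])
    show "x \<in> span (\<Union>c. gen_eigenspace T c)" using span_gen_eigenspaces[OF T] by blast
    fix s assume "s \<in> (\<Union>c. gen_eigenspace T c)"
    then obtain c where c: "s \<in> gen_eigenspace T c" by blast
    thus "R (S s) = S (R s)"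
      using gen_eigenspace_commuting[OF R c] S(2) lin_scale[OF R(1)] by simp
  qed (use R S in \<open>auto intro: lin_compI\<close>)
  with that S diag n show thesis by blast
qed

text \<open>The family may be infinite, so the induction is on the dimension of an invariant
  subspace: a member with a non-eigenvector in it has only proper eigenspaces there, and these are
  invariant and span it.\<close>

lemma joint_diagonalization:
  assumes lin: "\<And>T. T \<in> F \<Longrightarrow> lin T"
    and diag: "\<And>T. T \<in> F \<Longrightarrow> span {x. \<exists>c. T x = scale c x} = UNIV"
    and comm: "\<And>T U x. T \<in> F \<Longrightarrow> U \<in> F \<Longrightarrow> T (U x) = U (T x)"
  shows "span {x. \<forall>T\<in>F. \<exists>c. T x = scale c x} = UNIV"
proof -
  let ?J = "{x. \<forall>T\<in>F. \<exists>c. T x = scale c x}"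
  have "V \<subseteq> span ?J" if "subspace V" "\<And>T x. T \<in> F \<Longrightarrow> x \<in> V \<Longrightarrow> T x \<in> V" for V
    using that
  proof (induction "dim V" arbitrary: V rule: less_induct)
    case less
    show ?case
    proof (cases "V \<subseteq> ?J")
      case True
      thus ?thesis using span_base by blast
    next
      case False
      then obtain T x where T: "T \<in> F" and x: "x \<in> V" "\<nexists>c. T x = scale c x" by blast
      have sub: "V \<inter> {y. T y = scale c y} \<subseteq> span ?J" for c
      proof (rule less.hyps)
        let ?W = "V \<inter> {y. T y = scale c y}"
        show W: "subspace ?W"
          using less.prems(1)
          by (auto simp: subspace_def lin_0[OF lin[OF T]] lin_add[OF lin[OF T]] lin_scale[OF lin[OF T]]
              algebra_simps)
        have "?W \<noteq> V" using x by blast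
        hence "span ?W \<subset> span V" using W less.prems(1) by (auto simp: span_eq_iff[THEN iffD2])
        thus "dim ?W < dim V" by (rule dim_psubset)
        fix U y assume "U \<in> F" "y \<in> ?W"
        thus "U y \<in> ?W"
          using less.prems(2) comm[OF T, of U y] lin_scale[OF lin[of U]] by auto
      qed
      show ?thesis
      proof
        fix v assume v: "v \<in> V"
        obtain A y where A: "finite A" "\<forall>c\<in>A. T (y c) = scale c (y c)" "v = (\<Sum>c\<in>A. y c)"
          using eigen_sum[OF lin[OF T], of v] diag[OF T] by auto
        have "y c \<in> V" if "c \<in> A" for c
          using eigen_sum_in_invariant[OF lin[OF T] less.prems(1) less.prems(2)[OF T] A(1)] A v that
          by blast
        hence "y c \<in> span ?J" if "c \<in> A" for c using sub[of c] A(2) that by blast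
        thus "v \<in> span ?J" unfolding A(3) by (rule span_sum)
      qed
    qed
  qed
  from this[of UNIV] show ?thesis by auto
qed

subsection \<open>Traces on subspaces\<close>

lemma subspace_basis:
  assumes "subspace S"
  obtains B where "finite B" "independent B" "span B = S"
  using assms by (metis basis_exists finiteI_independent span_subspace)

lemma trace_on_cyclic:
  assumes S: "subspace S" "subspace S'" and lin: "lin A" "lin A'"
    and A: "\<And>x. x \<in> S \<Longrightarrow> A x \<in> S'" and A': "\<And>x. x \<in> S' \<Longrightarrow> A' x \<in> S"
  shows "trace_on S (\<lambda>x. A' (A x)) = trace_on S' (\<lambda>x. A (A' x))"
proof -
  obtain B C where B: "finite B" "independent B" "span B = S"
    and C: "finite C" "independent C" "span C = S'"
    using S subspace_basis by metis
  show ?thesis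
    unfolding B(3)[symmetric] C(3)[symmetric]
    using trace_bases_cyclic[OF B(1,2) C(1,2) lin] A A' B C
    by (subst (1 2) trace_on_span) (auto simp: lin lin_compI span_base)
qed

lemma trace_on_plus:
  assumes "subspace S" "lin T" "lin U" "\<And>x. x \<in> S \<Longrightarrow> T x \<in> S" "\<And>x. x \<in> S \<Longrightarrow> U x \<in> S"
  shows "trace_on S (\<lambda>x. T x + U x) = trace_on S T + trace_on S U"
proof -
  obtain B where B: "finite B" "independent B" "span B = S"
    using assms subspace_basis by metis
  have b: "b \<in> S" if "b \<in> B" for b using B that span_base by blast
  show ?thesis
    unfolding B(3)[symmetric]
    by (subst (1 2 3) trace_on_span)
      (use B b assms in \<open>auto simp: representation_add sum.distrib subspace_add intro: lin_plusI\<close>)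
qed

lemma trace_on_scale:
  assumes "subspace S" "lin T" "\<And>x. x \<in> S \<Longrightarrow> T x \<in> S"
  shows "trace_on S (\<lambda>x. scale c (T x)) = c * trace_on S T"
proof -
  obtain B where B: "finite B" "independent B" "span B = S"
    using assms subspace_basis by metis
  have b: "b \<in> S" if "b \<in> B" for b using B that span_base by blast
  show ?thesis
    unfolding B(3)[symmetric]
    by (subst (1 2) trace_on_span)
      (use B b assms in \<open>auto simp: representation_scale sum_distrib_left subspace_scale intro: lin_scaleI\<close>)
qed

text \<open>A basis can be chosen inside \<open>X\<close> itself, which makes the trace a sum of the
  prescribed eigenvalues.\<close>

lemma trace_on_eigenvectors:
  assumes T: "lin T" and "\<And>x. x \<in> X \<Longrightarrow> T x = scale (l x) x"
  obtains B where "finite B" "B \<subseteq> X" "independent B" "span B = span X"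
    "trace_on (span X) T = (\<Sum>b\<in>B. l b)"
proof -
  obtain B where B: "B \<subseteq> X" "independent B" "X \<subseteq> span B"
    using maximal_independent_subset[of X] by blast
  have f: "finite B" using B(2) by (rule finiteI_independent)
  have s: "span B = span X" using B by (metis span_mono span_span subset_antisym)
  have "trace_on (span B) T = (\<Sum>b\<in>B. representation B (T b) b)"
    using B assms by (intro trace_on_span f T) (auto simp: span_base span_scale subsetD)
  also have "\<dots> = (\<Sum>b\<in>B. l b)"
    using B assms(2)
    by (intro sum.cong) (auto simp: representation_scale span_base representation_basis subsetD)
  finally show thesis using that f B s by simp
qed

text \<open>Regarding \<open>T\<close> as a map from \<open>S\<close> onto its image followed by the
  inclusion, cyclicity replaces the trace on \<open>S\<close> by that on the image, where the
  nilpotency order has dropped by one.\<close>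

lemma trace_on_nilpotent:
  assumes "subspace S" "lin T" "\<And>x. x \<in> S \<Longrightarrow> T x \<in> S" "\<And>x. x \<in> S \<Longrightarrow> (T ^^ n) x = 0"
  shows "trace_on S T = 0"
  using assms(1,3,4)
proof (induction n arbitrary: S)
  case 0
  have "x = 0" if "x \<in> S" for x
    using 0(3)[OF that] by simp
  hence "S = span {}" using subspace_0[OF 0(1)] by (auto simp: span_empty)
  moreover have "trace_on (span {}) T = (\<Sum>b\<in>{}. representation {} (T b) b)"
    by (rule trace_on_span) (simp_all add: assms(2) independent_empty)
  ultimately show ?case by simp
next
  case (Suc n)
  interpret vp: vector_space_pair scale scale by unfold_locales
  have S': "subspace (T ` S)"
    using vp.linear_subspace_image assms(2) Suc.prems(1) unfolding lin_def by blast
  have "trace_on S (\<lambda>x. T x) = trace_on (T ` S) (\<lambda>x. T x)"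
    by (rule trace_on_cyclic[where A' = "\<lambda>x. x"]) (use Suc.prems S' assms lin_idI in auto)
  also have "\<dots> = 0"
    by (rule Suc.IH[OF S']) (use Suc.prems in \<open>auto simp: funpow_swap1\<close>)
  finally show ?case .
qed

end

section \<open>The Killing form\<close>

locale killing_superalgebra = lie_superalgebra L
  for L :: "'g::ab_group_add lie_superalg" +
  assumes fd: "finite_dim L" and nondeg: "nondegenerate_killing L"
begin

text \<open>The same choice as inside \<open>supertrace\<close>, so that unfolding that definition
  meets this basis.\<close>

definition hbasis :: "'g set" where
  "hbasis = (SOME B. homogeneous_basis L B)"

lemma independent_finite: "independent B \<Longrightarrow> finite B"
  using fd independent_span_bound[of _ B] unfolding finite_dim_def by auto

lemma span_homogeneous: "span (even_part L \<union> odd_part L) = UNIV"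
proof -
  have "x \<in> span (even_part L \<union> odd_part L)" for x
    using even_plus_odd[of x] by (metis UnI1 UnI2 span_add span_base)
  thus ?thesis by blast
qed

lemma homogeneous_hbasis: "homogeneous_basis L hbasis"
proof -
  obtain B where B: "B \<subseteq> even_part L \<union> odd_part L" "independent B"
    "even_part L \<union> odd_part L \<subseteq> span B"
    using maximal_independent_subset by blast
  have "span B = UNIV"
    using span_mono[OF B(3)] span_homogeneous by (auto simp: span_span)
  hence "homogeneous_basis L B" using B by (simp add: homogeneous_basis_def)
  thus ?thesis unfolding hbasis_def by (rule someI)
qed

sublocale complex_fd_space "scl L" hbasis
  using homogeneous_hbasis independent_finite
  by unfold_locales (auto simp: homogeneous_basis_def)

lemma lin_brk: "lin (brk L x)" "lin (\<lambda>y. brk L x y)" "lin (\<lambda>x. brk L x y)"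
  by (simp_all add: lin_iff brk_linear_simps)

lemma brk_diff: "brk L (x - y) z = brk L x z - brk L y z" "brk L z (x - y) = brk L z x - brk L z y"
  by (rule lin_diff[OF lin_brk(3)], rule lin_diff[OF lin_brk(1)])

lemma brk_uminus: "brk L (- x) z = - brk L x z" "brk L z (- x) = - brk L z x"
  by (rule lin_uminus[OF lin_brk(3)], rule lin_uminus[OF lin_brk(1)])

lemma brk_sum_left: "brk L (\<Sum>i\<in>A. x i) y = (\<Sum>i\<in>A. brk L (x i) y)"
  and brk_sum_right: "brk L y (\<Sum>i\<in>A. x i) = (\<Sum>i\<in>A. brk L y (x i))"
  using lin_sum[OF lin_brk(3)[of y], of x A] lin_sum[OF lin_brk(1)[of y], of x A] by auto

lemma component_decomp: "x = component L 0 x + component L (Suc 0) x"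
proof -
  have "component L (Suc 0) x = x - component L 0 x"
    using component_in_part[where i = 0 and x = x] by (intro component_eqI) (auto simp: Defs.part_def)
  thus ?thesis by simp
qed

lemma homogeneous_induct:
  assumes "\<And>x i. x \<in> part L i \<Longrightarrow> P x" "\<And>x y. P x \<Longrightarrow> P y \<Longrightarrow> P (x + y)"
  shows "P x"
  using assms component_in_part(1) component_decomp by metis

lemma part_inter: "x \<in> part L i \<Longrightarrow> x \<in> part L j \<Longrightarrow> odd (i + j) \<Longrightarrow> x = 0"
  using even_inter_odd by (auto simp: Defs.part_def split: if_splits)

text \<open>The parity involution. With it supertraces become ordinary traces, and sign rules come
  from moving it past operators.\<close>

definition grade :: "'g \<Rightarrow> 'g" where
  "grade x = component L 0 x - component L (Suc 0) x"

lemma lin_grade: "lin grade"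
  by (simp add: lin_iff grade_def component_add component_scale algebra_simps)

lemmas lin_gradeI = lin_compI[OF lin_grade]
lemmas lin_brkI = lin_compI[OF lin_brk(1)]

lemma grade_homogeneous: "x \<in> part L i \<Longrightarrow> grade x = scl L ((-1) ^ i) x"
  by (auto simp: grade_def component_homogeneous)

lemma grade_grade: "grade (grade x) = x"
proof (induction x rule: homogeneous_induct)
  case (1 x i)
  thus ?case by (simp add: grade_homogeneous lin_scale[OF lin_grade] flip: power_mult_distrib)
qed (simp add: lin_add[OF lin_grade])

lemma grade_part: "x \<in> part L i \<longleftrightarrow> grade x = scl L ((-1) ^ i) x"
proof
  assume *: "grade x = scl L ((-1) ^ i) x"
  let ?a = "component L 0 x" and ?b = "component L (Suc 0) x"
  have x: "x = ?a + ?b" by (rule component_decomp)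
  have double: "c = 0" if "c + c = 0" for c :: 'g
    using that scale_left_distrib[of 1 1 c] by simp
  have a: "?a \<in> part L 0" and b: "?b \<in> part L (Suc 0)" by (rule component_in_part)+
  show "x \<in> part L i"
  proof (cases "even i")
    case True
    hence "?a - ?b = x" using * by (simp add: grade_def)
    hence "?a - ?b = ?a + ?b" using x by simp
    hence "?b + ?b = 0" by (simp add: algebra_simps)
    thus ?thesis using double[of ?b] a x True by (simp add: Defs.part_def)
  next
    case False
    hence "?a - ?b = - x" using * by (simp add: grade_def)
    hence e: "?a - ?b = - (?a + ?b)" using x by simp
    have "?a + ?a = (?a - ?b) + (?a + ?b)" by (simp add: algebra_simps)
    also have "\<dots> = 0" unfolding e by simp
    finally have "?a + ?a = 0" .
    thus ?thesis using double[of ?a] b x False by (simp add: Defs.part_def)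
  qed
qed (rule grade_homogeneous)

text \<open>Homogeneity of an operator, encoded as commutation with \<open>grade\<close> up to
  sign.\<close>

definition op_parity :: "nat \<Rightarrow> ('g \<Rightarrow> 'g) \<Rightarrow> bool" where
  "op_parity p A \<longleftrightarrow> (\<forall>x. A (grade x) = scl L ((-1) ^ p) (grade (A x)))"

lemma op_parity_comp: "op_parity p A \<Longrightarrow> op_parity q B \<Longrightarrow> lin A \<Longrightarrow> op_parity (p + q) (\<lambda>x. A (B x))"
  by (simp add: op_parity_def lin_scale power_add mult.commute)

lemma op_parity_brk:
  assumes "x \<in> part L i"
  shows "op_parity i (\<lambda>y. brk L x y)" "op_parity i (brk L x)"
proof -
  have "brk L x (grade y) = scl L ((-1) ^ i) (grade (brk L x y))" for y
  proof (induction y rule: homogeneous_induct)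
    case (1 y j)
    thus ?case
      using brk_part[OF assms 1] 1
      by (simp add: grade_homogeneous brk_linear_simps power_add flip: power_mult_distrib mult.assoc)
  qed (simp add: brk_linear_simps lin_add[OF lin_grade] scale_right_distrib)
  thus "op_parity i (\<lambda>y. brk L x y)" "op_parity i (brk L x)" by (simp_all add: op_parity_def)
qed

lemma op_parity_part:
  assumes "op_parity p A" "lin A" "x \<in> part L i"
  shows "A x \<in> part L (p + i)"
proof -
  have "scl L ((-1) ^ i) (A x) = A (grade x)"
    using assms(2,3) by (simp add: grade_homogeneous lin_scale)
  also have "\<dots> = scl L ((-1) ^ p) (grade (A x))"
    using assms(1) by (simp add: op_parity_def)
  finally have "scl L ((-1) ^ i) (A x) = scl L ((-1) ^ p) (grade (A x))" .
  hence "scl L ((-1) ^ p) (scl L ((-1) ^ i) (A x)) = grade (A x)"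
    by (simp flip: power_mult_distrib)
  thus ?thesis by (simp add: grade_part power_add)
qed

section \<open>The supertrace\<close>

definition str :: "('g \<Rightarrow> 'g) \<Rightarrow> complex" where
  "str T = trace_on UNIV (\<lambda>x. grade (T x))"

lemma supertrace_eq_str:
  assumes "lin T"
  shows "supertrace L T = str T"
proof -
  have B: "finite hbasis" "independent hbasis" "span hbasis = UNIV"
    by (auto simp: finite_Basis independent_Basis span_Basis)
  have hom: "grade b = scl L ((-1) ^ parity L b) b" if "b \<in> hbasis" for b
  proof (cases "b \<in> even_part L")
    case True
    hence "b \<in> part L 0" by (simp add: Defs.part_def)
    thus ?thesis using grade_homogeneous[of b 0] True by (simp add: parity_def)
  next
    case False
    hence "b \<in> part L 1"
      using homogeneous_hbasis that by (auto simp: homogeneous_basis_def Defs.part_def)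
    thus ?thesis using grade_homogeneous[of b 1] False by (simp add: parity_def)
  qed
  have "representation hbasis (grade v) b = (-1) ^ parity L b * representation hbasis v b"
    if b: "b \<in> hbasis" for v b
  proof -
    have "grade v = (\<Sum>c\<in>hbasis. scl L (representation hbasis v c) (grade c))"
      by (rule basis_image_expansion[OF B(1,2) lin_grade]) (simp add: B(3))
    also have "\<dots> = (\<Sum>c\<in>hbasis. scl L (representation hbasis v c * (-1) ^ parity L c) c)"
      by (rule sum.cong) (simp_all add: hom)
    finally have "representation hbasis (grade v) b =
        (\<Sum>c\<in>hbasis. representation hbasis v c * (-1) ^ parity L c * representation hbasis c b)"
      using B by (simp add: representation_sum representation_scale)
    also have "\<dots> = (\<Sum>c\<in>hbasis. if c = b then representation hbasis v c * (-1) ^ parity L c else 0)"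
      by (rule sum.cong) (auto simp: representation_basis B)
    finally show ?thesis using B b by simp
  qed
  hence "supertrace L T = (\<Sum>b\<in>hbasis. representation hbasis (grade (T b)) b)"
    by (simp add: supertrace_def Let_def flip: hbasis_def)
  also have "\<dots> = trace_on (span hbasis) (\<lambda>x. grade (T x))"
    by (rule trace_on_span[symmetric]) (use B assms lin_grade in \<open>auto intro: lin_gradeI lin_brkI\<close>)
  finally show ?thesis by (simp add: str_def B)
qed

lemma str_plus: "lin S \<Longrightarrow> lin T \<Longrightarrow> str (\<lambda>x. S x + T x) = str S + str T"
  unfolding str_def by (simp add: lin_add[OF lin_grade] trace_on_plus lin_gradeI lin_brkI lin_grade)

lemma str_scale: "lin T \<Longrightarrow> str (\<lambda>x. scl L c (T x)) = c * str T"
  unfolding str_def by (simp add: lin_scale[OF lin_grade] trace_on_scale lin_gradeI lin_brkI lin_grade)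

lemma str_minus: "lin S \<Longrightarrow> lin T \<Longrightarrow> str (\<lambda>x. S x - T x) = str S - str T"
  using str_plus[of S "\<lambda>x. scl L (-1) (T x)"] str_scale[of T "-1"] lin_scaleI[of T "-1"] by simp

text \<open>Ordinary cyclicity moves \<open>B\<close> in front of \<open>grade\<close>, and
  exchanging the two costs the sign. For \<open>A\<close> of parity p the usual sign (-1)^(p q)
  agrees with this one when p and q have equal parity; otherwise both supertraces vanish.\<close>

lemma str_cyclic:
  assumes "lin A" "lin B" "op_parity q B"
  shows "str (\<lambda>x. A (B x)) = (-1) ^ q * str (\<lambda>x. B (A x))"
proof -
  have "str (\<lambda>x. A (B x)) = trace_on UNIV (\<lambda>x. B (grade (A x)))"
    unfolding str_def
    by (rule trace_on_cyclic[where A' = "\<lambda>x. grade (A x)"])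
      (use assms lin_grade in \<open>auto intro: lin_gradeI lin_brkI\<close>)
  also have "\<dots> = trace_on UNIV (\<lambda>x. scl L ((-1) ^ q) (grade (B (A x))))"
    using assms(3) by (simp add: op_parity_def)
  also have "\<dots> = (-1) ^ q * str (\<lambda>x. B (A x))"
    unfolding str_def
    by (rule trace_on_scale) (auto intro: lin_gradeI lin_compI[OF assms(2,1)])
  finally show ?thesis .
qed

text \<open>Inserting the square of \<open>grade\<close>, which is the identity, and cycling one
  factor round turns the supertrace into its negative.\<close>

lemma str_odd:
  assumes "lin T" "op_parity p T" "odd p"
  shows "str T = 0"
proof -
  have "str T = str (\<lambda>x. T (grade (grade x)))" by (simp add: grade_grade)
  also have "\<dots> = (-1) ^ 0 * str (\<lambda>x. grade (T (grade x)))"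
    by (rule str_cyclic[where A = "\<lambda>x. T (grade x)"])
      (use assms(1) lin_grade in \<open>auto intro: lin_compI[OF assms(1) lin_grade] simp: op_parity_def\<close>)
  also have "\<dots> = str (\<lambda>x. scl L (-1) (T x))"
    using assms by (simp add: op_parity_def lin_uminus[OF lin_grade] grade_grade)
  also have "\<dots> = - str T" using str_scale[OF assms(1), of "-1"] by simp
  finally show ?thesis by simp
qed

text \<open>An even operator commutes with \<open>grade\<close>, so its composite with
  \<open>grade\<close> is nilpotent too.\<close>

lemma str_nilpotent:
  assumes "lin T" "op_parity 0 T" "\<And>x. (T ^^ n) x = 0"
  shows "str T = 0"
proof -
  have "((\<lambda>x. grade (T x)) ^^ k) x = (grade ^^ k) ((T ^^ k) x)" for k x
  proof (induction k)
    case (Suc k)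
    have "T ((grade ^^ j) y) = (grade ^^ j) (T y)" for j y
      by (induction j) (use assms(2) in \<open>simp_all add: op_parity_def\<close>)
    thus ?case using Suc by simp
  qed simp
  thus ?thesis
    unfolding str_def using assms lin_grade
    by (intro trace_on_nilpotent[where n = n]) (auto intro: lin_gradeI lin_brkI simp: lin_0 lin_funpowI)
qed

section \<open>Symmetry, invariance and representation of functionals\<close>

lemma killing_str: "killing L x y = str (\<lambda>z. brk L x (brk L y z))"
  unfolding killing_def by (intro supertrace_eq_str lin_gradeI lin_brkI lin_brk)

lemma killing_linear:
  "killing L (x + y) z = killing L x z + killing L y z"
  "killing L z (x + y) = killing L z x + killing L z y"
  "killing L (scl L c x) z = c * killing L x z"
  "killing L z (scl L c x) = c * killing L z x"
  by (simp_all add: killing_str brk_linear_simps str_plus str_scale lin_gradeI lin_brkI lin_brk)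

lemma functional_killing: "functional L (\<lambda>x. killing L x y)" "functional L (\<lambda>y. killing L x y)"
    "functional L (killing L x)"
  by (simp_all add: functional_iff killing_linear)

lemma killing_zero [simp]: "killing L 0 x = 0" "killing L x 0 = 0"
  using killing_linear(3,4)[where c = 0 and x = 0] by auto

lemma killing_uminus: "killing L (- x) y = - killing L x y" "killing L y (- x) = - killing L y x"
  using killing_linear(3,4)[where c = "-1" and x = x] by auto

lemma killing_diff: "killing L (x - z) y = killing L x y - killing L z y"
    "killing L y (x - z) = killing L y x - killing L y z"
  using killing_linear(1,2)[where x = x and y = "- z" and z = y]
  by (auto simp: killing_uminus)

lemma killing_sum: "killing L (\<Sum>i\<in>A. x i) y = (\<Sum>i\<in>A. killing L (x i) y)"
    "killing L y (\<Sum>i\<in>A. x i) = (\<Sum>i\<in>A. killing L y (x i))"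
  using functional_sum[OF functional_killing(1)] functional_sum[OF functional_killing(2)] by auto

lemma killing_commute: "x \<in> part L i \<Longrightarrow> killing L y x = (-1) ^ i * killing L x y"
  unfolding killing_str by (rule str_cyclic) (auto intro: lin_brk op_parity_brk)

lemma killing_even_odd:
  assumes "x \<in> part L i" "y \<in> part L j" "odd (i + j)"
  shows "killing L x y = 0"
  unfolding killing_str
  by (rule str_odd[OF _ op_parity_comp[OF op_parity_brk(1)[OF assms(1)] op_parity_brk(1)[OF assms(2)]]])
    (use assms in \<open>auto intro: lin_brk lin_gradeI lin_brkI\<close>)

lemma brk_brk:
  assumes "x \<in> part L i" "y \<in> part L j"
  shows "brk L (brk L x y) z = brk L x (brk L y z) - scl L ((-1) ^ (i * j)) (brk L y (brk L x z))"
  using brk_jacobi[OF assms, of z] by simp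

text \<open>Expanding both sides leaves the common term str(ad x ad y ad z). The other two terms
  agree after moving ad y cyclically if the total parity is even, and vanish if it is odd.\<close>

lemma killing_invariant: "killing L (brk L x y) z = killing L x (brk L y z)"
proof -
  have h: "killing L (brk L x y) z = killing L x (brk L y z)"
    if x: "x \<in> part L i" and y: "y \<in> part L j" and z: "z \<in> part L k" for x y z i j k
  proof -
    let ?xyz = "str (\<lambda>w. brk L x (brk L y (brk L z w)))" and ?xzy = "str (\<lambda>w. brk L x (brk L z (brk L y w)))"
    have l: "killing L (brk L x y) z = ?xyz - (-1) ^ (i * j) * str (\<lambda>w. brk L y (brk L x (brk L z w)))"
      unfolding killing_str brk_brk[OF x y]
      by (simp add: str_minus str_scale lin_gradeI lin_brkI lin_brk lin_scaleI)
    have "brk L x (brk L (brk L y z) w) = brk L x (brk L y (brk L z w)) -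
        scl L ((-1) ^ (j * k)) (brk L x (brk L z (brk L y w)))" for w
      by (simp add: brk_brk[OF y z] brk_diff brk_linear_simps)
    hence r: "killing L x (brk L y z) = ?xyz - (-1) ^ (j * k) * ?xzy"
      unfolding killing_str
      by (simp add: str_minus str_scale lin_gradeI lin_brkI lin_brk lin_scaleI)
    have c: "?xzy = (-1) ^ j * str (\<lambda>w. brk L y (brk L x (brk L z w)))"
      by (rule str_cyclic[where A = "\<lambda>w. brk L x (brk L z w)"])
        (auto intro: lin_gradeI lin_brkI lin_brk op_parity_brk y)
    have "?xzy = 0" if "odd (i + j + k)"
    proof (rule str_odd)
      show "op_parity (i + (k + j)) (\<lambda>w. brk L x (brk L z (brk L y w)))"
        by (intro op_parity_comp op_parity_brk x y z lin_brk)
      show "lin (\<lambda>w. brk L x (brk L z (brk L y w)))" by (intro lin_brkI lin_brk)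
    qed (use that in auto)
    thus ?thesis
      using c by (cases "even i"; cases "even j"; cases "even k") (simp_all add: l r)
  qed
  show ?thesis
  proof (induction x rule: homogeneous_induct)
    case (1 x i)
    show ?case
    proof (induction y rule: homogeneous_induct)
      case (1 y j)
      show ?case
        by (induction z rule: homogeneous_induct)
          (use h \<open>x \<in> part L i\<close> \<open>y \<in> part L j\<close> in \<open>auto simp: killing_linear brk_linear_simps\<close>)
    qed (simp add: killing_linear brk_linear_simps)
  qed (simp add: killing_linear brk_linear_simps)
qed

lemma killing_nondegenerate_left: "(\<And>y. killing L x y = 0) \<Longrightarrow> x = 0"
  using nondeg by (auto simp: nondegenerate_killing_def)

lemma killing_nondegenerate_right:
  assumes "\<And>y. killing L y x = 0"
  shows "x = 0"
proof (rule killing_nondegenerate_left)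
  fix y show "killing L x y = 0"
  proof (induction y rule: homogeneous_induct)
    case (1 y i)
    thus ?case using killing_commute[of y i x] assms by simp
  qed (simp add: killing_linear)
qed

text \<open>Nondegeneracy makes v \<mapsto> (v, -) injective, hence surjective in finite dimension.
  \<open>\<Phi>\<close> replaces the form (v, -) by the vector whose coordinates are its values on
  the basis, so that the map becomes an endomorphism.\<close>

lemma functional_represented:
  assumes F: "functional L F"
  obtains v where "\<And>x. F x = killing L v x"
proof -
  define \<Phi> where "\<Phi> v = (\<Sum>b\<in>hbasis. scl L (killing L v b) b)" for v
  have lin: "lin \<Phi>"
    by (simp add: lin_iff \<Phi>_def killing_linear scale_left_distrib sum.distrib scale_sum_right)
  have coeff: "f b = g b"
    if "(\<Sum>b\<in>hbasis. scl L (f b) b) = (\<Sum>b\<in>hbasis. scl L (g b) b)" "b \<in> hbasis" for f g b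
  proof -
    have "representation hbasis (\<Sum>b\<in>hbasis. scl L (f b) b) b = f b" for f
    proof -
      have "representation hbasis (\<Sum>b\<in>hbasis. scl L (f b) b) b =
          (\<Sum>c\<in>hbasis. if c = b then f c else 0)"
        by (simp add: representation_sum representation_scale independent_Basis span_Basis
            representation_basis if_distrib cong: if_cong sum.cong)
          (auto intro!: sum.cong simp: representation_basis independent_Basis)
      thus ?thesis using that(2) finite_Basis by simp
    qed
    thus ?thesis using that(1) by metis
  qed
  have agree: "G x = G' x" if "functional L G" "functional L G'" "\<And>b. b \<in> hbasis \<Longrightarrow> G b = G' b" for G G' x
  proof -
    have "x \<in> span hbasis" by (simp add: span_Basis)
    thus ?thesis
      by (induction rule: span_induct_alt) (use that in \<open>auto simp: functional_0 functional_iff\<close>)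
  qed
  have "v = 0" if "\<Phi> v = 0" for v
  proof (rule killing_nondegenerate_left)
    have "killing L v b = 0" if "b \<in> hbasis" for b
      using coeff[of "killing L v" "\<lambda>_. 0" b] \<open>\<Phi> v = 0\<close> that by (simp add: \<Phi>_def)
    thus "killing L v y = 0" for y
      using agree[of "killing L v" "\<lambda>_. 0" y] functional_killing(3)[of v] by (simp add: functional_iff)
  qed
  hence "inj \<Phi>"
    using lin by (intro injI) (metis eq_iff_diff_eq_0 lin_diff)
  hence "surj \<Phi>"
    using lin linear_inj_imp_surj unfolding lin_def by blast
  then obtain v where "(\<Sum>b\<in>hbasis. scl L (F b) b) = \<Phi> v" by (metis surjD)
  hence "F b = killing L v b" if "b \<in> hbasis" for b
    using coeff[of F "killing L v" b] that by (simp add: \<Phi>_def)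
  hence "F x = killing L v x" for x
    using agree[OF F functional_killing(3)] by blast
  thus thesis by (rule that)
qed

text \<open>The left representation is applied to \<open>F\<close> composed with
  \<open>grade\<close>; the signs introduced in this way are those of supersymmetry.\<close>

lemma functional_represented_right:
  assumes F: "functional L F"
  obtains v where "\<And>x. F x = killing L x v"
proof -
  have G: "functional L (\<lambda>x. F (grade x))"
    using F lin_grade by (simp add: functional_iff lin_iff)
  obtain v where v: "\<And>x. F (grade x) = killing L v x" using functional_represented[OF G] by blast
  have "F x = killing L x v" for x
  proof (induction x rule: homogeneous_induct)
    case (1 x i)
    have "(-1) ^ i * F x = killing L v x"
      using v[of x] F 1 by (simp add: grade_homogeneous functional_iff)
    also have "\<dots> = (-1) ^ i * killing L x v" by (rule killing_commute[OF 1])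
    finally show ?case by simp
  qed (use F in \<open>simp add: functional_iff killing_linear\<close>)
  thus thesis by (rule that)
qed

section \<open>Trivial centre and inner derivations\<close>

lemma center_trivial:
  assumes "\<And>y. brk L x y = 0"
  shows "x = 0"
proof (rule killing_nondegenerate_left)
  fix y
  have "str (\<lambda>z. 0) = 0" using str_scale[OF lin_idI, of 0] by simp
  thus "killing L x y = 0" by (simp add: killing_str assms)
qed

text \<open>Choose d with str(D ad x) = (d, x); then E = D - ad d satisfies str(E ad x) = 0 for all
  x. Since ad (E x) is the commutator of E and ad x, cyclicity gives (E x, y) = str(E ad [x, y]) =
  0.\<close>

lemma derivation_inner:
  assumes D: "lin D" "op_parity 0 D" "\<And>x y. D (brk L x y) = brk L (D x) y + brk L x (D y)"
  obtains d where "d \<in> even_part L" "\<And>x. D x = brk L d x"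
proof -
  have "functional L (\<lambda>x. str (\<lambda>z. D (brk L x z)))"
    using D(1)
    by (simp add: functional_iff brk_linear_simps lin_add lin_scale str_plus str_scale lin_brkI lin_compI[OF D(1)] lin_brk)
  then obtain d0 where d0: "\<And>x. str (\<lambda>z. D (brk L x z)) = killing L d0 x"
    using functional_represented by blast
  \<comment> \<open>The even component represents the same functional: on odd x both the supertrace
    and the pairing with an even vector vanish, and on even x the odd component of \<open>d0\<close>
    pairs to 0.\<close>
  define d where "d = component L 0 d0"
  have d: "d \<in> part L 0" unfolding d_def by (rule component_in_part)
  have dD: "str (\<lambda>z. D (brk L x z)) = killing L d x" for x
  proof (induction x rule: homogeneous_induct)
    case (1 x i)
    show ?case
    proof (cases "even i")
      case True
      have "killing L d0 x = killing L d x + killing L (component L (Suc 0) d0) x"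
        using component_decomp[of d0] by (metis d_def killing_linear(1))
      moreover have "killing L (component L (Suc 0) d0) x = 0"
        by (rule killing_even_odd[OF component_in_part(1) 1]) (use True in auto)
      ultimately show ?thesis using d0 by simp
    next
      case False
      have "op_parity (0 + i) (\<lambda>z. D (brk L x z))"
        by (rule op_parity_comp[OF D(2) op_parity_brk(1)[OF 1] D(1)])
      hence "str (\<lambda>z. D (brk L x z)) = 0"
        using False by (intro str_odd lin_brkI lin_compI[OF D(1)] lin_brk D(1)) auto
      moreover have "killing L d x = 0"
        by (rule killing_even_odd[OF d 1]) (use False in auto)
      ultimately show ?thesis by simp
    qed
  next
    case (2 x y)
    thus ?case using D(1) by (simp add: brk_linear_simps lin_add killing_linear str_plus lin_brkI lin_compI[OF D(1)] lin_brk)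
  qed
  define E where "E x = D x - brk L d x" for x
  have E: "lin E" unfolding E_def by (intro lin_minusI D(1) lin_brk)
  have E0: "op_parity 0 E"
    using D(2) op_parity_brk(1)[OF d] by (simp add: op_parity_def E_def lin_diff[OF lin_grade])
  have Ed: "E (brk L x y) = brk L (E x) y + brk L x (E y)" for x y
  proof (induction x rule: homogeneous_induct)
    case (1 x i)
    show ?case using brk_jacobi[OF d 1, of y] by (simp add: E_def D(3) brk_diff algebra_simps)
  qed (simp add: brk_linear_simps lin_add[OF E] algebra_simps)
  have strE: "str (\<lambda>z. E (brk L x z)) = 0" for x
    unfolding E_def
    using dD[of x] by (simp add: str_minus lin_brkI lin_compI[OF D(1)] lin_brk D(1) flip: killing_str)
  have hh: "killing L (E x) y = 0" if x: "x \<in> part L i" and y: "y \<in> part L j" for x y i j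
  proof (cases "even (i + j)")
    case False
    have "E x \<in> part L i" using op_parity_part[OF E0 E x] by simp
    thus ?thesis using killing_even_odd[OF _ y] False by simp
  next
    case True
    have EE: "lin (\<lambda>z. E (brk L u (brk L v z)))" for u v
      by (rule lin_compI[OF E lin_brkI[OF lin_brk(1)]])
    \<comment> \<open>The cyclic move produces (-1)^i and the expansion of ad [x, y] produces
      (-1)^(i j); they agree when i and j have equal parity.\<close>
    from True have s: "(-1) ^ i = ((-1) ^ (i * j) :: complex)" by (auto simp: minus_one_power_iff)
    have "killing L (E x) y = str (\<lambda>z. E (brk L x (brk L y z)) - brk L x (E (brk L y z)))"
      unfolding killing_str by (simp add: Ed)
    also have "\<dots> = str (\<lambda>z. E (brk L x (brk L y z))) - str (\<lambda>z. brk L x (E (brk L y z)))"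
      by (rule str_minus[OF EE lin_brkI[OF lin_compI[OF E lin_brk(1)]]])
    also have "str (\<lambda>z. E (brk L y (brk L x z))) = (-1) ^ i * str (\<lambda>z. brk L x (E (brk L y z)))"
      by (rule str_cyclic[where A = "\<lambda>z. E (brk L y z)", OF lin_compI[OF E lin_brk(1)] lin_brk(1)
            op_parity_brk(2)[OF x]])
    hence "str (\<lambda>z. brk L x (E (brk L y z))) =
        (-1) ^ (i * j) * str (\<lambda>z. E (brk L y (brk L x z)))"
      by (simp flip: s power_mult_distrib mult.assoc)
    also have "str (\<lambda>z. E (brk L x (brk L y z))) - (-1) ^ (i * j) * str (\<lambda>z. E (brk L y (brk L x z))) =
        str (\<lambda>z. E (brk L (brk L x y) z))"
      unfolding brk_brk[OF x y]
      by (simp add: lin_diff[OF E] lin_scale[OF E] str_minus str_scale EE lin_scaleI)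
    finally show ?thesis using strE by simp
  qed
  have "E x = 0" for x
  proof (rule killing_nondegenerate_left)
    fix y
    show "killing L (E x) y = 0"
    proof (induction x rule: homogeneous_induct)
      case (1 x i)
      show ?case
        by (induction y rule: homogeneous_induct) (use hh 1 in \<open>auto simp: killing_linear\<close>)
    qed (simp add: lin_add[OF E] killing_linear)
  qed
  hence "D x = brk L d x" for x by (simp add: E_def)
  moreover have "d \<in> even_part L" using d by (simp add: Defs.part_def)
  ultimately show thesis using that by blast
qed

end

section \<open>Cartan subalgebras act diagonalizably\<close>

locale cartan_superalgebra = killing_superalgebra L
  for L :: "'g::ab_group_add lie_superalg" +
  fixes H :: "'g set"
  assumes cartan: "cartan_subalgebra L H"
begin

lemma subspace_H: "subspace H"
  and H_even: "x \<in> H \<Longrightarrow> x \<in> part L 0"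
  and H_brk: "x \<in> H \<Longrightarrow> y \<in> H \<Longrightarrow> brk L x y \<in> H"
  and H_nilpotent: "\<exists>n. lower_central L H n = {0}"
  and H_normalizer: "x \<in> part L 0 \<Longrightarrow> (\<And>y. y \<in> H \<Longrightarrow> brk L x y \<in> H) \<Longrightarrow> x \<in> H"
  using cartan unfolding cartan_subalgebra_def Defs.part_def by auto

section \<open>Jordan components of elements of the Cartan subalgebra\<close>

lemma even_derivation:
  "h \<in> part L 0 \<Longrightarrow> brk L h (brk L x y) = brk L (brk L h x) y + brk L x (brk L h y)"
proof (induction x rule: homogeneous_induct)
  case (1 x i)
  thus ?case using brk_jacobi[of h 0 x i y] by simp
qed (simp add: brk_linear_simps algebra_simps)

lemma even_skew: "h \<in> part L 0 \<Longrightarrow> brk L x h = - brk L h x"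
proof (induction x rule: homogeneous_induct)
  case (1 x i)
  thus ?case using brk_skew[of x i h 0] by simp
qed (simp add: brk_linear_simps)

text \<open>By the Leibniz rule the shift by c + d acts on a bracket as the shifts by c and d on the
  two factors; the induction is on the sum of the nilpotency orders.\<close>

lemma gen_eigenspace_brk:
  assumes h: "h \<in> part L 0" and x: "x \<in> gen_eigenspace (brk L h) c" and y: "y \<in> gen_eigenspace (brk L h) d"
  shows "brk L x y \<in> gen_eigenspace (brk L h) (c + d)"
proof -
  let ?N = "\<lambda>c z. brk L h z - scl L c z"
  have step: "?N (c + d) (brk L x y) = brk L (?N c x) y + brk L x (?N d y)" for x y
    using even_derivation[OF h, of x y] by (simp add: brk_diff brk_linear_simps algebra_simps)
  have "\<exists>k. (?N (c + d) ^^ k) (brk L x y) = 0"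
    if "m + n = l" "(?N c ^^ m) x = 0" "(?N d ^^ n) y = 0" for l m n x y
    using that
  proof (induction l arbitrary: m n x y)
    case 0
    hence "x = 0" by simp
    thus ?case by (intro exI[of _ 0]) (simp add: brk_zero)
  next
    case (Suc l)
    show ?case
    proof (cases "m = 0 \<or> n = 0")
      case True
      hence "brk L x y = 0" using Suc.prems by (auto simp: brk_zero)
      thus ?thesis by (intro exI[of _ 0]) simp
    next
      case False
      then obtain m' n' where mn: "m = Suc m'" "n = Suc n'" using not0_implies_Suc by blast
      have "(?N c ^^ m') (?N c x) = 0" "(?N d ^^ n') (?N d y) = 0"
        using Suc.prems mn by (simp_all add: funpow_Suc_right del: funpow.simps)
      then obtain k k' where k: "(?N (c + d) ^^ k) (brk L (?N c x) y) = 0"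
        "(?N (c + d) ^^ k') (brk L x (?N d y)) = 0"
        using Suc.IH[of m' n "?N c x" y] Suc.IH[of m n' x "?N d y"] Suc.prems mn by auto
      have N: "lin (?N (c + d))" by (rule lin_shift[OF lin_brk(1)])
      have "(?N (c + d) ^^ max k k') (?N (c + d) (brk L x y)) = 0"
        unfolding step lin_add[OF lin_funpowI[OF N]]
        using funpow_eq_0_mono[OF N k(1), of "max k k'"] funpow_eq_0_mono[OF N k(2), of "max k k'"]
        by simp
      hence "(?N (c + d) ^^ Suc (max k k')) (brk L x y) = 0"
        by (simp add: funpow_Suc_right del: funpow.simps)
      thus ?thesis by blast
    qed
  qed
  thus ?thesis using x y unfolding gen_eigenspace_def by blast
qed

text \<open>The semisimple part of ad h commutes with \<open>grade\<close> and is a derivation,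
  because generalized eigenvalues add under the bracket. So it is ad s for an even s.\<close>

lemma jordan_element:
  assumes h: "h \<in> part L 0"
  obtains s N where "s \<in> part L 0" "span {x. \<exists>c. brk L s x = scl L c x} = UNIV"
    "\<And>x. (brk L (h - s) ^^ N) x = 0"
    "\<And>c x. x \<in> gen_eigenspace (brk L h) c \<Longrightarrow> brk L s x = scl L c x"
proof -
  obtain S N where S: "lin S" "span {x. \<exists>c. S x = scl L c x} = UNIV"
    "\<And>x. ((\<lambda>x. brk L h x - S x) ^^ N) x = 0"
    "\<And>c x. x \<in> gen_eigenspace (brk L h) c \<Longrightarrow> S x = scl L c x"
    "\<And>R x. lin R \<Longrightarrow> (\<And>x. R (brk L h x) = brk L h (R x)) \<Longrightarrow> R (S x) = S (R x)"
    using jordan_decomposition[OF lin_brk(1)] by blast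
  have "grade (S x) = S (grade x)" for x
  proof (rule S(5)[OF lin_grade])
    show "grade (brk L h x) = brk L h (grade x)" for x
      using op_parity_brk(1)[OF h] by (simp add: op_parity_def)
  qed
  hence par: "op_parity 0 S" by (simp add: op_parity_def)
  have G: "span (\<Union>c. gen_eigenspace (brk L h) c) = UNIV"
    by (rule span_gen_eigenspaces[OF lin_brk(1)])
  have der: "S (brk L x y) = brk L (S x) y + brk L x (S y)" for x y
  proof -
    have *: "S (brk L x y) = brk L (S x) y + brk L x (S y)"
      if x: "x \<in> (\<Union>c. gen_eigenspace (brk L h) c)" for x
    proof (rule lin_span_eq[where T = "\<lambda>y. S (brk L x y)" and U = "\<lambda>y. brk L (S x) y + brk L x (S y)"
          and S = "\<Union>c. gen_eigenspace (brk L h) c"])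
      obtain c where c: "x \<in> gen_eigenspace (brk L h) c" using x by blast
      fix y assume "y \<in> (\<Union>c. gen_eigenspace (brk L h) c)"
      then obtain d where d: "y \<in> gen_eigenspace (brk L h) d" by blast
      show "S (brk L x y) = brk L (S x) y + brk L x (S y)"
        using S(4)[OF c] S(4)[OF d] S(4)[OF gen_eigenspace_brk[OF h c d]]
        by (simp add: brk_linear_simps algebra_simps)
    next
      show "lin (\<lambda>y. S (brk L x y))" by (rule lin_compI[OF S(1) lin_brk(1)])
      show "lin (\<lambda>y. brk L (S x) y + brk L x (S y))"
        by (rule lin_plusI[OF lin_brk(1) lin_brkI[OF S(1)]])
      show "y \<in> span (\<Union>c. gen_eigenspace (brk L h) c)" by (simp add: G)
    qed
    show ?thesis
    proof (rule lin_span_eq[where T = "\<lambda>x. S (brk L x y)" and U = "\<lambda>x. brk L (S x) y + brk L x (S y)"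
          and S = "\<Union>c. gen_eigenspace (brk L h) c"])
      show "lin (\<lambda>x. S (brk L x y))" by (rule lin_compI[OF S(1) lin_brk(3)])
      show "lin (\<lambda>x. brk L (S x) y + brk L x (S y))"
        by (rule lin_plusI[OF lin_compI[OF lin_brk(3) S(1)] lin_brk(3)])
      show "x \<in> span (\<Union>c. gen_eigenspace (brk L h) c)" by (simp add: G)
    qed (rule *)
  qed
  obtain s where s: "s \<in> even_part L" "\<And>x. S x = brk L s x"
    using derivation_inner[OF S(1) par der] by blast
  have "brk L (h - s) = (\<lambda>x. brk L h x - S x)" by (auto simp: s brk_diff)
  with that[of s N] s S show thesis by (simp add: Defs.part_def)
qed

lemma lower_central_subset: "lower_central L H n \<subseteq> H"
proof (induction n)
  case (Suc n)
  show ?case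
    unfolding lower_central.simps
    by (rule span_minimal[OF _ subspace_H]) (use Suc H_brk in blast)
qed simp

lemma funpow_lower_central: "h \<in> H \<Longrightarrow> y \<in> H \<Longrightarrow> (brk L h ^^ n) y \<in> lower_central L H n"
  by (induction n) (auto intro: span_base)

text \<open>The elements of \<open>H\<close> already known to act diagonalizably and to centralize
  \<open>H\<close>. In the end this is all of \<open>H\<close> (\<open>HS_eq_H\<close>).\<close>

definition HS :: "'g set" where
  "HS = {s\<in>H. (\<forall>y\<in>H. brk L s y = 0) \<and> span {x. \<exists>c. brk L s x = scl L c x} = UNIV}"

text \<open>Nilpotency puts \<open>H\<close> into the generalized eigenspace of ad h for 0, where s
  acts by 0. So s centralizes \<open>H\<close>, and self-normalization puts s into
  \<open>H\<close>.\<close>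

lemma H_jordan:
  assumes h: "h \<in> H"
  obtains s N where "s \<in> HS" "\<And>x. (brk L (h - s) ^^ N) x = 0"
proof -
  obtain s N where s: "s \<in> part L 0" "span {x. \<exists>c. brk L s x = scl L c x} = UNIV"
    "\<And>x. (brk L (h - s) ^^ N) x = 0"
    "\<And>c x. x \<in> gen_eigenspace (brk L h) c \<Longrightarrow> brk L s x = scl L c x"
    using jordan_element[OF H_even[OF h]] by blast
  have "brk L s y = 0" if y: "y \<in> H" for y
  proof -
    obtain n where "lower_central L H n = {0}" using H_nilpotent by blast
    hence "(brk L h ^^ n) y = 0" using funpow_lower_central[OF h y] by blast
    hence "y \<in> gen_eigenspace (brk L h) 0" by (auto simp: gen_eigenspace_def)
    thus ?thesis using s(4) by fastforce
  qed
  moreover from this have "s \<in> H"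
    using subspace_0[OF subspace_H] by (auto intro: H_normalizer[OF s(1)])
  ultimately have "s \<in> HS" using s(2) by (simp add: HS_def)
  thus thesis using that s(3) by blast
qed

lemma HS_H: "s \<in> HS \<Longrightarrow> s \<in> H"
  and HS_central: "s \<in> HS \<Longrightarrow> y \<in> H \<Longrightarrow> brk L s y = 0"
  by (auto simp: HS_def)

definition joint_eigen :: "'g set" where
  "joint_eigen = {x. (\<exists>i. x \<in> part L i) \<and> (\<forall>s\<in>HS. \<exists>c. brk L s x = scl L c x)}"

text \<open>Adding \<open>grade\<close> to the commuting family of all ad s makes the joint
  eigenvectors homogeneous.\<close>

lemma span_joint_eigen: "span joint_eigen = UNIV"
proof -
  let ?F = "insert grade (brk L ` HS)"
  have "span {x. \<forall>T\<in>?F. \<exists>c. T x = scl L c x} = UNIV"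
  proof (rule joint_diagonalization)
    fix T assume "T \<in> ?F"
    thus "lin T" using lin_grade lin_brk(1) by blast
    have "even_part L \<union> odd_part L \<subseteq> {x. \<exists>c. grade x = scl L c x}"
      using grade_homogeneous[of _ 0] grade_homogeneous[of _ 1] by (fastforce simp: Defs.part_def)
    hence "span {x. \<exists>c. grade x = scl L c x} = UNIV"
      using span_UNIV_mono span_homogeneous by blast
    thus "span {x. \<exists>c. T x = scl L c x} = UNIV"
      using \<open>T \<in> ?F\<close> by (auto simp: HS_def)
  next
    fix T U x assume TU: "T \<in> ?F" "U \<in> ?F"
    have g: "grade (brk L s x) = brk L s (grade x)" if "s \<in> HS" for s
      using op_parity_brk(1)[OF H_even[OF HS_H[OF that]]] by (simp add: op_parity_def)
    have "brk L s (brk L t x) = brk L t (brk L s x)" if "s \<in> HS" "t \<in> HS" for s t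
      using even_derivation[OF H_even[OF HS_H[OF that(1)]], of t x] HS_central[OF that(1) HS_H[OF that(2)]]
      by (simp add: brk_zero)
    thus "T (U x) = U (T x)" using TU g by auto
  qed
  moreover have "{x. \<forall>T\<in>?F. \<exists>c. T x = scl L c x} \<subseteq> joint_eigen"
  proof
    fix x assume x: "x \<in> {x. \<forall>T\<in>?F. \<exists>c. T x = scl L c x}"
    then obtain c where c: "grade x = scl L c x" by blast
    \<comment> \<open>\<open>grade\<close> squares to the identity, so its eigenvalue on a nonzero
      vector is 1 or -1.\<close>
    hence "x = scl L (c * c) x" using grade_grade[of x] by (simp add: lin_scale[OF lin_grade])
    hence "scl L (c * c - 1) x = 0" by (simp add: algebra_simps)
    hence "x = 0 \<or> c = 1 \<or> c = -1" by (auto simp: square_eq_1_iff)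
    hence "\<exists>i. grade x = scl L ((-1) ^ i) x"
      using c by (auto simp: lin_0[OF lin_grade] intro: exI[of _ 0] exI[of _ 1])
    thus "x \<in> joint_eigen" using x by (auto simp: joint_eigen_def grade_part)
  qed
  ultimately show ?thesis using span_UNIV_mono by blast
qed

definition MZ :: "'g set" where
  "MZ = {x \<in> part L 0. \<forall>s\<in>HS. brk L s x = 0}"

lemma subspace_MZ: "subspace MZ"
  using subspace_part[of 0] by (auto simp: MZ_def subspace_def brk_linear_simps brk_zero)

lemma MZ_brk: "h \<in> H \<Longrightarrow> x \<in> MZ \<Longrightarrow> brk L h x \<in> MZ"
  using brk_part[OF H_even, of h x 0] even_derivation[OF H_even[OF HS_H], of _ h x]
  by (auto simp: MZ_def brk_zero HS_central)

lemma H_subset_MZ: "H \<subseteq> MZ"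
  by (auto simp: MZ_def H_even HS_central)

text \<open>The semisimple part of h acts by 0 on \<open>MZ\<close>, so ad h coincides there with
  its nilpotent part.\<close>

lemma MZ_nilpotent:
  assumes h: "h \<in> H" and x: "x \<in> MZ"
  shows "\<exists>n. (brk L h ^^ n) x = 0"
proof -
  obtain s N where s: "s \<in> HS" "\<And>x. (brk L (h - s) ^^ N) x = 0"
    using H_jordan[OF h] by blast
  have "(brk L h ^^ n) x = (brk L (h - s) ^^ n) x \<and> (brk L h ^^ n) x \<in> MZ" for n
  proof (induction n)
    case (Suc n)
    hence "brk L s ((brk L h ^^ n) x) = 0" using s(1) unfolding MZ_def by blast
    hence "(brk L h ^^ Suc n) x = brk L (h - s) ((brk L h ^^ n) x)" by (simp add: brk_diff)
    also have "\<dots> = (brk L (h - s) ^^ Suc n) x" using Suc by simp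
    finally have "(brk L h ^^ Suc n) x = (brk L (h - s) ^^ Suc n) x" .
    moreover have "(brk L h ^^ Suc n) x \<in> MZ" using MZ_brk[OF h] Suc by auto
    ultimately show ?case by blast
  qed (use x in simp)
  thus ?thesis using s(2) by metis
qed

text \<open>Engel's theorem for the action of \<open>H\<close> on \<open>MZ / H\<close>: in a minimal \<open>H\<close>-invariant subspace
  properly containing \<open>H\<close>, the terms of the lower central series act trivially modulo \<open>H\<close>,
  starting from the last one.\<close>

lemma MZ_eq_H: "MZ = H"
proof (rule ccontr)
  assume "MZ \<noteq> H"
  define Q where "Q U \<longleftrightarrow> subspace U \<and> H \<subset> U \<and> U \<subseteq> MZ \<and> (\<forall>h\<in>H. \<forall>u\<in>U. brk L h u \<in> U)" for U
  have "Q MZ" using \<open>MZ \<noteq> H\<close> H_subset_MZ subspace_MZ MZ_brk by (auto simp: Q_def)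
  then obtain U where U: "Q U" and min: "\<And>V. Q V \<Longrightarrow> dim U \<le> dim V"
    using ex_has_least_nat[of Q MZ dim] by blast
  have Us: "subspace U" and HU: "H \<subset> U" and UM: "U \<subseteq> MZ"
    and Uinv: "\<And>h u. h \<in> H \<Longrightarrow> u \<in> U \<Longrightarrow> brk L h u \<in> U"
    using U by (auto simp: Q_def)
  obtain n where n: "lower_central L H n = {0}" using H_nilpotent by blast
  have "\<forall>h\<in>lower_central L H (n - k). \<forall>u\<in>U. brk L h u \<in> H" for k
  proof (induction k)
    case 0
    thus ?case using n subspace_0[OF subspace_H] by (simp add: brk_zero)
  next
    case (Suc k)
    show ?case
    proof (cases "k < n")
      case False
      thus ?thesis using Suc by simp
    next
      case True
      hence nk: "n - k = Suc (n - Suc k)" by simp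
      show ?thesis
      proof
        fix h assume hl: "h \<in> lower_central L H (n - Suc k)"
        hence h: "h \<in> H" using lower_central_subset by blast
        let ?W = "{u\<in>U. brk L h u \<in> H}"
        have "Q ?W"
          unfolding Q_def
        proof (intro conjI ballI)
          show "subspace ?W"
            using Us subspace_H by (auto simp: subspace_def brk_linear_simps brk_zero)
          show "?W \<subseteq> MZ" using UM by blast
          fix g u assume g: "g \<in> H" and u: "u \<in> ?W"
          have "brk L g h \<in> lower_central L H (n - k)"
            unfolding nk using g hl by (auto intro: span_base)
          hence "brk L (brk L g h) u \<in> H" using Suc.IH u by blast
          moreover have "brk L h (brk L g u) = brk L g (brk L h u) - brk L (brk L g h) u"
            using even_derivation[OF H_even[OF g], of h u] by simp
          ultimately have "brk L h (brk L g u) \<in> H"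
            using u H_brk[OF g] subspace_diff[OF subspace_H] by simp
          thus "brk L g u \<in> ?W" using Uinv[OF g] u by blast
        next
          obtain u where u: "u \<in> U" "u \<notin> H" using HU by blast
          obtain m where "(brk L h ^^ m) u = 0" using MZ_nilpotent[OF h] u UM by blast
          hence ex: "(brk L h ^^ m) u \<in> H" using subspace_0[OF subspace_H] by simp
          \<comment> \<open>The last iterate of u outside \<open>H\<close> is sent into
            \<open>H\<close> by h, so \<open>?W\<close> is strictly larger than
            \<open>H\<close>.\<close>
          define m where "m = (LEAST m. (brk L h ^^ m) u \<in> H)"
          have m: "(brk L h ^^ m) u \<in> H" unfolding m_def using ex by (rule LeastI)
          then obtain l where l: "m = Suc l" using u(2) by (cases m) auto
          have "(brk L h ^^ l) u \<notin> H"
            using not_less_Least[of l "\<lambda>m. (brk L h ^^ m) u \<in> H"] l by (auto simp: m_def)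
          moreover have "(brk L h ^^ l) u \<in> U" by (induction l) (use u Uinv[OF h] in auto)
          ultimately have "(brk L h ^^ l) u \<in> ?W - H" using m l by simp
          thus "H \<subset> ?W" using HU H_brk[OF h] by blast
        qed
        hence "dim U \<le> dim ?W" and "subspace ?W" using min by (auto simp: Q_def)
        hence "?W = U" using subspace_dim_equal[of ?W U] Us by blast
        thus "\<forall>u\<in>U. brk L h u \<in> H" by blast
      qed
    qed
  qed
  from this[of n] have inv: "\<And>h u. h \<in> H \<Longrightarrow> u \<in> U \<Longrightarrow> brk L h u \<in> H" by simp
  obtain u where u: "u \<in> U" "u \<notin> H" using HU by blast
  have "brk L u y \<in> H" if "y \<in> H" for y
    using inv[OF that u(1)] subspace_neg[OF subspace_H] even_skew[OF H_even[OF that], of u] by simp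
  moreover have "u \<in> part L 0" using u(1) UM by (auto simp: MZ_def)
  ultimately have "u \<in> H" using H_normalizer by blast
  thus False using u(2) by blast
qed

text \<open>If [s, x] = c x with s in \<open>HS\<close> and c \<noteq> 0, then c (z, x) = (z,
  [s, x]) = ([z, s], x) = 0. Odd vectors are orthogonal to z, and an even vector killed by all of
  \<open>HS\<close> lies in \<open>MZ\<close>, which is \<open>H\<close>.\<close>

lemma H_radical_trivial:
  assumes z: "z \<in> H" "\<And>g. g \<in> H \<Longrightarrow> brk L z g = 0" "\<And>x. x \<in> H \<Longrightarrow> killing L z x = 0"
  shows "z = 0"
proof (rule killing_nondegenerate_left)
  fix y
  have "y \<in> span joint_eigen" by (simp add: span_joint_eigen)
  thus "killing L z y = 0"
  proof (induction rule: span_induct_alt)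
    case (step c x y)
    obtain i where i: "x \<in> part L i" using step by (auto simp: joint_eigen_def)
    have "killing L z x = 0"
    proof (cases "even i")
      case False
      thus ?thesis using killing_even_odd[OF H_even[OF z(1)] i] by simp
    next
      case True
      hence x0: "x \<in> part L 0" using i by (simp add: Defs.part_def)
      show ?thesis
      proof (cases "\<forall>s\<in>HS. brk L s x = 0")
        case True
        hence "x \<in> H" using x0 MZ_eq_H by (auto simp: MZ_def)
        thus ?thesis by (rule z(3))
      next
        case False
        then obtain s c where s: "s \<in> HS" "brk L s x = scl L c x" "c \<noteq> 0"
          using step(1) by (fastforce simp: joint_eigen_def)
        have "c * killing L z x = killing L z (brk L s x)" by (simp add: s killing_linear)
        also have "\<dots> = killing L (brk L z s) x" by (simp add: killing_invariant)
        also have "\<dots> = 0" using z(2) HS_H[OF s(1)] by simp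
        finally show ?thesis using s(3) by simp
      qed
    qed
    thus ?case using step by (simp add: killing_linear)
  qed simp
qed

text \<open>The operators ad z and ad n commute, so their product is nilpotent and has supertrace
  0.\<close>

lemma killing_commuting_nilpotent:
  assumes z: "z \<in> part L 0" and n: "n \<in> part L 0" "brk L z n = 0" "\<And>x. (brk L n ^^ N) x = 0"
  shows "killing L z n = 0"
proof -
  have comm: "brk L z (brk L n x) = brk L n (brk L z x)" for x
    using even_derivation[OF z, of n x] n(2) by (simp add: brk_zero)
  have "((\<lambda>x. brk L z (brk L n x)) ^^ k) x = (brk L z ^^ k) ((brk L n ^^ k) x)" for k x
  proof (induction k)
    case (Suc k)
    have "brk L n ((brk L z ^^ j) y) = (brk L z ^^ j) (brk L n y)" for j y
      by (induction j) (simp_all flip: comm)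
    thus ?case using Suc by simp
  qed simp
  hence "((\<lambda>x. brk L z (brk L n x)) ^^ N) x = 0" for x
    using n(3) lin_0[OF lin_funpowI[OF lin_brk(1)]] by simp
  thus ?thesis
    unfolding killing_str
    using op_parity_comp[OF op_parity_brk(2)[OF z] op_parity_brk(2)[OF n(1)] lin_brk(1)]
    by (intro str_nilpotent[OF lin_brkI[OF lin_brk(1)]]) auto
qed

text \<open>Otherwise the last nonzero term of the lower central series contains some z \<noteq> 0
  that is central in \<open>H\<close> and a sum of brackets. By invariance z is orthogonal to the
  central elements \<open>HS\<close>; it is also orthogonal to nilpotent parts, hence to all of
  \<open>H\<close>.\<close>

lemma H_abelian:
  assumes "x \<in> H" "y \<in> H"
  shows "brk L x y = 0"
proof (rule ccontr)
  assume xy: "brk L x y \<noteq> 0"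
  obtain n where n: "lower_central L H n = {0}" using H_nilpotent by blast
  define m where "m = (LEAST m. lower_central L H m = {0})"
  have m: "lower_central L H m = {0}" unfolding m_def using n by (rule LeastI)
  have "brk L x y \<in> H" using H_brk assms by blast
  hence "m \<noteq> 0" using m xy by (intro notI) simp
  moreover have "brk L x y \<in> lower_central L H 1" using assms by (auto intro: span_base)
  hence "m \<noteq> 1" using m xy by (intro notI) simp
  \<comment> \<open>Two successors: the last nonzero term has index Suc k, so it is itself spanned
    by brackets.\<close>
  ultimately obtain k where k: "m = Suc (Suc k)" by (metis One_nat_def not0_implies_Suc)
  have "lower_central L H (Suc k) \<noteq> {0}"
    using not_less_Least[of "Suc k" "\<lambda>m. lower_central L H m = {0}"] k by (auto simp: m_def)
  moreover have "0 \<in> lower_central L H (Suc k)" by (simp add: span_zero)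
  ultimately obtain z where z: "z \<in> lower_central L H (Suc k)" "z \<noteq> 0" by blast
  have zH: "z \<in> H" using z(1) lower_central_subset by blast
  have central: "brk L z g = 0" if g: "g \<in> H" for g
  proof -
    have "brk L g z \<in> lower_central L H (Suc (Suc k))"
      unfolding lower_central.simps(2)[of L H "Suc k"] by (rule span_base) (use g z(1) in blast)
    hence "brk L g z = 0" using m k by blast
    thus ?thesis using even_skew[OF H_even[OF g], of z] by simp
  qed
  have zs: "killing L z s = 0" if s: "s \<in> HS" for s
  proof -
    have "z \<in> span {brk L x y |x y. x \<in> H \<and> y \<in> lower_central L H k}" using z(1) by simp
    thus ?thesis
    proof (induction rule: span_induct_alt)
      case (step c w v)
      then obtain a b where ab: "w = brk L a b" "a \<in> H" "b \<in> H" using lower_central_subset by blast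
      have "brk L b s = 0" using even_skew[OF H_even[OF HS_H[OF s]], of b] HS_central[OF s ab(3)] by simp
      thus ?case using step ab by (simp add: killing_linear killing_invariant)
    qed simp
  qed
  have "killing L z g = 0" if g: "g \<in> H" for g
  proof -
    obtain s N where s: "s \<in> HS" "\<And>x. (brk L (g - s) ^^ N) x = 0"
      using H_jordan[OF g] by blast
    have gs: "g - s \<in> H" by (rule subspace_diff[OF subspace_H g HS_H[OF s(1)]])
    have "killing L z (g - s) = 0"
      by (rule killing_commuting_nilpotent[OF H_even[OF zH] H_even[OF gs] central[OF gs] s(2)])
    thus ?thesis using zs[OF s(1)] by (simp add: killing_diff)
  qed
  hence "z = 0" using H_radical_trivial[OF zH central] by blast
  thus False using z(2) by blast
qed

text \<open>The nilpotent part h - s is orthogonal to \<open>H\<close> and commutes with it, so it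
  vanishes.\<close>

lemma HS_eq_H: "HS = H"
proof -
  have "h \<in> HS" if h: "h \<in> H" for h
  proof -
    obtain s N where s: "s \<in> HS" "\<And>x. (brk L (h - s) ^^ N) x = 0"
      using H_jordan[OF h] by blast
    have d: "h - s \<in> H" using h HS_H[OF s(1)] subspace_diff[OF subspace_H] by blast
    have "killing L (h - s) x = 0" if x: "x \<in> H" for x
      using killing_commuting_nilpotent[OF H_even[OF x] H_even[OF d] H_abelian[OF x d] s(2)]
        killing_commute[OF H_even[OF x], of "h - s"] by simp
    hence "h - s = 0" using H_radical_trivial[OF d] H_abelian[OF d] by blast
    thus ?thesis using s(1) by simp
  qed
  thus ?thesis using HS_H by blast
qed

lemma even_centralizer_H:
  assumes "x \<in> part L 0" "\<And>h. h \<in> H \<Longrightarrow> brk L h x = 0"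
  shows "x \<in> H"
  using assms MZ_eq_H HS_eq_H by (auto simp: MZ_def)

text \<open>The eigenvalue on a nonzero joint eigenvector depends linearly on h; the zero vector is
  assigned the zero functional.\<close>

lemma H_weight_vectors:
  "span {x. \<exists>i. x \<in> part L i \<and> (\<exists>\<mu>\<in>dual_space L H. x \<in> root_space L H \<mu>)} = UNIV"
proof (rule span_UNIV_mono[OF _ span_joint_eigen], rule subsetI)
  fix x assume x: "x \<in> joint_eigen"
  then obtain i where i: "x \<in> part L i" by (auto simp: joint_eigen_def)
  have "\<exists>\<mu>\<in>dual_space L H. x \<in> root_space L H \<mu>"
  proof (cases "x = 0")
    case True
    thus ?thesis
      by (intro bexI[of _ "\<lambda>_. 0"]) (auto simp: dual_space_def root_space_def brk_zero)
  next
    case False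
    obtain c where c: "\<And>h. h \<in> H \<Longrightarrow> brk L h x = scl L (c h) x"
      using x unfolding joint_eigen_def HS_eq_H by auto metis
    let ?\<mu> = "\<lambda>h. if h \<in> H then c h else 0"
    have "c (h + k) = c h + c k" if "h \<in> H" "k \<in> H" for h k
    proof -
      have "scl L (c (h + k)) x = scl L (c h + c k) x"
        using c that subspace_add[OF subspace_H that]
        by (metis brk_linear_simps(1) scale_left_distrib)
      thus ?thesis using False by simp
    qed
    moreover have "c (scl L a h) = a * c h" if "h \<in> H" for a h
    proof -
      have "scl L (c (scl L a h)) x = scl L (a * c h) x"
        using c that subspace_scale[OF subspace_H that]
        by (metis brk_linear_simps(3) scale_scale)
      thus ?thesis using False by simp
    qed
    ultimately have "?\<mu> \<in> dual_space L H"
      by (auto simp: dual_space_def subspace_add[OF subspace_H] subspace_scale[OF subspace_H])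
    moreover have "x \<in> root_space L H ?\<mu>" using c by (simp add: root_space_def)
    ultimately show ?thesis by blast
  qed
  thus "x \<in> {x. \<exists>i. x \<in> part L i \<and> (\<exists>\<mu>\<in>dual_space L H. x \<in> root_space L H \<mu>)}" using i by blast
qed

end

section \<open>Root spaces\<close>

context cartan_superalgebra
begin

abbreviation rs :: "('g \<Rightarrow> complex) \<Rightarrow> 'g set" where
  "rs \<equiv> root_space L H"

abbreviation dl :: "('g \<Rightarrow> complex) set" where
  "dl \<equiv> dual_space L H"

lemma dl_comb: "\<alpha> \<in> dl \<Longrightarrow> \<beta> \<in> dl \<Longrightarrow> (\<lambda>t. a * \<alpha> t + b * \<beta> t) \<in> dl"
  by (auto simp: dual_space_def algebra_simps)

lemma dl_plus: "\<alpha> \<in> dl \<Longrightarrow> \<beta> \<in> dl \<Longrightarrow> \<alpha> + \<beta> \<in> dl"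
  by (auto simp: dual_space_def algebra_simps)

lemma dl_uminus: "\<alpha> \<in> dl \<Longrightarrow> - \<alpha> \<in> dl"
  by (auto simp: dual_space_def algebra_simps)

lemma dl_zero: "0 \<in> dl"
  by (auto simp: dual_space_def)

lemma dl_outside: "\<alpha> \<in> dl \<Longrightarrow> x \<notin> H \<Longrightarrow> \<alpha> x = 0"
  by (auto simp: dual_space_def)

lemma dl_eqI:
  assumes "\<alpha> \<in> dl" "\<beta> \<in> dl" "\<And>h. h \<in> H \<Longrightarrow> \<alpha> h = \<beta> h"
  shows "\<alpha> = \<beta>"
  using assms dl_outside by (metis ext)

lemma dl_linear:
  "\<alpha> \<in> dl \<Longrightarrow> x \<in> H \<Longrightarrow> y \<in> H \<Longrightarrow> \<alpha> (x + y) = \<alpha> x + \<alpha> y"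
  "\<alpha> \<in> dl \<Longrightarrow> x \<in> H \<Longrightarrow> \<alpha> (scl L c x) = c * \<alpha> x"
  by (auto simp: dual_space_def)

lemma rs_D: "x \<in> rs \<mu> \<Longrightarrow> h \<in> H \<Longrightarrow> brk L h x = scl L (\<mu> h) x"
  by (simp add: root_space_def)

lemma subspace_rs: "subspace (rs \<mu>)"
  by (auto simp: subspace_def root_space_def brk_linear_simps brk_zero algebra_simps)

lemma rs_brk:
  assumes "x \<in> rs \<mu>" "y \<in> rs \<nu>"
  shows "brk L x y \<in> rs (\<lambda>t. \<mu> t + \<nu> t)"
  using assms even_derivation[OF H_even]
  by (auto simp: root_space_def brk_linear_simps algebra_simps)

lemma rs_brk_plus: "x \<in> rs \<mu> \<Longrightarrow> y \<in> rs \<nu> \<Longrightarrow> brk L x y \<in> rs (\<mu> + \<nu>)"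
  using rs_brk[of x \<mu> y \<nu>] by (simp add: plus_fun_def)

lemma rs_grade: "x \<in> rs \<mu> \<Longrightarrow> grade x \<in> rs \<mu>"
  using op_parity_brk(1)[OF H_even]
  by (auto simp: root_space_def op_parity_def lin_scale[OF lin_grade])

lemma self_negE: "c = - c \<Longrightarrow> c = 0" for c :: 'g
proof -
  assume "c = - c"
  hence "c + c = 0" by (simp add: eq_neg_iff_add_eq_0)
  thus "c = 0" using scale_left_distrib[of 1 1 c] by simp
qed

lemma component_grade: "component L 0 x = scl L (1/2) (x + grade x)"
  "component L (Suc 0) x = scl L (1/2) (x - grade x)"
proof -
  define a b where ab: "a = component L 0 x" "b = component L (Suc 0) x"
  have 1: "x = a + b" unfolding ab by (rule component_decomp)
  have 2: "grade x = a - b" by (simp add: ab grade_def)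
  have two: "scl L (1/2) (c + c) = c" for c :: 'g
    using scale_left_distrib[of "1/2" "1/2" c] by (simp add: scale_right_distrib)
  have "x + grade x = a + a" "x - grade x = b + b" by (simp_all add: 1 2[unfolded 1])
  thus "component L 0 x = scl L (1/2) (x + grade x)" "component L (Suc 0) x = scl L (1/2) (x - grade x)"
    by (simp_all only: two flip: ab)
qed

lemma rs_component:
  assumes "x \<in> rs \<mu>"
  shows "component L 0 x \<in> rs \<mu>" "component L (Suc 0) x \<in> rs \<mu>"
  unfolding component_grade using assms rs_grade subspace_rs
  by (auto intro!: subspace_scale subspace_add subspace_diff)

section \<open>Orthogonality and independence of weight spaces\<close>

lemma killing_rs:
  assumes "x \<in> rs \<mu>" "y \<in> rs \<nu>" "\<mu> \<in> dl" "\<nu> \<in> dl" "\<mu> + \<nu> \<noteq> 0"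
  shows "killing L x y = 0"
proof -
  obtain h where h: "h \<in> H" "\<mu> h + \<nu> h \<noteq> 0"
    using assms dl_eqI[OF dl_plus dl_zero, of \<mu> \<nu>] by auto
  have "\<mu> h * killing L x y = killing L (brk L h x) y"
    using rs_D[OF assms(1) h(1)] by (simp add: killing_linear)
  also have "\<dots> = - killing L (brk L x h) y"
    using even_skew[OF H_even[OF h(1)], of x] by (simp add: killing_uminus)
  also have "\<dots> = - (\<nu> h * killing L x y)"
    using rs_D[OF assms(2) h(1)] by (simp add: killing_invariant killing_linear)
  finally have "(\<mu> h + \<nu> h) * killing L x y = 0" by (simp add: algebra_simps)
  thus ?thesis using h(2) by simp
qed

definition weight_vectors :: "'g set" where
  "weight_vectors = {x. \<exists>i. x \<in> part L i \<and> (\<exists>\<mu>\<in>dl. x \<in> rs \<mu>)}"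

lemma span_weight_vectors: "span weight_vectors = UNIV"
  using H_weight_vectors by (simp add: weight_vectors_def)

lemma weight_vectors_induct [consumes 0, case_names weight add]:
  assumes "\<And>x i \<mu>. x \<in> part L i \<Longrightarrow> \<mu> \<in> dl \<Longrightarrow> x \<in> rs \<mu> \<Longrightarrow> P x"
    and "\<And>x y. P x \<Longrightarrow> P y \<Longrightarrow> P (x + y)"
  shows "P x"
proof -
  have "x \<in> span weight_vectors" by (simp add: span_weight_vectors)
  thus ?thesis
  proof (induction rule: span_induct_alt)
    case base
    show ?case using assms(1)[of 0 0 0] subspace_0[OF subspace_part] subspace_0[OF subspace_rs] dl_zero by blast
  next
    case (step c x y)
    then obtain i \<mu> where "x \<in> part L i" "\<mu> \<in> dl" "x \<in> rs \<mu>" by (auto simp: weight_vectors_def)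
    hence "P (scl L c x)"
      using assms(1) subspace_scale[OF subspace_part] subspace_scale[OF subspace_rs] by blast
    thus ?case using step assms(2) by blast
  qed
qed

lemma rs_nondegenerate:
  assumes z: "z \<in> rs \<mu>" "z \<in> part L i" "\<mu> \<in> dl"
    and 0: "\<And>w. w \<in> rs (- \<mu>) \<Longrightarrow> w \<in> part L i \<Longrightarrow> killing L z w = 0"
  shows "z = 0"
proof (rule killing_nondegenerate_left)
  fix y show "killing L z y = 0"
  proof (induction y rule: weight_vectors_induct)
    case (weight y j \<nu>)
    show ?case
    proof (cases "even (i + j)")
      case False
      thus ?thesis using killing_even_odd z(2) weight(1) by blast
    next
      case True
      hence yi: "y \<in> part L i" using weight(1) by (auto simp: Defs.part_def split: if_splits)
      show ?thesis
      proof (cases "\<mu> + \<nu> = 0")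
        case True
        hence "\<nu> = - \<mu>" by (simp add: eq_neg_iff_add_eq_0 add.commute)
        thus ?thesis using 0 yi weight by blast
      next
        case False
        thus ?thesis using killing_rs z weight by blast
      qed
    qed
  qed (simp add: killing_linear)
qed

lemma rs_dual_vector:
  assumes "z \<in> rs \<mu>" "z \<in> part L i" "\<mu> \<in> dl" "z \<noteq> 0"
  obtains w where "w \<in> rs (- \<mu>)" "w \<in> part L i" "killing L z w = 1"
proof -
  obtain w where w: "w \<in> rs (- \<mu>)" "w \<in> part L i" "killing L z w \<noteq> 0"
    using rs_nondegenerate[OF assms(1-3)] assms(4) by blast
  show thesis
    by (rule that[of "scl L (1 / killing L z w) w"])
      (use w in \<open>auto simp: killing_linear intro: subspace_scale[OF subspace_rs] subspace_scale[OF subspace_part]\<close>)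
qed

text \<open>Pairing the sum with a vector of weight opposite to \<mu> annihilates all summands but
  \<open>y \<mu>\<close>, and nondegeneracy concludes.\<close>

lemma rs_independent:
  assumes "finite A" "A \<subseteq> dl" "\<And>\<mu>. \<mu> \<in> A \<Longrightarrow> y \<mu> \<in> rs \<mu>" "(\<Sum>\<mu>\<in>A. y \<mu>) = 0" "\<mu> \<in> A"
  shows "y \<mu> = 0"
proof (rule killing_nondegenerate_left)
  fix w show "killing L (y \<mu>) w = 0"
  proof (induction w rule: weight_vectors_induct)
    case (weight w i \<nu>)
    show ?case
    proof (cases "\<mu> + \<nu> = 0")
      case True
      have "killing L (y \<kappa>) w = 0" if "\<kappa> \<in> A - {\<mu>}" for \<kappa>
      proof (rule killing_rs)
        show "\<kappa> + \<nu> \<noteq> 0" using True that by (metis DiffE add_right_cancel insertI1)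
      qed (use that assms weight in auto)
      hence "(\<Sum>\<kappa>\<in>A. killing L (y \<kappa>) w) = killing L (y \<mu>) w"
        using assms by (simp add: sum.remove[of A \<mu>])
      thus ?thesis using assms(4) by (simp flip: killing_sum)
    next
      case False
      thus ?thesis using killing_rs assms weight by blast
    qed
  qed (simp add: killing_linear)
qed

text \<open>Realizes any function on weights as an operator that is scalar on weight spaces. It
  supplies the inverse of ad h off its kernel and, later, the grading derivation of a root
  degree.\<close>

lemma weight_operator:
  obtains G where "lin G" "\<And>\<mu> x. \<mu> \<in> dl \<Longrightarrow> x \<in> rs \<mu> \<Longrightarrow> G x = scl L (F \<mu>) x"
proof -
  obtain B where B: "B \<subseteq> weight_vectors" "independent B" "weight_vectors \<subseteq> span B"
    using maximal_independent_subset by blast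
  have spanB: "span B = UNIV"
    using span_mono[OF B(3)] span_weight_vectors by (auto simp: span_span)
  have finB: "finite B" using B(2) by (rule finiteI_independent)
  have "\<forall>b\<in>B. \<exists>\<mu>. \<mu> \<in> dl \<and> b \<in> rs \<mu>" using B(1) by (auto simp: weight_vectors_def)
  then obtain l where l: "\<And>b. b \<in> B \<Longrightarrow> l b \<in> dl" "\<And>b. b \<in> B \<Longrightarrow> b \<in> rs (l b)" by metis
  interpret vp: vector_space_pair "scl L" "scl L" by unfold_locales
  obtain G where G: "lin G" "\<And>b. b \<in> B \<Longrightarrow> G b = scl L (F (l b)) b"
    using vp.linear_independent_extend[OF B(2), of "\<lambda>b. scl L (F (l b)) b"] unfolding lin_def by blast
  have "G x = scl L (F \<mu>) x" if x: "\<mu> \<in> dl" "x \<in> rs \<mu>" for \<mu> x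
  proof -
    let ?r = "representation B x"
    define y where "y \<nu> = (\<Sum>b\<in>{b\<in>B. l b = \<nu>}. scl L (?r b) b)" for \<nu>
    have xs: "x = (\<Sum>b\<in>B. scl L (?r b) b)"
      using sum_representation_eq[of B x B] B(2) finB spanB by simp
    define A where "A = insert \<mu> (l ` B)"
    have fA: "finite A" "A \<subseteq> dl" using finB l(1) x(1) by (auto simp: A_def)
    have xy: "x = (\<Sum>\<nu>\<in>A. y \<nu>)"
      unfolding y_def by (subst sum.group[OF finB fA(1)]) (auto simp: A_def simp flip: xs)
    have yG: "y \<nu> \<in> rs \<nu>" for \<nu>
      unfolding y_def using l(2) by (auto intro!: subspace_sum subspace_scale subspace_rs)
    define z where "z \<nu> = y \<nu> - (if \<nu> = \<mu> then x else 0)" for \<nu>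
    have zG: "z \<nu> \<in> rs \<nu>" for \<nu>
      using yG[of \<nu>] x(2) subspace_diff[OF subspace_rs, of "y \<nu>" \<nu> x] by (auto simp: z_def)
    have "(\<Sum>\<nu>\<in>A. z \<nu>) = 0"
      using fA(1) by (simp add: z_def sum_subtractf flip: xy) (simp add: A_def)
    hence "z \<mu> = 0"
      using rs_independent[OF fA zG, of \<mu>] by (simp add: A_def)
    hence x': "x = (\<Sum>b\<in>{b\<in>B. l b = \<mu>}. scl L (?r b) b)" by (simp add: z_def y_def)
    have "G (\<Sum>b\<in>{b\<in>B. l b = \<mu>}. scl L (?r b) b) =
        scl L (F \<mu>) (\<Sum>b\<in>{b\<in>B. l b = \<mu>}. scl L (?r b) b)"
      using G by (simp add: lin_sum lin_scale scale_sum_right mult.commute)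
    thus ?thesis by (simp flip: x')
  qed
  thus thesis using that G(1) by blast
qed

text \<open>Every weight is the negative of the weight of some basis vector: otherwise its weight
  vectors would be orthogonal to the whole basis.\<close>

lemma finite_weights: "finite {\<mu>\<in>dl. rs \<mu> \<noteq> {0}}"
proof -
  obtain B where B: "B \<subseteq> weight_vectors" "independent B" "weight_vectors \<subseteq> span B"
    using maximal_independent_subset by blast
  have spanB: "span B = UNIV"
    using span_mono[OF B(3)] span_weight_vectors by (auto simp: span_span)
  have finB: "finite B" using B(2) by (rule finiteI_independent)
  have "\<forall>b\<in>B. \<exists>\<mu>. \<mu> \<in> dl \<and> b \<in> rs \<mu>" using B(1) by (auto simp: weight_vectors_def)
  then obtain l where l: "\<And>b. b \<in> B \<Longrightarrow> l b \<in> dl" "\<And>b. b \<in> B \<Longrightarrow> b \<in> rs (l b)" by metis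
  have "\<mu> \<in> (\<lambda>b. - l b) ` B" if \<mu>: "\<mu> \<in> dl" "rs \<mu> \<noteq> {0}" for \<mu>
  proof (rule ccontr)
    assume *: "\<mu> \<notin> (\<lambda>b. - l b) ` B"
    obtain x where x: "x \<in> rs \<mu>" "x \<noteq> 0" using \<mu>(2) subspace_0[OF subspace_rs] by blast
    have "killing L x b = 0" if "b \<in> B" for b
    proof (rule killing_rs[OF x(1) l(2)[OF that] \<mu>(1) l(1)[OF that]])
      show "\<mu> + l b \<noteq> 0" using * that by (auto simp: eq_neg_iff_add_eq_0)
    qed
    moreover have "y \<in> span B" for y by (simp add: spanB)
    hence "killing L x y = 0" for y
      by (induction rule: span_induct_alt) (use calculation in \<open>auto simp: killing_linear\<close>)
    hence "x = 0" by (rule killing_nondegenerate_left)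
    thus False using x(2) by blast
  qed
  hence "{\<mu>\<in>dl. rs \<mu> \<noteq> {0}} \<subseteq> (\<lambda>b. - l b) ` B" by blast
  thus ?thesis using finB finite_surj by blast
qed

section \<open>The zero weight space and coroots\<close>

lemma H_rs: "h \<in> H \<Longrightarrow> h \<in> rs 0"
  using H_abelian by (auto simp: root_space_def)

lemma rs_0_even: "x \<in> rs 0 \<Longrightarrow> x \<in> part L 0 \<Longrightarrow> x \<in> H"
  by (rule even_centralizer_H) (auto simp: root_space_def)

lemma killing_H_nondegenerate:
  assumes "z \<in> H" "\<And>h. h \<in> H \<Longrightarrow> killing L z h = 0"
  shows "z = 0"
  by (rule H_radical_trivial) (use assms H_abelian in auto)

text \<open>The bracket of two odd vectors of weight 0 lies in \<open>H\<close> and is orthogonal to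
  \<open>H\<close>, so it vanishes. Hence ad z squares to 0 and anticommutes with ad w, their
  product is nilpotent, and (z, w) = 0.\<close>

lemma rs_0_odd:
  assumes z: "z \<in> rs 0" "z \<in> part L 1"
  shows "z = 0"
proof (rule rs_nondegenerate[OF z dl_zero])
  have comm: "brk L u w = 0" if u: "u \<in> rs 0" "u \<in> part L 1" and w: "w \<in> rs 0" "w \<in> part L 1" for u w
  proof (rule killing_H_nondegenerate)
    have "brk L u w \<in> rs 0" using rs_brk_plus[OF u(1) w(1)] by simp
    moreover have "brk L u w \<in> part L 0" using brk_part[OF u(2) w(2)] by (simp add: Defs.part_def)
    ultimately show "brk L u w \<in> H" by (rule rs_0_even)
    fix h assume h: "h \<in> H"
    have "brk L w h = - brk L h w" using even_skew[OF H_even[OF h]] .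
    also have "brk L h w = 0" using rs_D[OF w(1) h] by simp
    finally show "killing L (brk L u w) h = 0" by (simp add: killing_invariant)
  qed
  fix w assume "w \<in> rs (- 0)" and w1: "w \<in> part L 1"
  hence w: "w \<in> rs 0" by simp
  have sq: "brk L z (brk L z y) = 0" for y
    by (rule self_negE) (use brk_jacobi[OF z(2) z(2), of y] comm[OF z z] in \<open>simp add: brk_zero\<close>)
  have anti: "brk L z (brk L w y) = - brk L w (brk L z y)" for y
    using brk_jacobi[OF z(2) w1, of y] comm[OF z w w1] by (simp add: brk_zero)
  have "((\<lambda>y. brk L z (brk L w y)) ^^ 2) y = 0" for y
    using anti[of "brk L z (brk L w y)"] by (simp add: numeral_2_eq_2 anti brk_uminus sq brk_zero)
  moreover have "op_parity 0 (\<lambda>y. brk L z (brk L w y))"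
    using op_parity_comp[OF op_parity_brk(2)[OF z(2)] op_parity_brk(2)[OF w1] lin_brk(1)]
    by (simp add: op_parity_def)
  ultimately show "killing L z w = 0"
    unfolding killing_str by (intro str_nilpotent[OF lin_brkI[OF lin_brk(1)]])
qed

lemma rs_0: "rs 0 = H"
proof -
  have "x \<in> H" if "x \<in> rs 0" for x
  proof -
    have "component L (Suc 0) x = 0"
      using rs_component(2)[OF that] component_in_part(1)[where i = "Suc 0" and x = x] rs_0_odd by simp
    hence "x = component L 0 x" using component_decomp[of x] by simp
    thus ?thesis
      using rs_0_even rs_component(1)[OF that] component_in_part(1)[where i = 0 and x = x] by metis
  qed
  thus ?thesis using H_rs by blast
qed

text \<open>The functional is extended to the whole algebra and represented there; only the weight 0
  part of the representing vector pairs nontrivially with \<open>H\<close>, and this part lies in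
  \<open>H\<close>.\<close>

lemma coroot_ex1:
  assumes \<alpha>: "\<alpha> \<in> dl"
  shows "\<exists>!t. t \<in> H \<and> (\<forall>s\<in>H. killing L t s = \<alpha> s)"
proof -
  obtain f where f: "functional L f" "\<And>x. x \<in> H \<Longrightarrow> f x = \<alpha> x"
    using dual_space_extends[OF subspace_H \<alpha>] by blast
  obtain d where d: "\<And>x. f x = killing L d x" using functional_represented[OF f(1)] by blast
  have "\<exists>t\<in>H. \<forall>s\<in>H. killing L d s = killing L t s"
  proof (induction d rule: weight_vectors_induct)
    case (weight d i \<mu>)
    show ?case
    proof (cases "\<mu> = 0")
      case True
      thus ?thesis using weight rs_0 by blast
    next
      case False
      hence "killing L d s = killing L 0 s" if "s \<in> H" for s
        using killing_rs[OF weight(3) H_rs[OF that] weight(2) dl_zero] by simp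
      thus ?thesis using subspace_0[OF subspace_H] by blast
    qed
  next
    case (add x y)
    then obtain s t where "s \<in> H" "t \<in> H" "\<forall>h\<in>H. killing L x h = killing L s h"
      "\<forall>h\<in>H. killing L y h = killing L t h" by blast
    thus ?case by (intro bexI[of _ "s + t"]) (auto simp: killing_linear subspace_add[OF subspace_H])
  qed
  then obtain t where t: "t \<in> H" "\<forall>s\<in>H. killing L t s = \<alpha> s" using d f(2) by metis
  moreover have "u = t" if u: "u \<in> H" "\<forall>s\<in>H. killing L u s = \<alpha> s" for u
  proof -
    have "u - t = 0"
      by (rule killing_H_nondegenerate)
        (use t u in \<open>auto simp: killing_diff subspace_diff[OF subspace_H]\<close>)
    thus ?thesis by simp
  qed
  ultimately show ?thesis by blast
qed

abbreviation cr :: "('g \<Rightarrow> complex) \<Rightarrow> 'g" where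
  "cr \<equiv> coroot L H"

lemma coroot: "\<alpha> \<in> dl \<Longrightarrow> cr \<alpha> \<in> H" "\<alpha> \<in> dl \<Longrightarrow> s \<in> H \<Longrightarrow> killing L (cr \<alpha>) s = \<alpha> s"
  using theI'[OF coroot_ex1] unfolding coroot_def by blast+

lemma coroot_eqI:
  assumes "\<alpha> \<in> dl" "t \<in> H" "\<And>s. s \<in> H \<Longrightarrow> killing L t s = \<alpha> s"
  shows "cr \<alpha> = t"
  using coroot_ex1[OF assms(1)] coroot[OF assms(1)] assms by blast

lemma coroot_inj: "\<alpha> \<in> dl \<Longrightarrow> \<beta> \<in> dl \<Longrightarrow> cr \<alpha> = cr \<beta> \<Longrightarrow> \<alpha> = \<beta>"
  using coroot(2) by (metis dl_eqI)

lemma coroot_comb: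
  assumes "\<alpha> \<in> dl" "\<beta> \<in> dl"
  shows "cr (\<lambda>t. a * \<alpha> t + b * \<beta> t) = scl L a (cr \<alpha>) + scl L b (cr \<beta>)"
  using assms coroot subspace_H
  by (intro coroot_eqI dl_comb) (auto simp: killing_linear subspace_add subspace_scale)

lemma coroot_uminus: "\<alpha> \<in> dl \<Longrightarrow> cr (- \<alpha>) = - cr \<alpha>"
  using coroot subspace_neg[OF subspace_H]
  by (intro coroot_eqI dl_uminus) (auto simp: killing_uminus)

lemma coroot_zero_iff: "\<alpha> \<in> dl \<Longrightarrow> cr \<alpha> = 0 \<longleftrightarrow> \<alpha> = 0"
  using coroot(2)[of \<alpha>] coroot_eqI[OF dl_zero subspace_0[OF subspace_H]] dl_eqI[OF _ dl_zero, of \<alpha>]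
  by auto

lemma killing_H_commute: "s \<in> H \<Longrightarrow> killing L s t = killing L t s"
  using killing_commute[OF H_even, of s t] by simp

lemma coroot_symmetric: "\<alpha> \<in> dl \<Longrightarrow> \<beta> \<in> dl \<Longrightarrow> \<alpha> (cr \<beta>) = \<beta> (cr \<alpha>)"
  using coroot killing_H_commute by metis

lemma brk_opposite:
  assumes \<alpha>: "\<alpha> \<in> dl" and x: "x \<in> rs \<alpha>" and y: "y \<in> rs (- \<alpha>)"
  shows "brk L x y = scl L (killing L x y) (cr \<alpha>)"
proof -
  have "brk L x y \<in> H" using rs_brk_plus[OF x y] rs_0 by simp
  moreover have "killing L (brk L x y) h = killing L x y * \<alpha> h" if h: "h \<in> H" for h
  proof -
    have "brk L y h = scl L (\<alpha> h) y"
      using even_skew[OF H_even[OF h], of y] rs_D[OF y h] by simp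
    thus ?thesis by (simp add: killing_invariant killing_linear)
  qed
  ultimately have "brk L x y - scl L (killing L x y) (cr \<alpha>) = 0"
    using coroot[OF \<alpha>] subspace_H
    by (intro killing_H_nondegenerate)
      (auto simp: killing_diff killing_linear subspace_diff subspace_scale)
  thus ?thesis by simp
qed

text \<open>The commutator of two operators preserving \<open>span X\<close> has trace 0 there.
  \<open>P\<close> records the shape of the eigenvalues of ad [e, f], and \<open>B\<close> is a
  basis drawn from \<open>X\<close>.\<close>

lemma trace_string:
  assumes e: "e \<in> part L 0" and f: "f \<in> part L 0"
    and inv: "\<And>x. x \<in> X \<Longrightarrow> brk L e x \<in> span X" "\<And>x. x \<in> X \<Longrightarrow> brk L f x \<in> span X"
    and l: "\<And>x. x \<in> X \<Longrightarrow> \<exists>c. brk L (brk L e f) x = scl L c x \<and> P c"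
  obtains B l where "finite B" "B \<subseteq> X" "0 \<notin> B" "span B = span X" "\<And>b. b \<in> B \<Longrightarrow> P (l b)"
    "(\<Sum>b\<in>B. l b) = 0"
proof -
  obtain l where l: "\<And>x. x \<in> X \<Longrightarrow> brk L (brk L e f) x = scl L (l x) x" "\<And>x. x \<in> X \<Longrightarrow> P (l x)"
    using l by metis
  obtain B where B: "finite B" "B \<subseteq> X" "independent B" "span B = span X"
    "trace_on (span X) (brk L (brk L e f)) = (\<Sum>b\<in>B. l b)"
    using trace_on_eigenvectors[OF lin_brk(1), of X "brk L e f" l] l(1) by blast
  have inv': "brk L e x \<in> span X" "brk L f x \<in> span X" if "x \<in> span X" for x
    using lin_span_image[OF lin_brk(1)] inv that by blast+
  have S: "subspace (span X)" by simp
  let ?ef = "\<lambda>x. brk L e (brk L f x)" and ?fe = "\<lambda>x. brk L f (brk L e x)"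
  have lin: "lin ?ef" "lin ?fe" by (rule lin_brkI[OF lin_brk(1)])+
  have "brk L (brk L e f) = (\<lambda>x. ?ef x + scl L (-1) (?fe x))"
    using brk_brk[OF e f] by auto
  hence "trace_on (span X) (brk L (brk L e f)) =
      trace_on (span X) ?ef + trace_on (span X) (\<lambda>x. scl L (-1) (?fe x))"
    using inv' lin subspace_scale[OF S]
    by (simp only:) (rule trace_on_plus[OF S], auto intro: lin_scaleI simp del: scale_minus_left)
  also have "trace_on (span X) (\<lambda>x. scl L (-1) (?fe x)) = (-1) * trace_on (span X) ?fe"
    using inv' lin by (intro trace_on_scale S) auto
  also have "trace_on (span X) ?ef = trace_on (span X) ?fe"
    using inv' by (intro trace_on_cyclic S lin_brk) auto
  finally have "(\<Sum>b\<in>B. l b) = 0" using B(5) by simp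
  moreover have "0 \<notin> B" using B(3) dependent_zero by blast
  ultimately show thesis using that B l(2) by blast
qed

text \<open>If \<alpha>(h_\<alpha>) = 0, then h_\<alpha> = [e, f] acts on the whole \<alpha>-string
  through a weight \<beta> by the constant \<beta>(h_\<alpha>). Trace 0 forces this constant to be
  0, so h_\<alpha> is central, hence 0.\<close>

lemma even_root_nonisotropic:
  assumes \<alpha>: "\<alpha> \<in> dl" "\<alpha> \<noteq> 0" and e: "e \<in> rs \<alpha>" "e \<in> part L 0" "e \<noteq> 0"
  shows "\<alpha> (cr \<alpha>) \<noteq> 0"
proof
  assume iso: "\<alpha> (cr \<alpha>) = 0"
  obtain f where f: "f \<in> rs (- \<alpha>)" "f \<in> part L 0" "killing L e f = 1"
    using rs_dual_vector[OF e(1,2) \<alpha>(1) e(3)] by blast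
  have h: "brk L e f = cr \<alpha>" using brk_opposite[OF \<alpha>(1) e(1) f(1)] f(3) by simp
  have "brk L (cr \<alpha>) x = 0" for x
  proof (induction x rule: weight_vectors_induct)
    case (weight x i \<beta>)
    have hx: "brk L (cr \<alpha>) x = scl L (\<beta> (cr \<alpha>)) x"
      by (rule rs_D[OF weight(3) coroot(1)[OF \<alpha>(1)]])
    show ?case
    proof (cases "x = 0")
      case False
      let ?w = "\<lambda>k :: int. (\<lambda>t. \<beta> t + of_int k * \<alpha> t)"
      let ?X = "\<Union>k. rs (?w k)"
      have up: "brk L e y \<in> span ?X" if "y \<in> rs (?w k)" for y k
      proof (rule span_base)
        have "brk L e y \<in> rs (?w (k + 1))"
          using rs_brk[OF e(1) that] by (simp add: algebra_simps)
        thus "brk L e y \<in> ?X" by blast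
      qed
      have down: "brk L f y \<in> span ?X" if "y \<in> rs (?w k)" for y k
      proof (rule span_base)
        have "brk L f y \<in> rs (?w (k - 1))"
          using rs_brk[OF f(1) that] by (simp add: algebra_simps)
        thus "brk L f y \<in> ?X" by blast
      qed
      have eig: "\<exists>c. brk L (brk L e f) y = scl L c y \<and> c = \<beta> (cr \<alpha>)" if "y \<in> ?X" for y
        using that rs_D[OF _ coroot(1)[OF \<alpha>(1)]] iso by (auto simp: h)
      obtain B l where B: "finite B" "B \<subseteq> ?X" "0 \<notin> B" "span B = span ?X"
        "\<And>b. b \<in> B \<Longrightarrow> l b = \<beta> (cr \<alpha>)" "(\<Sum>b\<in>B. l b) = (0 :: complex)"
      proof (rule trace_string[OF e(2) f(2), of ?X "\<lambda>c. c = \<beta> (cr \<alpha>)"])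
        show "brk L e y \<in> span ?X" if "y \<in> ?X" for y using that up by blast
        show "brk L f y \<in> span ?X" if "y \<in> ?X" for y using that down by blast
      qed (use eig in blast)+
      have "x \<in> rs (?w 0)" using weight by simp
      hence "x \<in> span B" unfolding B(4) by (intro span_base) blast
      hence "B \<noteq> {}" using False by (auto simp: span_empty)
      moreover have "of_nat (card B) * \<beta> (cr \<alpha>) = 0" using B(5,6) by simp
      ultimately have "\<beta> (cr \<alpha>) = 0" using B(1) by simp
      thus ?thesis using hx by simp
    qed (simp add: brk_zero)
  qed (simp add: brk_linear_simps)
  hence "cr \<alpha> = 0" by (rule center_trivial)
  thus False using coroot_zero_iff \<alpha> by blast
qed

text \<open>Positive multiples of one nonzero c sum to 0 only over an empty basis.\<close>

lemma positive_trace_trivial: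
  assumes e: "e \<in> part L 0" and f: "f \<in> part L 0" and "c \<noteq> 0"
    and inv: "\<And>x. x \<in> X \<Longrightarrow> brk L e x \<in> span X" "\<And>x. x \<in> X \<Longrightarrow> brk L f x \<in> span X"
    and l: "\<And>x. x \<in> X \<Longrightarrow> \<exists>k\<ge>1. brk L (brk L e f) x = scl L (of_nat k * c) x"
  shows "X \<subseteq> {0}"
proof -
  have l': "\<exists>d. brk L (brk L e f) x = scl L d x \<and> (\<exists>k\<ge>1. d = of_nat k * c)" if "x \<in> X" for x
    using l[OF that] by blast
  obtain B l where B: "finite B" "B \<subseteq> X" "0 \<notin> B" "span B = span X"
    "\<And>b. b \<in> B \<Longrightarrow> \<exists>k\<ge>1. l b = of_nat k * c" "(\<Sum>b\<in>B. l b) = 0"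
    by (rule trace_string[OF e f, of X "\<lambda>d. \<exists>k\<ge>1. d = of_nat k * c", OF inv l']) auto
  obtain k where k: "\<And>b. b \<in> B \<Longrightarrow> k b \<ge> 1 \<and> l b = of_nat (k b) * c" using B(5) by metis
  have "of_nat (\<Sum>b\<in>B. k b) * c = 0"
    using B(6) k by (simp add: sum_distrib_right)
  hence "(\<Sum>b\<in>B. k b) = 0" using \<open>c \<noteq> 0\<close> by (metis mult_eq_0_iff of_nat_eq_0_iff)
  hence "B = {}" using k B(1) by fastforce
  thus ?thesis using B(4) span_base by (auto simp: span_empty)
qed

text \<open>The vectors of weights k \<alpha> with k \<ge> 1 and fixed parity, restricted at k = 1
  in the even case to those orthogonal to f, form a space stable under e and f. There [e, f] has the
  eigenvalues k \<alpha>(h_\<alpha>), so trace 0 leaves only the zero space.\<close>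

lemma even_root_multiples:
  assumes \<alpha>: "\<alpha> \<in> dl" "\<alpha> \<noteq> 0" and e: "e \<in> rs \<alpha>" "e \<in> part L 0" and f: "f \<in> rs (- \<alpha>)" "f \<in> part L 0"
    and ef: "killing L e f = 1"
    and x: "x \<in> rs (\<lambda>t. of_nat k * \<alpha> t)" "x \<in> part L i" "k \<ge> 1"
      "k = 1 \<Longrightarrow> even i \<Longrightarrow> killing L x f = 0"
  shows "x = 0"
proof -
  \<comment> \<open>The condition at k = 1 keeps f from leading out into \<open>H\<close>, because
    [y, f] = (y, f) h_\<alpha>.\<close>
  define W where "W k = {x. x \<in> rs (\<lambda>t. of_nat k * \<alpha> t) \<and> x \<in> part L i \<and>
    (k = 1 \<and> even i \<longrightarrow> killing L x f = 0)}" for k :: nat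
  let ?X = "\<Union>k\<in>{1..}. W k"
  have h: "brk L e f = cr \<alpha>" using brk_opposite[OF \<alpha>(1) e(1) f(1)] ef by simp
  have "e \<noteq> 0" using ef by auto
  hence c: "\<alpha> (cr \<alpha>) \<noteq> 0" using even_root_nonisotropic \<alpha> e by blast
  have up: "brk L e y \<in> span ?X" if y: "y \<in> ?X" for y
  proof -
    obtain k where k: "k \<ge> 1" "y \<in> W k" using y by auto
    hence yk: "y \<in> rs (\<lambda>t. of_nat k * \<alpha> t)" by (simp add: W_def)
    have "brk L e y \<in> rs (\<lambda>t. of_nat (Suc k) * \<alpha> t)"
      using rs_brk[OF e(1) yk] by (simp add: algebra_simps)
    hence "brk L e y \<in> W (Suc k)" using k brk_part[OF e(2), of y i] by (auto simp: W_def)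
    thus ?thesis by (intro span_base) auto
  qed
  have down: "brk L f y \<in> span ?X" if y: "y \<in> ?X" for y
  proof -
    obtain k where k: "k \<ge> 1" "y \<in> W k" using y by auto
    hence yk: "y \<in> rs (\<lambda>t. of_nat k * \<alpha> t)" by (simp add: W_def)
    have p: "brk L f y \<in> part L i" using brk_part[OF f(2), of y i] k by (simp add: W_def)
    show ?thesis
    proof (cases "k = 1")
      case True
      have y1: "y \<in> rs \<alpha>" using k True by (simp add: W_def)
      have "brk L f y = 0"
      proof (cases "even i")
        case True
        hence "y \<in> part L 0" using k by (simp add: W_def Defs.part_def)
        hence "brk L f y = - brk L y f" using even_skew[of y f] by simp
        also have "brk L y f = 0"
          using brk_opposite[OF \<alpha>(1) y1 f(1)] k \<open>k = 1\<close> True by (simp add: W_def)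
        finally show ?thesis by simp
      next
        case False
        have "brk L f y \<in> rs 0" using rs_brk_plus[OF f(1) y1] by simp
        thus ?thesis using rs_0_odd p False by (simp add: Defs.part_def)
      qed
      thus ?thesis by (simp add: span_zero)
    next
      case False
      then obtain j where j: "k = Suc j" "j \<ge> 1" using k(1) by (cases k) auto
      have "brk L f y \<in> rs (\<lambda>t. of_nat j * \<alpha> t)"
        using rs_brk[OF f(1) yk] by (simp add: j(1) algebra_simps)
      \<comment> \<open>On arrival in weight \<alpha> the condition holds because [f, f] = 0 for
        even f.\<close>
      moreover have "killing L (brk L f y) f = 0" if "even i"
      proof -
        have "y \<in> part L 0" using k \<open>even i\<close> by (simp add: W_def Defs.part_def)
        hence "brk L f y = - brk L y f" using even_skew[of y f] by simp
        moreover have "brk L f f = 0" by (rule self_negE) (rule even_skew[OF f(2)])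
        ultimately show ?thesis by (simp add: killing_uminus killing_invariant)
      qed
      ultimately have "brk L f y \<in> W j" using p by (auto simp: W_def)
      thus ?thesis using j by (intro span_base) auto
    qed
  qed
  have "?X \<subseteq> {0}"
  proof (rule positive_trace_trivial[OF e(2) f(2) c up down])
    fix y assume "y \<in> ?X"
    then obtain k where k: "k \<ge> 1" "y \<in> W k" by auto
    thus "\<exists>k\<ge>1. brk L (brk L e f) y = scl L (of_nat k * \<alpha> (cr \<alpha>)) y"
      using rs_D[OF _ coroot(1)[OF \<alpha>(1)], of y "\<lambda>t. of_nat k * \<alpha> t"]
      by (intro exI[of _ k]) (auto simp: h W_def)
  qed
  moreover have "x \<in> ?X" using x by (auto simp: W_def)
  ultimately show ?thesis by blast
qed

lemma even_root_space:
  assumes \<alpha>: "\<alpha> \<in> dl" "\<alpha> \<noteq> 0" and e: "e \<in> rs \<alpha>" "e \<in> part L 0" "e \<noteq> 0"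
  shows "x \<in> rs \<alpha> \<Longrightarrow> x \<in> part L 1 \<Longrightarrow> x = 0"
    and "x \<in> rs \<alpha> \<Longrightarrow> x \<in> part L 0 \<Longrightarrow> \<exists>c. x = scl L c e"
    and "2 \<le> k \<Longrightarrow> x \<in> rs (\<lambda>t. of_nat k * \<alpha> t) \<Longrightarrow> x \<in> part L i \<Longrightarrow> x = 0"
proof -
  obtain f where f: "f \<in> rs (- \<alpha>)" "f \<in> part L 0" "killing L e f = 1"
    using rs_dual_vector[OF e(1,2) \<alpha>(1) e(3)] by blast
  note mult = even_root_multiples[OF \<alpha> e(1,2) f]
  show "x = 0" if "x \<in> rs \<alpha>" "x \<in> part L 1"
    by (rule mult[of x 1 1]) (use that in auto)
  show "x = 0" if "2 \<le> k" "x \<in> rs (\<lambda>t. of_nat k * \<alpha> t)" "x \<in> part L i"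
    by (rule mult[of x k i]) (use that in auto)
  show "\<exists>c. x = scl L c e" if x: "x \<in> rs \<alpha>" "x \<in> part L 0"
  proof -
    let ?y = "x - scl L (killing L x f) e"
    have "?y = 0"
    proof (rule mult[of ?y 1 0])
      show "?y \<in> rs (\<lambda>t. of_nat 1 * \<alpha> t)"
        using x e by (simp add: subspace_diff[OF subspace_rs] subspace_scale[OF subspace_rs])
      show "?y \<in> part L 0"
        using x e by (simp add: subspace_diff[OF subspace_part] subspace_scale[OF subspace_part])
    qed (use f in \<open>simp_all add: killing_diff killing_linear\<close>)
    thus ?thesis by auto
  qed
qed

section \<open>Odd root spaces\<close>

lemma odd_commute:
  assumes "x \<in> part L 1" "y \<in> part L 1"
  shows "brk L x y = brk L y x"
  using brk_skew[OF assms] by simp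

lemma odd_jacobi:
  assumes "x \<in> part L 1" "y \<in> part L 1"
  shows "brk L x (brk L y z) = brk L (brk L x y) z - brk L y (brk L x z)"
  using brk_jacobi[OF assms, of z] by simp

lemma odd_square_zero:
  assumes "x \<in> part L 1" "brk L x x = 0"
  shows "brk L x (brk L x z) = 0"
  by (rule self_negE) (use odd_jacobi[OF assms(1) assms(1), of z] assms(2) in \<open>simp add: brk_zero\<close>)

text \<open>[x, x] is a nonzero even root vector for 2 \<alpha>, so [x, u] = t [x, x] by
  one-dimensionality. Applying ad y gives \<alpha>(h_\<alpha>) u = 2 t \<alpha>(h_\<alpha>) x, and
  (u, y) = 0 forces t = 0.\<close>

lemma odd_nonisotropic_root:
  assumes \<alpha>: "\<alpha> \<in> dl" "\<alpha> (cr \<alpha>) \<noteq> 0"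
    and x: "x \<in> rs \<alpha>" "x \<in> part L 1" and y: "y \<in> rs (- \<alpha>)" "y \<in> part L 1" "killing L x y = 1"
    and u: "u \<in> rs \<alpha>" "u \<in> part L 1" "killing L u y = 0"
  shows "u = 0"
proof -
  have crH: "cr \<alpha> \<in> H" using \<alpha>(1) by (rule coroot)
  have yx: "brk L y x = cr \<alpha>" using brk_opposite[OF \<alpha>(1) x(1) y(1)] odd_commute[OF x(2) y(2)] y(3) by simp
  have yu: "brk L y u = 0" using brk_opposite[OF \<alpha>(1) u(1) y(1)] odd_commute[OF u(2) y(2)] u(3) by simp
  have yxu: "brk L y (brk L x u) = scl L (\<alpha> (cr \<alpha>)) u"
    using odd_jacobi[OF y(2) x(2), of u] rs_D[OF u(1) crH] by (simp add: yx yu brk_zero)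
  have yxx: "brk L y (brk L x x) = scl L (2 * \<alpha> (cr \<alpha>)) x"
    using odd_jacobi[OF y(2) x(2), of x] rs_D[OF x(1) crH] even_skew[OF H_even[OF crH], of x]
      scale_left_distrib[of "\<alpha> (cr \<alpha>)" "\<alpha> (cr \<alpha>)" x] by (simp add: yx)
  have "x \<noteq> 0" using y(3) by auto
  hence xx: "brk L x x \<noteq> 0" using yxx \<alpha>(2) by (auto simp: brk_zero)
  let ?\<beta> = "\<lambda>t. \<alpha> t + \<alpha> t"
  have \<beta>: "?\<beta> \<in> dl" using dl_comb[OF \<alpha>(1) \<alpha>(1), of 1 1] by simp
  have "?\<beta> (cr \<alpha>) \<noteq> 0" using \<alpha>(2) by simp
  hence \<beta>0: "?\<beta> \<noteq> 0" by (auto simp: fun_eq_iff)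
  have p: "brk L x w \<in> part L 0" if "w \<in> part L 1" for w
    using brk_part[OF x(2) that] by (simp add: Defs.part_def)
  obtain t where t: "brk L x u = scl L t (brk L x x)"
    using even_root_space(2)[OF \<beta> \<beta>0 rs_brk[OF x(1) x(1)] p[OF x(2)] xx rs_brk[OF x(1) u(1)] p[OF u(2)]]
    by blast
  have "scl L (\<alpha> (cr \<alpha>)) u = scl L (\<alpha> (cr \<alpha>)) (scl L (2 * t) x)"
    using yxu t yxx by (simp add: brk_linear_simps mult_ac)
  hence u': "u = scl L (2 * t) x" using \<alpha>(2) by (simp del: scale_scale)
  hence "2 * t = 0" using u(3) y(3) by (simp add: killing_linear)
  thus ?thesis using u' by simp
qed

text \<open>On the part of \<open>L\<close> where \<open>h = [x, y] = [u, v]\<close> is invertible, \<open>x\<close>, \<open>y\<close> commute with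
  \<open>u v / h\<close> and anticommute past \<open>u\<close>, so supercyclicity of the trace in \<open>x y (u v + v u) / h\<close>
  gives \<open>0\<close>; on the kernel of \<open>h\<close> the operator \<open>x y\<close> squares to \<open>0\<close>.\<close>

lemma odd_isotropic_root:
  assumes \<alpha>: "\<alpha> \<in> dl" "\<alpha> (cr \<alpha>) = 0"
    and x: "x \<in> rs \<alpha>" "x \<in> part L 1" and y: "y \<in> rs (- \<alpha>)" "y \<in> part L 1" "killing L x y = 1"
    and u: "u \<in> rs \<beta>" "u \<in> part L 1" and v: "v \<in> rs (- \<beta>)" "v \<in> part L 1"
    and \<beta>: "\<beta> \<in> dl" "\<beta> (cr \<alpha>) = 0" and uv: "\<And>z. brk L (brk L u v) z = scl L c (brk L (cr \<alpha>) z)" "c \<noteq> 0"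
    and sq: "brk L x x = 0" "brk L y y = 0" and comm: "brk L u x = 0" "brk L u y = 0"
  shows False
proof -
  let ?h = "cr \<alpha>"
  have h: "?h \<in> H" using \<alpha>(1) by (rule coroot)
  have xy: "brk L x y = ?h" using brk_opposite[OF \<alpha>(1) x(1) y(1)] y(3) by simp
  \<comment> \<open>Since division by 0 yields 0, \<open>G\<close> inverts ad h where its eigenvalue
    is nonzero and is 0 on its kernel.\<close>
  obtain G where G: "lin G" "\<And>\<mu> z. \<mu> \<in> dl \<Longrightarrow> z \<in> rs \<mu> \<Longrightarrow> G z = scl L (1 / \<mu> ?h) z"
    using weight_operator[of "\<lambda>\<mu>. 1 / \<mu> ?h"] by blast
  have Gcomm: "G (brk L w z) = brk L w (G z)" if w: "w \<in> rs \<nu>" "\<nu> \<in> dl" "\<nu> ?h = 0" for w z \<nu>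
  proof (induction z rule: weight_vectors_induct)
    case (weight z i \<mu>)
    have "G (brk L w z) = scl L (1 / (\<nu> + \<mu>) ?h) (brk L w z)"
      by (rule G(2)[OF dl_plus[OF w(2) weight(2)] rs_brk_plus[OF w(1) weight(3)]])
    thus ?case using G(2)[OF weight(2,3)] w(3) by (simp add: brk_linear_simps)
  qed (simp add: brk_linear_simps lin_add[OF G(1)])
  have Gx: "G (brk L x z) = brk L x (G z)" for z by (rule Gcomm[OF x(1) \<alpha>])
  have Gy: "G (brk L y z) = brk L y (G z)" for z
    by (rule Gcomm[OF y(1) dl_uminus[OF \<alpha>(1)]]) (simp add: \<alpha>(2))
  have Gu: "G (brk L u z) = brk L u (G z)" for z by (rule Gcomm[OF u(1) \<beta>])
  have Gpar: "op_parity 0 G"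
  proof -
    have "G (grade z) = grade (G z)" for z
    proof (induction z rule: weight_vectors_induct)
      case (weight z i \<mu>)
      thus ?case using G(2) rs_grade by (simp add: lin_scale[OF lin_grade])
    qed (simp add: lin_add[OF G(1)] lin_add[OF lin_grade])
    thus ?thesis by (simp add: op_parity_def)
  qed
  have lX: "lin (\<lambda>z. brk L x (brk L y (F z)))" if "lin F" for F
    by (rule lin_brkI[OF lin_brkI[OF that]])
  \<comment> \<open>The projection onto the kernel of ad h.\<close>
  define P where "P z = z - G (brk L ?h z)" for z
  have linP: "lin P" unfolding P_def by (rule lin_minusI[OF lin_idI lin_compI[OF G(1) lin_brk(1)]])
  define T where "T z = brk L x (brk L y (P z))" for z
  have linT: "lin T" unfolding T_def by (rule lX[OF linP])
  have TT: "T (T z) = 0" for z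
  proof (induction z rule: weight_vectors_induct)
    case (weight z i \<mu>)
    have Pw: "P w = (if \<nu> ?h = 0 then w else 0)" if "w \<in> rs \<nu>" "\<nu> \<in> dl" for w \<nu>
      using rs_D[OF that(1) h] G(2)[OF that(2,1)] by (simp add: P_def lin_scale[OF G(1)] lin_0[OF G(1)])
    show ?case
    proof (cases "\<mu> ?h = 0")
      case False
      hence "T z = 0" using Pw[OF weight(3,2)] by (simp add: T_def brk_zero)
      thus ?thesis by (simp add: lin_0[OF linT])
    next
      case True
      have z1: "brk L y z \<in> rs (- \<alpha> + \<mu>)" by (rule rs_brk_plus[OF y(1) weight(3)])
      have z2: "brk L x (brk L y z) \<in> rs (\<alpha> + (- \<alpha> + \<mu>))" by (rule rs_brk_plus[OF x(1) z1])
      have Tz: "T z = brk L x (brk L y z)" using Pw[OF weight(3,2)] True by (simp add: T_def)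
      have PT: "P (T z) = brk L x (brk L y z)"
        unfolding Tz using Pw[OF z2] True weight(2) \<alpha>(1) by (simp add: dl_plus dl_uminus)
      have "T (T z) = brk L x (brk L y (P (T z)))" by (rule T_def)
      also note PT
      also have "brk L y (brk L x (brk L y z)) = brk L (brk L y x) (brk L y z)"
        using odd_jacobi[OF y(2) x(2), of "brk L y z"] odd_square_zero[OF y(2) sq(2)] by (simp add: brk_zero)
      also have "brk L y x = ?h" using odd_commute[OF x(2) y(2)] xy by simp
      also have "brk L ?h (brk L y z) = 0" using rs_D[OF z1 h] True \<alpha>(2) by simp
      finally show ?thesis by (simp add: brk_zero)
    qed
  qed (simp add: lin_add[OF linT])
  have Tpar: "op_parity 0 T"
  proof -
    have "P (grade z) = grade (P z)" for z
      using Gpar op_parity_brk(2)[OF H_even[OF h]]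
      by (simp add: P_def op_parity_def lin_diff[OF lin_grade])
    thus ?thesis
      using op_parity_brk(2)[OF x(2)] op_parity_brk(2)[OF y(2)]
      by (simp add: T_def op_parity_def brk_uminus)
  qed
  have strT: "str T = 0"
    by (rule str_nilpotent[OF linT Tpar, of 2]) (simp add: numeral_2_eq_2 TT)
  let ?R = "\<lambda>z. brk L x (brk L y (G (brk L u (brk L v z))))"
  let ?S = "\<lambda>z. brk L x (brk L y (G (brk L v (brk L u z))))"
  have linR: "lin ?R" "lin ?S" by (rule lX[OF lin_compI[OF G(1) lin_brkI[OF lin_brk(1)]]])+
  \<comment> \<open>Moving the odd ad u round the supertrace costs the sign -1; moving it past x and
    y then changes the sign twice.\<close>
  have "str ?S = (-1) ^ 1 * str (\<lambda>z. brk L u (brk L x (brk L y (G (brk L v z)))))"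
    by (rule str_cyclic[where A = "\<lambda>z. brk L x (brk L y (G (brk L v z)))"])
      (intro lX lin_compI[OF G(1) lin_brk(1)] lin_brk(1) op_parity_brk(2)[OF u(2)])+
  also have "(\<lambda>z. brk L u (brk L x (brk L y (G (brk L v z))))) = ?R"
  proof
    fix z
    show "brk L u (brk L x (brk L y (G (brk L v z)))) = ?R z"
      using odd_jacobi[OF u(2) x(2)] odd_jacobi[OF u(2) y(2)] by (simp add: comm brk_zero brk_uminus Gu)
  qed
  finally have RS: "str ?R + str ?S = 0" by simp
  \<comment> \<open>The identity is \<open>P\<close> plus \<open>G\<close> composed with ad h, and c
    ad h = ad u ad v + ad v ad u.\<close>
  have split: "brk L x (brk L y z) = T z + scl L (1 / c) (?R z + ?S z)" for z
  proof -
    have "brk L u (brk L v z) + brk L v (brk L u z) = scl L c (brk L ?h z)"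
      using odd_jacobi[OF u(2) v(2), of z] uv(1) by simp
    hence "?R z + ?S z = scl L c (brk L x (brk L y (G (brk L ?h z))))"
      by (simp add: brk_linear_simps lin_scale[OF G(1)] flip: brk_linear_simps(2) lin_add[OF G(1)])
    hence "scl L (1 / c) (?R z + ?S z) = brk L x (brk L y (G (brk L ?h z)))"
      using uv(2) by simp
    thus ?thesis by (simp add: T_def P_def brk_diff)
  qed
  have "killing L x y = str (\<lambda>z. T z + scl L (1 / c) (?R z + ?S z))"
    unfolding killing_str by (rule arg_cong[where f = str], rule ext, rule split)
  also have "\<dots> = str T + (1 / c) * (str ?R + str ?S)"
    using linT linR lin_plusI[OF linR] by (simp add: str_plus str_scale lin_scaleI)
  finally show False using strT RS y(3) by simp
qed

text \<open>The component of u orthogonal to y must vanish. If it did not in the isotropic case, its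
  dual v would give a second presentation [u, v] of h_\<alpha>, which
  \<open>odd_isotropic_root\<close> excludes.\<close>

lemma odd_root_dim1:
  assumes \<alpha>: "\<alpha> \<in> dl" "\<alpha> \<noteq> 0" and x: "x \<in> rs \<alpha>" "x \<in> part L 1" "x \<noteq> 0"
    and u: "u \<in> rs \<alpha>" "u \<in> part L 1"
  shows "\<exists>c. u = scl L c x"
proof -
  obtain y where y: "y \<in> rs (- \<alpha>)" "y \<in> part L 1" "killing L x y = 1"
    using rs_dual_vector[OF x(1,2) \<alpha>(1) x(3)] by blast
  let ?u = "u - scl L (killing L u y) x"
  have u': "?u \<in> rs \<alpha>" "?u \<in> part L 1" "killing L ?u y = 0"
    using x u y(3) by (auto simp: killing_diff killing_linear
        intro: subspace_diff[OF subspace_rs] subspace_scale[OF subspace_rs]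
          subspace_diff[OF subspace_part] subspace_scale[OF subspace_part])
  have "?u = 0"
  proof (cases "\<alpha> (cr \<alpha>) = 0")
    case False
    show ?thesis by (rule odd_nonisotropic_root[OF \<alpha>(1) False x(1,2) y u'])
  next
    case True
    show ?thesis
    proof (rule ccontr)
      assume "?u \<noteq> 0"
      then obtain v where v: "v \<in> rs (- \<alpha>)" "v \<in> part L 1" "killing L ?u v = 1"
        using rs_dual_vector[OF u'(1,2) \<alpha>(1)] by blast
      \<comment> \<open>A nonzero bracket would be an even vector of weight 2 \<gamma>, hence
        nonisotropic, whereas (2 \<gamma>, 2 \<gamma>) = 4 (\<gamma>, \<gamma>) = 0.\<close>
      have zero: "brk L a b = 0"
        if \<gamma>: "\<gamma> \<in> dl" "\<gamma> \<noteq> 0" "\<gamma> (cr \<gamma>) = 0" and "a \<in> rs \<gamma>" "b \<in> rs \<gamma>" "a \<in> part L 1" "b \<in> part L 1"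
        for a b \<gamma>
      proof (rule ccontr)
        assume *: "brk L a b \<noteq> 0"
        let ?\<beta> = "\<lambda>t. 1 * \<gamma> t + 1 * \<gamma> t"
        have "?\<beta> \<in> dl" by (rule dl_comb[OF \<gamma>(1) \<gamma>(1)])
        moreover have "?\<beta> \<noteq> 0" using \<gamma>(2) by (auto simp: fun_eq_iff)
        moreover have "brk L a b \<in> rs ?\<beta>" using rs_brk[OF that(4,5)] by simp
        moreover have "brk L a b \<in> part L 0" using brk_part[OF that(6,7)] by (simp add: Defs.part_def)
        ultimately have "?\<beta> (cr ?\<beta>) \<noteq> 0" using even_root_nonisotropic * by blast
        moreover have "?\<beta> (cr ?\<beta>) = 4 * \<gamma> (cr \<gamma>)"
          unfolding coroot_comb[OF \<gamma>(1) \<gamma>(1)]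
          using coroot(1)[OF \<gamma>(1)] by (simp add: dl_linear[OF \<gamma>(1)] subspace_add[OF subspace_H])
        ultimately show False using \<gamma>(3) by simp
      qed
      have m\<alpha>: "- \<alpha> \<in> dl" "- \<alpha> \<noteq> 0" "(- \<alpha>) (cr (- \<alpha>)) = 0"
        using dl_uminus \<alpha> True coroot(1)[OF \<alpha>(1)] dl_linear(2)[OF \<alpha>(1) coroot(1)[OF \<alpha>(1)], where c = "-1"]
        by (auto simp: coroot_uminus)
      have h: "brk L ?u v = cr \<alpha>" using brk_opposite[OF \<alpha>(1) u'(1) v(1)] v(3) by simp
      show False
      proof (rule odd_isotropic_root[OF \<alpha>(1) True x(1,2) y u'(1,2) v(1,2) \<alpha>(1) True, of 1])
        show "brk L ?u y = 0" using brk_opposite[OF \<alpha>(1) u'(1) y(1)] u'(3) by simp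
        show "brk L ?u x = 0" by (rule zero[OF \<alpha> True u'(1) x(1) u'(2) x(2)])
        show "brk L x x = 0" by (rule zero[OF \<alpha> True x(1) x(1) x(2) x(2)])
        show "brk L y y = 0" by (rule zero[OF m\<alpha> y(1) y(1) y(2) y(2)])
      qed (simp_all only: h scale_one one_neq_zero not_False_eq_True)
    qed
  qed
  thus ?thesis by auto
qed

section \<open>Roots and their parities\<close>

lemma roots_iff: "\<alpha> \<in> roots L H \<longleftrightarrow> \<alpha> \<in> dl \<and> \<alpha> \<noteq> 0 \<and> rs \<alpha> \<noteq> {0}"
proof
  assume "\<alpha> \<in> roots L H"
  thus "\<alpha> \<in> dl \<and> \<alpha> \<noteq> 0 \<and> rs \<alpha> \<noteq> {0}"
    by (auto simp: roots_def roots_of_parity_def)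
next
  assume \<alpha>: "\<alpha> \<in> dl \<and> \<alpha> \<noteq> 0 \<and> rs \<alpha> \<noteq> {0}"
  then obtain x where x: "x \<in> rs \<alpha>" "x \<noteq> 0" using subspace_0[OF subspace_rs] by blast
  have "component L 0 x \<noteq> 0 \<or> component L (Suc 0) x \<noteq> 0"
    using component_decomp[of x] x(2) by auto
  thus "\<alpha> \<in> roots L H"
    using \<alpha> rs_component[OF x(1)] component_in_part(1)[where x = x]
    by (auto simp: roots_def roots_of_parity_def)
qed

abbreviation par :: "('g \<Rightarrow> complex) \<Rightarrow> nat" where
  "par \<equiv> root_parity L H"

text \<open>An even root vector excludes odd vectors of the same weight, so each root space has a
  single parity.\<close>

lemma root_vector_part:
  assumes \<alpha>: "\<alpha> \<in> roots L H" and x: "x \<in> rs \<alpha>"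
  shows "x \<in> part L (par \<alpha>)"
proof (cases "\<alpha> \<in> roots_of_parity L H 0")
  case True
  then obtain e where e: "e \<in> rs \<alpha>" "e \<in> part L 0" "e \<noteq> 0" by (auto simp: roots_of_parity_def)
  have "component L (Suc 0) x = 0"
    using even_root_space(1)[OF _ _ e] \<alpha> rs_component(2)[OF x] component_in_part(1)[where i = "Suc 0" and x = x]
    by (auto simp: roots_iff)
  thus ?thesis
    using True component_decomp[of x] component_in_part(1)[where i = 0 and x = x]
    by (simp add: root_parity_def)
next
  case False
  hence "component L 0 x = 0"
    using \<alpha> rs_component(1)[OF x] component_in_part(1)[where i = 0 and x = x]
    by (auto simp: roots_of_parity_def roots_iff)
  thus ?thesis
    using False component_decomp[of x] component_in_part(1)[where i = "Suc 0" and x = x]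
    by (simp add: root_parity_def)
qed

lemma par_less_2: "par \<alpha> = 0 \<or> par \<alpha> = 1"
  by (simp add: root_parity_def)

lemma root_space_dim1:
  assumes \<alpha>: "\<alpha> \<in> roots L H" and x: "x \<in> rs \<alpha>" "x \<noteq> 0" and y: "y \<in> rs \<alpha>"
  shows "\<exists>c. y = scl L c x"
proof -
  have \<alpha>': "\<alpha> \<in> dl" "\<alpha> \<noteq> 0" using \<alpha> by (auto simp: roots_iff)
  note p = root_vector_part[OF \<alpha> x(1)] root_vector_part[OF \<alpha> y]
  show ?thesis
    using par_less_2[of \<alpha>] p even_root_space(2)[OF \<alpha>' x(1) _ x(2) y]
      odd_root_dim1[OF \<alpha>' x(1) _ x(2) y] by auto
qed

lemma part_parity_unique: "x \<in> part L i \<Longrightarrow> x \<in> part L j \<Longrightarrow> x \<noteq> 0 \<Longrightarrow> even i = even j"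
  using part_inter[of x i j] by auto

lemma par_eqI:
  assumes "\<alpha> \<in> roots L H" "x \<in> rs \<alpha>" "x \<noteq> 0" "x \<in> part L i"
  shows "par \<alpha> = i mod 2"
  using part_parity_unique[OF root_vector_part[OF assms(1,2)] assms(4,3)] par_less_2[of \<alpha>]
  by (auto simp: mod_2_eq_odd)

lemma roots_uminus:
  assumes \<alpha>: "\<alpha> \<in> roots L H"
  shows "- \<alpha> \<in> roots L H" "par (- \<alpha>) = par \<alpha>"
proof -
  have \<alpha>': "\<alpha> \<in> dl" "\<alpha> \<noteq> 0" using \<alpha> by (auto simp: roots_iff)
  obtain x where x: "x \<in> rs \<alpha>" "x \<noteq> 0" using \<alpha> subspace_0[OF subspace_rs] by (auto simp: roots_iff)
  obtain w where w: "w \<in> rs (- \<alpha>)" "w \<in> part L (par \<alpha>)" "killing L x w = 1"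
    using rs_dual_vector[OF x(1) root_vector_part[OF \<alpha> x(1)] \<alpha>'(1) x(2)] by blast
  have "w \<noteq> 0" using w(3) by auto
  thus m: "- \<alpha> \<in> roots L H" using \<alpha>' w(1) dl_uminus by (auto simp: roots_iff)
  show "par (- \<alpha>) = par \<alpha>"
    using par_eqI[OF m w(1) \<open>w \<noteq> 0\<close> w(2)] par_less_2[of \<alpha>] by auto
qed

lemma finite_roots: "finite (roots L H)"
  by (rule finite_subset[OF _ finite_weights]) (auto simp: roots_iff)

end

section \<open>Indecomposable roots\<close>

locale based_superalgebra = cartan_superalgebra L H
  for L :: "'g::ab_group_add lie_superalg" and H :: "'g set" +
  fixes \<Gamma> :: "('g \<Rightarrow> complex) set" and e :: "('g \<Rightarrow> complex) \<Rightarrow> 'g"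
  assumes base: "root_base L H \<Gamma>"
    and e_root: "\<alpha> \<in> roots L H \<Longrightarrow> e \<alpha> \<in> root_space L H \<alpha>"
    and e_nonzero: "\<alpha> \<in> roots L H \<Longrightarrow> e \<alpha> \<noteq> 0"
    and e_norm: "\<alpha> \<in> roots_over L H \<Gamma> \<Longrightarrow> killing L (e \<alpha>) (e (- \<alpha>)) = 1"
begin

abbreviation \<Delta> :: "('g \<Rightarrow> complex) set" where
  "\<Delta> \<equiv> roots L H"

abbreviation \<Delta>p :: "('g \<Rightarrow> complex) set" where
  "\<Delta>p \<equiv> roots_over L H \<Gamma>"

lemma root_dl: "\<alpha> \<in> \<Delta> \<Longrightarrow> \<alpha> \<in> dl" and root_nonzero: "\<alpha> \<in> \<Delta> \<Longrightarrow> \<alpha> \<noteq> 0"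
  by (auto simp: roots_iff)

lemma pos_root: "\<alpha> \<in> \<Delta>p \<Longrightarrow> \<alpha> \<in> \<Delta>"
  by (simp add: roots_over_def)

lemma finite_\<Gamma>: "finite \<Gamma>" and \<Gamma>_root: "\<gamma> \<in> \<Gamma> \<Longrightarrow> \<gamma> \<in> \<Delta>"
  and \<Gamma>_independent: "\<not> module.dependent (\<lambda>c \<alpha> x. c * \<alpha> x) \<Gamma>"
  and \<Gamma>_signs: "\<alpha> \<in> \<Delta> \<Longrightarrow> nonneg_combination \<Gamma> \<alpha> \<or> nonneg_combination \<Gamma> (- \<alpha>)"
  using base by (auto simp: root_base_def)

lemma \<Gamma>_dl: "\<gamma> \<in> \<Gamma> \<Longrightarrow> \<gamma> \<in> dl"
  using \<Gamma>_root root_dl by blast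

section \<open>Coordinates of roots with respect to the base\<close>

lemma fun_sum_apply: "(\<Sum>i\<in>A. f i) x = (\<Sum>i\<in>A. f i x)" for f :: "'i \<Rightarrow> 'g \<Rightarrow> complex"
  by (induction A rule: infinite_finite_induct) auto

lemma vector_space_functions: "vector_space (\<lambda>(c::complex) (\<alpha>::'g \<Rightarrow> complex) x. c * \<alpha> x)"
  by unfold_locales (auto simp: fun_eq_iff algebra_simps)

lemma coroots_independent: "independent (cr ` \<Gamma>)"
proof
  interpret fs: vector_space "\<lambda>(c::complex) (\<alpha>::'g \<Rightarrow> complex) x. c * \<alpha> x"
    by (rule vector_space_functions)
  assume "dependent (cr ` \<Gamma>)"
  then obtain u where u: "\<exists>v\<in>cr ` \<Gamma>. u v \<noteq> 0" "(\<Sum>v\<in>cr ` \<Gamma>. scl L (u v) v) = 0"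
    using dependent_finite[of "cr ` \<Gamma>"] finite_\<Gamma> by auto
  have inj: "inj_on cr \<Gamma>" using coroot_inj \<Gamma>_dl by (auto intro: inj_onI)
  have s0: "(\<Sum>\<gamma>\<in>\<Gamma>. scl L (u (cr \<gamma>)) (cr \<gamma>)) = 0"
    using u(2) by (simp add: sum.reindex[OF inj])
  have "(\<Sum>\<gamma>\<in>\<Gamma>. u (cr \<gamma>) * \<gamma> x) = 0" for x
  proof (cases "x \<in> H")
    case True
    have "killing L (\<Sum>\<gamma>\<in>\<Gamma>. scl L (u (cr \<gamma>)) (cr \<gamma>)) x = (\<Sum>\<gamma>\<in>\<Gamma>. u (cr \<gamma>) * \<gamma> x)"
      using coroot(2)[OF \<Gamma>_dl True] by (simp add: killing_sum killing_linear)
    thus ?thesis using s0 by simp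
  next
    case False
    show ?thesis by (rule sum.neutral) (simp add: dl_outside[OF \<Gamma>_dl False])
  qed
  hence "(\<Sum>\<gamma>\<in>\<Gamma>. (\<lambda>x. u (cr \<gamma>) * \<gamma> x)) = 0"
    by (auto simp: fun_eq_iff fun_sum_apply)
  thus False
    using \<Gamma>_independent u(1) fs.dependent_finite[OF finite_\<Gamma>] by fastforce
qed

text \<open>The functional on \<open>H\<close> that is dual to \<open>\<gamma>\<close> on the
  coroots of \<open>\<Gamma>\<close> has a coroot of its own; by symmetry of the form on
  \<open>H\<close>, this is the required vector.\<close>

lemma dual_basis_ex:
  assumes "\<gamma> \<in> \<Gamma>"
  shows "\<exists>v\<in>H. \<forall>\<delta>\<in>\<Gamma>. \<delta> v = (if \<delta> = \<gamma> then 1 else 0)"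
proof -
  interpret vsp: vector_space_pair "scl L" "(*) :: complex \<Rightarrow> complex \<Rightarrow> complex"
    by (intro vector_space_pair.intro vector_space_axioms vector_space_mult)
  obtain F where F: "functional L F" "\<And>v. v \<in> cr ` \<Gamma> \<Longrightarrow> F v = (if v = cr \<gamma> then 1 else 0)"
    using vsp.linear_independent_extend[OF coroots_independent, of "\<lambda>v. if v = cr \<gamma> then 1 else 0"]
    by auto
  define \<alpha> where "\<alpha> = (\<lambda>x. if x \<in> H then F x else 0)"
  have \<alpha>: "\<alpha> \<in> dl"
    using F(1) by (auto simp: \<alpha>_def dual_space_def functional_iff subspace_add[OF subspace_H] subspace_scale[OF subspace_H])
  have "\<delta> (cr \<alpha>) = (if \<delta> = \<gamma> then 1 else 0)" if "\<delta> \<in> \<Gamma>" for \<delta>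
  proof -
    have "\<delta> (cr \<alpha>) = \<alpha> (cr \<delta>)" by (rule coroot_symmetric[OF \<Gamma>_dl[OF that] \<alpha>])
    also have "\<dots> = (if cr \<delta> = cr \<gamma> then 1 else 0)"
      using F(2)[of "cr \<delta>"] that coroot(1)[OF \<Gamma>_dl[OF that]] by (simp add: \<alpha>_def)
    also have "cr \<delta> = cr \<gamma> \<longleftrightarrow> \<delta> = \<gamma>"
      using coroot_inj \<Gamma>_dl that assms by blast
    finally show ?thesis .
  qed
  thus ?thesis using coroot(1)[OF \<alpha>] by blast
qed

text \<open>The coweight of \<open>\<gamma>\<close>: evaluating a combination of
  \<open>\<Gamma>\<close> there reads off the coefficient of \<open>\<gamma>\<close>.\<close>

definition dd :: "('g \<Rightarrow> complex) \<Rightarrow> 'g" where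
  "dd \<gamma> = (SOME v. v \<in> H \<and> (\<forall>\<delta>\<in>\<Gamma>. \<delta> v = (if \<delta> = \<gamma> then 1 else 0)))"

lemma dd: "\<gamma> \<in> \<Gamma> \<Longrightarrow> dd \<gamma> \<in> H" "\<gamma> \<in> \<Gamma> \<Longrightarrow> \<delta> \<in> \<Gamma> \<Longrightarrow> \<delta> (dd \<gamma>) = (if \<delta> = \<gamma> then 1 else 0)"
  using someI_ex[of "\<lambda>v. v \<in> H \<and> (\<forall>\<delta>\<in>\<Gamma>. \<delta> v = (if \<delta> = \<gamma> then 1 else 0))"] dual_basis_ex[of \<gamma>]
  unfolding dd_def by blast+

lemma combination_coeff:
  assumes "S \<subseteq> \<Gamma>" "\<alpha> = (\<lambda>x. \<Sum>\<gamma>\<in>S. c \<gamma> * \<gamma> x)" "\<gamma> \<in> \<Gamma>"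
  shows "\<alpha> (dd \<gamma>) = (if \<gamma> \<in> S then c \<gamma> else 0)"
proof -
  have "\<alpha> (dd \<gamma>) = (\<Sum>\<delta>\<in>S. if \<delta> = \<gamma> then c \<gamma> else 0)"
    unfolding assms(2)
  proof (rule sum.cong)
    fix \<delta> assume "\<delta> \<in> S"
    hence "\<delta> (dd \<gamma>) = (if \<delta> = \<gamma> then 1 else 0)" using dd(2)[OF assms(3)] assms(1) by blast
    thus "c \<delta> * \<delta> (dd \<gamma>) = (if \<delta> = \<gamma> then c \<gamma> else 0)" by simp
  qed simp
  thus ?thesis using finite_subset[OF assms(1) finite_\<Gamma>] by simp
qed

lemma root_expansion:
  assumes "\<alpha> \<in> \<Delta>"
  shows "\<alpha> x = (\<Sum>\<gamma>\<in>\<Gamma>. \<alpha> (dd \<gamma>) * \<gamma> x)"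
proof -
  have *: "\<beta> x = (\<Sum>\<gamma>\<in>\<Gamma>. \<beta> (dd \<gamma>) * \<gamma> x)" if "nonneg_combination \<Gamma> \<beta>" for \<beta>
  proof -
    obtain n where n: "\<beta> = (\<lambda>x. \<Sum>\<gamma>\<in>\<Gamma>. of_nat (n \<gamma>) * \<gamma> x)"
      using \<open>nonneg_combination \<Gamma> \<beta>\<close> unfolding nonneg_combination_def by blast
    have "\<beta> (dd \<gamma>) = of_nat (n \<gamma>)" if "\<gamma> \<in> \<Gamma>" for \<gamma>
      using combination_coeff[OF subset_refl n that] that by simp
    hence "(\<Sum>\<gamma>\<in>\<Gamma>. \<beta> (dd \<gamma>) * \<gamma> x) = (\<Sum>\<gamma>\<in>\<Gamma>. of_nat (n \<gamma>) * \<gamma> x)" by simp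
    thus ?thesis by (simp add: n)
  qed
  show ?thesis
    using \<Gamma>_signs[OF assms] *[of \<alpha>] *[of "- \<alpha>"] by (auto simp: sum_negf)
qed

lemma pos_iff: "\<alpha> \<in> \<Delta> \<Longrightarrow> \<alpha> \<in> \<Delta>p \<longleftrightarrow> (\<forall>\<gamma>\<in>\<Gamma>. \<alpha> (dd \<gamma>) \<in> \<nat>)"
proof
  assume "\<alpha> \<in> \<Delta>p"
  then obtain n where "\<alpha> = (\<lambda>x. \<Sum>\<gamma>\<in>\<Gamma>. of_nat (n \<gamma>) * \<gamma> x)"
    unfolding roots_over_def nonneg_combination_def by blast
  from combination_coeff[OF subset_refl this] show "\<forall>\<gamma>\<in>\<Gamma>. \<alpha> (dd \<gamma>) \<in> \<nat>" by simp
next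
  assume \<alpha>: "\<alpha> \<in> \<Delta>" and "\<forall>\<gamma>\<in>\<Gamma>. \<alpha> (dd \<gamma>) \<in> \<nat>"
  hence "\<forall>\<gamma>\<in>\<Gamma>. \<exists>n. \<alpha> (dd \<gamma>) = of_nat n" by (auto elim!: Nats_cases)
  from bchoice[OF this] obtain n where n: "\<And>\<gamma>. \<gamma> \<in> \<Gamma> \<Longrightarrow> \<alpha> (dd \<gamma>) = of_nat (n \<gamma>)" by blast
  have "\<alpha> = (\<lambda>x. \<Sum>\<gamma>\<in>\<Gamma>. of_nat (n \<gamma>) * \<gamma> x)"
    using root_expansion[OF \<alpha>] n by (intro ext) simp
  thus "\<alpha> \<in> \<Delta>p" using \<alpha> unfolding roots_over_def nonneg_combination_def by blast
qed

lemma pos_coeffs: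
  assumes "\<alpha> \<in> \<Delta>p"
  shows "\<exists>n. \<forall>\<gamma>\<in>\<Gamma>. \<alpha> (dd \<gamma>) = of_nat (n \<gamma>)"
proof (rule bchoice, rule ballI)
  fix \<gamma> assume "\<gamma> \<in> \<Gamma>"
  hence "\<alpha> (dd \<gamma>) \<in> \<nat>" using pos_iff[OF pos_root[OF assms]] assms by blast
  thus "\<exists>n. \<alpha> (dd \<gamma>) = of_nat n" by (auto elim: Nats_cases)
qed

lemma root_signs: "\<alpha> \<in> \<Delta> \<Longrightarrow> \<alpha> \<in> \<Delta>p \<or> - \<alpha> \<in> \<Delta>p"
  using \<Gamma>_signs roots_uminus(1) by (auto simp: roots_over_def)

lemma nat_neg: "(z::complex) \<in> \<nat> \<Longrightarrow> - z \<in> \<nat> \<Longrightarrow> z = 0"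
proof -
  assume "z \<in> \<nat>" "- z \<in> \<nat>"
  then obtain m n where mn: "z = of_nat m" "- z = of_nat n" by (auto elim!: Nats_cases)
  hence "of_nat (m + n) = (0::complex)" by simp (metis add.right_inverse)
  hence "m = 0" by (simp only: of_nat_eq_0_iff)
  thus "z = 0" using mn by simp
qed

lemma pos_not_neg:
  assumes "\<alpha> \<in> \<Delta>p"
  shows "- \<alpha> \<notin> \<Delta>p"
proof
  assume n: "- \<alpha> \<in> \<Delta>p"
  have "\<alpha> (dd \<gamma>) = 0" if "\<gamma> \<in> \<Gamma>" for \<gamma>
  proof (rule nat_neg)
    show "\<alpha> (dd \<gamma>) \<in> \<nat>" using pos_iff[OF pos_root[OF assms]] assms that by blast
    have "(- \<alpha>) (dd \<gamma>) \<in> \<nat>" using pos_iff[OF pos_root[OF n]] n that by blast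
    thus "- \<alpha> (dd \<gamma>) \<in> \<nat>" by simp
  qed
  hence "\<alpha> x = 0" for x by (subst root_expansion[OF pos_root[OF assms]]) simp
  hence "\<alpha> = 0" by (auto simp: fun_eq_iff)
  thus False using root_nonzero pos_root assms by blast
qed

definition height :: "('g \<Rightarrow> complex) \<Rightarrow> nat" where
  "height \<alpha> = (THE n. of_nat n = (\<Sum>\<gamma>\<in>\<Gamma>. \<alpha> (dd \<gamma>)))"

lemma height: "\<alpha> \<in> \<Delta>p \<Longrightarrow> of_nat (height \<alpha>) = (\<Sum>\<gamma>\<in>\<Gamma>. \<alpha> (dd \<gamma>))"
proof -
  assume \<alpha>: "\<alpha> \<in> \<Delta>p"
  obtain m where "\<And>\<gamma>. \<gamma> \<in> \<Gamma> \<Longrightarrow> \<alpha> (dd \<gamma>) = of_nat (m \<gamma>)" using pos_coeffs[OF \<alpha>] by blast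
  hence n: "(\<Sum>\<gamma>\<in>\<Gamma>. \<alpha> (dd \<gamma>)) = of_nat (\<Sum>\<gamma>\<in>\<Gamma>. m \<gamma>)" by simp
  hence "height \<alpha> = (\<Sum>\<gamma>\<in>\<Gamma>. m \<gamma>)"
    unfolding height_def by (intro the_equality) (simp_all only: of_nat_eq_iff)
  thus ?thesis using n by simp
qed

lemma height_plus: "\<alpha> \<in> \<Delta>p \<Longrightarrow> \<beta> \<in> \<Delta>p \<Longrightarrow> \<alpha> + \<beta> \<in> \<Delta>p \<Longrightarrow> height (\<alpha> + \<beta>) = height \<alpha> + height \<beta>"
  using height[of \<alpha>] height[of \<beta>] height[of "\<alpha> + \<beta>"]
  by (simp add: sum.distrib) (metis of_nat_add of_nat_eq_iff)

lemma height_pos: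
  assumes \<alpha>: "\<alpha> \<in> \<Delta>p"
  shows "height \<alpha> > 0"
proof (rule ccontr)
  assume "\<not> height \<alpha> > 0"
  hence s: "(\<Sum>\<gamma>\<in>\<Gamma>. \<alpha> (dd \<gamma>)) = 0" using height[OF \<alpha>] by simp
  obtain n where n: "\<And>\<gamma>. \<gamma> \<in> \<Gamma> \<Longrightarrow> \<alpha> (dd \<gamma>) = of_nat (n \<gamma>)"
    using pos_coeffs[OF \<alpha>] by blast
  have "of_nat (\<Sum>\<gamma>\<in>\<Gamma>. n \<gamma>) = (0::complex)" using s n by simp
  hence "\<forall>\<gamma>\<in>\<Gamma>. n \<gamma> = 0" using finite_\<Gamma> by (metis of_nat_eq_0_iff sum_eq_0_iff)
  hence "\<alpha> x = 0" for x using root_expansion[OF pos_root[OF \<alpha>], of x] n by simp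
  thus False using root_nonzero[OF pos_root[OF \<alpha>]] by (auto simp: fun_eq_iff)
qed

lemma pos_plus: "\<alpha> \<in> \<Delta>p \<Longrightarrow> \<beta> \<in> \<Delta>p \<Longrightarrow> \<alpha> + \<beta> \<in> \<Delta> \<Longrightarrow> \<alpha> + \<beta> \<in> \<Delta>p"
  using pos_iff[OF pos_root, of \<alpha>] pos_iff[OF pos_root, of \<beta>] by (simp add: pos_iff Nats_add)

lemma pos_plus_nonzero: "\<alpha> \<in> \<Delta>p \<Longrightarrow> \<beta> \<in> \<Delta>p \<Longrightarrow> \<alpha> + \<beta> \<noteq> 0"
  using pos_not_neg[of \<alpha>] by (metis add_eq_0_iff)

lemma \<Gamma>_pos: "\<gamma> \<in> \<Gamma> \<Longrightarrow> \<gamma> \<in> \<Delta>p"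
proof -
  assume \<gamma>: "\<gamma> \<in> \<Gamma>"
  have "\<gamma> (dd \<delta>) \<in> \<nat>" if "\<delta> \<in> \<Gamma>" for \<delta>
    unfolding dd(2)[OF that \<gamma>] by simp
  thus ?thesis using pos_iff[OF \<Gamma>_root[OF \<gamma>]] by blast
qed

lemma height_\<Gamma>:
  assumes "\<gamma> \<in> \<Gamma>"
  shows "height \<gamma> = 1"
proof -
  have "of_nat (height \<gamma>) = (\<Sum>\<delta>\<in>\<Gamma>. if \<gamma> = \<delta> then 1 else (0::complex))"
    unfolding height[OF \<Gamma>_pos[OF assms]] by (rule sum.cong) (simp_all add: dd(2)[OF _ assms])
  also have "\<dots> = of_nat 1" using assms finite_\<Gamma> by simp
  finally show ?thesis by (simp only: of_nat_eq_iff)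
qed

text \<open>All roots vanish on the difference of the two sides, so it is central and therefore
  0.\<close>

lemma H_expansion:
  assumes x: "x \<in> H"
  shows "x = (\<Sum>\<gamma>\<in>\<Gamma>. scl L (\<gamma> x) (dd \<gamma>))"
proof -
  let ?y = "\<Sum>\<gamma>\<in>\<Gamma>. scl L (\<gamma> x) (dd \<gamma>)"
  have y: "?y \<in> H" using dd(1) subspace_H by (auto intro!: subspace_sum subspace_scale)
  have d: "x - ?y \<in> H" using x y subspace_H subspace_diff by blast
  have sum: "\<alpha> (\<Sum>\<gamma>\<in>S. scl L (c \<gamma>) (dd \<gamma>)) = (\<Sum>\<gamma>\<in>S. c \<gamma> * \<alpha> (dd \<gamma>)) \<and>
      (\<Sum>\<gamma>\<in>S. scl L (c \<gamma>) (dd \<gamma>)) \<in> H" if "\<alpha> \<in> dl" "finite S" "S \<subseteq> \<Gamma>" for \<alpha> S c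
    using that(2,3)
  proof (induction S rule: finite_induct)
    case empty
    show ?case using dl_linear(2)[OF \<open>\<alpha> \<in> dl\<close> subspace_0[OF subspace_H], of 0] subspace_0[OF subspace_H] by simp
  next
    case (insert \<gamma> S)
    have "scl L (c \<gamma>) (dd \<gamma>) \<in> H" using insert dd(1) subspace_scale[OF subspace_H] by simp
    thus ?case using insert dd(1) by (simp add: dl_linear[OF \<open>\<alpha> \<in> dl\<close>] subspace_add[OF subspace_H])
  qed
  have "\<alpha> (x - ?y) = 0" if \<alpha>: "\<alpha> \<in> \<Delta>" for \<alpha>
  proof -
    have "\<alpha> x = \<alpha> (x - ?y) + \<alpha> ?y"
      using dl_linear(1)[OF root_dl[OF \<alpha>] d y] by simp
    also have "\<alpha> ?y = (\<Sum>\<gamma>\<in>\<Gamma>. \<gamma> x * \<alpha> (dd \<gamma>))"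
      by (rule conjunct1[OF sum[OF root_dl[OF \<alpha>] finite_\<Gamma> subset_refl]])
    also have "\<dots> = \<alpha> x" using root_expansion[OF \<alpha>, of x] by (simp add: mult.commute)
    finally show ?thesis by simp
  qed
  hence "brk L (x - ?y) z = 0" for z
  proof (induction z rule: weight_vectors_induct)
    case (weight z i \<mu>)
    have "\<mu> (x - ?y) = 0 \<or> z = 0"
    proof (cases "\<mu> = 0 \<or> z = 0")
      case False
      hence "\<mu> \<in> \<Delta>" using weight by (auto simp: roots_iff)
      thus ?thesis using weight(4) by blast
    qed auto
    thus ?case using rs_D[OF weight(3) d] by auto
  qed (simp add: brk_linear_simps)
  hence "x - ?y = 0" by (rule center_trivial)
  thus ?thesis by simp
qed

subsection \<open>Nonvanishing brackets of root vectors\<close>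

text \<open>If \<alpha>, \<beta> and \<alpha> + \<beta> are odd roots, the bracket is 0 by parity;
  so this relation replaces the condition that \<alpha> + \<beta> be a root.\<close>

definition nb :: "('g \<Rightarrow> complex) \<Rightarrow> ('g \<Rightarrow> complex) \<Rightarrow> bool" where
  "nb \<alpha> \<beta> \<longleftrightarrow> brk L (e \<alpha>) (e \<beta>) \<noteq> 0"

lemma root_vector_multiple:
  assumes "\<alpha> \<in> \<Delta>" "x \<in> rs \<alpha>"
  obtains c where "x = scl L c (e \<alpha>)"
  using root_space_dim1[OF assms(1) e_root[OF assms(1)] e_nonzero[OF assms(1)] assms(2)] by blast

lemma e_part: "\<alpha> \<in> \<Delta> \<Longrightarrow> e \<alpha> \<in> part L (par \<alpha>)"
  by (rule root_vector_part[OF _ e_root])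

lemma nb_root: "\<alpha> \<in> \<Delta> \<Longrightarrow> \<beta> \<in> \<Delta> \<Longrightarrow> nb \<alpha> \<beta> \<Longrightarrow> \<alpha> + \<beta> \<noteq> 0 \<Longrightarrow> \<alpha> + \<beta> \<in> \<Delta>"
  using rs_brk_plus[OF e_root e_root] by (auto simp: roots_iff nb_def dl_plus)

lemma brk_e:
  assumes "\<alpha> \<in> \<Delta>" "\<beta> \<in> \<Delta>" "\<alpha> + \<beta> \<in> \<Delta>"
  obtains c where "brk L (e \<alpha>) (e \<beta>) = scl L c (e (\<alpha> + \<beta>))" "nb \<alpha> \<beta> \<longleftrightarrow> c \<noteq> 0"
proof -
  obtain c where "brk L (e \<alpha>) (e \<beta>) = scl L c (e (\<alpha> + \<beta>))"
    using root_vector_multiple[OF assms(3) rs_brk_plus[OF e_root e_root]] assms by blast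
  thus thesis using that e_nonzero[OF assms(3)] by (auto simp: nb_def)
qed

lemma nb_commute:
  assumes "\<alpha> \<in> \<Delta>" "\<beta> \<in> \<Delta>"
  shows "nb \<alpha> \<beta> \<longleftrightarrow> nb \<beta> \<alpha>"
  using brk_skew[OF e_part[OF assms(1)] e_part[OF assms(2)]]
    brk_skew[OF e_part[OF assms(2)] e_part[OF assms(1)]] by (auto simp: nb_def)

lemma killing_e_nonzero:
  assumes "\<alpha> \<in> \<Delta>"
  shows "killing L (e \<alpha>) (e (- \<alpha>)) \<noteq> 0"
proof
  assume *: "killing L (e \<alpha>) (e (- \<alpha>)) = 0"
  have "e \<alpha> = 0"
  proof (rule rs_nondegenerate[OF e_root[OF assms] e_part[OF assms] root_dl[OF assms]])
    fix w assume "w \<in> rs (- \<alpha>)"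
    then obtain c where "w = scl L c (e (- \<alpha>))"
      using root_vector_multiple[OF roots_uminus(1)[OF assms]] by blast
    thus "killing L (e \<alpha>) w = 0" using * by (simp add: killing_linear)
  qed
  thus False using e_nonzero[OF assms] by blast
qed

text \<open>([e_\<alpha>, e_\<beta>], e_\<gamma>) = (e_\<alpha>, [e_\<beta>, e_\<gamma>]), and
  either side is nonzero exactly when its bracket is.\<close>

lemma nb_rotate:
  assumes "\<alpha> \<in> \<Delta>" "\<beta> \<in> \<Delta>" "\<gamma> \<in> \<Delta>" "\<alpha> + \<beta> + \<gamma> = 0"
  shows "nb \<alpha> \<beta> \<longleftrightarrow> nb \<beta> \<gamma>"
proof -
  have 1: "\<alpha> + \<beta> = - \<gamma>" and 2: "\<beta> + \<gamma> = - \<alpha>"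
    using assms(4) by (simp_all add: eq_neg_iff_add_eq_0 algebra_simps)
  obtain c where c: "brk L (e \<alpha>) (e \<beta>) = scl L c (e (- \<gamma>))" "nb \<alpha> \<beta> \<longleftrightarrow> c \<noteq> 0"
    using brk_e[OF assms(1,2)] roots_uminus(1)[OF assms(3)] 1 by metis
  obtain d where d: "brk L (e \<beta>) (e \<gamma>) = scl L d (e (- \<alpha>))" "nb \<beta> \<gamma> \<longleftrightarrow> d \<noteq> 0"
    using brk_e[OF assms(2,3)] roots_uminus(1)[OF assms(1)] 2 by metis
  have "c * killing L (e (- \<gamma>)) (e \<gamma>) = d * killing L (e \<alpha>) (e (- \<alpha>))"
    using killing_invariant[of "e \<alpha>" "e \<beta>" "e \<gamma>"] by (simp add: c d killing_linear)
  moreover have "killing L (e (- \<gamma>)) (e \<gamma>) \<noteq> 0"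
    using killing_e_nonzero[OF roots_uminus(1)[OF assms(3)]] by simp
  ultimately show ?thesis using killing_e_nonzero[OF assms(1)] c d by auto
qed

text \<open>If the bracket vanishes, the string of weights \<beta> - k \<alpha> with k \<ge> 0 is
  stable under e_\<alpha> and f. Trace 0 of [e_\<alpha>, f] makes \<beta>(h_\<alpha>) equal to q
  \<alpha>(h_\<alpha>), where q is the average of k over a basis.\<close>

lemma even_string:
  assumes \<alpha>: "\<alpha> \<in> \<Delta>" "par \<alpha> = 0" and \<beta>: "\<beta> \<in> \<Delta>" and n: "\<not> nb \<alpha> \<beta>"
  shows "\<exists>q::real. q \<ge> 0 \<and> \<beta> (cr \<alpha>) = of_real q * \<alpha> (cr \<alpha>)"
proof -
  note \<alpha>d = root_dl[OF \<alpha>(1)]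
  have eE: "e \<alpha> \<in> part L 0" using e_part[OF \<alpha>(1)] \<alpha>(2) by simp
  obtain f where f: "f \<in> rs (- \<alpha>)" "f \<in> part L 0" "killing L (e \<alpha>) f = 1"
    using rs_dual_vector[OF e_root[OF \<alpha>(1)] eE \<alpha>d e_nonzero[OF \<alpha>(1)]] by blast
  have h: "brk L (e \<alpha>) f = cr \<alpha>" using brk_opposite[OF \<alpha>d e_root[OF \<alpha>(1)] f(1)] f(3) by simp
  let ?w = "\<lambda>k :: nat. (\<lambda>t. \<beta> t - of_nat k * \<alpha> t)"
  let ?X = "\<Union>k. rs (?w k)"
  have up: "brk L (e \<alpha>) y \<in> span ?X" if y: "y \<in> ?X" for y
  proof -
    obtain k where k: "y \<in> rs (?w k)" using y by blast
    show ?thesis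
    proof (cases k)
      case 0
      hence "y \<in> rs \<beta>" using k by simp
      then obtain c where "y = scl L c (e \<beta>)" using root_vector_multiple[OF \<beta>] by blast
      hence "brk L (e \<alpha>) y = 0" using n by (simp add: nb_def brk_linear_simps)
      thus ?thesis by (simp add: span_zero)
    next
      case (Suc j)
      have "brk L (e \<alpha>) y \<in> rs (?w j)"
        using rs_brk[OF e_root[OF \<alpha>(1)] k] by (simp add: Suc algebra_simps)
      thus ?thesis by (intro span_base) blast
    qed
  qed
  have down: "brk L f y \<in> span ?X" if y: "y \<in> ?X" for y
  proof -
    obtain k where k: "y \<in> rs (?w k)" using y by blast
    have "brk L f y \<in> rs (?w (Suc k))"
      using rs_brk[OF f(1) k] by (simp add: algebra_simps)
    thus ?thesis by (intro span_base) blast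
  qed
  have eig: "\<exists>c. brk L (brk L (e \<alpha>) f) y = scl L c y \<and> (\<exists>k::nat. c = \<beta> (cr \<alpha>) - of_nat k * \<alpha> (cr \<alpha>))"
    if "y \<in> ?X" for y
    using that rs_D[OF _ coroot(1)[OF \<alpha>d]] by (auto simp: h)
  obtain B l where B: "finite B" "B \<subseteq> ?X" "0 \<notin> B" "span B = span ?X"
    "\<And>b. b \<in> B \<Longrightarrow> \<exists>k::nat. l b = \<beta> (cr \<alpha>) - of_nat k * \<alpha> (cr \<alpha>)" "(\<Sum>b\<in>B. l b) = (0 :: complex)"
  proof (rule trace_string[OF eE f(2), of ?X "\<lambda>c. \<exists>k::nat. c = \<beta> (cr \<alpha>) - of_nat k * \<alpha> (cr \<alpha>)"])
    show "brk L (e \<alpha>) y \<in> span ?X" if "y \<in> ?X" for y using that by (rule up)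
    show "brk L f y \<in> span ?X" if "y \<in> ?X" for y using that by (rule down)
  qed (use eig in blast)+
  have "e \<beta> \<in> rs (?w 0)" using e_root[OF \<beta>] by simp
  hence "e \<beta> \<in> span B" unfolding B(4) by (intro span_base) blast
  hence "B \<noteq> {}" using e_nonzero[OF \<beta>] by (auto simp: span_empty)
  hence c0: "card B \<noteq> 0" using B(1) by simp
  obtain k where k: "\<And>b. b \<in> B \<Longrightarrow> l b = \<beta> (cr \<alpha>) - of_nat (k b) * \<alpha> (cr \<alpha>)" using B(5) by metis
  have "of_nat (card B) * \<beta> (cr \<alpha>) = of_nat (\<Sum>b\<in>B. k b) * \<alpha> (cr \<alpha>)"
    using B(6) k by (simp add: sum_subtractf sum_distrib_right)
  hence "\<beta> (cr \<alpha>) = of_real (of_nat (\<Sum>b\<in>B. k b) / of_nat (card B)) * \<alpha> (cr \<alpha>)"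
    using c0 by (simp add: field_simps)
  moreover have "(0::real) \<le> of_nat (\<Sum>b\<in>B. k b) / of_nat (card B)"
    by (intro divide_nonneg_nonneg of_nat_0_le_iff)
  ultimately show ?thesis by blast
qed

text \<open>If the bracket vanished, \<open>even_string\<close> would apply to \<beta> and, after
  rotation, to -(\<alpha> + \<beta>). Their ratios q, q' \<ge> 0 and the ratio 1 of \<alpha> would
  add up to 0.\<close>

lemma nb_even:
  assumes \<alpha>: "\<alpha> \<in> \<Delta>" "par \<alpha> = 0" and \<beta>: "\<beta> \<in> \<Delta>" and \<alpha>\<beta>: "\<alpha> + \<beta> \<in> \<Delta>"
  shows "nb \<alpha> \<beta>"
proof (rule ccontr)
  assume n: "\<not> nb \<alpha> \<beta>"
  let ?\<gamma> = "- (\<alpha> + \<beta>)"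
  have \<gamma>: "?\<gamma> \<in> \<Delta>" using roots_uminus(1)[OF \<alpha>\<beta>] .
  have "\<not> nb \<alpha> ?\<gamma>"
    using n nb_rotate[OF \<alpha>(1) \<beta> \<gamma>] nb_rotate[OF \<beta> \<gamma> \<alpha>(1)] nb_commute[OF \<alpha>(1) \<gamma>] by (simp add: algebra_simps)
  then obtain q' :: real where q': "q' \<ge> 0" "?\<gamma> (cr \<alpha>) = of_real q' * \<alpha> (cr \<alpha>)"
    using even_string[OF \<alpha> \<gamma>] by blast
  obtain q :: real where q: "q \<ge> 0" "\<beta> (cr \<alpha>) = of_real q * \<alpha> (cr \<alpha>)"
    using even_string[OF \<alpha> \<beta> n] by blast
  have "- (\<alpha> (cr \<alpha>) + \<beta> (cr \<alpha>)) = of_real q' * \<alpha> (cr \<alpha>)" using q'(2) by simp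
  hence "\<alpha> (cr \<alpha>) + \<beta> (cr \<alpha>) + of_real q' * \<alpha> (cr \<alpha>) = 0" by (metis add.right_inverse)
  hence "of_real (1 + q + q') * \<alpha> (cr \<alpha>) = 0"
    unfolding q(2) by (simp add: algebra_simps)
  moreover have "of_real (1 + q + q') \<noteq> (0::complex)" using q(1) q'(1) by (simp only: of_real_eq_0_iff)
  moreover have "\<alpha> (cr \<alpha>) \<noteq> 0"
    using even_root_nonisotropic[OF root_dl[OF \<alpha>(1)] root_nonzero[OF \<alpha>(1)] e_root[OF \<alpha>(1)] _ e_nonzero[OF \<alpha>(1)]]
      e_part[OF \<alpha>(1)] \<alpha>(2) by simp
  ultimately show False by simp
qed

lemma nb_parity:
  assumes "\<alpha> \<in> \<Delta>" "\<beta> \<in> \<Delta>" "\<alpha> + \<beta> \<in> \<Delta>" "nb \<alpha> \<beta>"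
  shows "par (\<alpha> + \<beta>) = (par \<alpha> + par \<beta>) mod 2"
  using par_eqI[OF assms(3) rs_brk_plus[OF e_root e_root] _ brk_part[OF e_part e_part]] assms
  by (simp add: nb_def)

text \<open>A nonzero bracket involves an even root among \<alpha>, \<beta>, \<alpha> + \<beta>;
  \<open>nb_even\<close> applied to it or its negative gives the claim, up to symmetry and
  rotation.\<close>

lemma nb_uminus_imp:
  assumes "\<alpha> \<in> \<Delta>" "\<beta> \<in> \<Delta>" "\<alpha> + \<beta> \<in> \<Delta>" "nb \<alpha> \<beta>"
  shows "nb (- \<alpha>) (- \<beta>)"
proof -
  note m = roots_uminus[OF assms(1)] roots_uminus[OF assms(2)]
  have s: "- \<alpha> + - \<beta> \<in> \<Delta>" using roots_uminus(1)[OF assms(3)] by (simp add: algebra_simps)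
  have "par \<alpha> = 0 \<or> par \<beta> = 0 \<or> par (\<alpha> + \<beta>) = 0"
    using nb_parity[OF assms] par_less_2[of \<alpha>] par_less_2[of \<beta>] by auto
  thus ?thesis
  proof (elim disjE)
    assume "par \<alpha> = 0"
    thus ?thesis using nb_even[of "- \<alpha>" "- \<beta>"] m s by simp
  next
    assume "par \<beta> = 0"
    hence "nb (- \<beta>) (- \<alpha>)" using nb_even[of "- \<beta>" "- \<alpha>"] m s by (simp add: algebra_simps)
    thus ?thesis using nb_commute m by blast
  next
    assume "par (\<alpha> + \<beta>) = 0"
    hence "nb (\<alpha> + \<beta>) (- \<alpha>)" using nb_even[of "\<alpha> + \<beta>" "- \<alpha>"] m assms by simp
    thus ?thesis using nb_rotate[of "\<alpha> + \<beta>" "- \<alpha>" "- \<beta>"] m assms by simp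
  qed
qed

lemma nb_uminus:
  assumes "\<alpha> \<in> \<Delta>" "\<beta> \<in> \<Delta>" "\<alpha> + \<beta> \<in> \<Delta>"
  shows "nb (- \<alpha>) (- \<beta>) \<longleftrightarrow> nb \<alpha> \<beta>"
  using nb_uminus_imp[OF assms] nb_uminus_imp[of "- \<alpha>" "- \<beta>"] assms roots_uminus(1)
  by (metis add.inverse_inverse minus_add_distrib)

lemma nb_minus:
  assumes "\<alpha> \<in> \<Delta>" "\<beta> \<in> \<Delta>" "\<alpha> + \<beta> \<in> \<Delta>" "nb \<alpha> \<beta>"
  shows "nb (\<alpha> + \<beta>) (- \<alpha>)"
proof -
  have "nb (- \<alpha>) (- \<beta>)" using nb_uminus assms by blast
  thus ?thesis
    using nb_rotate[of "\<alpha> + \<beta>" "- \<alpha>" "- \<beta>"] assms roots_uminus(1) by simp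
qed

lemma nb_difference:
  assumes "\<alpha> \<in> \<Delta>" "\<beta> \<in> \<Delta>" "\<delta> \<in> \<Delta>" "nb \<alpha> (- \<beta>)" "\<alpha> - \<beta> = \<delta>"
  shows "nb \<beta> \<delta>" "nb \<alpha> (- \<delta>)"
proof -
  have s: "\<alpha> = \<beta> + \<delta>" using assms(5) by (simp add: algebra_simps flip: assms(5))
  have "nb (- \<beta>) (- \<delta>)"
    using nb_rotate[of \<alpha> "- \<beta>" "- \<delta>"] assms roots_uminus(1) s by (simp add: algebra_simps)
  thus b: "nb \<beta> \<delta>" using nb_uminus[of \<beta> \<delta>] assms s by simp
  hence "nb \<delta> \<beta>" using nb_commute assms by blast
  thus "nb \<alpha> (- \<delta>)" using nb_minus[of \<delta> \<beta>] assms s by (simp add: add.commute)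
qed

text \<open>The Jacobi identity; the last two conditions ensure that the inner brackets are root
  vectors and not elements of \<open>H\<close>.\<close>

lemma nb_jacobi:
  assumes "\<alpha> \<in> \<Delta>" "\<beta> \<in> \<Delta>" "\<gamma> \<in> \<Delta>" "\<alpha> + \<beta> \<in> \<Delta>" "nb \<alpha> \<beta>" "nb (\<alpha> + \<beta>) \<gamma>"
    and "\<beta> + \<gamma> \<noteq> 0" "\<alpha> + \<gamma> \<noteq> 0"
  shows "nb \<beta> \<gamma> \<and> nb \<alpha> (\<beta> + \<gamma>) \<or> nb \<alpha> \<gamma> \<and> nb \<beta> (\<alpha> + \<gamma>)"
proof -
  obtain c where c: "brk L (e \<alpha>) (e \<beta>) = scl L c (e (\<alpha> + \<beta>))" "c \<noteq> 0"
    using brk_e[OF assms(1,2,4)] assms(5) by metis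
  have "brk L (brk L (e \<alpha>) (e \<beta>)) (e \<gamma>) \<noteq> 0"
    using c assms(6) by (simp add: nb_def brk_linear_simps)
  hence "brk L (e \<alpha>) (brk L (e \<beta>) (e \<gamma>)) \<noteq> 0 \<or> brk L (e \<beta>) (brk L (e \<alpha>) (e \<gamma>)) \<noteq> 0"
    using brk_brk[OF e_part[OF assms(1)] e_part[OF assms(2)]] by auto
  thus ?thesis
  proof
    assume *: "brk L (e \<alpha>) (brk L (e \<beta>) (e \<gamma>)) \<noteq> 0"
    hence n: "nb \<beta> \<gamma>" by (auto simp: nb_def brk_zero)
    obtain d where "brk L (e \<beta>) (e \<gamma>) = scl L d (e (\<beta> + \<gamma>))"
      using brk_e[OF assms(2,3) nb_root[OF assms(2,3) n assms(7)]] by metis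
    thus ?thesis using * n by (auto simp: nb_def brk_linear_simps)
  next
    assume *: "brk L (e \<beta>) (brk L (e \<alpha>) (e \<gamma>)) \<noteq> 0"
    hence n: "nb \<alpha> \<gamma>" by (auto simp: nb_def brk_zero)
    obtain d where "brk L (e \<alpha>) (e \<gamma>) = scl L d (e (\<alpha> + \<gamma>))"
      using brk_e[OF assms(1,3) nb_root[OF assms(1,3) n assms(8)]] by metis
    thus ?thesis using * n by (auto simp: nb_def brk_linear_simps)
  qed
qed

section \<open>Decompositions of positive roots into indecomposable ones, and degrees\<close>

definition indec :: "('g \<Rightarrow> complex) set" where
  "indec = {\<alpha>\<in>\<Delta>p. \<forall>\<beta>\<in>\<Delta>p. \<forall>\<gamma>\<in>\<Delta>p. \<beta> + \<gamma> = \<alpha> \<longrightarrow> \<not> nb \<beta> \<gamma>}"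

lemma indec_pos: "\<alpha> \<in> indec \<Longrightarrow> \<alpha> \<in> \<Delta>p"
  by (simp add: indec_def)

lemma indecD: "\<beta> \<in> \<Delta>p \<Longrightarrow> \<gamma> \<in> \<Delta>p \<Longrightarrow> \<beta> + \<gamma> \<in> indec \<Longrightarrow> \<not> nb \<beta> \<gamma>"
  by (auto simp: indec_def)

lemma pos_nb_plus: "\<beta> \<in> \<Delta>p \<Longrightarrow> \<gamma> \<in> \<Delta>p \<Longrightarrow> nb \<beta> \<gamma> \<Longrightarrow> \<beta> + \<gamma> \<in> \<Delta>p"
  using nb_root pos_root pos_plus pos_plus_nonzero by metis

text \<open>If the first summand splits as \<beta>1 + \<beta>2, the Jacobi identity moves one of
  these two to the other summand, leaving a first summand of smaller height.\<close>

lemma indec_decomposition: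
  assumes "\<alpha> \<in> \<Delta>p" "\<alpha> \<notin> indec"
  obtains \<beta> \<gamma> where "\<beta> \<in> indec" "\<gamma> \<in> \<Delta>p" "\<beta> + \<gamma> = \<alpha>" "nb \<beta> \<gamma>"
proof -
  have "\<exists>\<beta>\<in>indec. \<exists>\<gamma>\<in>\<Delta>p. \<beta> + \<gamma> = \<alpha> \<and> nb \<beta> \<gamma>"
    if "\<beta> \<in> \<Delta>p" "\<gamma> \<in> \<Delta>p" "\<beta> + \<gamma> = \<alpha>" "nb \<beta> \<gamma>" for \<beta> \<gamma>
    using that
  proof (induction "height \<beta>" arbitrary: \<beta> \<gamma> rule: less_induct)
    case less
    show ?case
    proof (cases "\<beta> \<in> indec")
      case True
      thus ?thesis using less.prems by blast
    next
      case False
      then obtain \<beta>1 \<beta>2 where b: "\<beta>1 \<in> \<Delta>p" "\<beta>2 \<in> \<Delta>p" "\<beta>1 + \<beta>2 = \<beta>" "nb \<beta>1 \<beta>2"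
        using less.prems(1) by (auto simp: indec_def)
      have h: "height \<beta>1 < height \<beta>" "height \<beta>2 < height \<beta>"
        using height_plus[OF b(1,2)] b(3) less.prems(1) height_pos[OF b(1)] height_pos[OF b(2)] by auto
      have "nb \<beta>2 \<gamma> \<and> nb \<beta>1 (\<beta>2 + \<gamma>) \<or> nb \<beta>1 \<gamma> \<and> nb \<beta>2 (\<beta>1 + \<gamma>)"
        using nb_jacobi[of \<beta>1 \<beta>2 \<gamma>] b less.prems pos_root pos_plus_nonzero by simp
      thus ?thesis
      proof (elim disjE conjE)
        assume n: "nb \<beta>2 \<gamma>" "nb \<beta>1 (\<beta>2 + \<gamma>)"
        show ?thesis
          by (rule less.hyps[OF h(1) b(1) pos_nb_plus[OF b(2) less.prems(2) n(1)] _ n(2)])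
            (use b less.prems in \<open>simp add: add.assoc[symmetric]\<close>)
      next
        assume n: "nb \<beta>1 \<gamma>" "nb \<beta>2 (\<beta>1 + \<gamma>)"
        have "\<beta>2 + (\<beta>1 + \<gamma>) = (\<beta>1 + \<beta>2) + \<gamma>" by (simp add: add_ac)
        hence "\<beta>2 + (\<beta>1 + \<gamma>) = \<alpha>" using b less.prems by simp
        from less.hyps[OF h(2) b(2) pos_nb_plus[OF b(1) less.prems(2) n(1)] this n(2)]
        show ?thesis .
      qed
    qed
  qed
  moreover obtain \<beta> \<gamma> where "\<beta> \<in> \<Delta>p" "\<gamma> \<in> \<Delta>p" "\<beta> + \<gamma> = \<alpha>" "nb \<beta> \<gamma>"
    using assms unfolding indec_def by blast
  ultimately show thesis using that by blast
qed

lemma \<Gamma>_indec: "\<gamma> \<in> \<Gamma> \<Longrightarrow> \<gamma> \<in> indec"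
proof -
  assume \<gamma>: "\<gamma> \<in> \<Gamma>"
  have False if "\<beta> \<in> \<Delta>p" "\<delta> \<in> \<Delta>p" "\<beta> + \<delta> = \<gamma>" for \<beta> \<delta>
    using height_plus[OF that(1,2)] height_pos[OF that(1)] height_pos[OF that(2)]
      height_\<Gamma>[OF \<gamma>] \<Gamma>_pos[OF \<gamma>] that(3) by simp
  thus ?thesis using \<Gamma>_pos[OF \<gamma>] by (auto simp: indec_def)
qed

text \<open>Otherwise the difference or its negative would be a positive root whose nonzero bracket
  with one of the two roots produces the other.\<close>

lemma nb_indec_minus:
  assumes \<beta>: "\<beta> \<in> indec" and \<beta>': "\<beta>' \<in> indec" and "\<beta> \<noteq> \<beta>'"
  shows "\<not> nb \<beta>' (- \<beta>)"
proof
  assume n: "nb \<beta>' (- \<beta>)"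
  note r = pos_root[OF indec_pos[OF \<beta>]] pos_root[OF indec_pos[OF \<beta>']]
  let ?\<delta> = "\<beta>' - \<beta>"
  have "?\<delta> \<in> \<Delta>"
    using nb_root[OF r(2) roots_uminus(1)[OF r(1)] n] \<open>\<beta> \<noteq> \<beta>'\<close> by simp
  hence "?\<delta> \<in> \<Delta>p \<or> \<beta> - \<beta>' \<in> \<Delta>p" using root_signs[of ?\<delta>] by simp
  thus False
  proof
    assume d: "?\<delta> \<in> \<Delta>p"
    have "nb \<beta> ?\<delta>" by (rule nb_difference(1)[OF r(2,1) pos_root[OF d] n refl])
    thus False using indecD[OF indec_pos[OF \<beta>] d] \<beta>' by simp
  next
    assume d: "\<beta> - \<beta>' \<in> \<Delta>p"
    have "nb (\<beta> - \<beta>') \<beta>'"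
      using nb_rotate[of "\<beta> - \<beta>'" \<beta>' "- \<beta>"] r roots_uminus(1) pos_root[OF d] n by simp
    thus False using indecD[OF d indec_pos[OF \<beta>']] \<beta> by simp
  qed
qed

text \<open>Counts the occurrences of \<open>\<theta>\<close> in a decomposition into indecomposable
  roots. It is a relation because the count could depend on the decomposition until
  \<open>degree_rel_unique\<close>.\<close>

inductive degree_rel :: "('g \<Rightarrow> complex) \<Rightarrow> ('g \<Rightarrow> complex) \<Rightarrow> nat \<Rightarrow> bool" for \<theta> where
  base: "\<beta> \<in> indec \<Longrightarrow> degree_rel \<theta> \<beta> (if \<beta> = \<theta> then 1 else 0)"
| step: "\<beta> \<in> indec \<Longrightarrow> \<gamma> \<in> \<Delta>p \<Longrightarrow> nb \<beta> \<gamma> \<Longrightarrow> degree_rel \<theta> \<gamma> n \<Longrightarrow>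
    degree_rel \<theta> (\<beta> + \<gamma>) ((if \<beta> = \<theta> then 1 else 0) + n)"

lemma degree_rel_exists: "\<alpha> \<in> \<Delta>p \<Longrightarrow> \<exists>n. degree_rel \<theta> \<alpha> n"
proof (induction "height \<alpha>" arbitrary: \<alpha> rule: less_induct)
  case less
  show ?case
  proof (cases "\<alpha> \<in> indec")
    case True
    thus ?thesis using degree_rel.base by blast
  next
    case False
    then obtain \<beta> \<gamma> where b: "\<beta> \<in> indec" "\<gamma> \<in> \<Delta>p" "\<beta> + \<gamma> = \<alpha>" "nb \<beta> \<gamma>"
      using indec_decomposition[OF less.prems] by blast
    have "height \<gamma> < height \<alpha>"
      using height_plus[OF indec_pos[OF b(1)] b(2)] height_pos[OF indec_pos[OF b(1)]] b(3) less.prems by simp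
    then obtain n where "degree_rel \<theta> \<gamma> n" using less.hyps b(2) by blast
    from degree_rel.step[OF b(1,2,4) this] show ?thesis using b(3) by blast
  qed
qed

lemma degree_rel_cases:
  assumes "degree_rel \<theta> \<alpha> n" "\<alpha> \<notin> indec"
  obtains \<beta> \<gamma> m where "\<beta> \<in> indec" "\<gamma> \<in> \<Delta>p" "nb \<beta> \<gamma>" "degree_rel \<theta> \<gamma> m" "\<alpha> = \<beta> + \<gamma>"
    "n = (if \<beta> = \<theta> then 1 else 0) + m"
  using assms by (cases rule: degree_rel.cases) auto

lemma degree_rel_indec:
  assumes "degree_rel \<theta> \<alpha> n" "\<alpha> \<in> indec"
  shows "n = (if \<alpha> = \<theta> then 1 else 0)"
  using assms indecD[OF indec_pos] by (cases rule: degree_rel.cases) auto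

text \<open>Two decompositions \<beta> + \<gamma> = \<beta>' + \<gamma>' are joined through \<delta>
  = \<gamma>' - \<beta>: both \<gamma>' = \<beta> + \<delta> and \<gamma> = \<beta>' + \<delta> have
  nonzero brackets, so either count is the total for \<beta>, \<beta>' and \<delta>.\<close>

lemma degree_rel_unique:
  "\<alpha> \<in> \<Delta>p \<Longrightarrow> degree_rel \<theta> \<alpha> n \<Longrightarrow> degree_rel \<theta> \<alpha> n' \<Longrightarrow> n = n'"
proof (induction "height \<alpha>" arbitrary: \<alpha> n n' rule: less_induct)
  case less
  let ?w = "\<lambda>\<beta>. if \<beta> = \<theta> then 1 else (0::nat)"
  show ?case
  proof (cases "\<alpha> \<in> indec")
    case True
    thus ?thesis using degree_rel_indec less.prems by metis
  next
    case False
    obtain \<beta> \<gamma> m where b: "\<beta> \<in> indec" "\<gamma> \<in> \<Delta>p" "nb \<beta> \<gamma>" "degree_rel \<theta> \<gamma> m" "\<alpha> = \<beta> + \<gamma>" "n = ?w \<beta> + m"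
      using degree_rel_cases[OF less.prems(2) False] by blast
    obtain \<beta>' \<gamma>' m' where b': "\<beta>' \<in> indec" "\<gamma>' \<in> \<Delta>p" "nb \<beta>' \<gamma>'" "degree_rel \<theta> \<gamma>' m'" "\<alpha> = \<beta>' + \<gamma>'"
      "n' = ?w \<beta>' + m'"
      using degree_rel_cases[OF less.prems(3) False] by blast
    note p = indec_pos[OF b(1)] indec_pos[OF b'(1)]
    have h: "height \<gamma> < height \<alpha>" "height \<gamma>' < height \<alpha>"
      using height_plus[OF p(1) b(2)] height_plus[OF p(2) b'(2)] height_pos[OF p(1)] height_pos[OF p(2)]
        b(5) b'(5) less.prems(1) by auto
    show ?thesis
    proof (cases "\<beta> = \<beta>'")
      case True
      hence "\<gamma> = \<gamma>'" using b(5) b'(5) by simp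
      hence "m = m'" using less.hyps[OF h(1) b(2) b(4)] b'(4) by simp
      thus ?thesis using b b' True by simp
    next
      case ne: False
      show ?thesis
      proof (cases "\<gamma>' = \<beta>")
        \<comment> \<open>Here \<delta> would be 0; the two decompositions differ only in their
          order.\<close>
        case True
        hence "\<gamma> = \<beta>'" using b(5) b'(5) by (simp add: add.commute)
        hence "m = ?w \<beta>'" using degree_rel_indec[OF b(4)] b'(1) by simp
        moreover have "m' = ?w \<beta>" using degree_rel_indec[OF b'(4)] b(1) True by simp
        ultimately show ?thesis using b b' by simp
      next
        case False
        let ?\<delta> = "\<gamma>' - \<beta>"
        \<comment> \<open>The root \<delta> arises from the Jacobi identity for \<beta>', \<gamma>'
          and the negative of \<beta>; the other branch would subtract two distinct indecomposable
          roots.\<close>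
        have "nb (\<beta> + \<gamma>) (- \<beta>)"
          using nb_minus[of \<beta> \<gamma>] pos_root p b less.prems(1) by simp
        hence "nb (\<beta>' + \<gamma>') (- \<beta>)" using b(5) b'(5) by simp
        hence "nb \<gamma>' (- \<beta>) \<and> nb \<beta>' ?\<delta> \<or> nb \<beta>' (- \<beta>) \<and> nb \<gamma>' (\<beta>' + - \<beta>)"
          using nb_jacobi[of \<beta>' \<gamma>' "- \<beta>"] pos_root p b' roots_uminus(1) less.prems(1) ne False by simp
        hence n: "nb \<gamma>' (- \<beta>)" "nb \<beta>' ?\<delta>"
          using nb_indec_minus[OF b(1) b'(1) ne] by blast+
        have dr: "?\<delta> \<in> \<Delta>"
          using nb_root[OF pos_root[OF b'(2)] roots_uminus(1)[OF pos_root[OF p(1)]] n(1)] False by simp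
        have d: "?\<delta> \<in> \<Delta>p"
        proof (rule ccontr)
          assume "?\<delta> \<notin> \<Delta>p"
          hence d': "\<beta> - \<gamma>' \<in> \<Delta>p" using root_signs[OF dr] by simp
          have "nb (\<beta> - \<gamma>') \<gamma>'"
            using nb_rotate[of "\<beta> - \<gamma>'" \<gamma>' "- \<beta>"] p b' roots_uminus(1) pos_root d' n(1) by simp
          thus False using indecD[OF d' b'(2)] b(1) by simp
        qed
        have n1: "nb \<beta> ?\<delta>"
          by (rule nb_difference(1)[OF pos_root[OF b'(2)] pos_root[OF p(1)] dr n(1) refl])
        obtain k where k: "degree_rel \<theta> ?\<delta> k" using degree_rel_exists[OF d] by blast
        have g': "\<gamma>' = \<beta> + ?\<delta>" by simp
        have "\<beta>' + \<gamma>' = \<beta> + \<gamma>" using b(5) b'(5) by simp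
        hence g: "\<gamma> = \<beta>' + ?\<delta>" by (simp add: algebra_simps)
        have "m' = ?w \<beta> + k"
          using less.hyps[OF h(2) b'(2) b'(4)] degree_rel.step[OF b(1) d n1 k] by simp
        moreover have "m = ?w \<beta>' + k"
          using less.hyps[OF h(1) b(2) b(4)] degree_rel.step[OF b'(1) d n(2) k] g by simp
        ultimately show ?thesis using b(6) b'(6) by simp
      qed
    qed
  qed
qed

definition deg :: "('g \<Rightarrow> complex) \<Rightarrow> ('g \<Rightarrow> complex) \<Rightarrow> nat" where
  "deg \<theta> \<alpha> = (THE n. degree_rel \<theta> \<alpha> n)"

lemma deg_eqI: "\<alpha> \<in> \<Delta>p \<Longrightarrow> degree_rel \<theta> \<alpha> n \<Longrightarrow> deg \<theta> \<alpha> = n"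
  unfolding deg_def using degree_rel_unique by blast

lemma deg_rel: "\<alpha> \<in> \<Delta>p \<Longrightarrow> degree_rel \<theta> \<alpha> (deg \<theta> \<alpha>)"
  using degree_rel_exists deg_eqI by metis

lemma deg_indec: "\<beta> \<in> indec \<Longrightarrow> deg \<theta> \<beta> = (if \<beta> = \<theta> then 1 else 0)"
  by (rule deg_eqI[OF indec_pos degree_rel.base])

lemma deg_step:
  assumes "\<beta> \<in> indec" "\<gamma> \<in> \<Delta>p" "nb \<beta> \<gamma>"
  shows "deg \<theta> (\<beta> + \<gamma>) = deg \<theta> \<beta> + deg \<theta> \<gamma>"
  using deg_eqI[OF pos_nb_plus[OF indec_pos[OF assms(1)] assms(2,3)] degree_rel.step[OF assms deg_rel[OF assms(2)]]]
    deg_indec[OF assms(1)] by simp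

text \<open>The Jacobi identity splits an indecomposable summand off \<beta>, which reduces the
  claim to \<open>deg_step\<close> and a smaller height.\<close>

lemma deg_plus:
  "\<beta> \<in> \<Delta>p \<Longrightarrow> \<gamma> \<in> \<Delta>p \<Longrightarrow> nb \<beta> \<gamma> \<Longrightarrow> deg \<theta> (\<beta> + \<gamma>) = deg \<theta> \<beta> + deg \<theta> \<gamma>"
proof (induction "height \<beta>" arbitrary: \<beta> \<gamma> rule: less_induct)
  case less
  show ?case
  proof (cases "\<beta> \<in> indec")
    case True
    thus ?thesis using deg_step less.prems by blast
  next
    case False
    then obtain \<beta>1 \<beta>2 where b: "\<beta>1 \<in> indec" "\<beta>2 \<in> \<Delta>p" "\<beta>1 + \<beta>2 = \<beta>" "nb \<beta>1 \<beta>2"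
      using indec_decomposition[OF less.prems(1)] by blast
    note p = indec_pos[OF b(1)]
    have h: "height \<beta>2 < height \<beta>"
      using height_plus[OF p b(2)] b(3) less.prems(1) height_pos[OF p] by auto
    have db: "deg \<theta> \<beta> = deg \<theta> \<beta>1 + deg \<theta> \<beta>2" using deg_step[OF b(1,2,4)] b(3) by simp
    have "nb \<beta>2 \<gamma> \<and> nb \<beta>1 (\<beta>2 + \<gamma>) \<or> nb \<beta>1 \<gamma> \<and> nb \<beta>2 (\<beta>1 + \<gamma>)"
      using nb_jacobi[of \<beta>1 \<beta>2 \<gamma>] b p less.prems pos_root pos_plus_nonzero by simp
    thus ?thesis
    proof (elim disjE conjE)
      assume n: "nb \<beta>2 \<gamma>" "nb \<beta>1 (\<beta>2 + \<gamma>)"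
      have d1: "deg \<theta> (\<beta>1 + (\<beta>2 + \<gamma>)) = deg \<theta> \<beta>1 + deg \<theta> (\<beta>2 + \<gamma>)"
        by (rule deg_step[OF b(1) pos_nb_plus[OF b(2) less.prems(2) n(1)] n(2)])
      have d2: "deg \<theta> (\<beta>2 + \<gamma>) = deg \<theta> \<beta>2 + deg \<theta> \<gamma>"
        by (rule less.hyps[OF h b(2) less.prems(2) n(1)])
      have "deg \<theta> (\<beta>1 + (\<beta>2 + \<gamma>)) = deg \<theta> \<beta> + deg \<theta> \<gamma>"
        unfolding d1 d2 db by simp
      moreover have "\<beta>1 + (\<beta>2 + \<gamma>) = \<beta> + \<gamma>" using add.assoc[of \<beta>1 \<beta>2 \<gamma>] b(3) by simp
      ultimately show ?thesis by (simp only:)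
    next
      assume n: "nb \<beta>1 \<gamma>" "nb \<beta>2 (\<beta>1 + \<gamma>)"
      have d1: "deg \<theta> (\<beta>2 + (\<beta>1 + \<gamma>)) = deg \<theta> \<beta>2 + deg \<theta> (\<beta>1 + \<gamma>)"
        by (rule less.hyps[OF h b(2) pos_nb_plus[OF p less.prems(2) n(1)] n(2)])
      have d2: "deg \<theta> (\<beta>1 + \<gamma>) = deg \<theta> \<beta>1 + deg \<theta> \<gamma>"
        by (rule deg_step[OF b(1) less.prems(2) n(1)])
      have "deg \<theta> (\<beta>2 + (\<beta>1 + \<gamma>)) = deg \<theta> \<beta> + deg \<theta> \<gamma>"
        unfolding d1 d2 db by simp
      moreover have "\<beta>2 + (\<beta>1 + \<gamma>) = \<beta> + \<gamma>"
        using add.assoc[of \<beta>1 \<beta>2 \<gamma>] b(3) by (simp add: add.left_commute)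
      ultimately show ?thesis by (simp only:)
    qed
  qed
qed

text \<open>The extension of the degree to all weights that is odd under negation. It is 0 at the
  weight 0, so the derivation built from it vanishes on \<open>H\<close>.\<close>

definition sdeg :: "('g \<Rightarrow> complex) \<Rightarrow> ('g \<Rightarrow> complex) \<Rightarrow> complex" where
  "sdeg \<theta> \<alpha> = (if \<alpha> \<in> \<Delta>p then of_nat (deg \<theta> \<alpha>) else if - \<alpha> \<in> \<Delta>p then - of_nat (deg \<theta> (- \<alpha>)) else 0)"

lemma sdeg_uminus: "sdeg \<theta> (- \<alpha>) = - sdeg \<theta> \<alpha>"
  using pos_not_neg[of \<alpha>] by (auto simp: sdeg_def)

lemma sdeg_0: "sdeg \<theta> 0 = 0"
  using pos_root root_nonzero by (auto simp: sdeg_def)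

lemma sdeg_plus_pos: "\<beta> \<in> \<Delta>p \<Longrightarrow> \<gamma> \<in> \<Delta>p \<Longrightarrow> nb \<beta> \<gamma> \<Longrightarrow> sdeg \<theta> (\<beta> + \<gamma>) = sdeg \<theta> \<beta> + sdeg \<theta> \<gamma>"
  by (simp add: sdeg_def pos_nb_plus deg_plus)

lemma sdeg_pos_neg:
  assumes \<mu>: "\<mu> \<in> \<Delta>p" and \<nu>: "\<nu> \<in> \<Delta>p" and s: "\<mu> - \<nu> \<in> \<Delta>" and n: "nb \<mu> (- \<nu>)"
  shows "sdeg \<theta> (\<mu> - \<nu>) = sdeg \<theta> \<mu> - sdeg \<theta> \<nu>"
proof (cases "\<mu> - \<nu> \<in> \<Delta>p")
  case True
  have "nb \<nu> (\<mu> - \<nu>)" by (rule nb_difference(1)[OF pos_root[OF \<mu>] pos_root[OF \<nu>] s n refl])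
  from sdeg_plus_pos[OF \<nu> True this] show ?thesis by simp
next
  case False
  hence d: "\<nu> - \<mu> \<in> \<Delta>p" using root_signs[OF s] by simp
  have "nb (\<nu> - \<mu>) \<mu>"
    using nb_rotate[of "\<nu> - \<mu>" \<mu> "- \<nu>"] \<mu> \<nu> roots_uminus(1) pos_root d n by simp
  from sdeg_plus_pos[OF d \<mu> this] have "sdeg \<theta> \<nu> = sdeg \<theta> (\<nu> - \<mu>) + sdeg \<theta> \<mu>" by simp
  thus ?thesis using sdeg_uminus[of \<theta> "\<nu> - \<mu>"] by simp
qed

text \<open>Additivity along nonzero brackets is what makes the degree a derivation; the mixed signs
  reduce to sums of positive roots.\<close>

lemma sdeg_plus:
  assumes r: "\<mu> \<in> \<Delta>" "\<nu> \<in> \<Delta>" and s: "\<mu> + \<nu> \<in> \<Delta>" and n: "nb \<mu> \<nu>"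
  shows "sdeg \<theta> (\<mu> + \<nu>) = sdeg \<theta> \<mu> + sdeg \<theta> \<nu>"
proof (cases "\<mu> \<in> \<Delta>p"; cases "\<nu> \<in> \<Delta>p")
  assume "\<mu> \<in> \<Delta>p" "\<nu> \<in> \<Delta>p"
  thus ?thesis using sdeg_plus_pos n by blast
next
  assume \<mu>: "\<mu> \<in> \<Delta>p" and "\<nu> \<notin> \<Delta>p"
  hence \<nu>: "- \<nu> \<in> \<Delta>p" using root_signs r by blast
  show ?thesis using sdeg_pos_neg[OF \<mu> \<nu>] s n by (simp add: sdeg_uminus)
next
  assume \<nu>: "\<nu> \<in> \<Delta>p" and "\<mu> \<notin> \<Delta>p"
  hence \<mu>: "- \<mu> \<in> \<Delta>p" using root_signs r by blast
  have "nb \<nu> \<mu>" using n nb_commute r by blast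
  moreover have "\<nu> + \<mu> \<in> \<Delta>" using s by (simp add: add.commute)
  ultimately have "sdeg \<theta> (\<nu> + \<mu>) = sdeg \<theta> \<nu> + sdeg \<theta> \<mu>"
    using sdeg_pos_neg[OF \<nu> \<mu>] by (simp add: sdeg_uminus)
  thus ?thesis by (simp add: add.commute)
next
  assume "\<mu> \<notin> \<Delta>p" "\<nu> \<notin> \<Delta>p"
  hence m: "- \<mu> \<in> \<Delta>p" "- \<nu> \<in> \<Delta>p" using root_signs r by blast+
  have "nb (- \<mu>) (- \<nu>)" using nb_uminus[OF r s] n by blast
  from sdeg_plus_pos[OF m this] have "sdeg \<theta> (- \<mu> + - \<nu>) = - sdeg \<theta> \<mu> + - sdeg \<theta> \<nu>"
    by (simp only: sdeg_uminus)
  also have "- \<mu> + - \<nu> = - (\<mu> + \<nu>)" by simp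
  finally show ?thesis by (simp only: sdeg_uminus) (simp add: algebra_simps add_eq_0_iff2 neg_eq_iff_add_eq_0)
qed

text \<open>If \<open>\<theta>\<close> is indecomposable but not in \<open>\<Gamma>\<close>, the grading by the degree in \<open>\<theta>\<close> is a derivation
  that vanishes on \<open>H\<close> and on the root spaces of \<open>\<Gamma>\<close>. Being inner, it is \<open>0\<close>.\<close>

lemma indec_eq_\<Gamma>: "indec = \<Gamma>"
proof -
  have False if \<theta>: "\<theta> \<in> indec" and n\<theta>: "\<theta> \<notin> \<Gamma>" for \<theta>
  proof -
    obtain D where D: "lin D" "\<And>\<mu> x. \<mu> \<in> dl \<Longrightarrow> x \<in> rs \<mu> \<Longrightarrow> D x = scl L (sdeg \<theta> \<mu>) x"
      using weight_operator[of "sdeg \<theta>"] by blast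
    have "D (grade z) = grade (D z)" for z
    proof (induction z rule: weight_vectors_induct)
      case (weight z i \<mu>)
      thus ?case using D(2) rs_grade by (simp add: lin_scale[OF lin_grade])
    qed (simp add: lin_add[OF D(1)] lin_add[OF lin_grade])
    hence par: "op_parity 0 D" by (simp add: op_parity_def)
    have der: "D (brk L x y) = brk L (D x) y + brk L x (D y)" for x y
    proof (induction x rule: weight_vectors_induct)
      case (weight x i \<mu>)
      note x = weight
      show ?case
      proof (induction y rule: weight_vectors_induct)
        case (weight y j \<nu>)
        have "D (brk L x y) = scl L (sdeg \<theta> (\<mu> + \<nu>)) (brk L x y)"
          by (rule D(2)[OF dl_plus[OF x(2) weight(2)] rs_brk_plus[OF x(3) weight(3)]])
        moreover have "brk L (D x) y + brk L x (D y) = scl L (sdeg \<theta> \<mu> + sdeg \<theta> \<nu>) (brk L x y)"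
          using D(2)[OF x(2,3)] D(2)[OF weight(2,3)] by (simp add: brk_linear_simps scale_left_distrib)
        moreover have "brk L x y = 0 \<or> sdeg \<theta> (\<mu> + \<nu>) = sdeg \<theta> \<mu> + sdeg \<theta> \<nu>"
        proof (cases "brk L x y = 0 \<or> \<mu> = 0 \<or> \<nu> = 0 \<or> \<mu> + \<nu> = 0")
          case True
          moreover have "sdeg \<theta> (\<mu> + \<nu>) = sdeg \<theta> \<mu> + sdeg \<theta> \<nu>" if "\<mu> + \<nu> = 0"
            using sdeg_uminus[of \<theta> \<mu>] sdeg_0 that by (simp add: add_eq_0_iff2)
          ultimately show ?thesis by (auto simp: sdeg_0)
        next
          case False
          have "x \<noteq> 0" "y \<noteq> 0" using False by (auto simp: brk_zero)
          hence r: "\<mu> \<in> \<Delta>" "\<nu> \<in> \<Delta>" using False x weight by (auto simp: roots_iff)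
          have s: "\<mu> + \<nu> \<in> \<Delta>"
            using False rs_brk_plus[OF x(3) weight(3)] dl_plus[OF x(2) weight(2)] by (auto simp: roots_iff)
          obtain c d where "x = scl L c (e \<mu>)" "y = scl L d (e \<nu>)"
            using root_vector_multiple[OF r(1) x(3)] root_vector_multiple[OF r(2) weight(3)] by metis
          hence "nb \<mu> \<nu>" using False by (auto simp: nb_def brk_linear_simps)
          thus ?thesis using sdeg_plus[OF r s] by blast
        qed
        ultimately show ?case by auto
      qed (simp_all add: brk_linear_simps lin_add[OF D(1)] algebra_simps)
    qed (simp_all add: brk_linear_simps lin_add[OF D(1)] algebra_simps)
    obtain d where d: "d \<in> even_part L" "\<And>x. D x = brk L d x"
      using derivation_inner[OF D(1) par der] by blast
    have d0: "d \<in> part L 0" using d(1) by (simp add: Defs.part_def)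
    have dH: "d \<in> H"
    proof (rule even_centralizer_H[OF d0])
      fix h assume h: "h \<in> H"
      have "brk L d h = 0" using D(2)[OF dl_zero H_rs[OF h]] d(2) by (simp add: sdeg_0)
      thus "brk L h d = 0" using even_skew[OF H_even[OF h], of d] by simp
    qed
    have ev: "\<beta> d = sdeg \<theta> \<beta>" if "\<beta> \<in> \<Delta>" for \<beta>
    proof -
      have "scl L (\<beta> d) (e \<beta>) = scl L (sdeg \<theta> \<beta>) (e \<beta>)"
        using rs_D[OF e_root[OF that] dH] D(2)[OF root_dl[OF that] e_root[OF that]] d(2) by simp
      thus ?thesis using e_nonzero[OF that] by simp
    qed
    have "\<gamma> d = 0" if "\<gamma> \<in> \<Gamma>" for \<gamma>
      using ev[OF \<Gamma>_root[OF that]] deg_indec[OF \<Gamma>_indec[OF that]] \<Gamma>_pos[OF that] that n\<theta>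
      by (auto simp: sdeg_def)
    hence "\<theta> d = 0"
      by (subst root_expansion[OF pos_root[OF indec_pos[OF \<theta>]]]) (rule sum.neutral, simp)
    moreover have "\<theta> d = 1"
      using ev[OF pos_root[OF indec_pos[OF \<theta>]]] deg_indec[OF \<theta>] indec_pos[OF \<theta>] by (simp add: sdeg_def)
    ultimately show False by simp
  qed
  thus ?thesis using \<Gamma>_indec by blast
qed

end

section \<open>Admissible triples\<close>

locale triple_superalgebra = based_superalgebra L H \<Gamma> e
  for L :: "'g::ab_group_add lie_superalg" and H \<Gamma> e +
  fixes \<Gamma>1 \<Gamma>2 :: "('g \<Rightarrow> complex) set" and \<tau> X Y \<phi>
  assumes admissible: "admissible_triple L H \<Gamma> \<Gamma>1 \<Gamma>2 \<tau>"
    and chevalley: "chevalley_vectors L H \<Gamma> X Y"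
    and iso: "triple_iso L X Y \<Gamma>1 \<Gamma>2 \<tau> \<phi>"
    and \<phi>_e: "\<alpha> \<in> roots_over L H \<Gamma>1 \<Longrightarrow> \<phi> (e \<alpha>) = e (tau_ext \<Gamma>1 \<tau> \<alpha>)"
begin

abbreviation R1 :: "('g \<Rightarrow> complex) set" where "R1 \<equiv> roots_over L H \<Gamma>1"
abbreviation R2 :: "('g \<Rightarrow> complex) set" where "R2 \<equiv> roots_over L H \<Gamma>2"
abbreviation T :: "('g \<Rightarrow> complex) \<Rightarrow> 'g \<Rightarrow> complex" where "T \<equiv> tau_ext \<Gamma>1 \<tau>"
abbreviation G1 :: "'g set" where "G1 \<equiv> chevalley_subalgebra L X Y \<Gamma>1"

lemma \<Gamma>1: "\<gamma> \<in> \<Gamma>1 \<Longrightarrow> \<gamma> \<in> \<Gamma>" and \<Gamma>2: "\<gamma> \<in> \<Gamma>2 \<Longrightarrow> \<gamma> \<in> \<Gamma>"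
  and \<tau>_bij: "bij_betw \<tau> \<Gamma>1 \<Gamma>2"
  and \<tau>_nilpotent: "\<gamma> \<in> \<Gamma>1 \<Longrightarrow> \<exists>k. (\<tau> ^^ k) \<gamma> \<notin> \<Gamma>1"
  using admissible unfolding admissible_triple_def by blast+

lemma \<tau>_\<Gamma>2: "\<gamma> \<in> \<Gamma>1 \<Longrightarrow> \<tau> \<gamma> \<in> \<Gamma>2"
  using \<tau>_bij by (auto simp: bij_betw_def)

lemma \<tau>_eq_iff: "\<gamma> \<in> \<Gamma>1 \<Longrightarrow> \<delta> \<in> \<Gamma>1 \<Longrightarrow> \<tau> \<gamma> = \<tau> \<delta> \<longleftrightarrow> \<gamma> = \<delta>"
  using \<tau>_bij by (auto simp: bij_betw_def inj_on_def)

text \<open>Coweights read off coefficients, so membership becomes a condition on the support of a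
  positive root.\<close>

lemma roots_over_iff:
  assumes "S \<subseteq> \<Gamma>"
  shows "\<alpha> \<in> roots_over L H S \<longleftrightarrow> \<alpha> \<in> \<Delta>p \<and> (\<forall>\<gamma>\<in>\<Gamma> - S. \<alpha> (dd \<gamma>) = 0)"
proof
  assume \<alpha>: "\<alpha> \<in> roots_over L H S"
  then obtain n where "\<alpha> = (\<lambda>x. \<Sum>\<gamma>\<in>S. of_nat (n \<gamma>) * \<gamma> x)"
    unfolding roots_over_def nonneg_combination_def by blast
  from combination_coeff[OF assms this] show "\<alpha> \<in> \<Delta>p \<and> (\<forall>\<gamma>\<in>\<Gamma> - S. \<alpha> (dd \<gamma>) = 0)"
    using \<alpha> pos_iff[of \<alpha>] by (auto simp: roots_over_def)
next
  assume \<alpha>: "\<alpha> \<in> \<Delta>p \<and> (\<forall>\<gamma>\<in>\<Gamma> - S. \<alpha> (dd \<gamma>) = 0)"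
  obtain n where n: "\<And>\<gamma>. \<gamma> \<in> \<Gamma> \<Longrightarrow> \<alpha> (dd \<gamma>) = of_nat (n \<gamma>)" using pos_coeffs \<alpha> by blast
  have "\<alpha> x = (\<Sum>\<gamma>\<in>S. of_nat (n \<gamma>) * \<gamma> x)" for x
  proof -
    have "\<alpha> x = (\<Sum>\<gamma>\<in>\<Gamma>. \<alpha> (dd \<gamma>) * \<gamma> x)" using root_expansion pos_root \<alpha> by blast
    also have "\<dots> = (\<Sum>\<gamma>\<in>S. \<alpha> (dd \<gamma>) * \<gamma> x)"
      by (rule sum.mono_neutral_right[OF finite_\<Gamma> assms]) (use \<alpha> in simp)
    also have "\<dots> = (\<Sum>\<gamma>\<in>S. of_nat (n \<gamma>) * \<gamma> x)" using n assms by (intro sum.cong) auto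
    finally show ?thesis .
  qed
  thus "\<alpha> \<in> roots_over L H S" using \<alpha> unfolding roots_over_def nonneg_combination_def by blast
qed

lemma sub12: "\<Gamma>1 \<subseteq> \<Gamma>" "\<Gamma>2 \<subseteq> \<Gamma>"
  using \<Gamma>1 \<Gamma>2 by blast+

lemma R_pos: "\<alpha> \<in> R1 \<Longrightarrow> \<alpha> \<in> \<Delta>p" "\<alpha> \<in> R2 \<Longrightarrow> \<alpha> \<in> \<Delta>p"
  using roots_over_iff sub12 by blast+

lemma coeff_0_sum:
  assumes "\<beta> \<in> \<Delta>p" "\<gamma> \<in> \<Delta>p" "\<delta> \<in> \<Gamma>"
  shows "(\<beta> + \<gamma>) (dd \<delta>) = 0 \<longleftrightarrow> \<beta> (dd \<delta>) = 0 \<and> \<gamma> (dd \<delta>) = 0"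
proof -
  obtain m n where "\<beta> (dd \<delta>) = of_nat m" "\<gamma> (dd \<delta>) = of_nat n"
    using pos_coeffs assms by meson
  moreover have "of_nat m + of_nat n = (0::complex) \<longleftrightarrow> m + n = 0" for m n :: nat
    unfolding of_nat_add[symmetric] of_nat_eq_0_iff ..
  ultimately show ?thesis by simp
qed

lemma roots_over_sum:
  assumes "S \<subseteq> \<Gamma>" "\<beta> \<in> \<Delta>p" "\<gamma> \<in> \<Delta>p" "\<beta> + \<gamma> \<in> \<Delta>p"
  shows "\<beta> + \<gamma> \<in> roots_over L H S \<longleftrightarrow> \<beta> \<in> roots_over L H S \<and> \<gamma> \<in> roots_over L H S"
  unfolding roots_over_iff[OF assms(1)] using assms(2-4) coeff_0_sum[OF assms(2,3)] by blast

lemma \<Gamma>_roots_over: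
  assumes "S \<subseteq> \<Gamma>" "\<gamma> \<in> \<Gamma>"
  shows "\<gamma> \<in> roots_over L H S \<longleftrightarrow> \<gamma> \<in> S"
proof -
  have "(\<forall>\<delta>\<in>\<Gamma> - S. \<gamma> (dd \<delta>) = 0) \<longleftrightarrow> \<gamma> \<in> S"
  proof
    assume *: "\<forall>\<delta>\<in>\<Gamma> - S. \<gamma> (dd \<delta>) = 0"
    have "\<gamma> (dd \<gamma>) = 1" by (simp add: dd(2)[OF assms(2,2)])
    thus "\<gamma> \<in> S" using * assms(2) by force
  next
    assume "\<gamma> \<in> S"
    thus "\<forall>\<delta>\<in>\<Gamma> - S. \<gamma> (dd \<delta>) = 0" using dd(2)[OF _ assms(2)] by auto
  qed
  thus ?thesis using roots_over_iff[OF assms(1)] \<Gamma>_pos[OF assms(2)] by blast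
qed

text \<open>Since \<open>indec\<close> is \<open>\<Gamma>\<close>, a positive root outside
  \<open>\<Gamma>\<close> splits off a simple root; both summands stay over \<open>S\<close> because
  nonnegative coefficients cannot cancel.\<close>

lemma simple_decomposition:
  assumes S: "S \<subseteq> \<Gamma>" and \<alpha>: "\<alpha> \<in> roots_over L H S" "\<alpha> \<notin> S"
  obtains \<gamma> \<delta> where "\<gamma> \<in> S" "\<delta> \<in> roots_over L H S" "\<gamma> + \<delta> = \<alpha>" "nb \<gamma> \<delta>" "height \<delta> < height \<alpha>"
proof -
  have p: "\<alpha> \<in> \<Delta>p" using roots_over_iff[OF S] \<alpha>(1) by blast
  have "\<alpha> \<notin> \<Gamma>" using \<Gamma>_roots_over[OF S] \<alpha> by blast
  hence "\<alpha> \<notin> indec" by (simp add: indec_eq_\<Gamma>)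
  then obtain \<gamma> \<delta> where g: "\<gamma> \<in> \<Gamma>" "\<delta> \<in> \<Delta>p" "\<gamma> + \<delta> = \<alpha>" "nb \<gamma> \<delta>"
    using indec_decomposition[OF p] indec_eq_\<Gamma> by metis
  have "\<gamma> \<in> roots_over L H S" "\<delta> \<in> roots_over L H S"
    using roots_over_sum[OF S \<Gamma>_pos[OF g(1)] g(2)] g(3) p \<alpha>(1) by auto
  moreover have "height \<delta> < height \<alpha>"
    using height_plus[OF \<Gamma>_pos[OF g(1)] g(2)] g(3) p height_\<Gamma>[OF g(1)] by simp
  ultimately show thesis using that g \<Gamma>_roots_over[OF S g(1)] by blast
qed

text \<open>The linear extension of \<open>\<tau>\<close> in coweight coordinates. It agrees with
  \<open>tau_ext\<close> on \<open>R1\<close>, and it is additive by construction.\<close>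

definition tl :: "('g \<Rightarrow> complex) \<Rightarrow> 'g \<Rightarrow> complex" where
  "tl \<alpha> = (\<lambda>x. \<Sum>\<gamma>\<in>\<Gamma>1. \<alpha> (dd \<gamma>) * \<tau> \<gamma> x)"

lemma finite_\<Gamma>1: "finite \<Gamma>1"
  using finite_subset[OF sub12(1) finite_\<Gamma>] .

lemma tl_plus: "tl (\<alpha> + \<beta>) = tl \<alpha> + tl \<beta>"
  by (simp add: tl_def fun_eq_iff algebra_simps sum.distrib)

lemma tl_\<Gamma>1:
  assumes "\<gamma> \<in> \<Gamma>1"
  shows "tl \<gamma> = \<tau> \<gamma>"
proof
  fix x
  have "tl \<gamma> x = (\<Sum>\<delta>\<in>\<Gamma>1. if \<delta> = \<gamma> then \<tau> \<gamma> x else 0)"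
    unfolding tl_def by (rule sum.cong) (use dd(2)[OF \<Gamma>1 \<Gamma>1[OF assms]] in auto)
  thus "tl \<gamma> x = \<tau> \<gamma> x" using assms finite_\<Gamma>1 by simp
qed

lemma tl_coeff:
  assumes "\<delta> \<in> \<Gamma>1"
  shows "tl \<alpha> (dd (\<tau> \<delta>)) = \<alpha> (dd \<delta>)"
proof -
  have "tl \<alpha> (dd (\<tau> \<delta>)) = (\<Sum>\<gamma>\<in>\<Gamma>1. if \<gamma> = \<delta> then \<alpha> (dd \<delta>) else 0)"
    unfolding tl_def
  proof (rule sum.cong)
    fix \<gamma> assume \<gamma>: "\<gamma> \<in> \<Gamma>1"
    have "\<tau> \<gamma> (dd (\<tau> \<delta>)) = (if \<tau> \<gamma> = \<tau> \<delta> then 1 else 0)"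
      by (rule dd(2)) (use \<tau>_\<Gamma>2 \<Gamma>2 \<gamma> assms in blast)+
    thus "\<alpha> (dd \<gamma>) * \<tau> \<gamma> (dd (\<tau> \<delta>)) = (if \<gamma> = \<delta> then \<alpha> (dd \<delta>) else 0)"
      using \<tau>_eq_iff[OF \<gamma> assms] by simp
  qed simp
  thus ?thesis using assms finite_\<Gamma>1 by simp
qed

lemma tl_coeff_outside:
  assumes "\<delta> \<in> \<Gamma>" "\<delta> \<notin> \<Gamma>2"
  shows "tl \<alpha> (dd \<delta>) = 0"
  unfolding tl_def
proof (rule sum.neutral, rule ballI)
  fix \<gamma> assume \<gamma>: "\<gamma> \<in> \<Gamma>1"
  have "\<tau> \<gamma> (dd \<delta>) = (if \<tau> \<gamma> = \<delta> then 1 else 0)"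
    by (rule dd(2)) (use \<tau>_\<Gamma>2 \<Gamma>2 \<gamma> assms in blast)+
  moreover have "\<tau> \<gamma> \<noteq> \<delta>" using \<tau>_\<Gamma>2[OF \<gamma>] assms(2) by blast
  ultimately show "\<alpha> (dd \<gamma>) * \<tau> \<gamma> (dd \<delta>) = 0" by simp
qed

lemma tau_ext_eq:
  assumes \<alpha>: "\<alpha> \<in> R1"
  shows "T \<alpha> = tl \<alpha>"
proof -
  obtain n where n: "\<alpha> = (\<lambda>x. \<Sum>\<gamma>\<in>\<Gamma>1. of_nat (n \<gamma>) * \<gamma> x)"
    using \<alpha> unfolding roots_over_def nonneg_combination_def by blast
  have c: "tl \<alpha> = (\<lambda>x. \<Sum>\<gamma>\<in>\<Gamma>1. of_nat (m \<gamma>) * \<tau> \<gamma> x)"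
    if m: "\<alpha> = (\<lambda>x. \<Sum>\<gamma>\<in>\<Gamma>1. of_nat (m \<gamma>) * \<gamma> x)" for m :: "_ \<Rightarrow> nat"
    unfolding tl_def
  proof (intro ext sum.cong refl)
    fix x \<gamma> assume "\<gamma> \<in> \<Gamma>1"
    hence "\<alpha> (dd \<gamma>) = of_nat (m \<gamma>)" using combination_coeff[OF sub12(1) m \<Gamma>1] by simp
    thus "\<alpha> (dd \<gamma>) * \<tau> \<gamma> x = of_nat (m \<gamma>) * \<tau> \<gamma> x" by simp
  qed
  show ?thesis
    unfolding tau_ext_def
  proof (rule the_equality)
    show "\<exists>n :: _ \<Rightarrow> nat. \<alpha> = (\<lambda>x. \<Sum>\<gamma>\<in>\<Gamma>1. of_nat (n \<gamma>) * \<gamma> x) \<and>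
        tl \<alpha> = (\<lambda>x. \<Sum>\<gamma>\<in>\<Gamma>1. of_nat (n \<gamma>) * \<tau> \<gamma> x)"
      by (rule exI[of _ n], rule conjI[OF n c[OF n]])
  next
    fix \<beta> assume "\<exists>n :: _ \<Rightarrow> nat. \<alpha> = (\<lambda>x. \<Sum>\<gamma>\<in>\<Gamma>1. of_nat (n \<gamma>) * \<gamma> x) \<and>
        \<beta> = (\<lambda>x. \<Sum>\<gamma>\<in>\<Gamma>1. of_nat (n \<gamma>) * \<tau> \<gamma> x)"
    thus "\<beta> = tl \<alpha>"
    proof (elim exE conjE)
      fix m :: "_ \<Rightarrow> nat"
      assume m: "\<alpha> = (\<lambda>x. \<Sum>\<gamma>\<in>\<Gamma>1. of_nat (m \<gamma>) * \<gamma> x)" "\<beta> = (\<lambda>x. \<Sum>\<gamma>\<in>\<Gamma>1. of_nat (m \<gamma>) * \<tau> \<gamma> x)"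
      show "\<beta> = tl \<alpha>" unfolding c[OF m(1)] by (rule m(2))
    qed
  qed
qed

section \<open>Transport of root vectors along the isomorphism\<close>

lemma G1_generators:
  assumes "\<gamma> \<in> \<Gamma>1"
  shows "X \<gamma> \<in> G1" "Y \<gamma> \<in> G1"
  using assms by (auto simp: chevalley_subalgebra_def generated_subalgebra_def)

lemma subspace_G1: "subspace G1"
proof -
  have "G1 = \<Inter>{T. sub_superalgebra L T \<and>
      X ` \<Gamma>1 \<union> Y ` \<Gamma>1 \<union> (\<lambda>\<alpha>. brk L (X \<alpha>) (Y \<alpha>)) ` \<Gamma>1 \<subseteq> T}"
    by (simp add: chevalley_subalgebra_def generated_subalgebra_def)
  thus ?thesis
    by (simp only:) (rule subspace_Inter, auto simp: sub_superalgebra_def graded_subspace_def)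
qed

lemma G1_brk: "x \<in> G1 \<Longrightarrow> y \<in> G1 \<Longrightarrow> brk L x y \<in> G1"
  unfolding chevalley_subalgebra_def generated_subalgebra_def sub_superalgebra_def by blast

lemma \<phi>_iso: "superalgebra_iso L G1 (chevalley_subalgebra L X Y \<Gamma>2) \<phi>"
  using iso by (simp add: triple_iso_def)

lemma \<phi>_X: "\<gamma> \<in> \<Gamma>1 \<Longrightarrow> \<phi> (X \<gamma>) = X (\<tau> \<gamma>)" and \<phi>_Y: "\<gamma> \<in> \<Gamma>1 \<Longrightarrow> \<phi> (Y \<gamma>) = Y (\<tau> \<gamma>)"
  using iso by (simp_all add: triple_iso_def)

lemma \<phi>_plus: "x \<in> G1 \<Longrightarrow> y \<in> G1 \<Longrightarrow> \<phi> (x + y) = \<phi> x + \<phi> y"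
  and \<phi>_scale: "x \<in> G1 \<Longrightarrow> \<phi> (scl L c x) = scl L c (\<phi> x)"
  and \<phi>_brk: "x \<in> G1 \<Longrightarrow> y \<in> G1 \<Longrightarrow> \<phi> (brk L x y) = brk L (\<phi> x) (\<phi> y)"
  using \<phi>_iso by (simp_all add: superalgebra_iso_def)

lemma \<phi>_inj: "inj_on \<phi> G1"
  using \<phi>_iso by (simp add: superalgebra_iso_def bij_betw_def)

lemma \<phi>_part:
  assumes "x \<in> G1" "x \<in> part L i"
  shows "\<phi> x \<in> part L i"
proof -
  have "\<phi> ` (G1 \<inter> part L i) \<subseteq> part L i" using \<phi>_iso by (simp add: superalgebra_iso_def)
  thus ?thesis using assms by blast
qed

lemma \<phi>_0: "\<phi> 0 = 0"
  using \<phi>_scale[OF subspace_0[OF subspace_G1], of 0] by simp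

lemma \<phi>_nonzero: "x \<in> G1 \<Longrightarrow> x \<noteq> 0 \<Longrightarrow> \<phi> x \<noteq> 0"
  using inj_onD[OF \<phi>_inj, of x 0] subspace_0[OF subspace_G1] \<phi>_0 by auto

lemma XY: 
  assumes "\<gamma> \<in> \<Gamma>"
  shows "X \<gamma> \<in> rs \<gamma>" "Y \<gamma> \<in> rs (- \<gamma>)" "killing L (X \<gamma>) (Y \<gamma>) = 1" "X \<gamma> \<noteq> 0" "Y \<gamma> \<noteq> 0"
    "brk L (X \<gamma>) (Y \<gamma>) = cr \<gamma>"
proof -
  show *: "X \<gamma> \<in> rs \<gamma>" "Y \<gamma> \<in> rs (- \<gamma>)" "killing L (X \<gamma>) (Y \<gamma>) = 1"
    using chevalley assms by (auto simp: chevalley_vectors_def)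
  thus "X \<gamma> \<noteq> 0" "Y \<gamma> \<noteq> 0" by auto
  show "brk L (X \<gamma>) (Y \<gamma>) = cr \<gamma>"
    using brk_opposite[OF \<Gamma>_dl[OF assms] *(1,2)] *(3) by simp
qed

lemma coroot_plus: "\<alpha> \<in> dl \<Longrightarrow> \<beta> \<in> dl \<Longrightarrow> cr (\<alpha> + \<beta>) = cr \<alpha> + cr \<beta>"
  using coroot_comb[of \<alpha> \<beta> 1 1] by (simp add: plus_fun_def)

text \<open>Induction on height: e_\<alpha> is a multiple of the bracket of a simple root vector
  with a lower one, so its image has weight \<open>tl \<alpha>\<close>. Coroots run along in the
  same induction; later they fix the normalization of
  \<open>\<phi> (e (- \<alpha>))\<close>.\<close>

lemma R1_transport:
  "\<alpha> \<in> R1 \<Longrightarrow> e \<alpha> \<in> G1 \<and> e (- \<alpha>) \<in> G1 \<and> cr \<alpha> \<in> G1 \<and> tl \<alpha> \<in> dl \<and>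
    \<phi> (e \<alpha>) \<in> rs (tl \<alpha>) \<and> \<phi> (e (- \<alpha>)) \<in> rs (- tl \<alpha>) \<and> \<phi> (cr \<alpha>) = cr (tl \<alpha>)"
proof (induction "height \<alpha>" arbitrary: \<alpha> rule: less_induct)
  case less
  show ?case
  proof (cases "\<alpha> \<in> \<Gamma>1")
    case True
    note g = XY[OF \<Gamma>1[OF True]] and g' = XY[OF \<Gamma>2[OF \<tau>_\<Gamma>2[OF True]]]
    note r = \<Gamma>_root[OF \<Gamma>1[OF True]]
    obtain c where c: "e \<alpha> = scl L c (X \<alpha>)"
      using root_space_dim1[OF r g(1) g(4) e_root[OF r]] by blast
    obtain d where d: "e (- \<alpha>) = scl L d (Y \<alpha>)"
      using root_space_dim1[OF roots_uminus(1)[OF r] g(2) g(5) e_root[OF roots_uminus(1)[OF r]]] by blast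
    have "cr \<alpha> \<in> G1" using G1_brk[OF G1_generators[OF True]] g(6) by simp
    moreover have "\<phi> (cr \<alpha>) = cr (\<tau> \<alpha>)"
      using \<phi>_brk[OF G1_generators[OF True]] \<phi>_X[OF True] \<phi>_Y[OF True] g(6) g'(6) by simp
    ultimately show ?thesis
      using c d G1_generators[OF True] \<phi>_X[OF True] \<phi>_Y[OF True] g'(1,2) \<Gamma>_dl[OF \<Gamma>2[OF \<tau>_\<Gamma>2[OF True]]]
      by (simp add: tl_\<Gamma>1[OF True] \<phi>_scale subspace_scale[OF subspace_G1] subspace_scale[OF subspace_rs])
  next
    case False
    obtain \<gamma> \<delta> where g: "\<gamma> \<in> \<Gamma>1" "\<delta> \<in> R1" "\<gamma> + \<delta> = \<alpha>" "nb \<gamma> \<delta>" "height \<delta> < height \<alpha>"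
      using simple_decomposition[OF sub12(1) less.prems False] by blast
    have \<gamma>1: "\<gamma> \<in> R1" using \<Gamma>_roots_over[OF sub12(1) \<Gamma>1[OF g(1)]] g(1) by blast
    note r = pos_root[OF R_pos(1)[OF \<gamma>1]] pos_root[OF R_pos(1)[OF g(2)]] pos_root[OF R_pos(1)[OF less.prems]]
    have "height \<gamma> < height \<alpha>"
      using height_plus[OF R_pos(1)[OF \<gamma>1] R_pos(1)[OF g(2)]] g(3) R_pos(1)[OF less.prems]
        height_pos[OF R_pos(1)[OF g(2)]] by simp
    note G = less.hyps[OF this \<gamma>1] and D = less.hyps[OF g(5,2)]
    have s: "\<gamma> + \<delta> \<in> \<Delta>" using r(3) g(3) by simp
    obtain c where c: "brk L (e \<gamma>) (e \<delta>) = scl L c (e \<alpha>)" "c \<noteq> 0"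
      using brk_e[OF r(1,2) s] g(3,4) by metis
    have m: "- \<gamma> + - \<delta> = - \<alpha>" using g(3) by auto
    obtain d where d: "brk L (e (- \<gamma>)) (e (- \<delta>)) = scl L d (e (- \<alpha>))" "d \<noteq> 0"
      using brk_e[OF roots_uminus(1)[OF r(1)] roots_uminus(1)[OF r(2)]] roots_uminus(1)[OF r(3)] m
        nb_uminus[OF r(1,2) s] g(4) by metis
    have ec: "e \<alpha> = scl L (1 / c) (brk L (e \<gamma>) (e \<delta>))" using c by simp
    have ed: "e (- \<alpha>) = scl L (1 / d) (brk L (e (- \<gamma>)) (e (- \<delta>)))" using d by simp
    have tla: "tl \<alpha> = tl \<gamma> + tl \<delta>" using tl_plus g(3) by metis
    have cra: "cr \<alpha> = cr \<gamma> + cr \<delta>" using coroot_plus root_dl r g(3) by metis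
    have "\<phi> (e \<alpha>) \<in> rs (tl \<gamma> + tl \<delta>)"
      unfolding ec using G D
      by (simp add: \<phi>_scale G1_brk \<phi>_brk rs_brk_plus subspace_scale[OF subspace_rs])
    moreover have "\<phi> (e (- \<alpha>)) \<in> rs (- tl \<gamma> + - tl \<delta>)"
      unfolding ed using G D rs_brk_plus[of "\<phi> (e (- \<gamma>))" "- tl \<gamma>" "\<phi> (e (- \<delta>))" "- tl \<delta>"]
      by (simp add: \<phi>_scale G1_brk \<phi>_brk subspace_scale[OF subspace_rs])
    moreover have "- tl \<gamma> + - tl \<delta> = - tl \<alpha>" unfolding tla by simp
    moreover have "e \<alpha> \<in> G1" "e (- \<alpha>) \<in> G1"
      unfolding ec ed using G D by (simp_all add: G1_brk subspace_scale[OF subspace_G1])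
    moreover have "cr \<alpha> \<in> G1" "\<phi> (cr \<alpha>) = cr (tl \<alpha>)"
      unfolding cra tla using G D by (simp_all add: subspace_add[OF subspace_G1] \<phi>_plus coroot_plus)
    moreover have "tl \<alpha> \<in> dl" unfolding tla using G D dl_plus by blast
    ultimately show ?thesis unfolding tla by metis
  qed
qed

lemma e_G1: "\<alpha> \<in> R1 \<Longrightarrow> e \<alpha> \<in> G1" "\<alpha> \<in> R1 \<Longrightarrow> e (- \<alpha>) \<in> G1"
  using R1_transport by blast+

text \<open>\<open>\<phi>\<close> is injective, so the image of e_\<alpha> is a nonzero vector of
  weight \<open>tl \<alpha>\<close>, which is therefore a root. Its coefficients are those of
  \<alpha>, moved from \<open>\<Gamma>1\<close> to \<open>\<Gamma>2\<close>.\<close>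

lemma T_root:
  assumes \<alpha>: "\<alpha> \<in> R1"
  shows "T \<alpha> \<in> R2" "par (T \<alpha>) = par \<alpha>" "cr (T \<alpha>) = \<phi> (cr \<alpha>)"
proof -
  note t = R1_transport[OF \<alpha>] and p = R_pos(1)[OF \<alpha>]
  have nz: "\<phi> (e \<alpha>) \<noteq> 0" using \<phi>_nonzero t e_nonzero[OF pos_root[OF p]] by blast
  have "tl \<alpha> \<noteq> 0"
  proof
    assume z: "tl \<alpha> = 0"
    have "\<alpha> (dd \<gamma>) = 0" if "\<gamma> \<in> \<Gamma>" for \<gamma>
    proof (cases "\<gamma> \<in> \<Gamma>1")
      case True
      thus ?thesis using tl_coeff[OF True, of \<alpha>] z by simp
    next
      case False
      thus ?thesis using \<alpha> that roots_over_iff[OF sub12(1)] by blast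
    qed
    hence "\<alpha> x = 0" for x by (subst root_expansion[OF pos_root[OF p]]) simp
    thus False using root_nonzero[OF pos_root[OF p]] by (auto simp: fun_eq_iff)
  qed
  hence r: "tl \<alpha> \<in> \<Delta>" using t nz by (auto simp: roots_iff)
  have "tl \<alpha> (dd \<delta>) \<in> \<nat>" if "\<delta> \<in> \<Gamma>" for \<delta>
  proof (cases "\<delta> \<in> \<Gamma>2")
    case True
    then obtain \<gamma> where "\<gamma> \<in> \<Gamma>1" "\<delta> = \<tau> \<gamma>" using \<tau>_bij by (auto simp: bij_betw_def)
    thus ?thesis using tl_coeff[of \<gamma> \<alpha>] pos_iff[OF pos_root[OF p]] p \<Gamma>1 by simp
  next
    case False
    thus ?thesis using tl_coeff_outside[OF that] by simp
  qed
  hence "tl \<alpha> \<in> \<Delta>p" using pos_iff[OF r] by blast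
  hence "tl \<alpha> \<in> R2" using roots_over_iff[OF sub12(2)] tl_coeff_outside by blast
  thus "T \<alpha> \<in> R2" by (simp add: tau_ext_eq[OF \<alpha>])
  show "par (T \<alpha>) = par \<alpha>"
    using par_eqI[OF r _ nz \<phi>_part[OF _ e_part[OF pos_root[OF p]]]] t par_less_2[of \<alpha>]
    by (auto simp: tau_ext_eq[OF \<alpha>])
  show "cr (T \<alpha>) = \<phi> (cr \<alpha>)" using t by (simp add: tau_ext_eq[OF \<alpha>])
qed

lemma T_pos: "\<alpha> \<in> R1 \<Longrightarrow> T \<alpha> \<in> \<Delta>p"
  using T_root(1) R_pos(2) by blast

text \<open>Compatibility is prescribed for positive roots. Applying \<open>\<phi>\<close> to
  [e_\<alpha>, e_-\<alpha>] = h_\<alpha> shows that the scalar left open for the negative root is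
  1.\<close>

lemma \<phi>_e_minus:
  assumes \<alpha>: "\<alpha> \<in> R1"
  shows "\<phi> (e (- \<alpha>)) = e (- T \<alpha>)"
proof -
  note t = R1_transport[OF \<alpha>] and p = R_pos(1)[OF \<alpha>] and Tp = T_pos[OF \<alpha>]
  have r: "\<alpha> \<in> \<Delta>" "T \<alpha> \<in> \<Delta>" "- T \<alpha> \<in> \<Delta>" "- \<alpha> \<in> \<Delta>"
    using pos_root p Tp roots_uminus(1) by blast+
  have "\<phi> (e (- \<alpha>)) \<in> rs (- T \<alpha>)" using t by (simp add: tau_ext_eq[OF \<alpha>])
  then obtain c where c: "\<phi> (e (- \<alpha>)) = scl L c (e (- T \<alpha>))" using root_vector_multiple[OF r(3)] by blast
  have 1: "brk L (e \<alpha>) (e (- \<alpha>)) = cr \<alpha>"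
    using brk_opposite[OF root_dl[OF r(1)] e_root[OF r(1)] e_root[OF r(4)]] e_norm[OF p] by simp
  have 2: "brk L (e (T \<alpha>)) (e (- T \<alpha>)) = cr (T \<alpha>)"
    using brk_opposite[OF root_dl[OF r(2)] e_root[OF r(2)] e_root[OF r(3)]] e_norm[OF Tp] by simp
  have "cr (T \<alpha>) = \<phi> (brk L (e \<alpha>) (e (- \<alpha>)))" using T_root(3)[OF \<alpha>] 1 by simp
  also have "\<dots> = scl L c (cr (T \<alpha>))"
    using \<phi>_brk[OF e_G1[OF \<alpha>]] \<phi>_e[OF \<alpha>] c 2 by (simp add: brk_linear_simps)
  finally have "scl L (c - 1) (cr (T \<alpha>)) = 0" by (simp add: algebra_simps)
  moreover have "cr (T \<alpha>) \<noteq> 0" using coroot_zero_iff[OF root_dl[OF r(2)]] root_nonzero[OF r(2)] by blast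
  ultimately show ?thesis using c by simp
qed

lemma T_plus:
  assumes "\<alpha> \<in> R1" "\<beta> \<in> R1" "\<alpha> + \<beta> \<in> R1"
  shows "T (\<alpha> + \<beta>) = T \<alpha> + T \<beta>"
  using assms by (simp add: tau_ext_eq tl_plus)

lemma T_inj:
  assumes \<alpha>: "\<alpha> \<in> R1" and \<beta>: "\<beta> \<in> R1" and "T \<alpha> = T \<beta>"
  shows "\<alpha> = \<beta>"
proof -
  have "tl \<alpha> = tl \<beta>" using assms by (simp add: tau_ext_eq)
  hence "\<alpha> (dd \<gamma>) = \<beta> (dd \<gamma>)" if "\<gamma> \<in> \<Gamma>" for \<gamma>
    using tl_coeff \<alpha> \<beta> that roots_over_iff[OF sub12(1)] by (cases "\<gamma> \<in> \<Gamma>1") (metis, auto)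
  hence "\<alpha> x = \<beta> x" for x
    by (subst (1 2) root_expansion) (auto intro: pos_root R_pos \<alpha> \<beta>)
  thus ?thesis by blast
qed

text \<open>A decomposition over \<open>\<Gamma>2\<close> is lifted summand by summand. The lifts
  have a nonzero bracket because \<open>\<phi>\<close> maps it to a nonzero bracket, so their sum is
  a root.\<close>

lemma T_surj: "\<beta> \<in> R2 \<Longrightarrow> \<exists>\<alpha>\<in>R1. T \<alpha> = \<beta>"
proof (induction "height \<beta>" arbitrary: \<beta> rule: less_induct)
  case less
  have base: "\<exists>\<alpha>\<in>R1. T \<alpha> = \<delta>" if "\<delta> \<in> \<Gamma>2" for \<delta>
  proof -
    obtain \<gamma> where g: "\<gamma> \<in> \<Gamma>1" "\<delta> = \<tau> \<gamma>" using \<tau>_bij \<open>\<delta> \<in> \<Gamma>2\<close> by (auto simp: bij_betw_def)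
    have "\<gamma> \<in> R1" using \<Gamma>_roots_over[OF sub12(1) \<Gamma>1[OF g(1)]] g(1) by blast
    thus ?thesis using g tau_ext_eq tl_\<Gamma>1 by auto
  qed
  show ?case
  proof (cases "\<beta> \<in> \<Gamma>2")
    case True
    thus ?thesis by (rule base)
  next
    case False
    obtain \<gamma> \<delta> where g: "\<gamma> \<in> \<Gamma>2" "\<delta> \<in> R2" "\<gamma> + \<delta> = \<beta>" "nb \<gamma> \<delta>" "height \<delta> < height \<beta>"
      using simple_decomposition[OF sub12(2) less.prems False] by blast
    obtain a where a: "a \<in> R1" "T a = \<gamma>" using base[OF g(1)] by blast
    obtain b where b: "b \<in> R1" "T b = \<delta>" using less.hyps[OF g(5,2)] by blast
    have "\<phi> (brk L (e a) (e b)) = brk L (e \<gamma>) (e \<delta>)"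
      using \<phi>_brk[OF e_G1(1)[OF a(1)] e_G1(1)[OF b(1)]] \<phi>_e[OF a(1)] \<phi>_e[OF b(1)] a(2) b(2) by simp
    hence n: "nb a b" using g(4) \<phi>_0 by (auto simp: nb_def)
    have p: "a + b \<in> \<Delta>p" by (rule pos_nb_plus[OF R_pos(1)[OF a(1)] R_pos(1)[OF b(1)] n])
    hence "a + b \<in> R1" using roots_over_sum[OF sub12(1) R_pos(1)[OF a(1)] R_pos(1)[OF b(1)]] a(1) b(1) by blast
    thus ?thesis using T_plus[OF a(1) b(1)] a(2) b(2) g(3) by auto
  qed
qed

text \<open>Otherwise \<open>\<tau>\<close> would carry a simple root in the support of \<alpha>
  along forever, its iterates staying in the supports of the iterates of \<alpha>.\<close>

lemma T_nilpotent:
  assumes \<alpha>: "\<alpha> \<in> R1"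
  shows "\<exists>k. (T ^^ k) \<alpha> \<notin> R1"
proof (rule ccontr)
  assume "\<nexists>k. (T ^^ k) \<alpha> \<notin> R1"
  hence all: "(T ^^ k) \<alpha> \<in> R1" for k by blast
  have "\<exists>\<gamma>\<in>\<Gamma>1. \<alpha> (dd \<gamma>) \<noteq> 0"
  proof (rule ccontr)
    assume "\<not> ?thesis"
    hence "\<alpha> (dd \<gamma>) = 0" if "\<gamma> \<in> \<Gamma>" for \<gamma> using \<alpha> that roots_over_iff[OF sub12(1)] by blast
    hence "\<alpha> x = 0" for x by (subst root_expansion[OF pos_root[OF R_pos(1)[OF \<alpha>]]]) simp
    thus False using root_nonzero[OF pos_root[OF R_pos(1)[OF \<alpha>]]] by (auto simp: fun_eq_iff)
  qed
  then obtain \<gamma> where \<gamma>: "\<gamma> \<in> \<Gamma>1" "\<alpha> (dd \<gamma>) \<noteq> 0" by blast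
  have "(\<tau> ^^ k) \<gamma> \<in> \<Gamma>1 \<and> ((T ^^ k) \<alpha>) (dd ((\<tau> ^^ k) \<gamma>)) \<noteq> 0" for k
  proof (induction k)
    case (Suc k)
    hence "(T ((T ^^ k) \<alpha>)) (dd (\<tau> ((\<tau> ^^ k) \<gamma>))) \<noteq> 0"
      using tau_ext_eq[OF all[of k]] tl_coeff by simp
    hence *: "((T ^^ Suc k) \<alpha>) (dd ((\<tau> ^^ Suc k) \<gamma>)) \<noteq> 0" by simp
    have "(\<tau> ^^ Suc k) \<gamma> \<in> \<Gamma>" using Suc \<tau>_\<Gamma>2 \<Gamma>2 by auto
    hence "(\<tau> ^^ Suc k) \<gamma> \<in> \<Gamma>1" using * all[of "Suc k"] roots_over_iff[OF sub12(1)] by blast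
    thus ?case using * by blast
  qed (use \<gamma> in simp)
  thus False using \<tau>_nilpotent[OF \<gamma>(1)] by blast
qed

section \<open>The partial order of the triple\<close>

abbreviation lt :: "('g \<Rightarrow> complex) \<Rightarrow> ('g \<Rightarrow> complex) \<Rightarrow> bool" where
  "lt \<equiv> triple_less L H \<Gamma>1 \<tau>"

lemma lt_iff: "lt \<alpha> \<beta> \<longleftrightarrow> (\<exists>k. (\<forall>j\<le>k. (T ^^ j) \<alpha> \<in> R1) \<and> \<beta> = (T ^^ Suc k) \<alpha>)"
proof
  assume "lt \<alpha> \<beta>"
  then obtain k where k: "k \<ge> 1" "\<forall>j<k. (T ^^ j) \<alpha> \<in> R1" "\<beta> = (T ^^ k) \<alpha>"
    unfolding triple_less_def by blast
  then obtain m where "k = Suc m" by (cases k) auto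
  thus "\<exists>k. (\<forall>j\<le>k. (T ^^ j) \<alpha> \<in> R1) \<and> \<beta> = (T ^^ Suc k) \<alpha>"
    using k(2,3) by (intro exI[of _ m]) auto
next
  assume "\<exists>k. (\<forall>j\<le>k. (T ^^ j) \<alpha> \<in> R1) \<and> \<beta> = (T ^^ Suc k) \<alpha>"
  then obtain k where k: "\<forall>j\<le>k. (T ^^ j) \<alpha> \<in> R1" "\<beta> = (T ^^ Suc k) \<alpha>" by blast
  thus "lt \<alpha> \<beta>" unfolding triple_less_def
    by (intro exI[of _ "Suc k"]) (auto simp: less_Suc_eq_le)
qed

lemma lt_unfold: "lt \<alpha> \<beta> \<longleftrightarrow> \<alpha> \<in> R1 \<and> (\<beta> = T \<alpha> \<or> lt (T \<alpha>) \<beta>)"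
proof
  assume "lt \<alpha> \<beta>"
  then obtain k where k: "\<forall>j\<le>k. (T ^^ j) \<alpha> \<in> R1" "\<beta> = (T ^^ Suc k) \<alpha>" unfolding lt_iff by blast
  have "\<alpha> \<in> R1" using k(1)[rule_format, of 0] by simp
  moreover have "lt (T \<alpha>) \<beta>" if "k = Suc m" for m
    unfolding lt_iff
  proof (intro exI[of _ m] conjI allI impI)
    show "(T ^^ j) (T \<alpha>) \<in> R1" if "j \<le> m" for j
      using k(1)[rule_format, of "Suc j"] that \<open>k = Suc m\<close> by (simp add: funpow_swap1)
    show "\<beta> = (T ^^ Suc m) (T \<alpha>)" using k(2) that by (simp add: funpow_swap1)
  qed
  ultimately show "\<alpha> \<in> R1 \<and> (\<beta> = T \<alpha> \<or> lt (T \<alpha>) \<beta>)" using k(2) by (cases k) auto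
next
  assume *: "\<alpha> \<in> R1 \<and> (\<beta> = T \<alpha> \<or> lt (T \<alpha>) \<beta>)"
  show "lt \<alpha> \<beta>"
  proof (cases "\<beta> = T \<alpha>")
    case True
    thus ?thesis unfolding lt_iff using * by (intro exI[of _ 0]) simp
  next
    case False
    then obtain k where k: "\<forall>j\<le>k. (T ^^ j) (T \<alpha>) \<in> R1" "\<beta> = (T ^^ Suc k) (T \<alpha>)"
      using * unfolding lt_iff by blast
    have "(T ^^ j) \<alpha> \<in> R1" if "j \<le> Suc k" for j
      using that k(1) * by (cases j) (auto simp: funpow_swap1)
    thus ?thesis unfolding lt_iff using k(2) by (intro exI[of _ "Suc k"]) (auto simp: funpow_swap1)
  qed
qed

lemma lt_R: "lt \<alpha> \<beta> \<Longrightarrow> \<alpha> \<in> R1 \<and> \<beta> \<in> R2 \<and> par \<beta> = par \<alpha>"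
proof -
  assume "lt \<alpha> \<beta>"
  then obtain k where k: "\<forall>j\<le>k. (T ^^ j) \<alpha> \<in> R1" "\<beta> = (T ^^ Suc k) \<alpha>" unfolding lt_iff by blast
  have "par ((T ^^ j) \<alpha>) = par \<alpha>" if "j \<le> Suc k" for j
    using that by (induction j) (use k(1) T_root(2) in auto)
  hence "par \<beta> = par \<alpha>" using k(2) by blast
  moreover have "\<beta> \<in> R2" using k T_root(1)[of "(T ^^ k) \<alpha>"] by simp
  ultimately show ?thesis using k(1)[rule_format, of 0] by simp
qed

text \<open>A root related to itself would have periodic iterates under \<open>T\<close>, which
  never leave \<open>R1\<close>.\<close>

lemma lt_irrefl: "\<not> lt \<alpha> \<alpha>"
proof
  assume "lt \<alpha> \<alpha>"
  then obtain k where k: "\<forall>j\<le>k. (T ^^ j) \<alpha> \<in> R1" "\<alpha> = (T ^^ Suc k) \<alpha>" unfolding lt_iff by blast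
  have "(T ^^ m) \<alpha> \<in> R1" for m
  proof -
    have "(T ^^ m) \<alpha> = (T ^^ (m mod Suc k)) \<alpha>"
      by (rule funpow_mod_eq[symmetric]) (use k(2) in simp)
    thus ?thesis using k(1) by (simp add: less_Suc_eq_le[symmetric])
  qed
  thus False using T_nilpotent[of \<alpha>] k(1)[rule_format, of 0] by simp
qed

text \<open>The counterpart of \<open>lt_unfold\<close> at the upper end; injectivity of
  \<open>T\<close> strips the last step.\<close>

lemma lt_T_unfold:
  assumes \<alpha>: "\<alpha> \<in> R1"
  shows "lt \<beta> (T \<alpha>) \<longleftrightarrow> \<beta> = \<alpha> \<or> lt \<beta> \<alpha>"
proof
  assume "lt \<beta> (T \<alpha>)"
  then obtain k where k: "\<forall>j\<le>k. (T ^^ j) \<beta> \<in> R1" "T \<alpha> = (T ^^ Suc k) \<beta>" unfolding lt_iff by blast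
  have a: "\<alpha> = (T ^^ k) \<beta>" using T_inj[OF \<alpha>, of "(T ^^ k) \<beta>"] k by simp
  show "\<beta> = \<alpha> \<or> lt \<beta> \<alpha>"
  proof (cases k)
    case (Suc m)
    thus ?thesis unfolding lt_iff using a k(1) by (intro disjI2 exI[of _ m]) auto
  qed (use a in simp)
next
  assume "\<beta> = \<alpha> \<or> lt \<beta> \<alpha>"
  thus "lt \<beta> (T \<alpha>)"
  proof
    assume "lt \<beta> \<alpha>"
    then obtain k where k: "\<forall>j\<le>k. (T ^^ j) \<beta> \<in> R1" "\<alpha> = (T ^^ Suc k) \<beta>" unfolding lt_iff by blast
    have "(T ^^ j) \<beta> \<in> R1" if "j \<le> Suc k" for j
      using that k(1) k(2)[symmetric] \<alpha> by (cases "j = Suc k") (auto simp del: funpow.simps)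
    thus ?thesis unfolding lt_iff using k(2) by (intro exI[of _ "Suc k"]) auto
  qed (use lt_unfold \<alpha> in blast)
qed

end

section \<open>Even tensors as operators\<close>

context killing_superalgebra
begin

text \<open>The even part of the tensor square. Both factors of a summand share the parity
  \<open>p i\<close>, which makes the signs computable summand by summand.\<close>

definition even_tensor :: "'g tensor2 \<Rightarrow> bool" where
  "even_tensor r \<longleftrightarrow> (\<exists>(n::nat) a b p. (\<forall>i<n. a i \<in> part L (p i) \<and> b i \<in> part L (p i)) \<and>
     r = (\<Sum>i<n. tensor2 L (a i) (b i)))"

lemma even_tensor_0: "even_tensor 0"
  unfolding even_tensor_def by (intro exI[of _ 0]) simp

lemma even_tensor_add_pure:
  assumes "even_tensor r" "x \<in> part L i" "y \<in> part L i"
  shows "even_tensor (r + tensor2 L x y)"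
proof -
  obtain n :: nat and a b p where r: "\<forall>i<n. a i \<in> part L (p i) \<and> b i \<in> part L (p i)"
    "r = (\<Sum>i<n. tensor2 L (a i) (b i))"
    using assms(1) unfolding even_tensor_def by blast
  let ?a = "a(n := x)" and ?b = "b(n := y)" and ?p = "p(n := i)"
  have "\<forall>j<Suc n. ?a j \<in> part L (?p j) \<and> ?b j \<in> part L (?p j)"
    using r(1) assms by (auto simp: less_Suc_eq)
  moreover have "r + tensor2 L x y = (\<Sum>i<Suc n. tensor2 L (?a i) (?b i))"
    by (simp add: r(2))
  ultimately show ?thesis unfolding even_tensor_def by blast
qed

lemma even_tensor_plus:
  assumes "even_tensor r" "even_tensor s"
  shows "even_tensor (r + s)"
proof -
  obtain n :: nat and a b p where s: "\<forall>i<n. a i \<in> part L (p i) \<and> b i \<in> part L (p i)"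
    "s = (\<Sum>i<n. tensor2 L (a i) (b i))"
    using assms(2) unfolding even_tensor_def by blast
  have "even_tensor (r + (\<Sum>i<m. tensor2 L (a i) (b i)))" if "m \<le> n" for m
    using that
  proof (induction m)
    case (Suc m)
    have "even_tensor ((r + (\<Sum>i<m. tensor2 L (a i) (b i))) + tensor2 L (a m) (b m))"
      by (rule even_tensor_add_pure[where i = "p m", OF Suc.IH]) (use Suc.prems s(1) in auto)
    moreover have "(r + (\<Sum>i<m. tensor2 L (a i) (b i))) + tensor2 L (a m) (b m) =
        r + (\<Sum>i<Suc m. tensor2 L (a i) (b i))"
      unfolding sum.lessThan_Suc by (rule add.assoc)
    ultimately show ?case by (simp only:)
  qed (use assms(1) in simp)
  thus ?thesis using s(2) by blast
qed

lemma even_tensor_pure: "x \<in> part L i \<Longrightarrow> y \<in> part L i \<Longrightarrow> even_tensor (tensor2 L x y)"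
  using even_tensor_add_pure[OF even_tensor_0] by simp

lemma even_tensor_sum:
  assumes "\<And>i. i \<in> A \<Longrightarrow> even_tensor (t i)"
  shows "even_tensor (\<Sum>i\<in>A. t i)"
  using assms
  by (induction A rule: infinite_finite_induct) (auto simp: even_tensor_0 even_tensor_plus)

lemma tscale_tensor2: "tscale c (tensor2 L x y) = tensor2 L (scl L c x) y"
  by (auto simp: fun_eq_iff tscale_def tensor2_def functional_iff)

lemma even_tensor_tscale: "x \<in> part L i \<Longrightarrow> y \<in> part L i \<Longrightarrow> even_tensor (tscale c (tensor2 L x y))"
  unfolding tscale_tensor2 by (intro even_tensor_pure subspace_scale[OF subspace_part])

definition cybe :: "'g tensor2 \<Rightarrow> 'g tensor3" where
  "cybe r = brk12_13 L r r + brk12_23 L r r + brk13_23 L r r"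

text \<open>\<open>f\<close> and \<open>G\<close> contract the first and the second factor with the
  Killing form. In \<open>cybe\<close>, skew-symmetry brings each bracket into the position required
  by invariance, and its sign cancels the sign of the tensor bracket.\<close>

lemma even_tensor_operators:
  assumes "even_tensor r"
  obtains f G where "lin f" "lin G"
    "\<And>x q. functional L q \<Longrightarrow> r (killing L x) q = q (f x)"
    "\<And>x q. functional L q \<Longrightarrow> r q (\<lambda>z. killing L z x) = q (G x)"
    "\<And>x q. functional L q \<Longrightarrow> super_flip L r (killing L x) q = q (G x)"
    "\<And>x y q. functional L q \<Longrightarrow> cybe r (killing L x) q (\<lambda>z. killing L z y) =
       q (brk L (f x) (G y) - f (brk L x (G y)) - G (brk L (f x) y))"
    "\<And>p q. \<not> (functional L p \<and> functional L q) \<Longrightarrow> r p q = 0"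
proof -
  obtain n :: nat and a b p where ab: "\<And>i. i < n \<Longrightarrow> a i \<in> part L (p i)" "\<And>i. i < n \<Longrightarrow> b i \<in> part L (p i)"
    and r: "r = (\<Sum>i<n. tensor2 L (a i) (b i))"
    using assms unfolding even_tensor_def by blast
  define f where "f x = (\<Sum>i<n. scl L (killing L x (a i)) (b i))" for x
  define G where "G x = (\<Sum>i<n. scl L (killing L (b i) x) (a i))" for x
  have lin: "lin f" "lin G"
    by (simp_all add: lin_iff f_def G_def killing_linear scale_left_distrib sum.distrib scale_sum_right)
  note fK = functional_killing
  have q_f: "q (f x) = (\<Sum>i<n. killing L x (a i) * q (b i))"
    and q_G: "q (G x) = (\<Sum>i<n. killing L (b i) x * q (a i))" if "functional L q" for q x
    using that by (simp_all add: f_def G_def functional_sum) (simp_all add: functional_iff)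
  have 1: "r (killing L x) q = q (f x)" if "functional L q" for x q
    using that by (simp add: r sum_tensor_apply tensor2_apply fK q_f)
  have 2: "r q (\<lambda>z. killing L z x) = q (G x)" if "functional L q" for x q
    using that by (simp add: r sum_tensor_apply tensor2_apply fK q_G mult.commute)
  have 3: "super_flip L r (killing L x) q = q (G x)" if q: "functional L q" for x q
  proof -
    have "super_flip L r = (\<Sum>i<n. tscale ((-1) ^ (p i * p i)) (tensor2 L (b i) (a i)))"
      unfolding r super_flip_sum using ab by (intro sum.cong) (auto intro: super_flip_tensor2)
    hence "super_flip L r (killing L x) q = (\<Sum>i<n. (-1) ^ (p i * p i) * (killing L x (b i) * q (a i)))"
      using q by (simp add: sum_tensor_apply tscale_def tensor2_apply fK)
    also have "\<dots> = (\<Sum>i<n. killing L (b i) x * q (a i))"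
    proof (rule sum.cong)
      fix i assume "i \<in> {..<n}"
      hence "killing L x (b i) = (-1) ^ p i * killing L (b i) x" using killing_commute ab by simp
      thus "(-1) ^ (p i * p i) * (killing L x (b i) * q (a i)) = killing L (b i) x * q (a i)"
        by (auto simp: minus_one_power_iff)
    qed simp
    finally show ?thesis using q_G[OF q] by simp
  qed
  have 4: "cybe r (killing L x) q (\<lambda>z. killing L z y) =
      q (brk L (f x) (G y) - f (brk L x (G y)) - G (brk L (f x) y))" if q: "functional L q" for x y q
  proof -
    let ?x = "killing L x" and ?y = "\<lambda>z. killing L z y"
    have apply3: "(\<Sum>i\<in>A. t i) f g k = (\<Sum>i\<in>A. t i f g k)"
      for A :: "nat set" and f g k and t :: "nat \<Rightarrow> 'g tensor3"
      by (induction A rule: infinite_finite_induct) auto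
    have q_diff: "q (u - v) = q u - q v" for u v
      using q by (metis add_diff_cancel diff_add_cancel functional_iff)
    have e1: "brk12_13 L r r ?x q ?y = - q (f (brk L x (G y)))"
    proof -
      have "brk12_13 L r r ?x q ?y = (\<Sum>i<n. \<Sum>j<n. (-1) ^ (p i * p j) *
          (killing L x (brk L (a i) (a j)) * q (b i) * killing L (b j) y))"
        unfolding r brk_sum(1) apply3
        by (intro sum.cong refl) (subst brk12_13_tensor2, use ab q fK in \<open>auto simp: tensor3_def\<close>)
      also have "\<dots> = (\<Sum>i<n. \<Sum>j<n. - (killing L (brk L x (a j)) (a i) * q (b i) * killing L (b j) y))"
      proof (intro sum.cong refl)
        fix i j assume "i \<in> {..<n}" "j \<in> {..<n}"
        \<comment> \<open>Exchanging the arguments gives the negative of the sign of the tensor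
          bracket; the product of the two is -1.\<close>
        hence "brk L (a i) (a j) = scl L (- ((-1) ^ (p i * p j))) (brk L (a j) (a i))"
          using ab by (intro brk_skew) auto
        thus "(-1) ^ (p i * p j) * (killing L x (brk L (a i) (a j)) * q (b i) * killing L (b j) y) =
            - (killing L (brk L x (a j)) (a i) * q (b i) * killing L (b j) y)"
          by (simp add: killing_linear killing_uminus killing_invariant minus_one_power_iff)
      qed
      also have "\<dots> = - (\<Sum>i<n. (\<Sum>j<n. killing L (b j) y * killing L (brk L x (a j)) (a i)) * q (b i))"
        by (simp add: sum_negf sum_distrib_left sum_distrib_right mult_ac)
      also have "\<dots> = - (\<Sum>i<n. killing L (brk L x (G y)) (a i) * q (b i))"
        by (simp add: G_def brk_sum_right brk_linear_simps killing_sum killing_linear)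
      finally show ?thesis using q_f[OF q] by simp
    qed
    have e2: "brk12_23 L r r ?x q ?y = q (brk L (f x) (G y))"
    proof -
      have "brk12_23 L r r ?x q ?y = (\<Sum>i<n. \<Sum>j<n. killing L x (a i) * q (brk L (b i) (a j)) * killing L (b j) y)"
        unfolding r brk_sum(2) apply3
        by (intro sum.cong refl) (subst brk12_23_tensor2, use q fK in \<open>auto simp: tensor3_def\<close>)
      also have "\<dots> = q (brk L (f x) (G y))"
        using q
        by (subst sum.swap) (simp add: f_def G_def brk_sum_left brk_sum_right brk_linear_simps functional_sum
            functional_iff[THEN iffD1, OF q, THEN conjunct2, rule_format] scale_sum_right sum_distrib_left mult_ac)
      finally show ?thesis .
    qed
    have e3: "brk13_23 L r r ?x q ?y = - q (G (brk L (f x) y))"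
    proof -
      have "brk13_23 L r r ?x q ?y = (\<Sum>i<n. \<Sum>j<n. (-1) ^ (p i * p j) *
          (killing L x (a i) * q (a j) * killing L (brk L (b i) (b j)) y))"
        unfolding r brk_sum(3) apply3
        by (intro sum.cong refl) (subst brk13_23_tensor2, use ab q fK in \<open>auto simp: tensor3_def\<close>)
      also have "\<dots> = (\<Sum>i<n. \<Sum>j<n. - (killing L x (a i) * killing L (b j) (brk L (b i) y) * q (a j)))"
      proof (intro sum.cong refl)
        fix i j assume "i \<in> {..<n}" "j \<in> {..<n}"
        hence "brk L (b i) (b j) = scl L (- ((-1) ^ (p i * p j))) (brk L (b j) (b i))"
          using ab by (intro brk_skew) auto
        thus "(-1) ^ (p i * p j) * (killing L x (a i) * q (a j) * killing L (brk L (b i) (b j)) y) =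
            - (killing L x (a i) * killing L (b j) (brk L (b i) y) * q (a j))"
          by (simp add: killing_linear killing_uminus killing_invariant minus_one_power_iff)
      qed
      also have "\<dots> = (\<Sum>j<n. \<Sum>i<n. - (killing L x (a i) * killing L (b j) (brk L (b i) y) * q (a j)))"
        by (rule sum.swap)
      also have "\<dots> = - (\<Sum>j<n. (\<Sum>i<n. killing L x (a i) * killing L (b j) (brk L (b i) y)) * q (a j))"
        by (simp add: sum_negf sum_distrib_left sum_distrib_right mult_ac)
      also have "\<dots> = - (\<Sum>j<n. killing L (b j) (brk L (f x) y) * q (a j))"
        by (simp add: f_def brk_sum_left brk_linear_simps killing_sum killing_linear)
      finally show ?thesis using q_G[OF q] by simp
    qed
    show ?thesis unfolding cybe_def by (simp add: e1 e2 e3 q_diff)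
  qed
  have 5: "r p q = 0" if "\<not> (functional L p \<and> functional L q)" for p q
    using that by (simp only: r sum_tensor_apply tensor2_def if_False sum.neutral_const)
  show thesis by (rule that[OF lin 1 2 3 4 5])
qed

text \<open>The Casimir element contracts to the identity: x is the sum of (b, x) times the dual
  vector of b, and the sign in the definition converts (b, x) into (x, b).\<close>

lemma casimir_apply:
  assumes B: "homogeneous_basis L B" and q: "functional L q"
  shows "casimir L B (killing L x) q = q x"
proof -
  have B': "finite B" "independent B" "span B = UNIV"
    using B independent_finite by (auto simp: homogeneous_basis_def)
  interpret vsp: vector_space_pair "scl L" "(*) :: complex \<Rightarrow> complex \<Rightarrow> complex"
    by (intro vector_space_pair.intro vector_space_axioms vector_space_mult)
  have agree: "v = w" if "\<And>a. a \<in> B \<Longrightarrow> killing L a v = killing L a w" for v w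
  proof -
    have "killing L y (v - w) = 0" for y
    proof -
      have "y \<in> span B" by (simp add: B')
      thus ?thesis
        by (induction rule: span_induct_alt) (use that in \<open>auto simp: killing_linear killing_diff\<close>)
    qed
    hence "v - w = 0" by (rule killing_nondegenerate_right)
    thus ?thesis by simp
  qed
  define D where "D b = (THE v. \<forall>a\<in>B. killing L a v = (if a = b then 1 else 0))" for b
  have D: "\<forall>a\<in>B. killing L a (D b) = (if a = b then 1 else 0)" for b
  proof -
    obtain F where F: "functional L F" "\<And>a. a \<in> B \<Longrightarrow> F a = (if a = b then 1 else 0)"
      using vsp.linear_independent_extend[OF B'(2), of "\<lambda>a. if a = b then 1 else 0"] by auto
    obtain v where v: "\<And>a. F a = killing L a v" using functional_represented_right[OF F(1)] by blast
    have ex: "\<forall>a\<in>B. killing L a v = (if a = b then 1 else 0)" using F(2) v by simp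
    show ?thesis unfolding D_def
      by (rule theI[of _ v]) (use ex agree in auto)
  qed
  have xs: "x = (\<Sum>b\<in>B. scl L (killing L b x) (D b))"
  proof (rule agree)
    fix a assume a: "a \<in> B"
    have "killing L a (\<Sum>b\<in>B. scl L (killing L b x) (D b)) = (\<Sum>b\<in>B. if b = a then killing L a x else 0)"
      unfolding killing_sum killing_linear using D a by (intro sum.cong) auto
    thus "killing L a x = killing L a (\<Sum>b\<in>B. scl L (killing L b x) (D b))" using a B' by simp
  qed
  have "q x = q (\<Sum>b\<in>B. scl L (killing L b x) (D b))" by (rule arg_cong[OF xs])
  also have "\<dots> = (\<Sum>b\<in>B. killing L b x * q (D b))"
    using q by (simp add: functional_sum) (simp add: functional_iff)
  also have "\<dots> = (\<Sum>b\<in>B. (-1) ^ parity L b * (killing L x b * q (D b)))"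
  proof (rule sum.cong)
    fix b assume "b \<in> B"
    hence "b \<in> part L (parity L b)"
      using B by (auto simp: homogeneous_basis_def parity_def Defs.part_def)
    hence "killing L x b = (-1) ^ parity L b * killing L b x" by (rule killing_commute)
    thus "killing L b x * q (D b) = (-1) ^ parity L b * (killing L x b * q (D b))"
      by (simp add: minus_one_power_iff)
  qed simp
  also have "\<dots> = casimir L B (killing L x) q"
    using q by (simp add: casimir_def sum_tensor_apply tscale_def tensor2_apply functional_killing flip: D_def)
  finally show ?thesis by simp
qed

text \<open>Every functional has the form (x, -) and also the form (-, y), so testing on these
  suffices. The second condition on the contractions gives G = 1 - f, which turns
  \<open>cybe\<close> into the difference of the two sides of the operator equation.\<close>

lemma cybe_reduction:
  assumes r: "even_tensor r"
    and f: "\<And>x q. functional L q \<Longrightarrow> r (killing L x) q = q (f x)"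
    and fG: "\<And>x q. functional L q \<Longrightarrow> r (killing L x) q + r q (\<lambda>z. killing L z x) = q x"
    and cyb: "\<And>x y. brk L (f x) (f y) = f (brk L (f x) y + brk L x (f y) - brk L x y)"
  shows "homogeneous_basis L B \<Longrightarrow> r + super_flip L r = casimir L B" "cybe r = 0"
proof -
  obtain f' G where lin: "lin f'" "lin G"
    and f': "\<And>x q. functional L q \<Longrightarrow> r (killing L x) q = q (f' x)"
    and G: "\<And>x q. functional L q \<Longrightarrow> r q (\<lambda>z. killing L z x) = q (G x)"
    and flip: "\<And>x q. functional L q \<Longrightarrow> super_flip L r (killing L x) q = q (G x)"
    and cyb': "\<And>x y q. functional L q \<Longrightarrow> cybe r (killing L x) q (\<lambda>z. killing L z y) =
       q (brk L (f' x) (G y) - f' (brk L x (G y)) - G (brk L (f' x) y))"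
    and zero: "\<And>p q. \<not> (functional L p \<and> functional L q) \<Longrightarrow> r p q = 0"
    using even_tensor_operators[OF r] by blast
  have ff: "f' x = f x" for x by (rule functional_separates) (metis f f')
  have GG: "G x = x - f x" for x
  proof (rule functional_separates)
    fix q assume q: "functional L q"
    have "q (f x) + q (G x) = q x" using fG[OF q, of x] f[OF q, of x] G[OF q, of x] by simp
    moreover have "q (x - f x) + q (f x) = q x" using q by (metis diff_add_cancel functional_iff)
    ultimately show "q (G x) = q (x - f x)" by (metis add.commute add_left_cancel)
  qed
  show "r + super_flip L r = casimir L B" if B: "homogeneous_basis L B"
  proof (intro ext)
    fix p q
    show "(r + super_flip L r) p q = casimir L B p q"
    proof (cases "functional L p \<and> functional L q")
      case True
      then obtain x where "p = killing L x" using functional_represented by (metis ext)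
      thus ?thesis
        using True casimir_apply[OF B] fG flip G by simp
    next
      case False
      have "super_flip L r p q = 0" by (simp only: super_flip_def False if_False)
      moreover have "casimir L B p q = 0"
        by (simp only: casimir_def sum_tensor_apply tscale_def tensor2_def False if_False
            mult_zero_right sum.neutral_const)
      ultimately show ?thesis using zero[OF False] by simp
    qed
  qed
  have lf: "lin f" using lin(1) ff by (simp add: lin_iff)
  show "cybe r = 0"
  proof (intro ext)
    fix p q s
    show "cybe r p q s = 0 p q s"
    proof (cases "functional L p \<and> functional L q \<and> functional L s")
      case True
      then obtain x where x: "p = killing L x" using functional_represented by (metis ext)
      obtain y where y: "s = (\<lambda>z. killing L z y)" using functional_represented_right True by (metis ext)
      have "brk L (f x) (G y) - f (brk L x (G y)) - G (brk L (f x) y) =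
          f (brk L (f x) y + brk L x (f y) - brk L x y) - brk L (f x) (f y)"
        by (simp add: GG brk_diff lin_diff[OF lf] lin_add[OF lf] algebra_simps)
      also have "\<dots> = 0" using cyb by simp
      finally show ?thesis
        using cyb' True functional_0 by (simp add: x y ff)
    next
      case False
      show ?thesis
        unfolding cybe_def plus_fun_def
        by (simp only: brk12_13_def brk12_23_def brk13_23_def False if_False zero_fun_def add_0_right)
    qed
  qed
qed

end

section \<open>The r-matrix of an admissible triple\<close>

locale r_matrix_superalgebra = triple_superalgebra L H \<Gamma> e \<Gamma>1 \<Gamma>2 \<tau> X Y \<phi>
  for L :: "'g::ab_group_add lie_superalg" and H \<Gamma> e \<Gamma>1 \<Gamma>2 \<tau> X Y \<phi> +
  fixes r0 :: "'g tensor2"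
  assumes r0_H: "r0 \<in> tensors_over L H"
    and r0_flip: "r0 + super_flip L r0 = cartan_casimir L H \<Gamma>"
    and r0_contract: "\<forall>\<alpha>\<in>\<Gamma>1. contract_left L H (\<tau> \<alpha>) r0 + contract_right L H \<alpha> r0 = 0"
begin

text \<open>The coweights are the basis of \<open>H\<close> dual to the coroots, so this is the
  expansion of x in \<open>H_expansion\<close>.\<close>

lemma cartan_casimir_apply:
  assumes x: "x \<in> H" and q: "functional L q"
  shows "cartan_casimir L H \<Gamma> (killing L x) q = q x"
proof -
  have D: "(THE v. v \<in> H \<and> (\<forall>\<delta>\<in>\<Gamma>. killing L (cr \<delta>) v = (if \<delta> = \<gamma> then 1 else 0))) = dd \<gamma>"
    if \<gamma>: "\<gamma> \<in> \<Gamma>" for \<gamma>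
  proof (rule the_equality)
    have *: "killing L (cr \<delta>) v = \<delta> v" if "\<delta> \<in> \<Gamma>" "v \<in> H" for \<delta> v
      using coroot(2)[OF \<Gamma>_dl[OF that(1)] that(2)] .
    show "dd \<gamma> \<in> H \<and> (\<forall>\<delta>\<in>\<Gamma>. killing L (cr \<delta>) (dd \<gamma>) = (if \<delta> = \<gamma> then 1 else 0))"
      using dd \<gamma> * by simp
    fix v assume v: "v \<in> H \<and> (\<forall>\<delta>\<in>\<Gamma>. killing L (cr \<delta>) v = (if \<delta> = \<gamma> then 1 else 0))"
    have "v = (\<Sum>\<delta>\<in>\<Gamma>. scl L (\<delta> v) (dd \<delta>))" using H_expansion v by blast
    also have "\<dots> = (\<Sum>\<delta>\<in>\<Gamma>. if \<delta> = \<gamma> then dd \<gamma> else 0)"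
    proof (rule sum.cong)
      fix \<delta> assume \<delta>: "\<delta> \<in> \<Gamma>"
      have "\<delta> v = (if \<delta> = \<gamma> then 1 else 0)" using *[OF \<delta>, of v] v \<delta> by simp
      thus "scl L (\<delta> v) (dd \<delta>) = (if \<delta> = \<gamma> then dd \<gamma> else 0)" by simp
    qed simp
    finally show "v = dd \<gamma>" using \<gamma> finite_\<Gamma> by simp
  qed
  have "cartan_casimir L H \<Gamma> (killing L x) q = (\<Sum>\<gamma>\<in>\<Gamma>. killing L x (cr \<gamma>) * q (dd \<gamma>))"
    using q D by (simp add: cartan_casimir_def sum_tensor_apply tensor2_apply functional_killing)
  also have "\<dots> = (\<Sum>\<gamma>\<in>\<Gamma>. q (scl L (\<gamma> x) (dd \<gamma>)))"
  proof (rule sum.cong)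
    fix \<gamma> assume "\<gamma> \<in> \<Gamma>"
    hence "killing L x (cr \<gamma>) = \<gamma> x"
      using coroot(2)[OF \<Gamma>_dl x] killing_H_commute[OF x] by simp
    thus "killing L x (cr \<gamma>) * q (dd \<gamma>) = q (scl L (\<gamma> x) (dd \<gamma>))" using q by (simp add: functional_iff)
  qed simp
  also have "\<dots> = q (\<Sum>\<gamma>\<in>\<Gamma>. scl L (\<gamma> x) (dd \<gamma>))" by (rule functional_sum[OF q, symmetric])
  also have "\<dots> = q x" by (rule arg_cong[OF H_expansion[OF x], symmetric])
  finally show ?thesis .
qed

text \<open>The contractions of r0. Its symmetric part gives f0 + g0 = 1 on \<open>H\<close>; the
  contraction condition, with functionals replaced by coroots, relates f0 at the coroot of
  \<open>\<tau> \<gamma>\<close> to g0 at that of \<open>\<gamma>\<close>.\<close>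

lemma r0_operators:
  obtains f0 g0 where "lin f0" "lin g0" "\<And>x. f0 x \<in> H" "even_tensor r0"
    "\<And>x q. functional L q \<Longrightarrow> r0 (killing L x) q = q (f0 x)"
    "\<And>x q. functional L q \<Longrightarrow> r0 q (\<lambda>z. killing L z x) = q (g0 x)"
    "\<And>x. x \<in> H \<Longrightarrow> f0 x + g0 x = x"
    "\<And>\<mu> x. \<mu> \<in> \<Delta> \<Longrightarrow> x \<in> rs \<mu> \<Longrightarrow> f0 x = 0 \<and> g0 x = 0"
    "\<And>\<gamma>. \<gamma> \<in> \<Gamma>1 \<Longrightarrow> f0 (cr (\<tau> \<gamma>)) + g0 (cr \<gamma>) = 0"
proof -
  obtain n :: nat and a b where ab: "\<And>i. i < n \<Longrightarrow> a i \<in> H" "\<And>i. i < n \<Longrightarrow> b i \<in> H"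
    and r0: "r0 = (\<Sum>i<n. tensor2 L (a i) (b i))"
    using r0_H unfolding tensors_over_def by blast
  define f0 where "f0 x = (\<Sum>i<n. scl L (killing L x (a i)) (b i))" for x
  define g0 where "g0 x = (\<Sum>i<n. scl L (killing L (b i) x) (a i))" for x
  have lin: "lin f0" "lin g0"
    by (simp_all add: lin_iff f0_def g0_def killing_linear scale_left_distrib sum.distrib scale_sum_right)
  have H: "f0 x \<in> H" for x
    unfolding f0_def using ab subspace_H by (intro subspace_sum) (auto intro: subspace_scale)
  have even: "even_tensor r0"
    unfolding r0 by (intro even_tensor_sum even_tensor_pure[where i = 0]) (auto simp: H_even ab)
  have 1: "r0 (killing L x) q = q (f0 x)" if "functional L q" for x q
    using that
    by (simp add: r0 sum_tensor_apply tensor2_apply functional_killing f0_def functional_sum)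
      (simp add: functional_iff)
  have 2: "r0 q (\<lambda>z. killing L z x) = q (g0 x)" if "functional L q" for x q
    using that
    by (simp add: r0 sum_tensor_apply tensor2_apply functional_killing g0_def functional_sum)
      (simp add: functional_iff mult.commute)
  have 3: "f0 x + g0 x = x" if x: "x \<in> H" for x
  proof (rule functional_separates)
    fix q assume q: "functional L q"
    obtain f' G where G: "\<And>x q. functional L q \<Longrightarrow> r0 q (\<lambda>z. killing L z x) = q (G x)"
      "\<And>x q. functional L q \<Longrightarrow> super_flip L r0 (killing L x) q = q (G x)"
      using even_tensor_operators[OF even] by metis
    have "super_flip L r0 (killing L x) q = q (g0 x)" using G[OF q] 2[OF q] by simp
    hence "q (f0 x) + q (g0 x) = (r0 + super_flip L r0) (killing L x) q" using 1[OF q] by simp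
    also have "\<dots> = q x" unfolding r0_flip by (rule cartan_casimir_apply[OF x q])
    finally show "q (f0 x + g0 x) = q x" using q by (simp add: functional_iff)
  qed
  have 4: "f0 x = 0 \<and> g0 x = 0" if "\<mu> \<in> \<Delta>" "x \<in> rs \<mu>" for \<mu> x
  proof -
    have "killing L x h = 0" "killing L h x = 0" if h: "h \<in> H" for h
      using killing_rs[OF \<open>x \<in> rs \<mu>\<close> H_rs[OF h] root_dl[OF \<open>\<mu> \<in> \<Delta>\<close>] dl_zero]
        killing_rs[OF H_rs[OF h] \<open>x \<in> rs \<mu>\<close> dl_zero root_dl[OF \<open>\<mu> \<in> \<Delta>\<close>]] root_nonzero[OF \<open>\<mu> \<in> \<Delta>\<close>] by simp_all
    thus ?thesis using ab by (simp add: f0_def g0_def)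
  qed
  have 5: "f0 (cr (\<tau> \<gamma>)) + g0 (cr \<gamma>) = 0" if \<gamma>: "\<gamma> \<in> \<Gamma>1" for \<gamma>
  proof -
    have d: "\<gamma> \<in> dl" "\<tau> \<gamma> \<in> dl" using \<Gamma>_dl \<Gamma>1 \<Gamma>2 \<tau>_\<Gamma>2 \<gamma> by blast+
    have "f0 (cr (\<tau> \<gamma>)) = contract_left L H (\<tau> \<gamma>) r0"
      unfolding r0 using ab
      by (subst contract_left_eq[OF subspace_H d(2)]) (auto simp: f0_def coroot(2)[OF d(2)])
    moreover have "killing L (b i) (cr \<gamma>) = \<gamma> (b i)" if "i < n" for i
      using coroot(2)[OF d(1) ab(2)[OF that]] killing_H_commute[OF ab(2)[OF that]] by simp
    hence "g0 (cr \<gamma>) = contract_right L H \<gamma> r0"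
      unfolding r0 using ab
      by (subst contract_right_eq[OF subspace_H d(1)]) (auto simp: g0_def)
    ultimately show ?thesis using r0_contract \<gamma> by simp
  qed
  show thesis by (rule that[OF lin H even 1 2 3 4 5])
qed

end

text \<open>The Yang--Baxter equation says that the pairs \<open>(f z - z, f z)\<close> form a subalgebra of \<open>L \<times> L\<close>. As a
  subspace they are spanned by the pairs \<open>gen\<close> below, on which closure can be checked.\<close>

locale bd_operator = triple_superalgebra L H \<Gamma> e \<Gamma>1 \<Gamma>2 \<tau> X Y \<phi>
  for L :: "'g::ab_group_add lie_superalg" and H \<Gamma> e \<Gamma>1 \<Gamma>2 \<tau> X Y \<phi> +
  fixes f :: "'g \<Rightarrow> 'g"
  assumes f_lin: "lin f"
    and f_pos: "\<alpha> \<in> \<Delta>p \<Longrightarrow> f (e \<alpha>) = e \<alpha> + (\<Sum>\<beta> | lt \<alpha> \<beta>. e \<beta>)"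
    and f_neg: "\<beta> \<in> \<Delta>p \<Longrightarrow> f (e (- \<beta>)) = - (\<Sum>\<alpha> | lt \<alpha> \<beta>. e (- \<alpha>))"
    and f_H: "h \<in> H \<Longrightarrow> f h \<in> H"
    and f_coroot: "\<alpha> \<in> R1 \<Longrightarrow> f (cr \<alpha> - cr (T \<alpha>)) = cr \<alpha>"
    and f_weight: "\<alpha> \<in> R1 \<Longrightarrow> h \<in> H \<Longrightarrow> T \<alpha> (f h - h) = \<alpha> (f h)"
begin

section \<open>Closure of the spanning pairs under brackets\<close>

definition W :: "'g \<Rightarrow> 'g \<Rightarrow> bool" where
  "W p q \<longleftrightarrow> (\<exists>z. q = f z \<and> p = f z - z)"

lemma W_0: "W 0 0"
  unfolding W_def by (rule exI[of _ 0]) (simp add: lin_0[OF f_lin])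

lemma W_scale: "W p q \<Longrightarrow> W (scl L c p) (scl L c q)"
  unfolding W_def
proof (elim exE conjE)
  fix z assume "q = f z" "p = f z - z"
  thus "\<exists>z. scl L c q = f z \<and> scl L c p = f z - z"
    by (intro exI[of _ "scl L c z"]) (simp add: lin_scale[OF f_lin] scale_right_diff_distrib)
qed

definition te :: "('g \<Rightarrow> complex) \<Rightarrow> 'g" where
  "te \<alpha> = (if \<alpha> \<in> R1 then e (T \<alpha>) else 0)"

text \<open>The choice selects the unique preimage of \<open>\<beta>\<close> under \<open>T\<close>;
  see \<open>tn_T\<close>.\<close>

definition tn :: "('g \<Rightarrow> complex) \<Rightarrow> 'g" where
  "tn \<beta> = (if \<beta> \<in> R2 then e (- (SOME \<alpha>. \<alpha> \<in> R1 \<and> T \<alpha> = \<beta>)) else 0)"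

lemma tn_T:
  assumes "\<alpha> \<in> R1"
  shows "tn (T \<alpha>) = e (- \<alpha>)"
proof -
  have "(SOME \<alpha>'. \<alpha>' \<in> R1 \<and> T \<alpha>' = T \<alpha>) = \<alpha>"
    by (rule some_equality) (use assms T_inj in auto)
  thus ?thesis using T_root(1)[OF assms] by (simp add: tn_def)
qed

lemma finite_lt: "finite {\<beta>. lt \<alpha> \<beta>}" "finite {\<alpha>. lt \<alpha> \<beta>}"
  using finite_subset[OF _ finite_roots] lt_R R_pos pos_root by (metis mem_Collect_eq subsetI)+

text \<open>f sends e_\<alpha> to the sum along the whole chain \<alpha>, T \<alpha>, ...;
  subtracting the chain that starts at T \<alpha> telescopes.\<close>

lemma f_te:
  assumes \<alpha>: "\<alpha> \<in> \<Delta>p"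
  shows "f (e \<alpha> - te \<alpha>) = e \<alpha>"
proof (cases "\<alpha> \<in> R1")
  case False
  hence "{\<beta>. lt \<alpha> \<beta>} = {}" using lt_unfold by blast
  thus ?thesis using f_pos[OF \<alpha>] False by (simp add: te_def)
next
  case True
  have "{\<beta>. lt \<alpha> \<beta>} = insert (T \<alpha>) {\<beta>. lt (T \<alpha>) \<beta>}" using lt_unfold[of \<alpha>] True by blast
  hence "(\<Sum>\<beta> | lt \<alpha> \<beta>. e \<beta>) = e (T \<alpha>) + (\<Sum>\<beta> | lt (T \<alpha>) \<beta>. e \<beta>)"
    using finite_lt lt_irrefl by simp
  thus ?thesis using f_pos[OF \<alpha>] f_pos[OF T_pos[OF True]] True by (simp add: te_def lin_diff[OF f_lin])
qed

text \<open>The same telescoping along predecessors, where the chain sum omits \<beta>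
  itself.\<close>

lemma f_tn:
  assumes \<beta>: "\<beta> \<in> \<Delta>p"
  shows "f (tn \<beta> - e (- \<beta>)) = tn \<beta>"
proof (cases "\<beta> \<in> R2")
  case False
  hence "{\<alpha>. lt \<alpha> \<beta>} = {}" using lt_R by blast
  hence "f (e (- \<beta>)) = 0" using f_neg[OF \<beta>] by simp
  thus ?thesis using False by (simp add: tn_def lin_uminus[OF f_lin])
next
  case True
  then obtain \<alpha> where \<alpha>: "\<alpha> \<in> R1" "T \<alpha> = \<beta>" using T_surj by blast
  have "{\<gamma>. lt \<gamma> \<beta>} = insert \<alpha> {\<gamma>. lt \<gamma> \<alpha>}" using lt_T_unfold[OF \<alpha>(1)] \<alpha>(2) by blast
  hence "(\<Sum>\<gamma> | lt \<gamma> \<beta>. e (- \<gamma>)) = e (- \<alpha>) + (\<Sum>\<gamma> | lt \<gamma> \<alpha>. e (- \<gamma>))"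
    using finite_lt lt_irrefl by simp
  thus ?thesis
    using f_neg[OF \<beta>] f_neg[OF R_pos(1)[OF \<alpha>(1)]] tn_T[OF \<alpha>(1)] \<alpha>(2) by (simp add: lin_diff[OF f_lin])
qed

lemma W_pos: "\<alpha> \<in> \<Delta>p \<Longrightarrow> W (te \<alpha>) (e \<alpha>)"
  unfolding W_def by (rule exI[of _ "e \<alpha> - te \<alpha>"]) (simp add: f_te)

lemma W_neg: "\<beta> \<in> \<Delta>p \<Longrightarrow> W (e (- \<beta>)) (tn \<beta>)"
  unfolding W_def by (rule exI[of _ "tn \<beta> - e (- \<beta>)"]) (simp add: f_tn)

lemma W_neg_T: "\<alpha> \<in> R1 \<Longrightarrow> W (e (- T \<alpha>)) (e (- \<alpha>))"
  using W_neg[OF T_pos] tn_T by metis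

lemma te_\<phi>: "\<alpha> \<in> R1 \<Longrightarrow> te \<alpha> = \<phi> (e \<alpha>)"
  by (simp add: te_def \<phi>_e)

lemma te_outside: "\<alpha> \<notin> R1 \<Longrightarrow> te \<alpha> = 0" and tn_outside: "\<beta> \<notin> R2 \<Longrightarrow> tn \<beta> = 0"
  by (simp_all add: te_def tn_def)

text \<open>\<open>\<phi>\<close> is a homomorphism, and a sum of positive roots lies in
  \<open>R1\<close> exactly when both summands do, so setting \<open>te\<close> to 0 outside
  \<open>R1\<close> respects brackets.\<close>

lemma W_pos_pos:
  assumes \<alpha>: "\<alpha> \<in> \<Delta>p" and \<beta>: "\<beta> \<in> \<Delta>p"
  shows "W (brk L (te \<alpha>) (te \<beta>)) (brk L (e \<alpha>) (e \<beta>))"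
proof (cases "nb \<alpha> \<beta>")
  case False
  hence z: "brk L (e \<alpha>) (e \<beta>) = 0" by (simp add: nb_def)
  have "brk L (te \<alpha>) (te \<beta>) = 0"
  proof (cases "\<alpha> \<in> R1 \<and> \<beta> \<in> R1")
    case True
    thus ?thesis using \<phi>_brk[OF e_G1(1) e_G1(1), of \<alpha> \<beta>] te_\<phi> z \<phi>_0 by simp
  qed (auto simp: te_outside brk_zero)
  thus ?thesis using z W_0 by simp
next
  case True
  have p: "\<alpha> + \<beta> \<in> \<Delta>p" by (rule pos_nb_plus[OF \<alpha> \<beta> True])
  obtain c where c: "brk L (e \<alpha>) (e \<beta>) = scl L c (e (\<alpha> + \<beta>))"
    using brk_e[OF pos_root[OF \<alpha>] pos_root[OF \<beta>] pos_root[OF p]] by blast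
  have "brk L (te \<alpha>) (te \<beta>) = scl L c (te (\<alpha> + \<beta>))"
  proof (cases "\<alpha> + \<beta> \<in> R1")
    case True
    hence r: "\<alpha> \<in> R1" "\<beta> \<in> R1" using roots_over_sum[OF sub12(1) \<alpha> \<beta> p] by blast+
    show ?thesis
      using \<phi>_brk[OF e_G1(1)[OF r(1)] e_G1(1)[OF r(2)]] \<phi>_scale[OF e_G1(1)[OF True], of c] c
      by (simp add: te_\<phi> r True)
  next
    case False
    hence "\<alpha> \<notin> R1 \<or> \<beta> \<notin> R1" using roots_over_sum[OF sub12(1) \<alpha> \<beta> p] by blast
    thus ?thesis using False by (auto simp: te_outside brk_zero)
  qed
  thus ?thesis using c W_scale[OF W_pos[OF p]] by simp
qed

text \<open>The same argument for the inverse of \<open>\<phi>\<close>, with \<open>R2\<close> in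
  place of \<open>R1\<close>.\<close>

lemma W_neg_neg:
  assumes \<alpha>: "\<alpha> \<in> \<Delta>p" and \<beta>: "\<beta> \<in> \<Delta>p"
  shows "W (brk L (e (- \<alpha>)) (e (- \<beta>))) (brk L (tn \<alpha>) (tn \<beta>))"
proof (cases "\<alpha> \<in> R2 \<and> \<beta> \<in> R2")
  case True
  obtain a b where ab: "a \<in> R1" "T a = \<alpha>" "b \<in> R1" "T b = \<beta>" using T_surj True by metis
  note p = R_pos(1)[OF ab(1)] R_pos(1)[OF ab(3)]
  note r = roots_uminus(1)[OF pos_root[OF p(1)]] roots_uminus(1)[OF pos_root[OF p(2)]]
  have l: "brk L (e (- \<alpha>)) (e (- \<beta>)) = \<phi> (brk L (e (- a)) (e (- b)))"
    using \<phi>_brk[OF e_G1(2)[OF ab(1)] e_G1(2)[OF ab(3)]] \<phi>_e_minus ab by simp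
  have t: "tn \<alpha> = e (- a)" "tn \<beta> = e (- b)" using tn_T ab by auto
  show ?thesis
  proof (cases "nb (- a) (- b)")
    case False
    hence "brk L (e (- a)) (e (- b)) = 0" by (simp add: nb_def)
    thus ?thesis unfolding l t using \<phi>_0 W_0 by simp
  next
    case True
    have nz: "- a + - b \<noteq> 0" using pos_plus_nonzero[OF p] by (metis add.inverse_distrib_swap add.commute neg_equal_0_iff_equal)
    have "- (- a + - b) = a + b" by simp
    hence s: "a + b \<in> \<Delta>" using roots_uminus(1)[OF nb_root[OF r True nz]] by (simp add: add.commute)
    hence ps: "a + b \<in> \<Delta>p" using pos_plus[OF p] by blast
    hence R: "a + b \<in> R1" using roots_over_sum[OF sub12(1) p] ab by blast
    have "- a + - b = - (a + b)" by simp
    then obtain c where c: "brk L (e (- a)) (e (- b)) = scl L c (e (- (a + b)))"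
      using brk_e[OF r] roots_uminus(1)[OF s] by metis
    have "\<phi> (brk L (e (- a)) (e (- b))) = scl L c (e (- T (a + b)))"
      unfolding c using \<phi>_scale[OF e_G1(2)[OF R]] \<phi>_e_minus[OF R] by simp
    thus ?thesis unfolding l t using c W_scale[OF W_neg_T[OF R]] by simp
  qed
next
  case False
  hence z: "brk L (tn \<alpha>) (tn \<beta>) = 0" by (auto simp: tn_outside brk_zero)
  note r = roots_uminus(1)[OF pos_root[OF \<alpha>]] roots_uminus(1)[OF pos_root[OF \<beta>]]
  show ?thesis
  proof (cases "nb (- \<alpha>) (- \<beta>)")
    case False
    thus ?thesis using z W_0 by (simp add: nb_def)
  next
    case True
    have nz: "- \<alpha> + - \<beta> \<noteq> 0" using pos_plus_nonzero[OF \<alpha> \<beta>] by (metis add.inverse_distrib_swap add.commute neg_equal_0_iff_equal)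
    have "- (- \<alpha> + - \<beta>) = \<alpha> + \<beta>" by simp
    hence s: "\<alpha> + \<beta> \<in> \<Delta>" using roots_uminus(1)[OF nb_root[OF r True nz]] by (simp add: add.commute)
    hence ps: "\<alpha> + \<beta> \<in> \<Delta>p" using pos_plus[OF \<alpha> \<beta>] by blast
    hence R: "\<alpha> + \<beta> \<notin> R2" using roots_over_sum[OF sub12(2) \<alpha> \<beta>] False \<open>\<not> (\<alpha> \<in> R2 \<and> \<beta> \<in> R2)\<close> by blast
    have "- \<alpha> + - \<beta> = - (\<alpha> + \<beta>)" by simp
    then obtain c where c: "brk L (e (- \<alpha>)) (e (- \<beta>)) = scl L c (e (- (\<alpha> + \<beta>)))"
      using brk_e[OF r] roots_uminus(1)[OF s] by metis
    show ?thesis using W_scale[OF W_neg[OF ps], of c] by (simp add: z c tn_outside[OF R])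
  qed
qed

text \<open>By \<open>f_weight\<close>, f h - h has the same eigenvalue on the root vector of T
  \<alpha> as f h has on e_\<alpha>.\<close>

lemma W_H_pos:
  assumes h: "h \<in> H" and \<alpha>: "\<alpha> \<in> \<Delta>p"
  shows "W (brk L (f h - h) (te \<alpha>)) (brk L (f h) (e \<alpha>))"
proof -
  have fh: "f h \<in> H" "f h - h \<in> H" using f_H[OF h] h subspace_diff[OF subspace_H] by blast+
  have q: "brk L (f h) (e \<alpha>) = scl L (\<alpha> (f h)) (e \<alpha>)"
    by (rule rs_D[OF e_root[OF pos_root[OF \<alpha>]] fh(1)])
  have "brk L (f h - h) (te \<alpha>) = scl L (\<alpha> (f h)) (te \<alpha>)"
  proof (cases "\<alpha> \<in> R1")
    case True
    thus ?thesis
      using rs_D[OF e_root[OF pos_root[OF T_pos[OF True]]] fh(2)] f_weight[OF True h] by (simp add: te_def)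
  qed (simp add: te_outside brk_zero)
  thus ?thesis using q W_scale[OF W_pos[OF \<alpha>]] by simp
qed

lemma W_H_neg:
  assumes h: "h \<in> H" and \<beta>: "\<beta> \<in> \<Delta>p"
  shows "W (brk L (f h - h) (e (- \<beta>))) (brk L (f h) (tn \<beta>))"
proof -
  have fh: "f h \<in> H" "f h - h \<in> H" using f_H[OF h] h subspace_diff[OF subspace_H] by blast+
  have p: "brk L (f h - h) (e (- \<beta>)) = scl L (- \<beta> (f h - h)) (e (- \<beta>))"
    using rs_D[OF e_root[OF roots_uminus(1)[OF pos_root[OF \<beta>]]] fh(2)] by simp
  have "brk L (f h) (tn \<beta>) = scl L (- \<beta> (f h - h)) (tn \<beta>)"
  proof (cases "\<beta> \<in> R2")
    case True
    then obtain a where a: "a \<in> R1" "T a = \<beta>" using T_surj by blast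
    have "brk L (f h) (e (- a)) = scl L (- a (f h)) (e (- a))"
      using rs_D[OF e_root[OF roots_uminus(1)[OF pos_root[OF R_pos(1)[OF a(1)]]]] fh(1)] by simp
    thus ?thesis using tn_T[OF a(1)] f_weight[OF a(1) h] a(2) by simp
  qed (simp add: tn_outside brk_zero)
  thus ?thesis unfolding p by (simp only:) (rule W_scale[OF W_neg[OF \<beta>]])
qed

lemma nb_pos_neg:
  assumes \<alpha>: "\<alpha> \<in> \<Delta>p" and \<beta>: "\<beta> \<in> \<Delta>p" and "\<alpha> \<noteq> \<beta>" "nb \<alpha> (- \<beta>)"
  obtains \<delta> c where "\<delta> \<in> \<Delta>p" "\<alpha> = \<beta> + \<delta>" "brk L (e \<alpha>) (e (- \<beta>)) = scl L c (e \<delta>)"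
    | \<delta> c where "\<delta> \<in> \<Delta>p" "\<beta> = \<alpha> + \<delta>" "brk L (e \<alpha>) (e (- \<beta>)) = scl L c (e (- \<delta>))"
proof -
  note r = pos_root[OF \<alpha>] roots_uminus(1)[OF pos_root[OF \<beta>]]
  have s: "\<alpha> + - \<beta> \<in> \<Delta>" using nb_root[OF r assms(4)] assms(3) by simp
  obtain c where c: "brk L (e \<alpha>) (e (- \<beta>)) = scl L c (e (\<alpha> + - \<beta>))" using brk_e[OF r s] by blast
  show thesis
  proof (cases "\<alpha> + - \<beta> \<in> \<Delta>p")
    case True
    show ?thesis by (rule that(1)[OF True _ c]) simp
  next
    case False
    hence d: "- (\<alpha> + - \<beta>) \<in> \<Delta>p" using root_signs[OF s] by blast
    show ?thesis by (rule that(2)[OF d, of c]) (simp_all add: c)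
  qed
qed

text \<open>If both \<alpha> and \<beta> are moved, the pair is (\<phi> w, w); here w may be
  h_\<alpha>, which \<open>f_coroot\<close> covers. If only one is, one entry is 0, and the
  difference of roots in the other can only have a sign and a support for which \<open>te\<close> or
  \<open>tn\<close> vanishes as well.\<close>

lemma W_pos_neg:
  assumes \<alpha>: "\<alpha> \<in> \<Delta>p" and \<beta>: "\<beta> \<in> \<Delta>p"
  shows "W (brk L (te \<alpha>) (e (- \<beta>))) (brk L (e \<alpha>) (tn \<beta>))"
proof (cases "\<alpha> \<in> R1"; cases "\<beta> \<in> R2")
  assume \<alpha>1: "\<alpha> \<in> R1" and \<beta>2: "\<beta> \<in> R2"
  obtain b where b: "b \<in> R1" "T b = \<beta>" using T_surj[OF \<beta>2] by blast
  note bp = R_pos(1)[OF b(1)]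
  let ?w = "brk L (e \<alpha>) (e (- b))"
  have l: "brk L (te \<alpha>) (e (- \<beta>)) = \<phi> ?w"
    using \<phi>_brk[OF e_G1(1)[OF \<alpha>1] e_G1(2)[OF b(1)]] te_\<phi>[OF \<alpha>1] \<phi>_e_minus[OF b(1)] b(2) by simp
  have t: "tn \<beta> = e (- b)" using tn_T[OF b(1)] b(2) by simp
  have "W (\<phi> ?w) ?w"
  proof (cases "\<alpha> = b")
    case True
    have "?w = cr \<alpha>"
      using brk_opposite[OF root_dl[OF pos_root[OF \<alpha>]] e_root[OF pos_root[OF \<alpha>]]
          e_root[OF roots_uminus(1)[OF pos_root[OF \<alpha>]]]] e_norm[OF \<alpha>] True by simp
    moreover have "W (cr (T \<alpha>)) (cr \<alpha>)"
      unfolding W_def by (rule exI[of _ "cr \<alpha> - cr (T \<alpha>)"]) (simp add: f_coroot[OF \<alpha>1])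
    ultimately show ?thesis using T_root(3)[OF \<alpha>1] by simp
  next
    case ne: False
    show ?thesis
    proof (cases "nb \<alpha> (- b)")
      case False
      thus ?thesis using \<phi>_0 W_0 by (simp add: nb_def)
    next
      case True
      from \<alpha> bp ne True show ?thesis
      proof (cases rule: nb_pos_neg)
        case (1 \<delta> c)
        have d: "\<delta> \<in> R1" using roots_over_sum[OF sub12(1) bp 1(1)] 1(2) \<alpha> \<alpha>1 by simp
        show ?thesis
          unfolding 1(3) using \<phi>_scale[OF e_G1(1)[OF d]] W_scale[OF W_pos[OF 1(1)]] te_\<phi>[OF d] by simp
      next
        case (2 \<delta> c)
        have d: "\<delta> \<in> R1" using roots_over_sum[OF sub12(1) \<alpha> 2(1)] 2(2) bp b(1) by simp
        show ?thesis
          unfolding 2(3) using \<phi>_scale[OF e_G1(2)[OF d]] W_scale[OF W_neg_T[OF d]] \<phi>_e_minus[OF d] by simp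
      qed
    qed
  qed
  thus ?thesis unfolding l t .
next
  assume \<alpha>1: "\<alpha> \<in> R1" and \<beta>2: "\<beta> \<notin> R2"
  let ?a = "T \<alpha>"
  note ap = T_pos[OF \<alpha>1]
  have ne: "?a \<noteq> \<beta>" using T_root(1)[OF \<alpha>1] \<beta>2 by blast
  have q: "brk L (e \<alpha>) (tn \<beta>) = 0" using tn_outside[OF \<beta>2] by (simp add: brk_zero)
  have "W (brk L (e ?a) (e (- \<beta>))) 0"
  proof (cases "nb ?a (- \<beta>)")
    case False
    thus ?thesis using W_0 by (simp add: nb_def)
  next
    case True
    from ap \<beta> ne True show ?thesis
    proof (cases rule: nb_pos_neg)
      case (1 \<delta> c)
      hence False using roots_over_sum[OF sub12(2) \<beta> 1(1)] ap T_root(1)[OF \<alpha>1] \<beta>2 by simp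
      thus ?thesis ..
    next
      case (2 \<delta> c)
      have "\<delta> \<notin> R2" using roots_over_sum[OF sub12(2) ap 2(1)] 2(2) \<beta> T_root(1)[OF \<alpha>1] \<beta>2 by simp
      thus ?thesis using W_scale[OF W_neg[OF 2(1)], of c] by (simp add: 2(3) tn_outside)
    qed
  qed
  thus ?thesis using q \<alpha>1 by (simp add: te_def)
next
  assume \<alpha>1: "\<alpha> \<notin> R1" and \<beta>2: "\<beta> \<in> R2"
  obtain b where b: "b \<in> R1" "T b = \<beta>" using T_surj[OF \<beta>2] by blast
  note bp = R_pos(1)[OF b(1)]
  have t: "tn \<beta> = e (- b)" using tn_T[OF b(1)] b(2) by simp
  have ne: "\<alpha> \<noteq> b" using \<alpha>1 b(1) by blast
  have "W 0 (brk L (e \<alpha>) (e (- b)))"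
  proof (cases "nb \<alpha> (- b)")
    case False
    thus ?thesis using W_0 by (simp add: nb_def)
  next
    case True
    from \<alpha> bp ne True show ?thesis
    proof (cases rule: nb_pos_neg)
      case (1 \<delta> c)
      have "\<delta> \<notin> R1" using roots_over_sum[OF sub12(1) bp 1(1)] 1(2) \<alpha> \<alpha>1 b(1) by simp
      thus ?thesis using W_scale[OF W_pos[OF 1(1)], of c] by (simp add: 1(3) te_outside)
    next
      case (2 \<delta> c)
      hence False using roots_over_sum[OF sub12(1) \<alpha> 2(1)] bp b(1) \<alpha>1 by simp
      thus ?thesis ..
    qed
  qed
  thus ?thesis using t \<alpha>1 by (simp add: te_outside brk_zero)
next
  assume "\<alpha> \<notin> R1" "\<beta> \<notin> R2"
  thus ?thesis using W_0 by (simp add: te_outside tn_outside brk_zero)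
qed

text \<open>The spanning pairs with their common parity, which determines the sign in
  \<open>W_swap\<close>.\<close>

definition gen :: "nat \<Rightarrow> 'g \<Rightarrow> 'g \<Rightarrow> bool" where
  "gen i p q \<longleftrightarrow> (\<exists>\<alpha>\<in>\<Delta>p. i = par \<alpha> \<and> p = te \<alpha> \<and> q = e \<alpha>) \<or>
     (\<exists>\<beta>\<in>\<Delta>p. i = par \<beta> \<and> p = e (- \<beta>) \<and> q = tn \<beta>) \<or> (\<exists>h\<in>H. i = 0 \<and> p = f h - h \<and> q = f h)"

lemma gen_part:
  assumes "gen i p q"
  shows "p \<in> part L i" "q \<in> part L i"
proof -
  have te: "te \<alpha> \<in> part L (par \<alpha>)" for \<alpha>
    using e_part[OF pos_root[OF T_pos]] T_root(2) subspace_0[OF subspace_part] by (auto simp: te_def)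
  have tn: "tn \<beta> \<in> part L (par \<beta>)" for \<beta>
  proof (cases "\<beta> \<in> R2")
    case True
    then obtain a where a: "a \<in> R1" "T a = \<beta>" using T_surj by blast
    have r: "a \<in> \<Delta>" using pos_root R_pos(1) a(1) by blast
    show ?thesis
      using e_part[OF roots_uminus(1)[OF r]] roots_uminus(2)[OF r] T_root(2)[OF a(1)] tn_T[OF a(1)] a(2) by simp
  qed (simp add: tn_outside subspace_0[OF subspace_part])
  have neg: "e (- \<beta>) \<in> part L (par \<beta>)" if "\<beta> \<in> \<Delta>p" for \<beta>
    using e_part[OF roots_uminus(1)[OF pos_root[OF that]]] roots_uminus(2)[OF pos_root[OF that]] by simp
  have HH: "f h \<in> part L 0" "f h - h \<in> part L 0" if "h \<in> H" for h
    using H_even f_H that subspace_diff[OF subspace_H] by blast+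
  show "p \<in> part L i" "q \<in> part L i"
    using assms te tn neg HH e_part pos_root unfolding gen_def by blast+
qed

lemma gen_W: "gen i p q \<Longrightarrow> W p q"
  unfolding gen_def using W_pos W_neg by (auto simp: W_def)

lemma W_swap:
  assumes "gen i p q" "gen j p' q'" "W (brk L p p') (brk L q q')"
  shows "W (brk L p' p) (brk L q' q)"
  using W_scale[OF assms(3), of "- ((-1) ^ (j * i))"]
    brk_skew[OF gen_part(1)[OF assms(2)] gen_part(1)[OF assms(1)]]
    brk_skew[OF gen_part(2)[OF assms(2)] gen_part(2)[OF assms(1)]] by simp

lemma gen_closed:
  assumes g: "gen i p q" and g': "gen j p' q'"
  shows "W (brk L p p') (brk L q q')"
proof -
  have HH: "W (brk L (f h - h) (f k - k)) (brk L (f h) (f k))" if "h \<in> H" "k \<in> H" for h k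
  proof -
    have "f h \<in> H" "f k \<in> H" "f h - h \<in> H" "f k - k \<in> H"
      using that f_H subspace_diff[OF subspace_H] by blast+
    thus ?thesis using H_abelian W_0 by simp
  qed
  from g consider (pos) \<alpha> where "\<alpha> \<in> \<Delta>p" "p = te \<alpha>" "q = e \<alpha>"
    | (neg) \<beta> where "\<beta> \<in> \<Delta>p" "p = e (- \<beta>)" "q = tn \<beta>"
    | (H) h where "h \<in> H" "p = f h - h" "q = f h" unfolding gen_def by blast
  note c = this
  from g' consider (pos) \<alpha> where "\<alpha> \<in> \<Delta>p" "p' = te \<alpha>" "q' = e \<alpha>"
    | (neg) \<beta> where "\<beta> \<in> \<Delta>p" "p' = e (- \<beta>)" "q' = tn \<beta>"
    | (H) h where "h \<in> H" "p' = f h - h" "q' = f h" unfolding gen_def by blast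
  note c' = this
  show ?thesis
  proof (cases rule: c)
    case (pos \<alpha>)
    show ?thesis
    proof (cases rule: c')
      case (H h)
      thus ?thesis using pos W_H_pos by (intro W_swap[OF g' g]) simp
    qed (use pos W_pos_pos W_pos_neg in auto)
  next
    case (neg \<beta>)
    show ?thesis
    proof (cases rule: c')
      case (pos \<alpha>)
      thus ?thesis using neg W_pos_neg by (intro W_swap[OF g' g]) simp
    next
      case (H h)
      thus ?thesis using neg W_H_neg by (intro W_swap[OF g' g]) simp
    qed (use neg W_neg_neg in auto)
  next
    case (H h)
    show ?thesis
      by (cases rule: c') (use H W_H_pos W_H_neg HH in auto)
  qed
qed

text \<open>The differences e_\<alpha> - te \<alpha> are triangular for the order of the triple; the
  induction is on the number of roots above \<alpha>, and below it for negative root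
  vectors.\<close>

lemma e_span_gen:
  assumes "\<alpha> \<in> \<Delta>p"
  shows "e \<alpha> \<in> span {q - p |i p q. gen i p q}" "e (- \<alpha>) \<in> span {q - p |i p q. gen i p q}"
proof -
  let ?S = "{q - p |i p q. gen i p q}"
  show "e \<alpha> \<in> span ?S"
    using assms
  proof (induction "card {\<beta>. lt \<alpha> \<beta>}" arbitrary: \<alpha> rule: less_induct)
    case less
    have "gen (par \<alpha>) (te \<alpha>) (e \<alpha>)" using less.prems by (auto simp: gen_def)
    hence d: "e \<alpha> - te \<alpha> \<in> span ?S" by (intro span_base) blast
    have "te \<alpha> \<in> span ?S"
    proof (cases "\<alpha> \<in> R1")
      case True
      have "{\<beta>. lt (T \<alpha>) \<beta>} \<subset> {\<beta>. lt \<alpha> \<beta>}" using lt_unfold[of \<alpha>] True lt_irrefl[of "T \<alpha>"] by blast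
      hence "card {\<beta>. lt (T \<alpha>) \<beta>} < card {\<beta>. lt \<alpha> \<beta>}" using finite_lt by (intro psubset_card_mono)
      thus ?thesis using less.hyps T_pos[OF True] True by (simp add: te_def)
    qed (simp add: te_outside span_zero)
    from span_add[OF d this] show ?case by simp
  qed
  show "e (- \<alpha>) \<in> span ?S"
    using assms
  proof (induction "card {\<beta>. lt \<beta> \<alpha>}" arbitrary: \<alpha> rule: less_induct)
    case less
    have "gen (par \<alpha>) (e (- \<alpha>)) (tn \<alpha>)" using less.prems by (auto simp: gen_def)
    hence d: "tn \<alpha> - e (- \<alpha>) \<in> span ?S" by (intro span_base) blast
    have "tn \<alpha> \<in> span ?S"
    proof (cases "\<alpha> \<in> R2")
      case True
      then obtain a where a: "a \<in> R1" "T a = \<alpha>" using T_surj by blast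
      have "{\<beta>. lt \<beta> a} \<subset> {\<beta>. lt \<beta> \<alpha>}" using lt_T_unfold[OF a(1)] a(2) lt_irrefl[of a] by blast
      hence "card {\<beta>. lt \<beta> a} < card {\<beta>. lt \<beta> \<alpha>}" using finite_lt by (intro psubset_card_mono)
      thus ?thesis using less.hyps R_pos(1)[OF a(1)] tn_T[OF a(1)] a(2) by simp
    qed (simp add: tn_outside span_zero)
    from span_diff[OF this d] show ?case by simp
  qed
qed

lemma span_gen: "span {q - p |i p q. gen i p q} = UNIV"
proof -
  let ?S = "{q - p |i p q. gen i p q}"
  have "x \<in> span ?S" for x
  proof (induction x rule: weight_vectors_induct)
    case (weight x i \<mu>)
    show ?case
    proof (cases "\<mu> = 0 \<or> x = 0")
      case True
      hence "x \<in> H" using weight(3) rs_0 subspace_0[OF subspace_H] by auto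
      hence "gen 0 (f x - x) (f x)" by (auto simp: gen_def)
      hence "f x - (f x - x) \<in> ?S" by blast
      thus ?thesis by (simp add: span_base)
    next
      case False
      hence r: "\<mu> \<in> \<Delta>" using weight by (auto simp: roots_iff)
      then obtain c where c: "x = scl L c (e \<mu>)" using root_vector_multiple[OF r weight(3)] by blast
      have "e \<mu> \<in> span ?S"
        using root_signs[OF r] e_span_gen(1)[of \<mu>] e_span_gen(2)[of "- \<mu>"] by auto
      thus ?thesis using c span_scale by blast
    qed
  qed (rule span_add)
  thus ?thesis by blast
qed

lemma f_cybe: "brk L (f x) (f y) = f (brk L (f x) y + brk L x (f y) - brk L x y)"
proof -
  let ?S = "{q - p |i p q. gen i p q}"
  have gg: "brk L (f x) (f y) = f (brk L (f x) y + brk L x (f y) - brk L x y)"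
    if x: "x \<in> ?S" and y: "y \<in> ?S" for x y
  proof -
    obtain i p q j p' q' where g: "gen i p q" "x = q - p" "gen j p' q'" "y = q' - p'"
      using x y by blast
    have fx: "f x = q" "f y = q'" using gen_W[OF g(1)] gen_W[OF g(3)] g(2,4) by (auto simp: W_def)
    obtain z where z: "brk L q q' = f z" "brk L p p' = f z - z"
      using gen_closed[OF g(1,3)] by (auto simp: W_def)
    \<comment> \<open>The two entries of a pair determine z as their difference; rewritten with x =
      q - p and y = q' - p', this is the argument of f in the equation.\<close>
    have "z = brk L q q' - brk L p p'" using z by simp
    also have "\<dots> = brk L q (q' - p') + brk L (q - p) q' - brk L (q - p) (q' - p')"
      by (simp add: brk_diff algebra_simps)
    finally show ?thesis using z(1) fx g(2,4) by simp
  qed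
  have l1: "lin (\<lambda>y. brk L (f x) (f y))" "lin (\<lambda>y. f (brk L (f x) y + brk L x (f y) - brk L x y))" for x
    by (rule lin_brkI[OF f_lin],
        rule lin_compI[OF f_lin lin_minusI[OF lin_plusI[OF lin_brk(1) lin_brkI[OF f_lin]] lin_brk(1)]])
  have l2: "lin (\<lambda>x. brk L (f x) (f y))" "lin (\<lambda>x. f (brk L (f x) y + brk L x (f y) - brk L x y))" for y
    by (rule lin_compI[OF lin_brk(3) f_lin],
        rule lin_compI[OF f_lin lin_minusI[OF lin_plusI[OF lin_compI[OF lin_brk(3) f_lin] lin_brk(3)] lin_brk(3)]])
  have 1: "brk L (f x) (f y) = f (brk L (f x) y + brk L x (f y) - brk L x y)" if "x \<in> ?S" for x y
  proof (rule lin_span_eq[OF l1])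
    show "y \<in> span ?S" by (simp add: span_gen)
  qed (rule gg[OF that])
  show ?thesis
  proof (rule lin_span_eq[OF l2])
    show "x \<in> span ?S" by (simp add: span_gen)
  qed (rule 1)
qed

end

context r_matrix_superalgebra
begin

section \<open>The contraction operators of the r-matrix\<close>

definition rm :: "'g tensor2" where
  "rm = r_matrix L H \<Gamma> \<Gamma>1 \<tau> e r0"

definition pairs :: "(('g \<Rightarrow> complex) \<times> ('g \<Rightarrow> complex)) set" where
  "pairs = {(\<alpha>, \<beta>). \<alpha> \<in> \<Delta>p \<and> \<beta> \<in> \<Delta>p \<and> lt \<alpha> \<beta>}"

lemma finite_pos: "finite \<Delta>p"
  by (rule finite_subset[OF _ finite_roots]) (use pos_root in blast)

lemma e_part_minus: "\<alpha> \<in> \<Delta>p \<Longrightarrow> e (- \<alpha>) \<in> part L (par \<alpha>)"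
  using e_part[OF roots_uminus(1)[OF pos_root]] roots_uminus(2)[OF pos_root] by metis

lemma e_part_lt: "lt \<alpha> \<beta> \<Longrightarrow> e \<beta> \<in> part L (par \<alpha>)"
  using e_part[OF pos_root[OF R_pos(2)], of \<beta>] lt_R by metis

lemma rm_apply:
  assumes "functional L p" "functional L q"
  shows "rm p q = r0 p q + (\<Sum>\<alpha>\<in>\<Delta>p. p (e (- \<alpha>)) * q (e \<alpha>)) +
    (\<Sum>(\<alpha>, \<beta>)\<in>pairs. p (e (- \<alpha>)) * q (e \<beta>) - (-1) ^ par \<alpha> * (p (e \<beta>) * q (e (- \<alpha>))))"
  using assms
  by (simp add: rm_def r_matrix_def pairs_def sum_tensor_apply tensor2_apply tscale_def case_prod_beta)

lemma rm_even: "even_tensor r0 \<Longrightarrow> even_tensor rm"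
proof -
  assume r0: "even_tensor r0"
  have minus: "tensor2 L x y - tscale c (tensor2 L y' x') = tensor2 L x y + tscale (- c) (tensor2 L y' x')"
    for x y x' y' c by (simp add: fun_eq_iff tscale_def)
  show ?thesis
    unfolding rm_def r_matrix_def pairs_def[symmetric] minus
  proof (intro even_tensor_plus r0 even_tensor_sum)
    show "even_tensor (tensor2 L (e (- \<alpha>)) (e \<alpha>))" if "\<alpha> \<in> \<Delta>p" for \<alpha>
      by (rule even_tensor_pure[OF e_part_minus[OF that] e_part[OF pos_root[OF that]]])
    fix x assume "x \<in> pairs"
    then obtain \<alpha> \<beta> where x: "x = (\<alpha>, \<beta>)" "\<alpha> \<in> \<Delta>p" "lt \<alpha> \<beta>" by (auto simp: pairs_def)
    show "even_tensor (case x of (\<alpha>, \<beta>) \<Rightarrow> tensor2 L (e (- \<alpha>)) (e \<beta>) +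
        tscale (- ((-1) ^ par \<alpha>)) (tensor2 L (e \<beta>) (e (- \<alpha>))))"
      unfolding x(1) prod.case
      by (intro even_tensor_plus even_tensor_pure[OF e_part_minus[OF x(2)] e_part_lt[OF x(3)]]
          even_tensor_tscale[OF e_part_lt[OF x(3)] e_part_minus[OF x(2)]])
  qed
qed

lemma killing_e:
  assumes "\<alpha> \<in> \<Delta>p" "\<beta> \<in> \<Delta>p"
  shows "killing L (e \<alpha>) (e \<beta>) = 0" "killing L (e (- \<alpha>)) (e (- \<beta>)) = 0"
    "killing L (e \<alpha>) (e (- \<beta>)) = (if \<alpha> = \<beta> then 1 else 0)"
    "killing L (e (- \<alpha>)) (e \<beta>) = (if \<alpha> = \<beta> then (-1) ^ par \<alpha> else 0)"
proof -
  note r = pos_root[OF assms(1)] pos_root[OF assms(2)]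
  note r' = roots_uminus(1)[OF r(1)] roots_uminus(1)[OF r(2)]
  have z: "killing L (e \<mu>) (e \<nu>) = 0" if "\<mu> \<in> \<Delta>" "\<nu> \<in> \<Delta>" "\<mu> + \<nu> \<noteq> 0" for \<mu> \<nu>
    by (rule killing_rs[OF e_root e_root root_dl root_dl]) (use that in auto)
  show "killing L (e \<alpha>) (e \<beta>) = 0" using z[OF r] pos_plus_nonzero[OF assms] by blast
  have "- \<alpha> + - \<beta> \<noteq> 0" using pos_plus_nonzero[OF assms] by (metis add.inverse_inverse minus_add_distrib neg_equal_0_iff_equal)
  thus "killing L (e (- \<alpha>)) (e (- \<beta>)) = 0" using z[OF r'] by blast
  show "killing L (e \<alpha>) (e (- \<beta>)) = (if \<alpha> = \<beta> then 1 else 0)"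
    using z[OF r(1) r'(2)] e_norm[OF assms(1)] by auto
  show "killing L (e (- \<alpha>)) (e \<beta>) = (if \<alpha> = \<beta> then (-1) ^ par \<alpha> else 0)"
    using z[OF r'(1) r(2)] e_norm[OF assms(1)] killing_commute[OF e_part[OF r(1)], of "e (- \<alpha>)"] by auto
qed

lemma killing_H_e:
  assumes "h \<in> H" "\<alpha> \<in> \<Delta>"
  shows "killing L h (e \<alpha>) = 0" "killing L (e \<alpha>) h = 0"
  using killing_rs[OF H_rs[OF assms(1)] e_root[OF assms(2)] dl_zero root_dl[OF assms(2)]]
    killing_rs[OF e_root[OF assms(2)] H_rs[OF assms(1)] root_dl[OF assms(2)] dl_zero] root_nonzero[OF assms(2)]
  by simp_all

lemma sum_pairs: "(\<Sum>(\<alpha>, \<beta>)\<in>pairs. F \<alpha> \<beta>) = (\<Sum>\<alpha>\<in>\<Delta>p. \<Sum>\<beta> | lt \<alpha> \<beta>. F \<alpha> \<beta>)"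
  for F :: "_ \<Rightarrow> _ \<Rightarrow> complex"
proof -
  have "pairs = Sigma \<Delta>p (\<lambda>\<alpha>. {\<beta>. lt \<alpha> \<beta>})"
    using lt_R R_pos by (auto simp: pairs_def)
  moreover have "finite {\<beta>. lt \<alpha> \<beta>}" for \<alpha>
    by (rule finite_subset[OF _ finite_pos]) (use lt_R R_pos in blast)
  ultimately show ?thesis by (simp add: sum.Sigma finite_pos)
qed

text \<open>The contraction f is evaluated on root vectors and on \<open>H\<close>, which verifies
  \<open>bd_operator\<close>; together with f + G = 1 this feeds
  \<open>cybe_reduction\<close>.\<close>

lemma rm_solution:
  shows "homogeneous_basis L B \<Longrightarrow> rm + super_flip L rm = casimir L B" "cybe rm = 0"
proof -
  obtain f0 g0 where lin0: "lin f0" "lin g0" and f0H: "\<And>x. f0 x \<in> H" and even0: "even_tensor r0"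
    and r0f: "\<And>x q. functional L q \<Longrightarrow> r0 (killing L x) q = q (f0 x)"
    and r0g: "\<And>x q. functional L q \<Longrightarrow> r0 q (\<lambda>z. killing L z x) = q (g0 x)"
    and fg0: "\<And>x. x \<in> H \<Longrightarrow> f0 x + g0 x = x"
    and root0: "\<And>\<mu> x. \<mu> \<in> \<Delta> \<Longrightarrow> x \<in> rs \<mu> \<Longrightarrow> f0 x = 0 \<and> g0 x = 0"
    and con0: "\<And>\<gamma>. \<gamma> \<in> \<Gamma>1 \<Longrightarrow> f0 (cr (\<tau> \<gamma>)) + g0 (cr \<gamma>) = 0"
    by (rule r0_operators) (rule that)
  note fK = functional_killing
  obtain f G where lin: "lin f" "lin G"
    and f: "\<And>x q. functional L q \<Longrightarrow> rm (killing L x) q = q (f x)"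
    and G: "\<And>x q. functional L q \<Longrightarrow> rm q (\<lambda>z. killing L z x) = q (G x)"
    by (rule even_tensor_operators[OF rm_even[OF even0]]) (rule that)
  have qf: "q (f x) = q (f0 x) + (\<Sum>\<alpha>\<in>\<Delta>p. killing L x (e (- \<alpha>)) * q (e \<alpha>)) +
      (\<Sum>(\<alpha>, \<beta>)\<in>pairs. killing L x (e (- \<alpha>)) * q (e \<beta>) - (-1) ^ par \<alpha> * (killing L x (e \<beta>) * q (e (- \<alpha>))))"
    if q: "functional L q" for q x
    using rm_apply[OF fK(3) q, of x] f[OF q] r0f[OF q] by simp
  have qG: "q (G x) = q (g0 x) + (\<Sum>\<alpha>\<in>\<Delta>p. q (e (- \<alpha>)) * killing L (e \<alpha>) x) +
      (\<Sum>(\<alpha>, \<beta>)\<in>pairs. q (e (- \<alpha>)) * killing L (e \<beta>) x - (-1) ^ par \<alpha> * (q (e \<beta>) * killing L (e (- \<alpha>)) x))"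
    if q: "functional L q" for q x
    using rm_apply[OF q fK(1), of x] G[OF q] r0g[OF q] by simp
  have qfG: "q (f x) + q (G x) = q (f0 x) + q (g0 x) +
      (\<Sum>\<alpha>\<in>\<Delta>p. killing L x (e (- \<alpha>)) * q (e \<alpha>) + killing L (e \<alpha>) x * q (e (- \<alpha>)))"
    if q: "functional L q" for q x
  proof -
    \<comment> \<open>The sum over pairs is super-antisymmetric, so it enters the two contractions
      with opposite signs and drops out of f + G.\<close>
    have "(\<Sum>(\<alpha>, \<beta>)\<in>pairs. killing L x (e (- \<alpha>)) * q (e \<beta>) - (-1) ^ par \<alpha> * (killing L x (e \<beta>) * q (e (- \<alpha>)))) =
        - (\<Sum>(\<alpha>, \<beta>)\<in>pairs. q (e (- \<alpha>)) * killing L (e \<beta>) x - (-1) ^ par \<alpha> * (q (e \<beta>) * killing L (e (- \<alpha>)) x))"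
      unfolding sum_negf[symmetric]
    proof (rule sum.cong)
      fix ab assume "ab \<in> pairs"
      then obtain \<alpha> \<beta> where x: "ab = (\<alpha>, \<beta>)" "\<alpha> \<in> \<Delta>p" "lt \<alpha> \<beta>" by (auto simp: pairs_def)
      have k: "killing L x (e (- \<alpha>)) = (-1) ^ par \<alpha> * killing L (e (- \<alpha>)) x"
        "killing L x (e \<beta>) = (-1) ^ par \<alpha> * killing L (e \<beta>) x"
        using killing_commute[OF e_part_minus[OF x(2)]] killing_commute[OF e_part_lt[OF x(3)]] by blast+
      show "(case ab of (\<alpha>, \<beta>) \<Rightarrow> killing L x (e (- \<alpha>)) * q (e \<beta>) - (-1) ^ par \<alpha> * (killing L x (e \<beta>) * q (e (- \<alpha>)))) =
          - (case ab of (\<alpha>, \<beta>) \<Rightarrow> q (e (- \<alpha>)) * killing L (e \<beta>) x - (-1) ^ par \<alpha> * (q (e \<beta>) * killing L (e (- \<alpha>)) x))"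
        unfolding x(1) prod.case k by (simp add: minus_one_power_iff)
    qed simp
    thus ?thesis unfolding qf[OF q] qG[OF q] by (simp add: sum.distrib mult.commute)
  qed
  have fH: "f h = f0 h" if h: "h \<in> H" for h
  proof (rule functional_separates)
    fix q assume q: "functional L q"
    have "(\<Sum>\<alpha>\<in>\<Delta>p. killing L h (e (- \<alpha>)) * q (e \<alpha>)) = 0"
      by (rule sum.neutral) (simp add: killing_H_e[OF h] roots_uminus(1) pos_root)
    moreover have "(\<Sum>(\<alpha>, \<beta>)\<in>pairs. killing L h (e (- \<alpha>)) * q (e \<beta>) -
        (-1) ^ par \<alpha> * (killing L h (e \<beta>) * q (e (- \<alpha>)))) = 0"
      by (rule sum.neutral) (auto simp: killing_H_e[OF h] roots_uminus(1) pos_root pairs_def)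
    ultimately show "q (f h) = q (f0 h)" using qf[OF q, of h] by simp
  qed
  have fpos: "f (e a) = e a + (\<Sum>\<beta> | lt a \<beta>. e \<beta>)" if a: "a \<in> \<Delta>p" for a
  proof (rule functional_separates)
    fix q assume q: "functional L q"
    have 1: "(\<Sum>\<alpha>\<in>\<Delta>p. killing L (e a) (e (- \<alpha>)) * q (e \<alpha>)) = q (e a)"
    proof -
      have "(\<Sum>\<alpha>\<in>\<Delta>p. killing L (e a) (e (- \<alpha>)) * q (e \<alpha>)) = (\<Sum>\<alpha>\<in>\<Delta>p. if a = \<alpha> then q (e \<alpha>) else 0)"
        by (rule sum.cong) (simp_all add: killing_e[OF a])
      thus ?thesis using a finite_pos by simp
    qed
    have "(\<Sum>(\<alpha>, \<beta>)\<in>pairs. killing L (e a) (e (- \<alpha>)) * q (e \<beta>) -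
        (-1) ^ par \<alpha> * (killing L (e a) (e \<beta>) * q (e (- \<alpha>)))) =
        (\<Sum>(\<alpha>, \<beta>)\<in>pairs. if a = \<alpha> then q (e \<beta>) else 0)"
      by (rule sum.cong) (auto simp: pairs_def killing_e[OF a])
    also have "\<dots> = (\<Sum>\<alpha>\<in>\<Delta>p. if a = \<alpha> then (\<Sum>\<beta> | lt \<alpha> \<beta>. q (e \<beta>)) else 0)"
      unfolding sum_pairs by (rule sum.cong) auto
    also have "\<dots> = q (\<Sum>\<beta> | lt a \<beta>. e \<beta>)" using a finite_pos by (simp add: functional_sum[OF q])
    finally show "q (f (e a)) = q (e a + (\<Sum>\<beta> | lt a \<beta>. e \<beta>))"
      using qf[OF q, of "e a"] 1 root0[OF pos_root[OF a] e_root[OF pos_root[OF a]]] q functional_0[OF q]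
      by (simp add: functional_iff)
  qed
  have fneg: "f (e (- b)) = - (\<Sum>\<alpha> | lt \<alpha> b. e (- \<alpha>))" if b: "b \<in> \<Delta>p" for b
  proof (rule functional_separates)
    fix q assume q: "functional L q"
    have r: "- b \<in> \<Delta>" by (rule roots_uminus(1)[OF pos_root[OF b]])
    have 1: "(\<Sum>\<alpha>\<in>\<Delta>p. killing L (e (- b)) (e (- \<alpha>)) * q (e \<alpha>)) = 0"
      by (rule sum.neutral) (simp add: killing_e[OF b])
    have "(\<Sum>(\<alpha>, \<beta>)\<in>pairs. killing L (e (- b)) (e (- \<alpha>)) * q (e \<beta>) -
        (-1) ^ par \<alpha> * (killing L (e (- b)) (e \<beta>) * q (e (- \<alpha>)))) =
        (\<Sum>(\<alpha>, \<beta>)\<in>pairs. if b = \<beta> then - q (e (- \<alpha>)) else 0)"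
    proof (rule sum.cong)
      fix ab assume "ab \<in> pairs"
      then obtain \<alpha> \<beta> where x: "ab = (\<alpha>, \<beta>)" "\<alpha> \<in> \<Delta>p" "\<beta> \<in> \<Delta>p" "lt \<alpha> \<beta>" by (auto simp: pairs_def)
      \<comment> \<open>Related roots have equal parity, so the sign of the pairing of negative with
        positive root vectors cancels the sign in r.\<close>
      have "par \<beta> = par \<alpha>" using lt_R x(4) by blast
      thus "(case ab of (\<alpha>, \<beta>) \<Rightarrow> killing L (e (- b)) (e (- \<alpha>)) * q (e \<beta>) -
          (-1) ^ par \<alpha> * (killing L (e (- b)) (e \<beta>) * q (e (- \<alpha>)))) =
          (case ab of (\<alpha>, \<beta>) \<Rightarrow> if b = \<beta> then - q (e (- \<alpha>)) else 0)"
        unfolding x(1) prod.case killing_e(2)[OF b x(2)] killing_e(4)[OF b x(3)]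
        by (auto simp: minus_one_power_iff)
    qed simp
    also have "\<dots> = (\<Sum>\<alpha>\<in>\<Delta>p. \<Sum>\<beta> | lt \<alpha> \<beta>. if b = \<beta> then - q (e (- \<alpha>)) else 0)"
      by (rule sum_pairs)
    also have "\<dots> = (\<Sum>\<alpha>\<in>\<Delta>p. if lt \<alpha> b then - q (e (- \<alpha>)) else 0)"
    proof (rule sum.cong)
      fix \<alpha>
      have "finite {\<beta>. lt \<alpha> \<beta>}"
        by (rule finite_subset[OF _ finite_pos]) (use lt_R R_pos in blast)
      thus "(\<Sum>\<beta> | lt \<alpha> \<beta>. if b = \<beta> then - q (e (- \<alpha>)) else 0) = (if lt \<alpha> b then - q (e (- \<alpha>)) else 0)"
        by simp
    qed simp
    also have "\<dots> = (\<Sum>\<alpha> | \<alpha> \<in> \<Delta>p \<and> lt \<alpha> b. - q (e (- \<alpha>)))"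
      using finite_pos by (simp add: sum.If_cases Int_def)
    also have "\<dots> = (\<Sum>\<alpha> | lt \<alpha> b. - q (e (- \<alpha>)))"
      by (rule sum.cong) (use lt_R R_pos in blast)+
    also have "\<dots> = - q (\<Sum>\<alpha> | lt \<alpha> b. e (- \<alpha>))"
      by (simp add: functional_sum[OF q] sum_negf)
    also have "\<dots> = q (- (\<Sum>\<alpha> | lt \<alpha> b. e (- \<alpha>)))"
      using functional_iff[THEN iffD1, OF q, THEN conjunct2, rule_format, of "-1"] by simp
    finally show "q (f (e (- b))) = q (- (\<Sum>\<alpha> | lt \<alpha> b. e (- \<alpha>)))"
      using qf[OF q, of "e (- b)"] 1 root0[OF r e_root[OF r]] functional_0[OF q] by simp
  qed
  \<comment> \<open>Both contractions and the coroots are additive, so the relation passes from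
    simple roots to all of \<open>R1\<close> along decompositions.\<close>
  have conT: "f0 (cr (T \<alpha>)) + g0 (cr \<alpha>) = 0" if "\<alpha> \<in> R1" for \<alpha>
    using that
  proof (induction "height \<alpha>" arbitrary: \<alpha> rule: less_induct)
    case less
    have simple: "T \<gamma> = \<tau> \<gamma> \<and> \<gamma> \<in> R1" if "\<gamma> \<in> \<Gamma>1" for \<gamma>
      using tau_ext_eq tl_\<Gamma>1[OF that] \<Gamma>_roots_over[OF sub12(1) \<Gamma>1[OF that]] that by simp
    show ?case
    proof (cases "\<alpha> \<in> \<Gamma>1")
      case True
      thus ?thesis using con0 simple by simp
    next
      case False
      obtain \<gamma> \<delta> where g: "\<gamma> \<in> \<Gamma>1" "\<delta> \<in> R1" "\<gamma> + \<delta> = \<alpha>" "nb \<gamma> \<delta>" "height \<delta> < height \<alpha>"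
        using simple_decomposition[OF sub12(1) less.prems False] by blast
      have \<gamma>: "\<gamma> \<in> R1" "T \<gamma> = \<tau> \<gamma>" using simple[OF g(1)] by auto
      have d: "\<gamma> \<in> dl" "\<delta> \<in> dl" "T \<gamma> \<in> dl" "T \<delta> \<in> dl"
        using root_dl pos_root R_pos(1) T_pos \<gamma>(1) g(2) by blast+
      have Ta: "cr (T \<alpha>) = cr (T \<gamma>) + cr (T \<delta>)"
        using T_plus[OF \<gamma>(1) g(2)] g(3) less.prems coroot_plus[OF d(3,4)] by simp
      have ca: "cr \<alpha> = cr \<gamma> + cr \<delta>" using coroot_plus[OF d(1,2)] g(3) by simp
      have "f0 (cr (T \<alpha>)) + g0 (cr \<alpha>) = (f0 (cr (T \<gamma>)) + g0 (cr \<gamma>)) + (f0 (cr (T \<delta>)) + g0 (cr \<delta>))"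
        unfolding Ta ca by (simp add: lin_add[OF lin0(1)] lin_add[OF lin0(2)])
      thus ?thesis using con0[OF g(1)] less.hyps[OF g(5,2)] \<gamma>(2) by simp
    qed
  qed
  have crH: "cr \<alpha> \<in> H" "cr (T \<alpha>) \<in> H" if "\<alpha> \<in> R1" for \<alpha>
    using coroot(1)[OF root_dl[OF pos_root[OF R_pos(1)[OF that]]]]
      coroot(1)[OF root_dl[OF pos_root[OF T_pos[OF that]]]] by blast+
  \<comment> \<open>Both sides are the value of r0 at the functionals (h, -) and (-, k).\<close>
  have adj: "killing L (f0 h) k = killing L h (g0 k)" for h k
    using r0f[OF fK(1), of h k] r0g[OF fK(3), of h k] by simp
  have bd: "bd_operator L H \<Gamma> e \<Gamma>1 \<Gamma>2 \<tau> X Y \<phi> f"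
  proof
    show "lin f" by (rule lin(1))
    show "f (e \<alpha>) = e \<alpha> + (\<Sum>\<beta> | lt \<alpha> \<beta>. e \<beta>)" if "\<alpha> \<in> \<Delta>p" for \<alpha> by (rule fpos[OF that])
    show "f (e (- \<beta>)) = - (\<Sum>\<alpha> | lt \<alpha> \<beta>. e (- \<alpha>))" if "\<beta> \<in> \<Delta>p" for \<beta> by (rule fneg[OF that])
    show "f h \<in> H" if "h \<in> H" for h using fH[OF that] f0H by simp
    show "f (cr \<alpha> - cr (T \<alpha>)) = cr \<alpha>" if \<alpha>: "\<alpha> \<in> R1" for \<alpha>
    proof -
      have "f (cr \<alpha> - cr (T \<alpha>)) = f0 (cr \<alpha>) - f0 (cr (T \<alpha>))"
        using fH crH[OF \<alpha>] by (simp add: lin_diff[OF lin(1)])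
      also have "f0 (cr (T \<alpha>)) = - g0 (cr \<alpha>)" using conT[OF \<alpha>] by (simp add: eq_neg_iff_add_eq_0)
      finally show ?thesis using fg0[OF crH(1)[OF \<alpha>]] by simp
    qed
    show "T \<alpha> (f h - h) = \<alpha> (f h)" if \<alpha>: "\<alpha> \<in> R1" and h: "h \<in> H" for \<alpha> h
    proof -
      note d = root_dl[OF pos_root[OF R_pos(1)[OF \<alpha>]]] root_dl[OF pos_root[OF T_pos[OF \<alpha>]]]
      have fh: "f h = f0 h" "f0 h \<in> H" using fH[OF h] f0H by auto
      have fhh: "f0 h - h \<in> H" using fh(2) h subspace_diff[OF subspace_H] by blast
      have "T \<alpha> (f h - h) = killing L (f0 h - h) (cr (T \<alpha>))"
        using coroot(2)[OF d(2) fhh] killing_H_commute[OF fhh] fh(1) by simp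
      \<comment> \<open>Adjointness moves the condition on weights over to coroots, where
        \<open>conT\<close> applies.\<close>
      also have "\<dots> = killing L h (g0 (cr (T \<alpha>)) - cr (T \<alpha>))"
        by (simp add: killing_diff adj)
      also have "g0 (cr (T \<alpha>)) - cr (T \<alpha>) = - f0 (cr (T \<alpha>))"
        using fg0[OF crH(2)[OF \<alpha>]] by (metis add_diff_cancel_right' minus_diff_eq)
      also have "- f0 (cr (T \<alpha>)) = g0 (cr \<alpha>)" using conT[OF \<alpha>] by (simp add: add_eq_0_iff)
      also have "killing L h (g0 (cr \<alpha>)) = killing L (f0 h) (cr \<alpha>)" by (simp add: adj)
      also have "\<dots> = \<alpha> (f h)" using coroot(2)[OF d(1) fh(2)] killing_H_commute[OF fh(2)] fh(1) by simp
      finally show ?thesis .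
    qed
  qed
  have fGx: "f x + G x = x" for x
  proof -
    have e: "f (e \<mu>) + G (e \<mu>) = e \<mu>" if \<mu>: "\<mu> \<in> \<Delta>" for \<mu>
    proof (rule functional_separates)
      fix q assume q: "functional L q"
      have z: "q (f0 (e \<mu>)) = 0" "q (g0 (e \<mu>)) = 0"
        using root0[OF \<mu> e_root[OF \<mu>]] functional_0[OF q] by auto
      have "(\<Sum>\<alpha>\<in>\<Delta>p. killing L (e \<mu>) (e (- \<alpha>)) * q (e \<alpha>) + killing L (e \<alpha>) (e \<mu>) * q (e (- \<alpha>))) = q (e \<mu>)"
      proof (cases "\<mu> \<in> \<Delta>p")
        case True
        have "(\<Sum>\<alpha>\<in>\<Delta>p. killing L (e \<mu>) (e (- \<alpha>)) * q (e \<alpha>) + killing L (e \<alpha>) (e \<mu>) * q (e (- \<alpha>))) =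
            (\<Sum>\<alpha>\<in>\<Delta>p. if \<mu> = \<alpha> then q (e \<mu>) else 0)"
          by (rule sum.cong) (auto simp: killing_e True)
        thus ?thesis using True finite_pos by simp
      next
        case False
        hence n: "- \<mu> \<in> \<Delta>p" using root_signs[OF \<mu>] by blast
        have "(\<Sum>\<alpha>\<in>\<Delta>p. killing L (e \<mu>) (e (- \<alpha>)) * q (e \<alpha>) + killing L (e \<alpha>) (e \<mu>) * q (e (- \<alpha>))) =
            (\<Sum>\<alpha>\<in>\<Delta>p. if - \<mu> = \<alpha> then q (e \<mu>) else 0)"
        proof (rule sum.cong)
          fix \<alpha> assume \<alpha>: "\<alpha> \<in> \<Delta>p"
          show "killing L (e \<mu>) (e (- \<alpha>)) * q (e \<alpha>) + killing L (e \<alpha>) (e \<mu>) * q (e (- \<alpha>)) =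
              (if - \<mu> = \<alpha> then q (e \<mu>) else 0)"
            using killing_e(2)[OF n \<alpha>] killing_e(3)[OF \<alpha> n] by auto
        qed simp
        thus ?thesis using n finite_pos by simp
      qed
      thus "q (f (e \<mu>) + G (e \<mu>)) = q (e \<mu>)"
        using qfG[OF q, of "e \<mu>"] z q by (simp add: functional_iff)
    qed
    have h: "f h + G h = h" if h: "h \<in> H" for h
    proof (rule functional_separates)
      fix q assume q: "functional L q"
      have "(\<Sum>\<alpha>\<in>\<Delta>p. killing L h (e (- \<alpha>)) * q (e \<alpha>) + killing L (e \<alpha>) h * q (e (- \<alpha>))) = 0"
        by (rule sum.neutral) (simp add: killing_H_e[OF h] roots_uminus(1) pos_root)
      hence "q (f h) + q (G h) = q (f0 h) + q (g0 h)" using qfG[OF q, of h] by simp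
      also have "\<dots> = q (f0 h + g0 h)" using q by (simp add: functional_iff)
      also have "f0 h + g0 h = h" by (rule fg0[OF h])
      finally show "q (f h + G h) = q h" using q by (simp add: functional_iff)
    qed
    show ?thesis
    proof (induction x rule: weight_vectors_induct)
      case (weight x i \<mu>)
      show ?case
      proof (cases "\<mu> = 0 \<or> x = 0")
        case True
        thus ?thesis using h weight(3) rs_0 subspace_0[OF subspace_H] by auto
      next
        case False
        hence r: "\<mu> \<in> \<Delta>" using weight by (auto simp: roots_iff)
        then obtain c where "x = scl L c (e \<mu>)" using root_vector_multiple[OF r weight(3)] by blast
        thus ?thesis using e[OF r]
          by (simp add: lin_scale[OF lin(1)] lin_scale[OF lin(2)] flip: scale_right_distrib)
      qed
    next
      case (add x y)
      have "f (x + y) + G (x + y) = (f x + G x) + (f y + G y)"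
        by (simp add: lin_add[OF lin(1)] lin_add[OF lin(2)])
      thus ?case using add by simp
    qed
  qed
  have fG: "rm (killing L x) q + rm q (\<lambda>z. killing L z x) = q x" if q: "functional L q" for x q
  proof -
    have "rm (killing L x) q + rm q (\<lambda>z. killing L z x) = q (f x + G x)"
      using f[OF q] G[OF q] q by (simp add: functional_iff)
    thus ?thesis by (simp only: fGx)
  qed
  note sol = cybe_reduction[OF rm_even[OF even0] f fG bd_operator.f_cybe[OF bd]]
  show "homogeneous_basis L B \<Longrightarrow> rm + super_flip L rm = casimir L B" by (rule sol(1))
  show "cybe rm = 0" by (rule sol(2))
qed

end

theorem theorem2:
  fixes L :: "'g::ab_group_add lie_superalg"
    and H :: "'g set"
    and \<Gamma> \<Gamma>1 \<Gamma>2 :: "('g \<Rightarrow> complex) set"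
    and \<tau> :: "('g \<Rightarrow> complex) \<Rightarrow> 'g \<Rightarrow> complex"
    and X Y e :: "('g \<Rightarrow> complex) \<Rightarrow> 'g"
    and \<phi> :: "'g \<Rightarrow> 'g"
    and r0 r :: "'g tensor2"
  assumes "simple_lie_superalgebra L" and "finite_dim L" and "nondegenerate_killing L"
    and "cartan_subalgebra L H"
    and "root_base L H \<Gamma>"
    and "admissible_triple L H \<Gamma> \<Gamma>1 \<Gamma>2 \<tau>"
    and "chevalley_vectors L H \<Gamma> X Y"
    and "triple_iso L X Y \<Gamma>1 \<Gamma>2 \<tau> \<phi>"
    and "compatible_root_vectors L H \<Gamma> \<Gamma>1 \<tau> \<phi> e"
    and "r0 \<in> tensors_over L H"
    and "r0 + super_flip L r0 = cartan_casimir L H \<Gamma>"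
    and "\<forall>\<alpha>\<in>\<Gamma>1. contract_left L H (\<tau> \<alpha>) r0 + contract_right L H \<alpha> r0 = 0"
    and "r = r_matrix L H \<Gamma> \<Gamma>1 \<tau> e r0"
  shows "(\<forall>B. homogeneous_basis L B \<longrightarrow> r + super_flip L r = casimir L B) \<and>
    brk12_13 L r r + brk12_23 L r r + brk13_23 L r r = 0"
proof -
  interpret lie_superalgebra L
    using assms(1) by (simp add: simple_lie_superalgebra_def)
  interpret r_matrix_superalgebra L H \<Gamma> e \<Gamma>1 \<Gamma>2 \<tau> X Y \<phi> r0
    by unfold_locales (use assms in \<open>auto simp: compatible_root_vectors_def\<close>)
  have "r = rm" using assms(13) by (simp add: rm_def)
  thus ?thesis using rm_solution by (simp add: cybe_def)
qed

end
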